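(* There exist universal constants $c,C>0$ such that for every integer $n\ge 2$ and every isotropic, log-concave probability measure $\mu$ on $\mathbb{R}^n$, in the gauge order, $$ \gamma_{c/(\log n)^2}\prec\mu\prec\gamma_{C(\log n)^2}. $$
   Context: A gauge function on $\mathbb{R}^n$ is a real-valued, non-negative, convex function $\|\cdot\|$ on $\mathbb{R}^n$ satisfying $\|\lambda x\|=\lambda\|x\|$ for all $x\in\mathbb{R}^n$, $\lambda\ge 0$. For probability measures $\mu_1,\mu_2$ on $\mathbb{R}^n$, $\mu_1\prec\mu_2$ in the gauge order means $\int\|x\|\,d\mu_1(x)\le\int\|x\|\,d\mu_2(x)$ for every gauge function $\|\cdot\|$ on $\mathbb{R}^n$. $\gamma_t$ denotes the Gaussian probability measure on $\mathbb{R}^n$ with mean zero and covariance $t\cdot\mathrm{Id}$. A probability measure on $\mathbb{R}^n$ is log-concave if it has a density $p$ such that $\{p>0\}$ is convex and $\log(1/p)$ is convex on this set; it is isotropic if its barycenter is at the origin and its covariance matrix is the identity. *)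

theory Defs
  imports "HOL-Probability.Probability"
begin

text \<open>
  The universal constants are quantified before the dimension, so the dimension cannot be a type
  index.  Points of n-dimensional Euclidean space are therefore the extensional functions on
  \<open>{..<n}\<close>, as in the library's finite product measures; scaling and addition have to be restricted
  to \<open>{..<n}\<close> to stay inside this carrier.
\<close>

definition Rn :: "nat \<Rightarrow> (nat \<Rightarrow> real) set" where
  "Rn n = (\<Pi>\<^sub>E i\<in>{..<n}. UNIV)"

definition scale_Rn :: "nat \<Rightarrow> real \<Rightarrow> (nat \<Rightarrow> real) \<Rightarrow> (nat \<Rightarrow> real)" where
  "scale_Rn n a x = (\<lambda>i\<in>{..<n}. a * x i)"

definition add_Rn :: "nat \<Rightarrow> (nat \<Rightarrow> real) \<Rightarrow> (nat \<Rightarrow> real) \<Rightarrow> (nat \<Rightarrow> real)" where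
  "add_Rn n x y = (\<lambda>i\<in>{..<n}. x i + y i)"

definition convex_set_Rn :: "nat \<Rightarrow> (nat \<Rightarrow> real) set \<Rightarrow> bool" where
  "convex_set_Rn n S \<longleftrightarrow> S \<subseteq> Rn n \<and>
     (\<forall>x\<in>S. \<forall>y\<in>S. \<forall>u v. 0 \<le> u \<longrightarrow> 0 \<le> v \<longrightarrow> u + v = 1 \<longrightarrow>
        add_Rn n (scale_Rn n u x) (scale_Rn n v y) \<in> S)"

definition convex_on_Rn :: "nat \<Rightarrow> (nat \<Rightarrow> real) set \<Rightarrow> ((nat \<Rightarrow> real) \<Rightarrow> real) \<Rightarrow> bool" where
  "convex_on_Rn n S f \<longleftrightarrow> convex_set_Rn n S \<and>
     (\<forall>x\<in>S. \<forall>y\<in>S. \<forall>u v. 0 \<le> u \<longrightarrow> 0 \<le> v \<longrightarrow> u + v = 1 \<longrightarrow>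
        f (add_Rn n (scale_Rn n u x) (scale_Rn n v y)) \<le> u * f x + v * f y)"

definition gauge_function :: "nat \<Rightarrow> ((nat \<Rightarrow> real) \<Rightarrow> real) \<Rightarrow> bool" where
  "gauge_function n q \<longleftrightarrow>
     (\<forall>x\<in>Rn n. 0 \<le> q x) \<and>
     convex_on_Rn n (Rn n) q \<and>
     (\<forall>x\<in>Rn n. \<forall>a\<ge>0. q (scale_Rn n a x) = a * q x)"

definition borel_Rn :: "nat \<Rightarrow> (nat \<Rightarrow> real) measure" where
  "borel_Rn n = (\<Pi>\<^sub>M i\<in>{..<n}. borel)"

definition lborel_Rn :: "nat \<Rightarrow> (nat \<Rightarrow> real) measure" where
  "lborel_Rn n = (\<Pi>\<^sub>M i\<in>{..<n}. lborel)"

definition prob_measure_Rn :: "nat \<Rightarrow> (nat \<Rightarrow> real) measure \<Rightarrow> bool" where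
  "prob_measure_Rn n M \<longleftrightarrow> prob_space M \<and> sets M = sets (borel_Rn n)"

text \<open>
  Integrals of gauge functions are taken in \<open>[0, \<infinity>]\<close>, since a gauge function need not be integrable
  and the Bochner integral would then be 0.
\<close>

definition gauge_le :: "nat \<Rightarrow> (nat \<Rightarrow> real) measure \<Rightarrow> (nat \<Rightarrow> real) measure \<Rightarrow> bool" where
  "gauge_le n M1 M2 \<longleftrightarrow>
     (\<forall>q. gauge_function n q \<longrightarrow>
        (\<integral>\<^sup>+ x. ennreal (q x) \<partial>M1) \<le> (\<integral>\<^sup>+ x. ennreal (q x) \<partial>M2))"

text \<open>
  The Gaussian measure with mean zero and covariance \<open>t Id\<close> is the law of \<open>n\<close> independent
  one-dimensional Gaussians of variance \<open>t\<close>; \<open>normal_density\<close> takes the standard deviation.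
  Only \<open>t > 0\<close> is meaningful.
\<close>

definition gaussian_Rn :: "nat \<Rightarrow> real \<Rightarrow> (nat \<Rightarrow> real) measure" where
  "gaussian_Rn n t = (\<Pi>\<^sub>M i\<in>{..<n}. density lborel (\<lambda>s. ennreal (normal_density 0 (sqrt t) s)))"

text \<open>
  Requiring a Borel density is no restriction: a Lebesgue measurable log-concave density can be set
  to 0 on the (null) boundary of the convex set where it is positive, and is then Borel.
\<close>

definition log_concave :: "nat \<Rightarrow> (nat \<Rightarrow> real) measure \<Rightarrow> bool" where
  "log_concave n M \<longleftrightarrow>
     (\<exists>p. p \<in> borel_measurable (lborel_Rn n) \<and>
          (\<forall>x\<in>Rn n. 0 \<le> p x) \<and>
          M = density (lborel_Rn n) (\<lambda>x. ennreal (p x)) \<and>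
          convex_set_Rn n {x\<in>Rn n. 0 < p x} \<and>
          convex_on_Rn n {x\<in>Rn n. 0 < p x} (\<lambda>x. ln (1 / p x)))"

definition mean_coord :: "(nat \<Rightarrow> real) measure \<Rightarrow> nat \<Rightarrow> real" where
  "mean_coord M i = (\<integral>x. x i \<partial>M)"

definition covariance_coord :: "(nat \<Rightarrow> real) measure \<Rightarrow> nat \<Rightarrow> nat \<Rightarrow> real" where
  "covariance_coord M i j = (\<integral>x. (x i - mean_coord M i) * (x j - mean_coord M j) \<partial>M)"

text \<open>
  The square-integrability makes the barycenter and the covariance matrix of a probability measure
  well-defined.
\<close>

definition isotropic :: "nat \<Rightarrow> (nat \<Rightarrow> real) measure \<Rightarrow> bool" where
  "isotropic n M \<longleftrightarrow>
     (\<forall>i<n. integrable M (\<lambda>x. (x i)\<^sup>2)) \<and>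
     (\<forall>i<n. mean_coord M i = 0) \<and>
     (\<forall>i<n. \<forall>j<n. covariance_coord M i j = (if i = j then 1 else 0))"

end

theory Submission
  imports Defs
begin

text \<open>
  The measure is convolved with a Gaussian of small variance, multiplied by a Gaussian factor and
  restricted to a large box. By the Prekopa--Leindler inequality the result is a smooth density
  \<open>exp (- V)\<close> on the box with \<open>Hess V >= t\<close> for some \<open>t > 0\<close>. For such densities the Bochner formula
  gives the Poincare inequality, with constant \<open>sqrt (a / t)\<close> when the covariance is at most \<open>a\<close>
  (Klartag's improved Lichnerowicz inequality), and this bounds the third moments.

  Stochastic localization is run in discrete time: multiplying by \<open>1 + r (x_i - mean_i)\<close> and by
  \<open>1 - r (x_i - mean_i)\<close> splits a density into two densities with that average, and raises the
  strong log-concavity in direction \<open>i\<close> by at least \<open>r^2 / 2\<close>. With \<open>q\<close> a power of two of order \<open>log n\<close>, the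
  third moment bound controls the growth of \<open>tr ((cov - 1)^q)\<close> up to a time of order \<open>1 / q^2\<close>, so
  that the covariance stays between 1/2 and 3/2 outside an event of polynomially small probability.

  Let \<open>U s x\<close> be the mean of \<open>N (x + sqrt s Z)\<close> for the gauge function \<open>N\<close> and a standard Gaussian
  \<open>Z\<close>. One step of the localization changes \<open>U s (mean w)\<close> on average by half of \<open>tr (Q cov^2)\<close>,
  where \<open>Q\<close> is the Hessian, while the heat flow changes it by half of \<open>tr Q\<close>. As long as the
  covariance is of order 1, backward induction therefore compares the integral of \<open>N\<close> with \<open>U\<close> at
  a time of order \<open>1 / log^2 n\<close> from below; from above one continues with the bound \<open>1 / t\<close> for the
  covariance, which costs a total time of order \<open>log^2 n\<close>.
\<close>

text \<open>The power \<open>log^2\<close> comes from one balance. The third moment bound blows up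
  like \<open>1 / sqrt t\<close>, so \<open>tr ((cov - 1)^q)\<close>, up to an additive term, grows
  at a relative rate of order \<open>q^2 / sqrt t\<close>; this is integrable at 0, with integral of
  order \<open>q^2 * sqrt T\<close> up to time \<open>T\<close>. When the covariance leaves its
  window, \<open>4^q * tr ((cov - 1)^q)\<close> exceeds \<open>2^q\<close>, so a growth exponent
  that is a small multiple of \<open>q\<close> is affordable: \<open>T\<close> may be of order
  \<open>1 / q^2\<close>. The gain \<open>2^q\<close> must beat a fixed power of \<open>n\<close>,
  hence \<open>q\<close> of order \<open>log n\<close>.

  Smoothing yields a twice differentiable density, the Gaussian factor makes the localization start
  at a positive time, and the box bounds the moments of all densities uniformly. Thus a sweep of
  size \<open>d\<close> has a second-order expansion with an error of order
  \<open>d * sqrt d\<close> that is uniform over the densities, and the roughly \<open>1 / d\<close>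
  sweeps cost \<open>sqrt d\<close> in total, which vanishes with the mesh. Matrices are handled by
  traces and Cauchy--Schwarz instead of eigenvalues; this is why \<open>q\<close> is a power of
  two.\<close>

abbreviation Bn :: "nat => (nat => real) measure" where "Bn n \<equiv> \<Pi>\<^sub>M i\<in>{..<n}. borel"

section \<open>Calculus on a box\<close>

locale cube =
 fixes n :: nat and R :: real
 assumes R_pos: "0 < R"
begin

definition box :: "(nat => real) set" where
 "box = (\<Pi>\<^sub>E i\<in>{..<n}. {-R..R})"

definition bm :: "(nat => real) measure" where
 "bm = restrict_space (\<Pi>\<^sub>M i\<in>{..<n}. lborel) box"

abbreviation J :: "((nat => real) => real) => real" where
 "J f \<equiv> integral\<^sup>L bm f"

lemma box_sets: "box \<in> sets (\<Pi>\<^sub>M i\<in>{..<n}. lborel)"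
 unfolding box_def by (rule sets_PiM_I_finite) auto

lemma space_bm [simp]: "space bm = box"
 unfolding bm_def box_def by auto

lemma boxD: "x \<in> box ==> i < n ==> \<bar>x i\<bar> <= R"
 unfolding box_def PiE_iff by (drule conjunct1, drule bspec[of _ _ i], simp, simp add: abs_le_iff)

text \<open>In the product topology of \<open>nat => real\<close> the box is a product of intervals
  and, beyond \<open>n\<close>, of singletons \<open>{undefined}\<close>, hence a product of compact
  sets.\<close>

lemma compact_box: "compact box"
proof -
 have "box = PiE UNIV (%i. if i < n then {-R..R} else {undefined})"
 proof (rule set_eqI, rule iffI)
  fix x assume "x \<in> box"
  thus "x \<in> PiE UNIV (%i. if i < n then {-R..R} else {undefined})"
   unfolding box_def PiE_iff extensional_def by simp
 next
  fix x assume x: "x \<in> PiE UNIV (%i. if i < n then {-R..R} else {undefined})"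
  have *: "x i \<in> (if i < n then {-R..R} else {undefined})" for i
   using x unfolding PiE_iff by blast
  have "x i \<in> {-R..R}" if "i < n" for i using *[of i] that by simp
  moreover have "x i = undefined" if "~ i < n" for i using *[of i] that by simp
  ultimately show "x \<in> box" unfolding box_def PiE_iff extensional_def by simp
 qed
 moreover have "compactin (product_topology (%i. euclidean) UNIV)
   (PiE UNIV (%i::nat. if i < n then {-R..R} else {undefined::real}))"
  by (subst compactin_PiE) simp
 ultimately show ?thesis
  unfolding euclidean_product_topology by simp
qed

text \<open>Continuity refers to the product topology on all of \<open>nat => real\<close>,
  measurability to the finite product. The identity between the two is measurable because the
  coordinates beyond \<open>n\<close> are constantly \<open>undefined\<close>.\<close>

lemma meas_cont:
 assumes "continuous_on box f"
 shows "(f :: _ => real) \<in> borel_measurable bm"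
proof -
 have id: "(%x. x) \<in> measurable (\<Pi>\<^sub>M i\<in>{..<n}. lborel :: real measure) (borel :: (nat => real) measure)"
 proof -
  have "(%x. x) \<in> measurable (\<Pi>\<^sub>M i\<in>{..<n}. lborel :: real measure) (\<Pi>\<^sub>M i\<in>UNIV. borel :: real measure)"
  proof (rule measurable_PiM_single')
   fix i :: nat
   show "(%x. x i) \<in> measurable (\<Pi>\<^sub>M i\<in>{..<n}. lborel :: real measure) (borel :: real measure)"
   proof (cases "i < n")
    case True
    thus ?thesis
     by simp
   next
    case False
    hence "!!x. (x :: nat => real) \<in> space (\<Pi>\<^sub>M i\<in>{..<n}. lborel :: real measure) ==> x i = undefined"
     by (auto simp: space_PiM PiE_iff extensional_def)
    hence "(%x. x i) \<in> measurable (\<Pi>\<^sub>M i\<in>{..<n}. lborel :: real measure) (borel :: real measure) \<longleftrightarrow>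
      (%x. undefined :: real) \<in> measurable (\<Pi>\<^sub>M i\<in>{..<n}. lborel :: real measure) (borel :: real measure)"
     by (rule measurable_cong)
    thus ?thesis by simp
   qed
  qed auto
  thus ?thesis
   using measurable_cong_sets[OF refl sets_PiM_equal_borel] by blast
 qed
 have "(%x. x) \<in> measurable bm (restrict_space borel box)"
  unfolding bm_def
  by (intro measurable_restrict_space3 id) auto
 moreover have "f \<in> measurable (restrict_space borel box) borel"
  using assms by (rule borel_measurable_continuous_on_restrict)
 ultimately show ?thesis
  using measurable_compose by blast
qed

lemma emeasure_box: "emeasure (\<Pi>\<^sub>M i\<in>{..<n}. lborel) box = ennreal ((2 * R) ^ n)"
proof -
 interpret product_sigma_finite "%_::nat. lborel :: real measure"
  by standard
 have "emeasure (\<Pi>\<^sub>M i\<in>{..<n}. lborel) box = (PROD i<n. emeasure lborel {-R..R})"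
  unfolding box_def by (rule emeasure_PiM) auto
 also have "... = ennreal ((2 * R) ^ n)"
  using R_pos by (simp add: ennreal_power)
 finally show ?thesis .
qed

lemma emeasure_bm: "emeasure bm box = ennreal ((2 * R) ^ n)"
 unfolding bm_def by (subst emeasure_restrict_space) (auto simp: box_sets emeasure_box)

sublocale bm: finite_measure bm
 by (rule finite_measureI) (simp add: emeasure_bm)

lemma J_one: "J (%_. 1) = (2 * R) ^ n"
 using R_pos emeasure_bm by (simp add: measure_def)

lemma bounded_cont:
 assumes "continuous_on box (f :: _ => real)"
 shows "\<exists>B>0. \<forall>x\<in>box. \<bar>f x\<bar> <= B"
proof -
 have "bounded (f ` box)"
  by (intro compact_imp_bounded compact_continuous_image assms compact_box)
 thus ?thesis
  unfolding bounded_pos by auto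
qed

lemma integ:
 assumes "continuous_on box f"
 shows "integrable bm (f :: _ => real)"
proof -
 obtain B where "B > 0" and B: "\<forall>x\<in>box. \<bar>f x\<bar> <= B"
  using bounded_cont[OF assms] by blast
 have "AE x in bm. norm (f x) <= B"
  by (rule AE_I2) (simp add: B)
 thus ?thesis
  by (rule bm.integrable_const_bound) (rule meas_cont[OF assms])
qed

lemma cont_coord [continuous_intros]: "continuous_on A (%x::nat => real. x i)"
 by (rule continuous_on_subset[OF continuous_on_product_coordinates]) simp

lemma J_mono:
 "continuous_on box f ==> continuous_on box g ==> (!!x. x \<in> box ==> f x <= g x) ==> J f <= J g"
 by (intro integral_mono integ) auto

lemma J_nonneg: "(!!x. x \<in> box ==> 0 <= f x) ==> 0 <= J f"
 by (intro Bochner_Integration.integral_nonneg) auto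

lemma J_cong: "(!!x. x \<in> box ==> f x = g x) ==> J f = J g"
 by (intro Bochner_Integration.integral_cong) auto

lemma J_add: "continuous_on box f ==> continuous_on box g ==> J (%x. f x + g x) = J f + J g"
 by (intro Bochner_Integration.integral_add integ)

lemma J_diff: "continuous_on box f ==> continuous_on box g ==> J (%x. f x - g x) = J f - J g"
 by (intro Bochner_Integration.integral_diff integ)

lemma J_sum: "(!!i. i \<in> S ==> continuous_on box (f i)) ==> J (%x. \<Sum>i\<in>S. f i x) = (\<Sum>i\<in>S. J (f i))"
 by (intro Bochner_Integration.integral_sum integ)

text \<open>For \<open>c > 0\<close> the polynomial is evaluated at its minimum
  \<open>- b / c\<close>. Adding the values at two opposite points excludes \<open>c < 0\<close>,
  and for \<open>c = 0\<close> a nonzero slope would produce a negative value.\<close>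

lemma discr:
 fixes a b c :: real
 assumes *: "!!s. 0 <= a + 2 * b * s + c * s^2"
 shows "b^2 <= a * c"
proof -
 have a: "0 <= a" using *[of 0] by simp
 have c0: "0 <= c"
 proof (rule ccontr)
  assume "~ 0 <= c"
  hence c: "c < 0" by simp
  let ?t = "sqrt ((a + 1)/- c)"
  have t: "?t^2 = (a + 1)/- c"
   using c a by (intro real_sqrt_pow2 divide_nonneg_pos) auto
  have "0 <= (a + 2 * b*?t + c*?t^2) + (a + 2 * b*(- ?t) + c*(- ?t)^2)"
   by (intro add_nonneg_nonneg *)
  also have "... = 2*(a + c*?t^2)" by simp
  also have "c*?t^2 = - (a + 1)" unfolding t using c by simp
  finally show False by simp
 qed
 show ?thesis
 proof (cases "c = 0")
  case False
  with c0 have c: "c > 0" by simp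
  have "0 <= (a + 2 * b*(- b/c) + c*(- b/c)^2) * c"
   using *[of "-b/c"] c by (intro mult_nonneg_nonneg) auto
  also have "... = a * c - b\<^sup>2" using c by (simp add: power2_eq_square distrib_right left_diff_distrib)
  finally show ?thesis by simp
 next
  case True
  have "b = 0"
  proof (rule ccontr)
   assume b: "b ~= 0"
   have "0 <= a + 2 * b*(- (a + 1)/b)" using *[of "- (a + 1)/b"] True by simp
   also have "2 * b*(- (a + 1)/b) = - 2*(a + 1)" using b by simp
   finally show False using a by simp
  qed
  thus ?thesis using True by simp
 qed
qed

lemma J_cauchy:
 assumes [continuous_intros]: "continuous_on box f" "continuous_on box g" "continuous_on box w"
  and w: "!!x. x \<in> box ==> 0 <= w x"
 shows "(J (%x. w x*(f x * g x)))^2 <= J (%x. w x*(f x)^2) * J (%x. w x*(g x)^2)"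
proof (rule discr)
 fix s
 have "0 <= J (%x. w x*(f x + s * g x)^2)"
  using w by (intro J_nonneg) auto
 also have "J (%x. w x*(f x + s * g x)^2) =
   J (%x. (w x*(f x)^2 + (2 * s)*(w x*(f x * g x))) + s^2*(w x*(g x)^2))"
  by (intro J_cong) (auto simp: power2_eq_square algebra_simps)
 also have "... = J (%x. w x*(f x)^2 + (2 * s)*(w x*(f x * g x))) + J (%x. s^2*(w x*(g x)^2))"
  by (intro J_add continuous_intros)
 also have "... = J (%x. w x*(f x)^2) + J (%x. (2 * s)*(w x*(f x * g x))) + J (%x. s^2*(w x*(g x)^2))"
  by (subst J_add) (intro continuous_intros refl)+
 finally show "0 <= J (%x. w x*(f x)^2) + 2 * J (%x. w x*(f x * g x)) * s + J (%x. w x*(g x)^2) * s^2"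
  by (simp only: integral_mult_right_zero) (simp add: mult_ac)
qed

text \<open>The derivative is two-sided also on the faces: functions live on all of
  \<open>nat => real\<close>, and only the base point is confined to the box.\<close>

definition pd :: "nat => ((nat => real) => real) => ((nat => real) => real) => bool" where
 "pd i f f' \<longleftrightarrow> (\<forall>x\<in>box. ((%r. f (x(i := r))) has_real_derivative f' x) (at (x i)))"

lemma pd_const: "pd i (%x. c) (%x. 0)"
 unfolding pd_def by auto

lemma pd_coord: "pd i (%x. x j) (%x. if i = j then 1 else 0)"
 unfolding pd_def by auto

lemma pd_add: "pd i f f' ==> pd i g g' ==> pd i (%x. f x + g x) (%x. f' x + g' x)"
 unfolding pd_def by (auto intro!: derivative_eq_intros)

lemma pd_diff: "pd i f f' ==> pd i g g' ==> pd i (%x. f x - g x) (%x. f' x - g' x)"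
 unfolding pd_def by (auto intro!: derivative_eq_intros)

lemma pd_mult: "pd i f f' ==> pd i g g' ==> pd i (%x. f x * g x) (%x. f' x * g x + f x * g' x)"
 unfolding pd_def by (auto intro!: derivative_eq_intros)

lemma pd_cmult: "pd i f f' ==> pd i (%x. c * f x) (%x. c * f' x)"
 unfolding pd_def by (auto intro!: derivative_eq_intros)

lemma pd_exp: "pd i f f' ==> pd i (%x. exp (- f x)) (%x. - (exp (- f x) * f' x))"
 unfolding pd_def by (auto intro!: derivative_eq_intros)

lemma pd_sum: "(!!j. j \<in> S ==> pd i (f j) (f' j)) ==> pd i (%x. \<Sum>j\<in>S. f j x) (%x. \<Sum>j\<in>S. f' j x)"
 unfolding pd_def by (auto intro!: derivative_eq_intros)

text \<open>The divergence theorem for a field along one axis: Fubini isolates coordinate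
  \<open>i\<close>, the fundamental theorem of calculus leaves the values on the two faces, and
  these vanish.\<close>

lemma J_div:
 assumes i: "i < n" and F: "pd i F F'" "continuous_on box F'"
  and face: "!!x. x \<in> box ==> x i = R | x i = -R ==> F x = 0"
 shows "J F' = 0"
proof -
 interpret product_sigma_finite "%_::nat. lborel :: real measure"
  by standard
 define I where "I = {..<n} - {i}"
 have I: "insert i I = {..<n}" "i \<notin> I" "finite I" using i by (auto simp: I_def)
 define P where "P = (\<Pi>\<^sub>M j\<in>{..<n}. lborel :: real measure)"
 have box_eq: "x(i := y) \<in> box \<longleftrightarrow> x(i := 0) \<in> box & y \<in> {-R..R}" if "x \<in> space (PiM I (%_. lborel))" for x y
 proof -
  have e: "x j = undefined" if "~ j < n" for j
   using \<open>x \<in> _\<close> that i by (auto simp: space_PiM PiE_iff extensional_def I_def)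
  have "x(i := y) \<in> box \<longleftrightarrow> (ALL j<n. (x(i := y)) j \<in> {-R..R})" for y
   using e i unfolding box_def PiE_iff extensional_def by auto
  moreover have "(ALL j<n. (x(i := y)) j \<in> {-R..R}) \<longleftrightarrow> (ALL j<n. j ~= i --> x j \<in> {-R..R}) & y \<in> {-R..R}" for y
   using i by (metis fun_upd_other fun_upd_same)
  ultimately show ?thesis using R_pos by simp
 qed
 have int: "integrable P (%x. indicator box x *\<^sub>R F' x)"
  using integ[OF F(2)] box_sets unfolding bm_def P_def by (subst (asm) integrable_restrict_space) auto
 have "J F' = (LINT x|P. indicator box x *\<^sub>R F' x)"
  unfolding bm_def P_def using box_sets by (subst integral_restrict_space) auto
 also have "... = (LINT x|PiM I (%_. lborel). (LINT y|lborel. indicator box (x(i := y)) *\<^sub>R F' (x(i := y))))"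
  using int unfolding P_def I(1)[symmetric] by (intro product_integral_insert I)
 also have "... = (LINT x|PiM I (%_. lborel :: real measure). 0)"
 proof (rule Bochner_Integration.integral_cong[OF refl])
  fix x assume x: "x \<in> space (PiM I (%_. lborel :: real measure))"
  show "(LINT y|lborel. indicator box (x(i := y)) *\<^sub>R F' (x(i := y))) = 0"
  proof (cases "x(i := 0) \<in> box")
   case True
   have b: "x(i := y) \<in> box" if "-R <= y" "y <= R" for y
    using box_eq[OF x] True that by auto
   have "(LINT y|lborel. indicator box (x(i := y)) *\<^sub>R F' (x(i := y)))
     = (LINT y|lborel. indicator {-R..R} y *\<^sub>R F' (x(i := y)))"
   proof (rule Bochner_Integration.integral_cong[OF refl])
    fix y
    have "x(i := y) \<in> box \<longleftrightarrow> y \<in> {-R..R}" using box_eq[OF x, of y] True by blast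
    thus "indicator box (x(i := y)) *\<^sub>R F' (x(i := y)) = indicator {-R..R} y *\<^sub>R F' (x(i := y))"
     unfolding indicator_def by simp
   qed
   also have "... = F (x(i := R)) - F (x(i := - R))"
   proof (rule integral_FTC_atLeastAtMost)
    fix y assume y: "-R <= y" "y <= R"
    have "((%r. F ((x(i := y))(i := r))) has_real_derivative F' (x(i := y))) (at ((x(i := y)) i))"
     using F(1) b[OF y] unfolding pd_def by blast
    thus "((%y. F (x(i := y))) has_vector_derivative F' (x(i := y))) (at y within {-R..R})"
     by (simp add: has_field_derivative_at_within has_real_derivative_iff_has_vector_derivative[symmetric])
   next
    show "continuous_on {-R..R} (%y. F' (x(i := y)))"
    proof (rule continuous_on_compose2[OF F(2)])
     show "continuous_on {- R..R} (%y. x(i := y))"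
     proof (rule continuous_on_coordinatewise_then_product)
      fix j show "continuous_on {- R..R} (%y. (x(i := y)) j)"
       by (cases "j = i") auto
     qed
    qed (use b in auto)
   qed (use R_pos in auto)
   also have "... = 0"
    using face[of "x(i := R)"] face[of "x(i := -R)"] b[of R] b[of "-R"] R_pos by auto
   finally show ?thesis .
  next
   case False
   hence "x(i := y) \<notin> box" for y using box_eq[OF x, of y] by blast
   thus ?thesis by simp
  qed
 qed
 finally show ?thesis by simp
qed

end

section \<open>Cosine polynomials, the generator and the Bochner formula\<close>

context cube
begin

text \<open>
 Cosine polynomials satisfy the Neumann condition on the faces of the box, so no boundary terms
 appear below. \<open>cp c K is\<close> is the partial derivative along \<open>is\<close> of the polynomial with
 coefficients \<open>c\<close> and frequencies \<open>K\<close>.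
\<close>

definition dcos :: "nat => nat => real => real" where
 "dcos m k r = (k * pi/(2 * R)) ^ m * cos (k * pi*(r + R)/(2 * R) + m * pi/2)"

definition tens :: "(nat => nat) => nat list => (nat => real) => real" where
 "tens k is x = (PROD j<n. dcos (count_list is j) (k j) (x j))"

definition cp :: "((nat => nat) => real) => (nat => nat) set => nat list => (nat => real) => real" where
 "cp c K is x = (\<Sum>k\<in>K. c k * tens k is x)"

lemma dcos_deriv: "(dcos m k has_real_derivative dcos (Suc m) k r) (at r)"
proof -
 have "cos (a + real (Suc m) * pi/2) = - sin (a + real m * pi/2)" for a :: real
 proof -
  have "a + real (Suc m) * pi/2 = (a + real m * pi/2) + pi/2" by (simp add: field_simps)
  thus ?thesis by (simp only: cos_add) simp
 qed
 thus ?thesis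
  unfolding dcos_def using R_pos by (auto intro!: derivative_eq_intros)
qed

lemma cont_dcos: "continuous_on A (%x :: nat => real. dcos m k (x j))"
proof -
 have "continuous_on UNIV (dcos m k)"
  by (rule DERIV_continuous_on[OF has_field_derivative_at_within[OF dcos_deriv]])
 from continuous_on_compose2[OF this cont_coord subset_UNIV] show ?thesis .
qed

lemma cont_tens [continuous_intros]: "continuous_on A (%x. tens k is x)"
 unfolding tens_def by (intro continuous_intros cont_dcos)

lemma cont_cp [continuous_intros]: "continuous_on A (%x. cp c K is x)"
 unfolding cp_def by (intro continuous_intros)

lemma pd_tens:
 assumes "i < n"
 shows "pd i (%x. tens k is x) (%x. tens k (i # is) x)"
 unfolding pd_def
proof
 fix x
 have split: "{..<n} = insert i ({..<n} - {i})" using assms by auto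
 have "tens k is (x(i := r)) = dcos (count_list is i) (k i) r *
   (\<Prod>j\<in>{..<n} - {i}. dcos (count_list is j) (k j) (x j))" for r
  unfolding tens_def by (subst split, subst prod.insert) auto
 moreover have "tens k (i # is) x = dcos (Suc (count_list is i)) (k i) (x i) *
   (\<Prod>j\<in>{..<n} - {i}. dcos (count_list is j) (k j) (x j))"
  unfolding tens_def by (subst split, subst prod.insert) auto
 ultimately show "((%r. tens k is (x(i := r))) has_real_derivative tens k (i # is) x) (at (x i))"
  by (simp add: DERIV_cmult_right dcos_deriv)
qed

lemma pd_cp: "i < n ==> pd i (%x. cp c K is x) (%x. cp c K (i # is) x)"
 unfolding cp_def by (intro pd_sum pd_cmult pd_tens)

lemma tens_swap: "tens k (i # j # is) = tens k (j # i # is)"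
 unfolding tens_def by (intro ext prod.cong) auto

lemma cp_swap: "cp c K (i # j # is) = cp c K (j # i # is)"
 unfolding cp_def by (intro ext sum.cong) (simp_all add: tens_swap)

lemma cp_rot: "cp c K [i, j, l] = cp c K [j, l, i]"
proof -
 have "tens k [i, j, l] = tens k [j, l, i]" for k
  unfolding tens_def by (intro ext prod.cong) auto
 thus ?thesis unfolding cp_def by (intro ext sum.cong) auto
qed

lemma dcos_face: "dcos 1 k R = 0" "dcos 1 k (- R) = 0"
proof -
 have "cos (a + pi/2) = - sin a" for a :: real by (simp add: cos_add)
 thus "dcos 1 k R = 0" "dcos 1 k (- R) = 0"
  unfolding dcos_def using R_pos sin_npi[of k] by auto
qed

text \<open>A single derivative along \<open>i\<close> turns the cosine in that coordinate into a
  sine vanishing at both ends; derivatives along other axes leave this factor alone. This is the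
  Neumann condition.\<close>

lemma cp_face:
 assumes "i < n" "x i = R | x i = - R" "count_list is i = 1"
 shows "cp c K is x = 0"
proof -
 have "tens k is x = 0" for k
  unfolding tens_def using assms dcos_face by (intro prod_zero) (auto intro!: bexI[of _ i])
 thus ?thesis unfolding cp_def by simp
qed

definition C1 :: "((nat => real) => real) => (nat => (nat => real) => real) => bool" where
 "C1 g g1 \<longleftrightarrow> continuous_on box g & (ALL i<n. continuous_on box (g1 i) & pd i g (g1 i))"

text \<open>\<open>V1\<close> and \<open>V2\<close> are the gradient and the Hessian of
  \<open>V\<close>, and the last clause says that the Hessian is at least the diagonal matrix
  \<open>t\<close>. The bound is a vector because a tilt improves one coordinate at a time.\<close>

definition pot :: "(nat => real) => ((nat => real) => real) => (nat => (nat => real) => real) =>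
  (nat => nat => (nat => real) => real) => bool" where
 "pot t V V1 V2 \<longleftrightarrow> C1 V V1 & (ALL i<n. C1 (V1 i) (V2 i)) &
  (\<forall>x\<in>box. ALL v. (SUM i<n. t i*(v i)^2) <= (SUM i<n. SUM j<n. V2 i j x * v i * v j))"

text \<open>The generator \<open>Laplacian u - grad V . grad u\<close> of the diffusion reversible
  for \<open>exp (- V)\<close>, applied to a cosine polynomial \<open>u\<close>.\<close>

definition lap :: "(nat => (nat => real) => real) => ((nat => nat) => real) => (nat => nat) set => (nat => real) => real" where
 "lap V1 c K x = (SUM i<n. cp c K [i, i] x - V1 i x * cp c K [i] x)"

lemma C1_cp: "C1 (%x. cp c K is x) (%i x. cp c K (i # is) x)"
 unfolding C1_def by (auto intro!: continuous_intros pd_cp)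

lemma C1D: "C1 g g1 ==> continuous_on box g"
 "C1 g g1 ==> i < n ==> continuous_on box (g1 i)" "C1 g g1 ==> i < n ==> pd i g (g1 i)"
 unfolding C1_def by auto

lemma potD: "pot t V V1 V2 ==> C1 V V1" "pot t V V1 V2 ==> i < n ==> C1 (V1 i) (V2 i)"
 "pot t V V1 V2 ==> x \<in> box ==> (SUM i<n. t i*(v i)^2) <= (SUM i<n. SUM j<n. V2 i j x * v i * v j)"
 unfolding pot_def by auto

lemma cont_lap:
 assumes "!!i. i < n ==> continuous_on box (V1 i)"
 shows "continuous_on box (%x. lap V1 c K x)"
 unfolding lap_def using assms by (auto intro!: continuous_intros)

text \<open>The divergence theorem for the field \<open>exp (- V) g grad u\<close>, whose normal
  component vanishes on the faces by the Neumann condition.\<close>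

lemma J_by_parts:
 assumes V: "C1 V V1" and g: "C1 g g1"
 shows "J (%x. exp (- V x)*(g x * lap V1 c K x)) = - J (%x. exp (- V x)*(SUM i<n. g1 i x * cp c K [i] x))"
proof -
 note [continuous_intros] = C1D(1)[OF V] C1D(1)[OF g] C1D(2)[OF V] C1D(2)[OF g]
 let ?F' = "%i x. - (exp (- V x) * V1 i x)*(g x * cp c K [i] x) +
   exp (- V x)*(g1 i x * cp c K [i] x + g x * cp c K [i, i] x)"
 have cF: "continuous_on box (?F' i)" if "i < n" for i
  using that by (intro continuous_intros)
 have "J (?F' i) = 0" if i: "i < n" for i
 proof (rule J_div[OF i])
  show "pd i (%x. exp (- V x)*(g x * cp c K [i] x)) (?F' i)"
   by (intro pd_mult pd_exp C1D(3)[OF V] C1D(3)[OF g] pd_cp i)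
  show "exp (- V x)*(g x * cp c K [i] x) = 0" if "x i = R | x i = - R" for x
   using cp_face[of i x "[i]" c K] i that by simp
 qed (rule cF[OF i])
 hence "J (%x. SUM i<n. ?F' i x) = 0"
  by (subst J_sum) (use cF in auto)
 moreover have "(SUM i<n. ?F' i x) = exp (- V x)*(g x * lap V1 c K x) + exp (- V x)*(SUM i<n. g1 i x * cp c K [i] x)" for x
  unfolding lap_def sum_distrib_left sum.distrib[symmetric] by (intro sum.cong refl) (simp add: algebra_simps)
 ultimately have "J (%x. exp (- V x)*(g x * lap V1 c K x) + exp (- V x)*(SUM i<n. g1 i x * cp c K [i] x)) = 0"
  by simp
 thus ?thesis
  by (subst (asm) J_add) (auto intro!: continuous_intros cont_lap)
qed

text \<open>The divergence theorem for \<open>exp (- V)\<close> times the field \<open>G\<close>,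
  which is \<open>Lu grad u\<close> minus half the gradient of \<open>|grad u|^2\<close>. The
  commutator of the generator with the gradient produces the Hessian of \<open>V\<close>.\<close>

lemma bochner:
 assumes P: "pot t V V1 V2"
 shows "J (%x. exp (- V x)*(lap V1 c K x)^2) =
  J (%x. exp (- V x)*(SUM i<n. SUM j<n. (cp c K [i, j] x)^2)) +
  J (%x. exp (- V x)*(SUM i<n. SUM j<n. V2 i j x * cp c K [i] x * cp c K [j] x))"
proof -
 note V = potD(1)[OF P] and V1 = potD(2)[OF P]
 note [continuous_intros] = C1D(1)[OF V] C1D(2)[OF V] C1D(2)[OF V1] cont_lap[OF C1D(2)[OF V]]
 let ?w = "%x. exp (- V x)" and ?u = "cp c K"
 let ?L = "lap V1 c K"
 define L' where "L' i x = (SUM j<n. ?u [i, j, j] x - (V2 j i x*?u [j] x + V1 j x*?u [i, j] x))" for i x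
 have pdL: "pd i ?L (L' i)" if "i < n" for i
  unfolding lap_def L'_def using that
  by (intro pd_sum pd_diff pd_mult pd_cp C1D(3)[OF V1]) auto
 define G where "G i x = ?u [i] x*?L x - (SUM j<n. ?u [j] x*?u [i, j] x)" for i x
 define G' where "G' i x = (?u [i, i] x*?L x + ?u [i] x * L' i x) -
   (SUM j<n. ?u [i, j] x*?u [i, j] x + ?u [j] x*?u [i, i, j] x)" for i x
 have pdG: "pd i (G i) (G' i)" if "i < n" for i
  unfolding G_def G'_def using that
  by (intro pd_diff pd_sum pd_mult pd_cp pdL)
 have cG: "continuous_on box (G i)" "continuous_on box (G' i)" if "i < n" for i
  using that unfolding G_def G'_def L'_def by (auto intro!: continuous_intros)
 let ?F' = "%i x. - (?w x * V1 i x) * G i x + ?w x * G' i x"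
 have cF: "continuous_on box (?F' i)" if "i < n" for i
  using that by (intro continuous_intros cG)
 have "J (?F' i) = 0" if i: "i < n" for i
 proof (rule J_div[OF i])
  show "pd i (%x. ?w x * G i x) (?F' i)"
   by (intro pd_mult pd_exp C1D(3)[OF V] pdG i)
  show "?w x * G i x = 0" if x: "x i = R | x i = - R" for x
  proof -
   \<comment> \<open>For \<open>j = i\<close> the first derivative vanishes on the face; for
     \<open>j ~= i\<close> the mixed one does, being differentiated just once along
     \<open>i\<close>.\<close>
   have "?u [j] x*?u [i, j] x = 0" if "j < n" for j
    using cp_face[of i x "[i]" c K] cp_face[of i x "[i, j]" c K] i x by (cases "j = i") auto
   thus ?thesis
    unfolding G_def using cp_face[of i x "[i]" c K] i x by (auto intro!: sum.neutral)
  qed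
 qed (rule cF[OF i])
 hence z: "J (%x. SUM i<n. ?F' i x) = 0"
  by (subst J_sum) (use cF in auto)
 let ?H = "%x. SUM i<n. SUM j<n. (?u [i, j] x)^2"
 let ?Q = "%x. SUM i<n. SUM j<n. V2 i j x*?u [i] x*?u [j] x"
 have "(SUM i<n. ?F' i x) = ?w x*(?L x)^2 - (?w x*?H x + ?w x*?Q x)" for x
 proof -
  \<comment> \<open>\<open>a\<close> collects the terms with the gradient of \<open>V\<close> and
    second derivatives of \<open>u\<close>, \<open>b\<close> those with third derivatives. Each
    occurs with both orders of the indices and opposite signs, so both cancel after
    summation.\<close>
  define a where "a i j = ?u [i] x * V1 j x*?u [i, j] x" for i j
  define b where "b i j = ?u [i] x*?u [i, j, j] x" for i j
  have sa: "V1 i x*(?u [j] x*?u [i, j] x) = a j i" for i j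
   unfolding a_def using cp_swap[of c K i j "[]"] by simp
  have sb: "?u [j] x*?u [i, i, j] x = b j i" for i j
   unfolding b_def using cp_rot[of c K j i i] by simp
  have L2: "(?L x)^2 = (SUM i<n. (?u [i, i] x - V1 i x*?u [i] x)*?L x)"
   unfolding power2_eq_square by (simp add: lap_def sum_distrib_right)
  have Q: "?Q x = (SUM i<n. SUM j<n. ?u [i] x*(V2 j i x*?u [j] x))"
   by (subst sum.swap) (simp add: mult_ac)
  have "- V1 i x * G i x + G' i x = (?u [i, i] x - V1 i x*?u [i] x)*?L x
    + (SUM j<n. a j i) + (SUM j<n. b i j) - (SUM j<n. ?u [i] x*(V2 j i x*?u [j] x)) - (SUM j<n. a i j)
    - (SUM j<n. (?u [i, j] x)^2) - (SUM j<n. b j i)" for i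
  proof -
   have "?u [i] x * L' i x = (SUM j<n. b i j) - (SUM j<n. ?u [i] x*(V2 j i x*?u [j] x)) - (SUM j<n. a i j)"
    unfolding L'_def sum_distrib_left a_def b_def sum_subtractf[symmetric]
    by (intro sum.cong refl) (simp add: algebra_simps)
   moreover have "V1 i x*(SUM j<n. ?u [j] x*?u [i, j] x) = (SUM j<n. a j i)"
    unfolding sum_distrib_left sa ..
   ultimately show ?thesis
    unfolding G_def G'_def sum.distrib sb by (simp add: algebra_simps power2_eq_square)
  qed
  hence "(SUM i<n. - V1 i x * G i x + G' i x) = (?L x)^2 - ?H x - ?Q x
    + ((SUM i<n. SUM j<n. a j i) - (SUM i<n. SUM j<n. a i j)) + ((SUM i<n. SUM j<n. b i j) - (SUM i<n. SUM j<n. b j i))"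
   unfolding L2 Q by (simp add: sum.distrib sum_subtractf)
  also have "... = (?L x)^2 - ?H x - ?Q x"
   using sum.swap[of a "{..<n}" "{..<n}"] sum.swap[of b "{..<n}" "{..<n}"] by simp
  finally have e: "(SUM i<n. - V1 i x * G i x + G' i x) = (?L x)^2 - ?H x - ?Q x" .
  have "(SUM i<n. ?F' i x) = ?w x*(SUM i<n. - V1 i x * G i x + G' i x)"
   unfolding sum_distrib_left by (intro sum.cong refl) (simp add: algebra_simps)
  thus ?thesis unfolding e by (simp add: algebra_simps)
 qed
 with z have "J (%x. ?w x*(?L x)^2 - (?w x*?H x + ?w x*?Q x)) = 0"
  by simp
 also have "J (%x. ?w x*(?L x)^2 - (?w x*?H x + ?w x*?Q x)) =
   J (%x. ?w x*(?L x)^2) - J (%x. ?w x*?H x + ?w x*?Q x)"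
  by (intro J_diff continuous_intros) auto
 also have "J (%x. ?w x*?H x + ?w x*?Q x) = J (%x. ?w x*?H x) + J (%x. ?w x*?Q x)"
  by (intro J_add continuous_intros) auto
 finally show ?thesis by simp
qed

end

section \<open>The algebra of cosine polynomials and the Neumann problem without potential\<close>

context cube
begin

lemma cp_add:
 assumes "finite K" "finite K'"
 shows "EX c'' K''. finite K'' & (ALL is x. cp c'' K'' is x = a * cp c K is x + b * cp c' K' is x)"
proof (intro exI[of _ "%k. (if k \<in> K then a * c k else 0) + (if k \<in> K' then b * c' k else 0)"] exI[of _ "K \<union> K'"] conjI allI)
 show "finite (K \<union> K')" using assms by simp
 fix "is" x
 have 1: "(\<Sum>k\<in>K \<union> K'. if k \<in> K then a * c k * tens k is x else 0) = (\<Sum>k\<in>K. a * c k * tens k is x)"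
  using assms by (intro sum.mono_neutral_cong_right) auto
 have 2: "(\<Sum>k\<in>K \<union> K'. if k \<in> K' then b * c' k * tens k is x else 0) = (\<Sum>k\<in>K'. b * c' k * tens k is x)"
  using assms by (intro sum.mono_neutral_cong_right) auto
 have "cp (%k. (if k \<in> K then a * c k else 0) + (if k \<in> K' then b * c' k else 0)) (K \<union> K') is x =
  (\<Sum>k\<in>K \<union> K'. if k \<in> K then a * c k * tens k is x else 0) +
  (\<Sum>k\<in>K \<union> K'. if k \<in> K' then b * c' k * tens k is x else 0)"
  unfolding cp_def sum.distrib[symmetric] by (intro sum.cong refl) (simp add: algebra_simps)
 thus "cp (%k. (if k \<in> K then a * c k else 0) + (if k \<in> K' then b * c' k else 0)) (K \<union> K') is x =
   a * cp c K is x + b * cp c' K' is x"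
  unfolding 1 2 cp_def sum_distrib_left by (simp add: mult.assoc)
qed

definition cosp :: "((nat => real) => real) set" where
 "cosp = {f. EX c K. finite K & (ALL x. f x = cp c K [] x)}"

lemma cosp_lin:
 assumes "f \<in> cosp" "g \<in> cosp"
 shows "(%x. a * f x + b * g x) \<in> cosp"
proof -
 obtain c K where 1: "finite K" "!!x. f x = cp c K [] x" using assms(1) unfolding cosp_def by blast
 obtain c' K' where 2: "finite K'" "!!x. g x = cp c' K' [] x" using assms(2) unfolding cosp_def by blast
 show ?thesis
  using cp_add[OF 1(1) 2(1), of a c b c'] unfolding cosp_def mem_Collect_eq 1(2) 2(2) by metis
qed

lemma cosp_tens: "(%x. tens k [] x) \<in> cosp"
 unfolding cosp_def mem_Collect_eq by (intro exI[of _ "%_. 1"] exI[of _ "{k}"]) (simp add: cp_def)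

lemma cosp_sum:
 assumes "finite S" "!!k. k \<in> S ==> f k \<in> cosp"
 shows "(%x. \<Sum>k\<in>S. c k * f k x) \<in> cosp"
 using assms
proof (induction S rule: finite_induct)
 case empty
 show ?case unfolding cosp_def mem_Collect_eq by (intro exI[of _ "%_. 1"] exI[of _ "{}"]) (simp add: cp_def)
next
 case (insert k S)
 thus ?case using cosp_lin[of "f k" "%x. \<Sum>k\<in>S. c k * f k x" "c k" 1] by simp
qed

lemma tens_upd:
 assumes "i < n"
 shows "tens (k(i := m)) [] x = dcos 0 m (x i)*(\<Prod>j\<in>{..<n} - {i}. dcos 0 (k j) (x j))"
proof -
 have split: "{..<n} = insert i ({..<n} - {i})" using assms by auto
 show ?thesis
  unfolding tens_def by (subst split, subst prod.insert) auto
qed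

lemma dcos_prod: "dcos 0 k r * dcos 0 l r =
  (dcos 0 (l + k) r + dcos 0 (if k <= l then l - k else k - l) r)/2"
proof -
 define \<theta> where "\<theta> = pi*(r + R)/(2 * R)"
 have d: "dcos 0 m r = cos (m*\<theta>)" for m
  unfolding dcos_def \<theta>_def by (simp add: mult.assoc)
 have "cos (real (if k <= l then l - k else k - l)*\<theta>) = cos (real k*\<theta> - real l*\<theta>)"
  using cos_minus[of "real k*\<theta> - real l*\<theta>"] by (simp add: of_nat_diff left_diff_distrib)
 thus ?thesis
  unfolding d cos_times_cos by (simp add: distrib_right algebra_simps)
qed

lemma cosp_mult_dcos:
 assumes "i < n" "f \<in> cosp"
 shows "(%x. dcos 0 m (x i) * f x) \<in> cosp"
proof -
 have t: "(%x. dcos 0 m (x i) * tens k [] x) \<in> cosp" for k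
 proof -
  let ?l = "if m <= k i then k i - m else m - k i"
  have "dcos 0 m (x i) * tens k [] x = 1/2 * tens (k(i := k i + m)) [] x + 1/2 * tens (k(i := ?l)) [] x" for x
  proof -
   define P where "P = (\<Prod>j\<in>{..<n} - {i}. dcos 0 (k j) (x j))"
   have "tens k [] x = dcos 0 (k i) (x i) * P"
    using tens_upd[OF assms(1), of k "k i" x] by (simp add: P_def)
   hence "dcos 0 m (x i) * tens k [] x = (dcos 0 m (x i) * dcos 0 (k i) (x i)) * P" by simp
   also have "... = 1/2*(dcos 0 (k i + m) (x i) * P) + 1/2*(dcos 0 ?l (x i) * P)"
    unfolding dcos_prod by (simp only: add_divide_distrib distrib_right times_divide_eq_left mult_1)
   finally show ?thesis
    unfolding tens_upd[OF assms(1)] P_def .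
  qed
  thus ?thesis
   using cosp_lin[OF cosp_tens cosp_tens, of "1/2" "k(i := k i + m)" "1/2" "k(i := ?l)"] by simp
 qed
 obtain c K where K: "finite K" "!!x. f x = cp c K [] x"
  using assms(2) unfolding cosp_def by blast
 have "(%x. dcos 0 m (x i) * f x) = (%x. \<Sum>k\<in>K. c k*(dcos 0 m (x i) * tens k [] x))"
  unfolding K(2) cp_def sum_distrib_left by (intro ext sum.cong refl) simp
 thus ?thesis using cosp_sum[OF K(1), of "%k x. dcos 0 m (x i) * tens k [] x" c] t by simp
qed

lemma cosp_mult:
 assumes "f \<in> cosp" "g \<in> cosp"
 shows "(%x. f x * g x) \<in> cosp"
proof -
 have t: "(%x. (PROD j<m. dcos 0 (k j) (x j)) * g x) \<in> cosp" if "m <= n" for k m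
  using that
 proof (induction m)
  case 0
  thus ?case using assms(2) by simp
 next
  case (Suc m)
  hence "(%x. dcos 0 (k m) (x m)*((PROD j<m. dcos 0 (k j) (x j)) * g x)) \<in> cosp"
   by (intro cosp_mult_dcos) auto
  thus ?case by (simp add: mult_ac)
 qed
 obtain c K where K: "finite K" "!!x. f x = cp c K [] x"
  using assms(1) unfolding cosp_def by blast
 have "(%x. f x * g x) = (%x. \<Sum>k\<in>K. c k*(tens k [] x * g x))"
  unfolding K(2) cp_def sum_distrib_right by (intro ext sum.cong refl) simp
 moreover have "(%x. tens k [] x * g x) \<in> cosp" for k
  using t[of n k] unfolding tens_def by simp
 ultimately show ?thesis
  using cosp_sum[OF K(1), of "%k x. tens k [] x * g x" c] by simp
qed

lemma cosp_const: "(%_. a) \<in> cosp"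
proof -
 have "tens (%_. 0) [] x = 1" for x unfolding tens_def dcos_def by simp
 thus ?thesis using cosp_lin[OF cosp_tens cosp_tens, of a "%_. 0" 0 "%_. 0"] by simp
qed

text \<open>Over the box the angle runs through \<open>[0, pi]\<close> only, where the cosine is
  injective; the half-period scaling of the frequencies is made for this.\<close>

lemma cosp_sep:
 assumes "x \<in> box" "y \<in> box" "x ~= y"
 shows "\<exists>f\<in>cosp. f x ~= f y"
proof -
 obtain i where i: "i < n" "x i ~= y i"
  using assms unfolding box_def by (metis PiE_ext lessThan_iff)
 have "(%x. dcos 0 1 (x i)*1) \<in> cosp"
  by (rule cosp_mult_dcos[OF i(1) cosp_const])
 moreover have "dcos 0 1 (x i) ~= dcos 0 1 (y i)"
 proof
  assume "dcos 0 1 (x i) = dcos 0 1 (y i)"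
  hence "cos (pi*(x i + R)/(2 * R)) = cos (pi*(y i + R)/(2 * R))"
   unfolding dcos_def by simp
  moreover have "0 <= pi*(z i + R)/(2 * R) & pi*(z i + R)/(2 * R) <= pi" if "z \<in> box" for z
  proof -
   have "0 <= (z i + R)/(2 * R)" "(z i + R)/(2 * R) <= 1"
    using boxD[OF that i(1)] R_pos by (auto simp: abs_le_iff)
   hence "0 <= pi*((z i + R)/(2 * R))" "pi*((z i + R)/(2 * R)) <= pi*1"
    by (intro mult_nonneg_nonneg mult_left_mono; simp)+
   thus ?thesis by simp
  qed
  ultimately have "pi*(x i + R)/(2 * R) = pi*(y i + R)/(2 * R)"
   using cos_inj_pi assms by blast
  thus False using i(2) R_pos by simp
 qed
 ultimately show ?thesis by (intro bexI[of _ "%x. dcos 0 1 (x i)*1"]) auto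
qed

text \<open>Tensor products of cosines are eigenfunctions with eigenvalue \<open>l k\<close>, so
  coefficients are divided by it. The eigenvalue 0 belongs to constants only, and their share of
  \<open>f\<close> goes into \<open>a\<close>.\<close>

lemma lap0_surj:
 assumes "f \<in> cosp"
 shows "EX c K a. finite K & (ALL x. lap (%_ _. 0) c K x = f x + a)"
proof -
 obtain c K where K: "finite K" "!!x. f x = cp c K [] x"
  using assms unfolding cosp_def by blast
 define l where "l k = - (SUM i<n. (real (k i) * pi/(2 * R))^2)" for k :: "nat => nat"
 have t2: "tens k [i, i] x = - (real (k i) * pi/(2 * R))\<^sup>2 * tens k [] x" if "i < n" for i k x
 proof -
  have split: "{..<n} = insert i ({..<n} - {i})" using that by auto
  have "dcos 2 m r = - (real m * pi/(2 * R))\<^sup>2 * dcos 0 m r" for m r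
   unfolding dcos_def by simp
  thus ?thesis
   unfolding tens_def by (subst (1 2) split, subst (1 2) prod.insert)
    (auto intro!: prod.cong simp: numeral_2_eq_2)
 qed
 have z: "tens k [] x = 1" if "l k = 0" for k x
 proof -
  have "\<forall>i\<in>{..<n}. (real (k i) * pi/(2 * R))^2 = 0"
   using that unfolding l_def by (subst sum_nonneg_eq_0_iff[symmetric]) auto
  hence "k i = 0" if "i < n" for i using that R_pos by auto
  thus ?thesis unfolding tens_def dcos_def by (intro prod.neutral) auto
 qed
 define c' where "c' k = (if l k = 0 then 0 else c k/l k)" for k
 have "lap (%_ _. 0) c' K x = f x + - (\<Sum>k\<in>K. if l k = 0 then c k else 0)" for x
 proof -
  have "lap (%_ _. 0) c' K x = (SUM i<n. \<Sum>k\<in>K. c' k*(- (real (k i) * pi/(2 * R))\<^sup>2 * tens k [] x))"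
   unfolding lap_def cp_def by (intro sum.cong refl) (simp add: t2)
  also have "... = (\<Sum>k\<in>K. c' k * l k * tens k [] x)"
   unfolding l_def by (subst sum.swap) (simp add: sum_distrib_left sum_negf mult_ac)
  also have "... = (\<Sum>k\<in>K. c k * tens k [] x - (if l k = 0 then c k else 0))"
   by (intro sum.cong refl) (auto simp: c'_def z)
  finally show ?thesis unfolding K(2) cp_def by (simp add: sum_subtractf)
 qed
 thus ?thesis using K(1) by blast
qed

text \<open>
 Weak solvability of the Neumann problem \<open>lap V1 u = h + a\<close>, with a free constant \<open>a\<close>. It holds
 for zero potential by Stone--Weierstrass and survives small changes of the potential; the continuity
 method then reaches every convex potential.
\<close>

definition dens :: "(nat => (nat => real) => real) => bool" where
 "dens V1 \<longleftrightarrow> (ALL h e. continuous_on box h --> e > 0 -->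
  (EX c K a. finite K & J (%x. (lap V1 c K x - h x - a)^2) <= e))"

text \<open>Stone--Weierstrass replaces \<open>h\<close> by a cosine polynomial, for which the
  equation is solved exactly. The uniform distance \<open>d\<close> is such that \<open>d^2\<close>
  times the volume of the box equals \<open>e\<close>.\<close>

lemma dens0: "dens (%_ _. 0)"
 unfolding dens_def
proof (intro allI impI)
 fix h :: "(nat => real) => real" and e :: real
 assume h: "continuous_on box h" and e: "e > 0"
 interpret function_ring_on cosp box
 proof
  show "continuous_on box f" if fc: "f \<in> cosp" for f
  proof -
   obtain c K where f: "!!x. f x = cp c K [] x" using fc unfolding cosp_def by blast
   have "continuous_on box (%x. f x)" unfolding f by (rule cont_cp)
   thus ?thesis by simp
  qed
  show "(%x. f x + g x) \<in> cosp" if "f \<in> cosp" "g \<in> cosp" for f g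
   using cosp_lin[OF that, of 1 1] by simp
 qed (auto intro: compact_box cosp_mult cosp_const cosp_sep)
 define d where "d = sqrt (e/(2 * R) ^ n)"
 have d: "d > 0" using e R_pos by (simp add: d_def)
 obtain g where g: "g \<in> cosp" "!!x. x \<in> box ==> \<bar>h x - g x\<bar> < d"
  using Stone_Weierstrass_basic[OF h d] by blast
 obtain c K a where K: "finite K" "!!x. lap (%_ _. 0) c K x = g x + a"
  using lap0_surj[OF g(1)] by blast
 have cg: "continuous_on box g" using g(1) by (rule continuous)
 have "J (%x. (lap (%_ _. 0) c K x - h x - a)^2) <= J (%x. d^2*1)"
 proof (intro J_mono)
  show "continuous_on box (%x. (lap (%_ _. 0) c K x - h x - a)^2)"
   unfolding K by (intro continuous_intros h cg)
  fix x assume "x \<in> box"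
  from g(2)[OF this] have "\<bar>g x - h x\<bar> <= \<bar>d\<bar>" by simp
  thus "(lap (%_ _. 0) c K x - h x - a)^2 <= d^2*1"
   unfolding K by (simp add: abs_le_square_iff)
 qed simp
 also have "... = e"
  unfolding integral_mult_right_zero J_one using e R_pos by (simp add: d_def)
 finally show "EX c K a. finite K & J (%x. (lap (%_ _. 0) c K x - h x - a)^2) <= e"
  using K(1) by blast
qed

end

lemma le_if_le_eps:
 fixes x y z :: real
 assumes "!!\<eta>. 0 < \<eta> ==> x <= y + \<eta> * z"
 shows "x <= y"
proof (rule field_le_epsilon)
 fix e :: real assume e: "0 < e"
 have "x <= y + e/(\<bar>z\<bar> + 1) * z" using e by (intro assms) simp
 also have "e/(\<bar>z\<bar> + 1) * z <= e/(\<bar>z\<bar> + 1)*(\<bar>z\<bar> + 1)" using e by (intro mult_left_mono) auto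
 also have "... = e" by simp
 finally show "x <= y + e" by simp
qed

section \<open>The continuity method for the Neumann problem\<close>

context cube
begin

lemma pot_scale:
 assumes "pot (%_. 0) V V1 V2" "0 <= \<tau>"
 shows "pot (%_. 0) (%x. \<tau> * V x) (%i x. \<tau> * V1 i x) (%i j x. \<tau> * V2 i j x)"
 unfolding pot_def
proof (intro conjI allI impI ballI)
 note V = potD[OF assms(1)]
 show "C1 (%x. \<tau> * V x) (%i x. \<tau> * V1 i x)"
  unfolding C1_def using C1D[OF V(1)] by (auto intro!: continuous_intros pd_cmult)
 show "C1 (%x. \<tau> * V1 i x) (%j x. \<tau> * V2 i j x)" if "i < n" for i
  unfolding C1_def using C1D[OF V(2)[OF that]] by (auto intro!: continuous_intros pd_cmult)
 show "(SUM i<n. 0*(v i)^2) <= (SUM i<n. SUM j<n. \<tau> * V2 i j x * v i * v j)" if "x \<in> box" for x v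
 proof -
  have "0 <= \<tau>*(SUM i<n. SUM j<n. V2 i j x * v i * v j)"
   using V(3)[OF that, of v] assms(2) by (intro mult_nonneg_nonneg) auto
  thus ?thesis by (simp add: sum_distrib_left mult.assoc)
 qed
qed

lemma J_exp_bounds:
 assumes V: "continuous_on box V" "!!x. x \<in> box ==> \<bar>V x\<bar> <= B"
  and f: "continuous_on box f" "!!x. x \<in> box ==> 0 <= f x"
 shows "J (%x. exp (- V x) * f x) <= exp B * J f" "J f <= exp B * J (%x. exp (- V x) * f x)"
proof -
 note [continuous_intros] = V(1) f(1)
 have 1: "exp (- V x) <= exp B" "1 <= exp B * exp (- V x)" if "x \<in> box" for x
  using V(2)[OF that] by (auto simp flip: exp_add)
 have "J (%x. exp (- V x) * f x) <= J (%x. exp B * f x)"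
  using 1 f(2) by (intro J_mono continuous_intros mult_right_mono) auto
 thus "J (%x. exp (- V x) * f x) <= exp B * J f" by simp
 have "J f <= J (%x. exp B*(exp (- V x) * f x))"
 proof (intro J_mono continuous_intros)
  fix x assume x: "x \<in> box"
  have "1 * f x <= (exp B * exp (- V x)) * f x" using 1[OF x] f(2)[OF x] by (intro mult_right_mono) auto
  thus "f x <= exp B*(exp (- V x) * f x)" by simp
 qed
 thus "J f <= exp B * J (%x. exp (- V x) * f x)" by simp
qed

text \<open>The derivative along \<open>i\<close> of \<open>x_i * (u_i)^2\<close> integrates to
  zero, since \<open>u_i\<close> vanishes on the faces; the cross term \<open>2 x_i u_i u_ii\<close>
  is absorbed by completing a square, with \<open>|x_i| <= R\<close>.\<close>

lemma grad_le_hess: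
 assumes i: "i < n"
 shows "J (%x. (cp c K [i] x)^2) <= 4 * R^2 * J (%x. (cp c K [i, i] x)^2)"
proof -
 let ?u = "cp c K [i]" and ?v = "cp c K [i, i]"
 let ?F' = "%x. 1*(?u x*?u x) + x i*(?v x*?u x + ?u x*?v x)"
 have "J ?F' = 0"
 proof (rule J_div[OF i])
  show "pd i (%x. x i*(?u x*?u x)) ?F'"
   using pd_coord[of i i] by (intro pd_mult pd_cp i) simp
  show "x i*(?u x*?u x) = 0" if "x i = R | x i = - R" for x
   using cp_face[of i x "[i]" c K] i that by simp
 qed (intro continuous_intros)
 moreover have "J (%x. 1/2*(?u x)^2 - 2 * R^2*(?v x)^2) <= J ?F'"
 proof (intro J_mono continuous_intros)
  fix x assume "x \<in> box"
  have "(x i)^2 <= R^2" using boxD[OF \<open>x \<in> box\<close> i] R_pos by (simp add: abs_le_square_iff[symmetric])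
  hence "(x i)^2*(?v x)^2 <= R^2*(?v x)^2" by (intro mult_right_mono) auto
  moreover have "0 <= (?u x + 2 * x i*?v x)^2" by simp
  ultimately show "1/2*(?u x)^2 - 2 * R^2*(?v x)^2 <= ?F' x"
   by (simp add: power2_eq_square algebra_simps)
 qed
 moreover have "J (%x. 1/2*(?u x)^2 - 2 * R^2*(?v x)^2) = 1/2 * J (%x. (?u x)^2) - 2 * R^2 * J (%x. (?v x)^2)"
  by (subst J_diff) (intro continuous_intros, intro continuous_intros, simp)
 ultimately show ?thesis by linarith
qed

text \<open>For a convex potential the Bochner formula bounds the second derivatives by
  \<open>Lu\<close>, and \<open>grad_le_hess\<close> passes to the gradient. The potential enters
  only through \<open>B\<close>, so the estimate is uniform along the path \<open>\<tau> V\<close>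
  with \<open>\<tau>\<close> in \<open>[0, 1]\<close>.\<close>

lemma apriori:
 assumes P: "pot (%_. 0) V V1 V2" and B: "!!x. x \<in> box ==> \<bar>V x\<bar> <= B"
 shows "J (%x. SUM i<n. (cp c K [i] x)^2) <= 4 * R^2 * exp (2 * B) * J (%x. (lap V1 c K x)^2)"
proof -
 note V = potD(1)[OF P] and V1 = potD(2)[OF P]
 note [continuous_intros] = C1D(1)[OF V] C1D(2)[OF V] C1D(2)[OF V1] cont_lap[OF C1D(2)[OF V]]
 let ?w = "%x. exp (- V x)"
 have "J (%x. SUM i<n. (cp c K [i] x)^2) = (SUM i<n. J (%x. (cp c K [i] x)^2))"
  by (intro J_sum continuous_intros)
 also have "... <= (SUM i<n. 4 * R^2 * J (%x. (cp c K [i, i] x)^2))"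
  by (intro sum_mono grad_le_hess) auto
 also have "... = 4 * R^2 * J (%x. SUM i<n. (cp c K [i, i] x)^2)"
  by (subst J_sum) (auto intro!: continuous_intros simp: sum_distrib_left)
 also have "J (%x. SUM i<n. (cp c K [i, i] x)^2) <= exp B * J (%x. ?w x*(SUM i<n. (cp c K [i, i] x)^2))"
  by (intro J_exp_bounds continuous_intros B sum_nonneg) auto
 also have "J (%x. ?w x*(SUM i<n. (cp c K [i, i] x)^2)) <= J (%x. ?w x*(SUM i<n. SUM j<n. (cp c K [i, j] x)^2))"
  by (intro J_mono continuous_intros mult_left_mono sum_mono) (auto intro!: member_le_sum)
 also have "... <= J (%x. ?w x*(lap V1 c K x)^2)"
 proof -
  have "0 <= J (%x. ?w x*(SUM i<n. SUM j<n. V2 i j x * cp c K [i] x * cp c K [j] x))"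
   using potD(3)[OF P] by (intro J_nonneg mult_nonneg_nonneg) auto
  thus ?thesis using bochner[OF P, of c K] by simp
 qed
 also have "... <= exp B * J (%x. (lap V1 c K x)^2)"
  by (intro J_exp_bounds continuous_intros B) auto
 finally show ?thesis
  by (simp add: mult_left_mono exp_add[symmetric] mult.assoc[symmetric])
qed

lemma J_lap_zero:
 assumes V: "C1 V V1"
 shows "J (%x. exp (- V x) * lap V1 c K x) = 0"
proof -
 have "C1 (%_. 1) (%_ _. 0)" unfolding C1_def by (auto intro: pd_const)
 from J_by_parts[OF V this, of c K] show ?thesis by simp
qed

lemma sum_cauchy:
 fixes a b :: "nat => real"
 shows "(SUM i<m. a i * b i)^2 <= (SUM i<m. (a i)^2)*(SUM i<m. (b i)^2)"
 by (rule Cauchy_Schwarz_ineq_sum)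

text \<open>The point is to control the free constant \<open>a\<close>. Since \<open>Lu\<close> has
  weighted mean zero, \<open>a\<close> is minus the weighted mean of \<open>h\<close> plus the
  residual, and Cauchy--Schwarz bounds it.\<close>

lemma lap_bound:
 assumes P: "pot (%_. 0) V V1 V2" and B: "!!x. x \<in> box ==> \<bar>V x\<bar> <= B" "B >= 0"
  and h: "continuous_on box h" and r: "J (%x. (lap V1 c K x - h x - a)^2) <= J (%x. (h x)^2)/8"
 shows "J (%x. (lap V1 c K x)^2) <= 11 * exp (2 * B) * J (%x. (h x)^2)"
proof -
 note V = potD(1)[OF P] and V1 = potD(2)[OF P]
 note [continuous_intros] = h C1D(1)[OF V] cont_lap[OF C1D(2)[OF V]]
 let ?w = "%x. exp (- V x)" and ?L = "lap V1 c K"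
 define r where "r x = ?L x - h x - a" for x
 have cr [continuous_intros]: "continuous_on box (%x. r x)" unfolding r_def by (intro continuous_intros)
 define N where "N = J (%x. (h x)^2)"
 have N0: "N >= 0" unfolding N_def by (intro J_nonneg) simp
 have rN: "J (%x. (r x)^2) <= N/8" using r unfolding r_def N_def .
 have w: "J ?w > 0"
 proof -
  have "0 < exp (- B)*(2 * R) ^ n" using R_pos by simp
  also have "... <= J ?w"
   using J_exp_bounds(2)[OF C1D(1)[OF V] B(1), of "%_. 1"] unfolding J_one
   by (simp add: exp_minus field_simps)
  finally show ?thesis .
 qed
 have "J (%x. ?w x*(h x + r x)) + J (%x. a*?w x) = J (%x. ?w x*(h x + r x) + a*?w x)"
  by (intro J_add[symmetric] continuous_intros)
 also have "... = J (%x. ?w x*?L x)" by (intro J_cong) (simp add: r_def algebra_simps)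
 also have "... = 0" by (rule J_lap_zero[OF V])
 finally have a: "a * J ?w = - J (%x. ?w x*((h x + r x)*1))" by simp
 have "(a * J ?w)^2 <= J (%x. ?w x*(h x + r x)^2) * J (%x. ?w x*1^2)"
  unfolding a power2_minus by (intro J_cauchy continuous_intros) auto
 moreover have "(a * J ?w)^2 = (a^2 * J ?w) * J ?w"
  by (simp add: power2_eq_square)
 ultimately have "(a^2 * J ?w) * J ?w <= J (%x. ?w x*(h x + r x)^2) * J ?w"
  by simp
 hence "a^2 * J ?w <= J (%x. ?w x*(h x + r x)^2)" using w by simp
 also have "... <= exp B * J (%x. (h x + r x)^2)"
  by (intro J_exp_bounds continuous_intros B) auto
 also have "J (%x. (h x + r x)^2) <= J (%x. 2*(h x)^2 + 2*(r x)^2)"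
 proof (intro J_mono continuous_intros)
  fix x
  have "0 <= (h x - r x)^2" by simp
  thus "(h x + r x)^2 <= 2*(h x)^2 + 2*(r x)^2" by (simp add: power2_eq_square algebra_simps)
 qed
 also have "... = 2 * N + 2 * J (%x. (r x)^2)"
  by (subst J_add) (auto intro!: continuous_intros simp: N_def)
 also have "... <= 9/4 * N" using rN by simp
 finally have aw: "a^2 * J ?w <= exp B*(9/4 * N)" by simp
 have "J (%x. a^2) = a^2 * J (%_. 1)" by simp
 also have "... <= a^2*(exp B * J (%x. ?w x*1))"
  using J_exp_bounds(2)[OF C1D(1)[OF V] B(1), of "%_. 1"] by (intro mult_left_mono) auto
 also have "... = exp B*(a^2 * J ?w)" by simp
 also have "... <= exp B*(exp B*(9/4 * N))" using aw by (intro mult_left_mono) auto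
 finally have a2: "J (%x. a^2) <= exp B*(exp B*(9/4 * N))" .
 have "J (%x. (?L x)^2) <= J (%x. 3*(h x)^2 + (3 * a^2 + 3*(r x)^2))"
 proof (intro J_mono continuous_intros)
  fix x
  have "?L x = h x + a + r x" by (simp add: r_def)
  moreover have "0 <= (h x - a)^2 + (a - r x)^2 + (h x - r x)^2" by simp
  ultimately show "(?L x)^2 <= 3*(h x)^2 + (3 * a^2 + 3*(r x)^2)" by (simp add: power2_eq_square algebra_simps)
 qed
 also have "... = 3 * N + (3 * J (%x. a^2) + 3 * J (%x. (r x)^2))"
  by (subst J_add, intro continuous_intros, intro continuous_intros, subst J_add)
   (auto intro!: continuous_intros simp: N_def)
 also have "... <= 3 * N + (3*(exp B*(exp B*(9/4 * N))) + 3*(N/8))"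
  using a2 rN by simp
 also have "exp B*(exp B*(9/4 * N)) = 9/4*(exp (2 * B) * N)"
  by (simp add: exp_add[symmetric])
 also have "3 * N + (3*(9/4*(exp (2 * B) * N)) + 3*(N/8)) <= 11*(exp (2 * B) * N)"
 proof -
  have "1 * N <= exp (2 * B) * N" using B(2) N0 by (intro mult_right_mono) auto
  with N0 show ?thesis by linarith
 qed
 finally show ?thesis by (simp add: N_def)
qed

text \<open>A contraction: the operators at \<open>\<tau>\<close> and \<open>\<tau>'\<close> differ
  by \<open>(\<tau>' - \<tau>) grad V . grad u\<close>, and \<open>apriori\<close> bounds the
  gradient. A solution at \<open>\<tau>\<close> with squared error \<open>N / 8\<close> therefore
  solves the equation at \<open>\<tau>'\<close> with squared error \<open>N / 2\<close>, and solving
  again for the residual halves it repeatedly. The factor 352 is \<open>8 * 4 * 11\<close>, from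
  \<open>apriori\<close> and \<open>lap_bound\<close>.\<close>

lemma dens_step:
 fixes B \<tau> \<tau>' :: real
 assumes P: "pot (%_. 0) V V1 V2" and B: "B >= 0" "!!x. x \<in> box ==> \<bar>V x\<bar> <= B"
   "!!x i. x \<in> box ==> i < n ==> \<bar>V1 i x\<bar> <= B"
  and \<tau>: "0 <= \<tau>" "\<tau> <= 1" and D: "dens (%i x. \<tau> * V1 i x)"
  and close: "(\<tau>' - \<tau>)^2*(352 * n * B^2 * R^2 * exp (4 * B)) <= 1"
 shows "dens (%i x. \<tau>' * V1 i x)"
proof -
 note V = potD(1)[OF P]
 note [continuous_intros] = C1D(1)[OF V] C1D(2)[OF V]
 let ?L = "%\<tau>. lap (%i x. \<tau> * V1 i x)"
 have [continuous_intros]: "continuous_on box (%x. ?L \<tau> c K x)" for \<tau> c K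
  by (intro cont_lap continuous_intros)
 have contract: "EX c K a. finite K & J (%x. (?L \<tau>' c K x - h x - a)^2) <= J (%x. (h x)^2)/2"
  if h[continuous_intros]: "continuous_on box (%x. h x)" for h
 proof (cases "J (%x. (h x)^2) = 0")
  case True
  thus ?thesis
   by (intro exI[of _ "%_. 0"] exI[of _ "{}"] exI[of _ 0]) (simp add: lap_def cp_def)
 next
  case False
  define N where "N = J (%x. (h x)^2)"
  have "0 <= N" unfolding N_def by (intro J_nonneg) simp
  moreover have "N ~= 0" using False unfolding N_def .
  ultimately have N: "N > 0" by linarith
  obtain c K a where K: "finite K" and r: "J (%x. (?L \<tau> c K x - h x - a)^2) <= N/8"
   using D h N unfolding dens_def by (meson divide_pos_pos zero_less_numeral)
  have B\<tau>: "\<bar>\<tau> * V x\<bar> <= B" if "x \<in> box" for x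
   using B(2)[OF that] \<tau> mult_mono[of \<tau> 1 "\<bar>V x\<bar>" B] by (simp add: abs_mult)
  let ?S = "%x. SUM i<n. (cp c K [i] x)^2" and ?T = "%x. SUM i<n. V1 i x * cp c K [i] x"
  have "J ?S <= 4 * R^2 * exp (2 * B) * J (%x. (?L \<tau> c K x)^2)"
   by (rule apriori[OF pot_scale[OF P \<tau>(1)] B\<tau>])
  also have "... <= 4 * R^2 * exp (2 * B)*(11 * exp (2 * B) * N)"
   unfolding N_def using r unfolding N_def
   by (intro mult_left_mono lap_bound[OF pot_scale[OF P \<tau>(1)] B\<tau> B(1) h]) auto
  also have "... = 44 * R^2 * exp (4 * B) * N"
  proof -
   have ee: "exp (4 * B) = exp (2 * B) * exp (2 * B)" by (simp flip: exp_add)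
   show ?thesis unfolding ee by simp
  qed
  finally have S: "J ?S <= 44 * R^2 * exp (4 * B) * N" .
  have "J (%x. (?L \<tau>' c K x - h x - a)^2) <= J (%x. 2*(?L \<tau> c K x - h x - a)^2 + 2*(\<tau>' - \<tau>)^2*(n * B^2)*?S x)"
  proof (intro J_mono continuous_intros)
   fix x assume x: "x \<in> box"
   let ?r = "?L \<tau> c K x - h x - a"
   have e: "?L \<tau>' c K x = ?L \<tau> c K x - (\<tau>' - \<tau>)*?T x"
    unfolding lap_def sum_distrib_left sum_subtractf[symmetric]
    by (intro sum.cong refl) (simp add: algebra_simps)
   have "(SUM i<n. (V1 i x)^2) <= (SUM i<n. B^2)"
    using B(3)[OF x] B(1) by (intro sum_mono) (simp add: abs_le_square_iff[symmetric])
   hence "(?T x)^2 <= (n * B^2)*?S x"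
    using sum_cauchy[of "%i. V1 i x" "%i. cp c K [i] x" n]
     mult_right_mono[of "SUM i<n. (V1 i x)^2" "n * B^2" "?S x"] by (simp add: sum_nonneg)
   hence "(\<tau>' - \<tau>)^2*(?T x)^2 <= (\<tau>' - \<tau>)^2*((n * B^2)*?S x)"
    by (intro mult_left_mono) auto
   moreover have "(?L \<tau>' c K x - h x - a)^2 <= 2*?r^2 + 2*((\<tau>' - \<tau>)^2*(?T x)^2)"
   proof -
    have "0 <= (?r + (\<tau>' - \<tau>)*?T x)^2" by simp
    thus ?thesis unfolding e by (simp add: power2_eq_square algebra_simps)
   qed
   ultimately show "(?L \<tau>' c K x - h x - a)^2 <= 2*?r^2 + 2*(\<tau>' - \<tau>)^2*(n * B^2)*?S x"
    by simp
  qed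
  also have "... = 2 * J (%x. (?L \<tau> c K x - h x - a)^2) + 2*(\<tau>' - \<tau>)^2*(n * B^2) * J ?S"
   by (subst J_add, intro continuous_intros, intro continuous_intros) simp
  also have "... <= 2*(N/8) + 2*(\<tau>' - \<tau>)^2*(n * B^2)*(44 * R^2 * exp (4 * B) * N)"
   using r S by (intro add_mono mult_left_mono) auto
  also have "... = N/4 + ((\<tau>' - \<tau>)^2*(352 * n * B^2 * R^2 * exp (4 * B)))*(N/4)"
   by simp
  also have "... <= N/4 + 1*(N/4)"
   using N close by (intro add_mono mult_right_mono) auto
  also have "... = N/2" by simp
  finally show ?thesis using K unfolding N_def by blast
 qed
 have iter: "EX c K a. finite K & J (%x. (?L \<tau>' c K x - h x - a)^2) <= (1/2) ^ k * J (%x. (h x)^2)"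
  if h: "continuous_on box (%x. h x)" for h k
 proof (induction k)
  case 0
  show ?case
   by (intro exI[of _ "%_. 0"] exI[of _ "{}"] exI[of _ 0]) (simp add: lap_def cp_def)
 next
  case (Suc k)
  then obtain c K a where K: "finite K" and 1: "J (%x. (?L \<tau>' c K x - h x - a)^2) <= (1/2) ^ k * J (%x. (h x)^2)"
   by blast
  define g where "g x = h x + a - ?L \<tau>' c K x" for x
  have "continuous_on box (%x. g x)" unfolding g_def by (intro continuous_intros h)
  from contract[OF this] obtain c' K' a' where K': "finite K'"
   and 2: "J (%x. (?L \<tau>' c' K' x - g x - a')^2) <= J (%x. (g x)^2)/2" by blast
  obtain d M where M: "finite M" "!!is x. cp d M is x = 1 * cp c K is x + 1 * cp c' K' is x"
   using cp_add[OF K K', of 1 c 1 c'] by blast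
  have "?L \<tau>' d M x = ?L \<tau>' c K x + ?L \<tau>' c' K' x" for x
   unfolding lap_def M(2) sum.distrib[symmetric] by (intro sum.cong refl) (simp add: algebra_simps)
  hence eq: "?L \<tau>' d M x - h x - (a + a') = ?L \<tau>' c' K' x - g x - a'" for x
   unfolding g_def by simp
  have "J (%x. (?L \<tau>' d M x - h x - (a + a'))^2) <= J (%x. (g x)^2)/2"
   unfolding eq by (rule 2)
  also have "J (%x. (g x)^2) = J (%x. (?L \<tau>' c K x - h x - a)^2)"
   by (intro J_cong) (simp add: g_def power2_eq_square algebra_simps)
  also have ".../2 <= (1/2) ^ Suc k * J (%x. (h x)^2)" using 1 by simp
  finally show ?case using M(1) by blast
 qed
 show ?thesis
  unfolding dens_def
 proof (intro allI impI)
  fix h :: "(nat => real) => real" and e :: real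
  assume h: "continuous_on box h" and e: "e > 0"
  define N where "N = J (%x. (h x)^2)"
  have N: "N >= 0" unfolding N_def by (intro J_nonneg) simp
  obtain k where k: "(1/2) ^ k < e/(N + 1)"
   using real_arch_pow_inv[of "e/(N + 1)" "1/2"] e N by auto
  have "(1/2) ^ k * N <= e/(N + 1) * N" using k N by (intro mult_right_mono) auto
  also have "... <= e" using e N by (simp add: field_simps)
  finally have "(1/2) ^ k * N <= e" .
  with iter[OF h, of k] show "EX c K a. finite K & J (%x. (?L \<tau>' c K x - h x - a)^2) <= e"
   unfolding N_def by (meson order_trans)
 qed
qed

text \<open>The admissible increment of \<open>\<tau>\<close> is the same along the whole path, so
  finitely many steps of length \<open>1 / N\<close> lead from the zero potential to
  \<open>V\<close>.\<close>

lemma dens_pot: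
 assumes P: "pot (%_. 0) V V1 V2"
 shows "dens V1"
proof -
 note V = potD(1)[OF P]
 obtain B0 where B0: "B0 > 0" "!!x. x \<in> box ==> \<bar>V x\<bar> <= B0"
  using bounded_cont[OF C1D(1)[OF V]] by blast
 have "ALL i. \<exists>b>0. i < n --> (\<forall>x\<in>box. \<bar>V1 i x\<bar> <= b)"
  using bounded_cont[OF C1D(2)[OF V]] by (metis zero_less_one)
 then obtain b where b: "!!i. b i > 0" "!!i x. i < n ==> x \<in> box ==> \<bar>V1 i x\<bar> <= b i"
  by metis
 define B where "B = B0 + (SUM i<n. b i)"
 have bs: "0 <= (SUM i<n. b i)" using b(1) by (intro sum_nonneg) (simp add: less_imp_le)
 have B: "B >= 0" "!!x. x \<in> box ==> \<bar>V x\<bar> <= B" "!!x i. x \<in> box ==> i < n ==> \<bar>V1 i x\<bar> <= B"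
 proof -
  show "B >= 0" using B0 bs by (simp add: B_def)
  show "\<bar>V x\<bar> <= B" if "x \<in> box" for x using B0(2)[OF that] bs by (simp add: B_def)
  show "\<bar>V1 i x\<bar> <= B" if "x \<in> box" "i < n" for x i
  proof -
   have "b i <= (SUM i<n. b i)" using that b(1) by (intro member_le_sum) (auto simp: less_imp_le)
   thus ?thesis using b(2)[OF that(2,1)] B0(1) by (simp add: B_def)
  qed
 qed
 define M where "M = 352 * n * B^2 * R^2 * exp (4 * B)"
 have M: "M >= 0" by (simp add: M_def)
 obtain N :: nat where N: "real N > M + 1" using reals_Archimedean2 by blast
 have N1: "real N >= 1" using N M by simp
 have step: "(1/real N)^2 * M <= 1"
 proof -
  have "M <= real N*1" using N by simp
  also have "... <= real N * real N" using N1 by (intro mult_left_mono) auto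
  finally show ?thesis using N1 by (simp add: power2_eq_square)
 qed
 have "dens (%i x. real j/real N * V1 i x)" if "j <= N" for j
  using that
 proof (induction j)
  case 0
  thus ?case using dens0 by simp
 next
  case (Suc j)
  have d: "real (Suc j)/real N - real j/real N = 1/real N"
   by (simp add: diff_divide_distrib[symmetric])
  show ?case
  proof (rule dens_step[OF P B, where \<tau> = "real j/real N"])
   show "dens (%i x. real j/real N * V1 i x)" using Suc by simp
   show "(real (Suc j)/real N - real j/real N)^2*(352 * n * B^2 * R^2 * exp (4 * B)) <= 1"
    unfolding d M_def[symmetric] by (rule step)
  qed (use Suc.prems N1 in auto)
 qed
 from this[of N] N1 show ?thesis by simp
qed

end

section \<open>Poincare inequalities on a box\<close>

context cube
begin

lemma J_dah:
 assumes "continuous_on box f" "continuous_on box g" "continuous_on box h"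
 shows "J (%x. (f x - g x) + h x) = J f - J g + J h"
proof -
 have "J (%x. (f x - g x) + h x) = J (%x. f x - g x) + J h"
  using assms by (intro J_add continuous_intros)
 thus ?thesis using J_diff[OF assms(1,2)] by simp
qed

lemma J_aah:
 assumes "continuous_on box f" "continuous_on box g" "continuous_on box h"
 shows "J (%x. (f x + g x) + h x) = J f + J g + J h"
proof -
 have "J (%x. (f x + g x) + h x) = J (%x. f x + g x) + J h"
  using assms by (intro J_add continuous_intros)
 thus ?thesis using J_add[OF assms(1,2)] by simp
qed

text \<open>A dual form of the Poincare inequality on cosine polynomials. It is the form into which
  the Bochner formula feeds directly.\<close>

definition PC :: "real => ((nat => real) => real) => (nat => (nat => real) => real) => bool" where
 "PC C V V1 \<longleftrightarrow> (ALL c K. J (%x. exp (- V x)*(SUM i<n. (cp c K [i] x)^2)) <= C * J (%x. exp (- V x)*(lap V1 c K x)^2))"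

definition PI :: "real => ((nat => real) => real) => bool" where
 "PI C V \<longleftrightarrow> (ALL g g1. C1 g g1 -->
  J (%x. exp (- V x)*(g x - J (%x. exp (- V x) * g x))^2) <= C * J (%x. exp (- V x)*(SUM i<n. (g1 i x)^2)))"

text \<open>Duality: let \<open>G\<close> be the centred \<open>g\<close> and \<open>Lu\<close>
  close to \<open>a - G\<close>. Then the variance \<open>E\<close> of \<open>g\<close> is close to
  the integral of \<open>grad g . grad u\<close>, and Cauchy--Schwarz with \<open>PC\<close> bounds
  that by \<open>sqrt (D * C) * sqrt E\<close>, where \<open>D\<close> is the energy of
  \<open>g\<close>.\<close>

lemma PC_PI:
 assumes P: "pot (%_. 0) V V1 V2" and w1: "J (%x. exp (- V x)) = 1" and C: "PC C V V1" "0 <= C"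
 shows "PI C V"
 unfolding PI_def
proof (intro allI impI)
 fix g g1 assume g: "C1 g g1"
 note V = potD(1)[OF P]
 note [continuous_intros] = C1D(1)[OF V] C1D(2)[OF V] C1D(1)[OF g] C1D(2)[OF g] cont_lap[OF C1D(2)[OF V]]
 obtain B where B: "B > 0" "!!x. x \<in> box ==> \<bar>V x\<bar> <= B"
  using bounded_cont[OF C1D(1)[OF V]] by blast
 let ?w = "%x. exp (- V x)"
 define m where "m = J (%x. ?w x * g x)"
 define G where "G x = g x - m" for x
 have cG [continuous_intros]: "continuous_on box (%x. G x)" unfolding G_def by (intro continuous_intros)
 have G1: "C1 G g1"
  unfolding C1_def
 proof (intro conjI allI impI)
  show "continuous_on box G" using cG by simp
  show "pd i G (g1 i)" if "i < n" for i
   using pd_diff[OF C1D(3)[OF g that] pd_const[of i m]] unfolding G_def by simp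
 qed (rule C1D(2)[OF g])
 have G0: "J (%x. ?w x * G x) = 0"
 proof -
  have "J (%x. ?w x * G x) = J (%x. ?w x * g x - m*?w x)"
   by (intro J_cong) (simp add: G_def algebra_simps)
  also have "... = m - m * J ?w"
   by (subst J_diff) (auto intro!: continuous_intros simp: m_def)
  finally show ?thesis by (simp add: w1)
 qed
 define E where "E = J (%x. ?w x*(G x)^2)"
 define D where "D = J (%x. ?w x*(SUM i<n. (g1 i x)^2))"
 have E0: "E >= 0" and D0: "D >= 0"
  unfolding E_def D_def by (intro J_nonneg mult_nonneg_nonneg sum_nonneg; simp)+
 have main: "E <= sqrt (D * C) * sqrt E + \<eta>*(sqrt E + sqrt (D * C))" if \<eta>: "\<eta> > 0" for \<eta>
 proof -
  have "dens V1" by (rule dens_pot[OF P])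
  moreover have "continuous_on box (%x. - G x)" by (intro continuous_intros)
  moreover have "\<eta>^2/exp B > 0" using \<eta> by simp
  ultimately obtain c K a where r: "J (%x. (lap V1 c K x - - G x - a)^2) <= \<eta>^2/exp B"
   unfolding dens_def by blast
  let ?L = "lap V1 c K"
  define r where "r x = ?L x + G x - a" for x
  have cr [continuous_intros]: "continuous_on box (%x. r x)" unfolding r_def by (intro continuous_intros)
  define \<rho> where "\<rho> = J (%x. ?w x*(r x)^2)"
  have "\<rho> <= exp B * J (%x. (r x)^2)"
   unfolding \<rho>_def by (intro J_exp_bounds continuous_intros B) auto
  also have "... <= exp B*(\<eta>^2/exp B)"
   using r unfolding r_def by (intro mult_left_mono) auto
  finally have \<rho>: "\<rho> <= \<eta>^2" by simp
  have \<rho>0: "\<rho> >= 0" unfolding \<rho>_def by (intro J_nonneg) simp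
  have rG: "\<bar>J (%x. ?w x*(r x * G x))\<bar> <= \<eta> * sqrt E"
  proof -
   have "(J (%x. ?w x*(r x * G x)))^2 <= \<rho> * E"
    unfolding \<rho>_def E_def by (intro J_cauchy continuous_intros) auto
   also have "... <= \<eta>^2 * E" using \<rho> E0 by (intro mult_right_mono)
   also have "... = (\<eta> * sqrt E)^2" using E0 by (simp add: power_mult_distrib)
   finally have "\<bar>J (%x. ?w x*(r x * G x))\<bar> <= \<bar>\<eta> * sqrt E\<bar>" by (simp add: abs_le_square_iff)
   thus ?thesis using \<eta> E0 by simp
  qed
  have L0: "J (%x. ?w x*?L x) = 0" by (rule J_lap_zero[OF V])
  \<comment> \<open>As \<open>Lu\<close> has mean zero, its second moment is at most that of
    \<open>Lu - a = r - G\<close>.\<close>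
  have LL: "J (%x. ?w x*(?L x)^2) <= (sqrt E + \<eta>)^2"
  proof -
   have "J (%x. ?w x*(?L x)^2) <= J (%x. ?w x*(?L x)^2) + a^2" by simp
   also have "... = J (%x. (?w x*(?L x)^2 - (2 * a)*(?w x*?L x)) + a^2*?w x)"
    by (subst J_dah) (auto intro!: continuous_intros simp: L0 w1)
   also have "... = J (%x. (?w x*(r x)^2 - 2*(?w x*(r x * G x))) + ?w x*(G x)^2)"
    by (intro J_cong) (simp add: r_def power2_eq_square algebra_simps)
   also have "... = \<rho> - 2 * J (%x. ?w x*(r x * G x)) + E"
    by (subst J_dah) (auto intro!: continuous_intros simp: \<rho>_def E_def)
   also have "... <= \<eta>^2 + 2*(\<eta> * sqrt E) + E" using \<rho> rG by simp
   also have "... = (sqrt E + \<eta>)^2" using E0 by (simp add: power2_sum)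
   finally show ?thesis .
  qed
  let ?T = "%x. SUM i<n. g1 i x * cp c K [i] x"
  have "J (%x. ?w x*?T x) <= sqrt D * sqrt (J (%x. ?w x*(SUM i<n. (cp c K [i] x)^2)))"
  proof -
   define S where "S = J (%x. ?w x*(SUM i<n. (cp c K [i] x)^2))"
   have "(J (%x. ?w x*?T x))^2 <= D * S"
   proof (rule discr)
    fix s
    have "0 <= J (%x. ?w x*(SUM i<n. (g1 i x + s * cp c K [i] x)^2))"
     by (intro J_nonneg mult_nonneg_nonneg sum_nonneg) auto
    also have "... = J (%x. (?w x*(SUM i<n. (g1 i x)^2) + (2 * s)*(?w x*?T x)) + s^2*(?w x*(SUM i<n. (cp c K [i] x)^2)))"
     by (intro J_cong) (simp add: sum_distrib_left sum.distrib[symmetric] power2_eq_square algebra_simps)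
    also have "... = D + 2 * J (%x. ?w x*?T x) * s + S * s^2"
     by (subst J_aah) (auto intro!: continuous_intros simp: D_def S_def)
    finally show "0 <= D + 2 * J (%x. ?w x*?T x) * s + S * s^2" .
   qed
   hence "\<bar>J (%x. ?w x*?T x)\<bar> <= sqrt (D * S)"
    using real_sqrt_le_mono by fastforce
   thus ?thesis by (simp add: real_sqrt_mult S_def)
  qed
  also have "... <= sqrt D * sqrt (C * J (%x. ?w x*(?L x)^2))"
   using C(1) D0 unfolding PC_def by (intro mult_left_mono real_sqrt_le_mono) auto
  also have "... <= sqrt D * sqrt (C*(sqrt E + \<eta>)^2)"
   using LL C(2) D0 by (intro mult_left_mono real_sqrt_le_mono) auto
  also have "... = sqrt (D * C)*(sqrt E + \<eta>)"
   using E0 \<eta> by (simp add: real_sqrt_mult)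
  finally have T: "J (%x. ?w x*?T x) <= sqrt (D * C)*(sqrt E + \<eta>)" .
  have "E = J (%x. (?w x*(r x * G x) - ?w x*(G x*?L x)) + a*(?w x * G x))"
   unfolding E_def by (intro J_cong) (simp add: r_def power2_eq_square algebra_simps)
  also have "... = J (%x. ?w x*(r x * G x)) - J (%x. ?w x*(G x*?L x)) + a * J (%x. ?w x * G x)"
   by (subst J_dah) (auto intro!: continuous_intros)
  also have "... = J (%x. ?w x*(r x * G x)) + J (%x. ?w x*?T x)"
   unfolding J_by_parts[OF V G1] G0 by simp
  also have "... <= \<eta> * sqrt E + sqrt (D * C)*(sqrt E + \<eta>)"
   using T rG by linarith
  finally show ?thesis by (simp add: algebra_simps)
 qed
 have "E <= sqrt (D * C) * sqrt E"
  by (rule le_if_le_eps[OF main])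
 hence "E <= D * C"
 proof (cases "E = 0")
  case False
  hence "sqrt E > 0" using E0 by simp
  moreover have "sqrt E * sqrt E <= sqrt (D * C) * sqrt E"
   using \<open>E <= sqrt (D * C) * sqrt E\<close> E0 by simp
  ultimately have "sqrt E <= sqrt (D * C)" by (metis mult_right_le_imp_le)
  thus ?thesis using real_sqrt_le_iff by blast
 qed (use D0 C(2) in simp)
 thus "J (%x. ?w x*(g x - J (%x. ?w x * g x))^2) <= C * J (%x. ?w x*(SUM i<n. (g1 i x)^2))"
  unfolding E_def D_def G_def m_def by (simp add: mult.commute)
qed

definition mean :: "((nat => real) => real) => nat => real" where
 "mean w i = J (%x. w x * x i)"

text \<open>The squared length of the mean gradient is at most \<open>a N\<close>, by integrating
  \<open>Lu\<close> against the centred coordinates. The fluctuation of the gradient is at most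
  \<open>C H\<close> by Poincare applied to each partial derivative, and \<open>H <= N - t S\<close>
  by Bochner. Adding up gives \<open>S <= a N + C (N - t S)\<close>.\<close>

lemma PC_improve:
 assumes P: "pot (%_. t) V V1 V2" and t: "t >= 0" and w1: "J (%x. exp (- V x)) = 1"
  and PI: "PI C V" and C0: "0 <= C"
  and a: "!!v. J (%x. exp (- V x)*(SUM i<n. v i*(x i - mean (%x. exp (- V x)) i))^2) <= a*(SUM i<n. (v i)^2)"
 shows "(1 + C * t) * J (%x. exp (- V x)*(SUM i<n. (cp c K [i] x)^2)) <=
  (C + a) * J (%x. exp (- V x)*(lap V1 c K x)^2)"
proof -
 note V = potD(1)[OF P] and V1 = potD(2)[OF P]
 note [continuous_intros] = C1D(1)[OF V] C1D(2)[OF V] C1D(2)[OF V1] cont_lap[OF C1D(2)[OF V]]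
 let ?w = "%x. exp (- V x)" and ?u = "cp c K" and ?L = "lap V1 c K"
 let ?m = "mean ?w"
 define N where "N = J (%x. ?w x*(?L x)^2)"
 define S where "S = J (%x. ?w x*(SUM i<n. (?u [i] x)^2))"
 define H where "H = J (%x. ?w x*(SUM i<n. SUM j<n. (?u [i, j] x)^2))"
 define ub where "ub i = J (%x. ?w x*?u [i] x)" for i
 have N0: "N >= 0" unfolding N_def by (intro J_nonneg) simp
 have NH: "t * S + H <= N"
 proof -
  have "J (%x. t*(?w x*(SUM i<n. (?u [i] x)^2))) <= J (%x. ?w x*(SUM i<n. SUM j<n. V2 i j x*?u [i] x*?u [j] x))"
  proof (intro J_mono continuous_intros)
   fix x assume "x \<in> box"
   hence "(SUM i<n. t*(?u [i] x)^2) <= (SUM i<n. SUM j<n. V2 i j x*?u [i] x*?u [j] x)"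
    by (rule potD(3)[OF P])
   hence "?w x*(SUM i<n. t*(?u [i] x)^2) <= ?w x*(SUM i<n. SUM j<n. V2 i j x*?u [i] x*?u [j] x)"
    by (intro mult_left_mono) auto
   thus "t*(?w x*(SUM i<n. (?u [i] x)^2)) <= ?w x*(SUM i<n. SUM j<n. V2 i j x*?u [i] x*?u [j] x)"
    by (simp add: sum_distrib_left mult.left_commute)
  qed auto
  thus ?thesis using bochner[OF P, of c K] unfolding N_def S_def H_def by simp
 qed
 have var: "J (%x. ?w x*(?u [i] x - ub i)^2) = J (%x. ?w x*(?u [i] x)^2) - (ub i)\<^sup>2" for i
 proof -
  have "J (%x. ?w x*(?u [i] x - ub i)^2) =
    J (%x. (?w x*(?u [i] x)^2 - (2 * ub i)*(?w x*?u [i] x)) + (ub i)^2*?w x)"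
   by (intro J_cong) (simp add: power2_eq_square algebra_simps)
  also have "... = J (%x. ?w x*(?u [i] x)^2) - (2 * ub i) * ub i + (ub i)^2 * J ?w"
   by (subst J_dah) (auto intro!: continuous_intros simp: ub_def)
  finally show ?thesis by (simp add: w1 power2_eq_square)
 qed
 have "S - (SUM i<n. (ub i)^2) = (SUM i<n. J (%x. ?w x*(?u [i] x - ub i)^2))"
  unfolding S_def var sum_subtractf by (simp add: sum_distrib_left J_sum continuous_intros)
 also have "... <= (SUM i<n. C * J (%x. ?w x*(SUM j<n. (?u [j, i] x)^2)))"
  using PI C1_cp unfolding PI_def ub_def by (intro sum_mono) blast
 also have "... = C * H"
 proof -
  have "(SUM i<n. J (%x. ?w x*(SUM j<n. (?u [j, i] x)^2))) = J (%x. SUM i<n. ?w x*(SUM j<n. (?u [j, i] x)^2))"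
   by (intro J_sum[symmetric] continuous_intros)
  also have "... = H"
   unfolding H_def by (intro J_cong) (simp add: sum_distrib_left cp_swap[of c K _ _ "[]"])
  finally show ?thesis unfolding sum_distrib_left[symmetric] by (rule arg_cong)
 qed
 finally have 1: "S - (SUM i<n. (ub i)^2) <= C * H" .
 define s where "s = (SUM i<n. (ub i)^2)"
 have s0: "s >= 0" unfolding s_def by (intro sum_nonneg) simp
 have ub: "ub i = - J (%x. ?w x*((x i - ?m i)*?L x))" if i: "i < n" for i
 proof -
  have "C1 (%x. x i - ?m i) (%j x. (if j = i then 1 else 0) - 0)"
   unfolding C1_def by (intro conjI allI impI pd_diff pd_coord pd_const continuous_intros)
  from J_by_parts[OF V this, of c K] show ?thesis
   using i by (simp add: ub_def if_distrib[of "%z. z * _"] cong: if_cong)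
 qed
 define q where "q x = (SUM i<n. ub i*(x i - ?m i))" for x
 have cq [continuous_intros]: "continuous_on box (%x. q x)" unfolding q_def by (intro continuous_intros)
 have "s = - J (%x. ?w x*(q x*?L x))"
 proof -
  have "J (%x. ?w x*(q x*?L x)) = J (%x. SUM i<n. ub i*(?w x*((x i - ?m i)*?L x)))"
   unfolding q_def by (intro J_cong) (simp add: sum_distrib_left mult_ac)
  also have "... = (SUM i<n. ub i * J (%x. ?w x*((x i - ?m i)*?L x)))"
   by (subst J_sum) (auto intro!: continuous_intros)
  also have "... = (SUM i<n. - (ub i * ub i))" by (intro sum.cong refl) (simp add: ub)
  finally show ?thesis unfolding s_def by (simp add: sum_negf power2_eq_square)
 qed
 hence "s^2 = (J (%x. ?w x*(q x*?L x)))^2" by simp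
 also have "... <= J (%x. ?w x*(q x)^2) * N"
  unfolding N_def by (intro J_cauchy continuous_intros) auto
 also have "... <= (a * s) * N"
  unfolding q_def s_def using N0 a by (intro mult_right_mono) auto
 finally have "s * s <= (a * N) * s" by (simp add: power2_eq_square mult_ac)
 moreover have "0 <= a * N | s = 0"
  using calculation s0 by (metis mult_le_cancel_right2 mult_le_0_iff mult_less_cancel_right_disj not_le
    order.trans zero_le_square linorder_not_less order_less_le)
 ultimately have s: "s <= a * N | s = 0" using s0 by (cases "s = 0") auto
 have a0: "0 <= a * N"
 proof (cases "n = 0")
  case True
  hence "N = 0" unfolding N_def lap_def by simp
  thus ?thesis by simp
 next
  case False
  have "0 <= J (%x. ?w x*(SUM i<n. (if i = 0 then 1 else 0)*(x i - ?m i))^2)"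
   by (intro J_nonneg) simp
  also have "... <= a*(SUM i<n. (if i = 0 then 1 else 0)^2)" by (rule a)
  also have "(SUM i<n. (if i = (0::nat) then 1 else (0::real))^2) = 1"
   using False by (subst sum.remove[of _ 0]) auto
  finally show ?thesis using N0 by simp
 qed
 from s a0 have sN: "s <= a * N" by auto
 have "C * H <= C*(N - t * S)" using NH C0 by (intro mult_left_mono) auto
 with 1 sN have "S <= a * N + C*(N - t * S)" unfolding s_def by linarith
 thus ?thesis unfolding S_def N_def by (simp add: algebra_simps)
qed

text \<open>The Bochner formula alone gives the constant \<open>1 / t\<close>. The best constant
  \<open>C\<close> is an infimum and is itself admissible; by \<open>PC_improve\<close> so is
  \<open>(C + a) / (1 + C t)\<close>, which thus cannot be smaller than \<open>C\<close>. This means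
  \<open>C^2 t <= a\<close>.\<close>

theorem improved_poincare:
 assumes P: "pot (%_. t) V V1 V2" and t: "t > 0" and w1: "J (%x. exp (- V x)) = 1"
  and a: "!!v. J (%x. exp (- V x)*(SUM i<n. v i*(x i - mean (%x. exp (- V x)) i))^2) <= a*(SUM i<n. (v i)^2)"
  and a0: "a >= 0"
 shows "PI (sqrt (a/t)) V" "PI (1/t) V"
proof -
 let ?w = "%x. exp (- V x)"
 have P0: "pot (%_. 0) V V1 V2"
  unfolding pot_def
 proof (intro conjI allI impI ballI)
  fix x v assume "x \<in> box"
  have "0 <= (SUM i<n. t*(v i)^2)" using t by (intro sum_nonneg) simp
  also have "... <= (SUM i<n. SUM j<n. V2 i j x * v i * v j)" by (rule potD(3)[OF P \<open>x \<in> box\<close>])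
  finally show "(SUM i<n. 0*(v i)^2) <= (SUM i<n. SUM j<n. V2 i j x * v i * v j)" by simp
 qed (use potD[OF P] in auto)
 have NN: "0 <= J (%x. ?w x*(lap V1 c K x)^2)" for c K
  by (intro J_nonneg) simp
 have base: "PC (1/t) V V1"
  unfolding PC_def
 proof (intro allI)
  fix c K
  note V = potD(1)[OF P] and V1 = potD(2)[OF P]
  note [continuous_intros] = C1D(1)[OF V] C1D(2)[OF V] C1D(2)[OF V1]
  have "t * J (%x. ?w x*(SUM i<n. (cp c K [i] x)^2)) =
    J (%x. t*(?w x*(SUM i<n. (cp c K [i] x)^2)))" by simp
  also have "... <= J (%x. ?w x*(SUM i<n. SUM j<n. V2 i j x * cp c K [i] x * cp c K [j] x))"
  proof (intro J_mono continuous_intros)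
   fix x assume "x \<in> box"
   hence "(SUM i<n. t*(cp c K [i] x)^2) <= (SUM i<n. SUM j<n. V2 i j x * cp c K [i] x * cp c K [j] x)"
    by (rule potD(3)[OF P])
   hence "?w x*(SUM i<n. t*(cp c K [i] x)^2) <= ?w x*(SUM i<n. SUM j<n. V2 i j x * cp c K [i] x * cp c K [j] x)"
    by (intro mult_left_mono) auto
   thus "t*(?w x*(SUM i<n. (cp c K [i] x)^2)) <= ?w x*(SUM i<n. SUM j<n. V2 i j x * cp c K [i] x * cp c K [j] x)"
    by (simp add: sum_distrib_left mult.left_commute)
  qed auto
  also have "... <= J (%x. ?w x*(lap V1 c K x)^2)"
  proof -
   have "0 <= J (%x. ?w x*(SUM i<n. SUM j<n. (cp c K [i, j] x)^2))"
    by (intro J_nonneg mult_nonneg_nonneg sum_nonneg) auto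
   thus ?thesis using bochner[OF P, of c K] by simp
  qed
  finally show "J (%x. ?w x*(SUM i<n. (cp c K [i] x)^2)) <= 1/t * J (%x. ?w x*(lap V1 c K x)^2)"
   using t by (simp add: field_simps)
 qed
 show "PI (1/t) V" using PC_PI[OF P0 w1 base] t by simp
 define X where "X = {C. 0 <= C & PC C V V1}"
 have Xne: "1/t \<in> X" using base t by (simp add: X_def)
 have bdd: "bdd_below X" unfolding X_def by auto
 define C where "C = Inf X"
 have C0: "0 <= C" unfolding C_def
 proof (rule cInf_greatest)
  show "X ~= {}" using Xne by blast
 qed (simp add: X_def)
 have PCC: "PC C V V1"
  unfolding PC_def
 proof (intro allI)
  fix c K
  define N where "N = J (%x. ?w x*(lap V1 c K x)^2)"
  define S where "S = J (%x. ?w x*(SUM i<n. (cp c K [i] x)^2))"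
  have le: "S <= D * N" if "D \<in> X" for D using that unfolding X_def PC_def N_def S_def by auto
  have "S <= C * N"
  proof (cases "N = 0")
   case True
   thus ?thesis using le[OF Xne] by simp
  next
   case False
   hence N: "N > 0" using NN[of c K] unfolding N_def by linarith
   have "S/N <= C" unfolding C_def using Xne le N
    by (intro cInf_greatest) (auto simp: field_simps)
   thus ?thesis using N by (simp add: field_simps)
  qed
  thus "J (%x. ?w x*(SUM i<n. (cp c K [i] x)^2)) <= C * J (%x. ?w x*(lap V1 c K x)^2)"
   unfolding N_def S_def .
 qed
 have PIC: "PI C V" by (rule PC_PI[OF P0 w1 PCC C0])
 have den: "1 + C * t > 0" using C0 t by (simp add: add_pos_nonneg)
 have "(C + a)/(1 + C * t) \<in> X"
  unfolding X_def PC_def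
 proof (intro CollectI conjI allI)
  show "0 <= (C + a)/(1 + C * t)" using C0 a0 den by simp
  fix c K
  show "J (%x. ?w x*(SUM i<n. (cp c K [i] x)^2)) <= (C + a)/(1 + C * t) * J (%x. ?w x*(lap V1 c K x)^2)"
   using PC_improve[OF P less_imp_le[OF t] w1 PIC C0 a, of c K] den by (simp add: field_simps)
 qed
 hence "C <= (C + a)/(1 + C * t)" unfolding C_def using bdd by (intro cInf_lower)
 hence "C*(1 + C * t) <= C + a" using den by (simp add: field_simps)
 hence "C^2 <= a/t" using t by (simp add: field_simps power2_eq_square)
 hence Cle: "C <= sqrt (a/t)" by (rule real_le_rsqrt)
 have "PC (sqrt (a/t)) V V1"
  unfolding PC_def
 proof (intro allI)
  fix c K
  have "C * J (%x. ?w x*(lap V1 c K x)^2) <= sqrt (a/t) * J (%x. ?w x*(lap V1 c K x)^2)"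
   using Cle NN by (rule mult_right_mono)
  thus "J (%x. ?w x*(SUM i<n. (cp c K [i] x)^2)) <= sqrt (a/t) * J (%x. ?w x*(lap V1 c K x)^2)"
   using PCC unfolding PC_def by (meson order_trans)
 qed
 thus "PI (sqrt (a/t)) V" using PC_PI[OF P0 w1] a0 t by simp
qed

end

section \<open>Tilts and the discrete stochastic localization\<close>

context cube
begin

definition dns :: "((nat => real) => real) => bool" where
 "dns w \<longleftrightarrow> continuous_on box w & (\<forall>x\<in>box. 0 < w x) & J w = 1"

definition slc :: "(nat => real) => ((nat => real) => real) => bool" where
 "slc t w \<longleftrightarrow> J w = 1 & (EX V V1 V2. pot t V V1 V2 & (\<forall>x\<in>box. w x = exp (- V x)))"

definition ctr :: "((nat => real) => real) => nat => (nat => real) => real" where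
 "ctr w i x = x i - mean w i"

definition cov :: "((nat => real) => real) => nat => nat => real" where
 "cov w i j = J (%x. w x*(ctr w i x * ctr w j x))"

definition trd :: "((nat => real) => real) => nat => nat => nat => real" where
 "trd w i j k = J (%x. w x*(ctr w i x * ctr w j x * ctr w k x))"

definition tilt :: "real => nat => ((nat => real) => real) => (nat => real) => real" where
 "tilt r i w x = w x*(1 + r * ctr w i x)"

text \<open>On the box a centred coordinate is at most \<open>2 R\<close>, so an admissible tilt
  multiplies the density by a factor between 3/4 and 5/4.\<close>

definition rok :: "real => bool" where
 "rok r \<longleftrightarrow> \<bar>r\<bar>*(8 * R) <= 1"

lemma cont_ctr [continuous_intros]: "continuous_on A (%x. ctr w i x)"
 unfolding ctr_def by (intro continuous_intros)

lemma dns_cont: "dns w ==> continuous_on box (%x. w x)"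
 unfolding dns_def by simp

lemma dns_pos: "dns w ==> x \<in> box ==> 0 < w x"
 unfolding dns_def by simp

lemma dns_one: "dns w ==> J w = 1"
 unfolding dns_def by simp

lemma slc_dns: "slc t w ==> dns w"
proof -
 assume "slc t w"
 then obtain V V1 V2 where V: "J w = 1" "pot t V V1 V2" "\<forall>x\<in>box. w x = exp (- V x)"
  unfolding slc_def by blast
 have "continuous_on box (%x. exp (- V x))"
  by (intro continuous_intros C1D(1)[OF potD(1)[OF V(2)]])
 hence "continuous_on box w"
  by (rule continuous_on_eq) (use V(3) in auto)
 thus "dns w" using V unfolding dns_def by auto
qed

lemma J_dns_bound:
 assumes w: "dns w" and f: "continuous_on box f" "!!x. x \<in> box ==> \<bar>f x\<bar> <= B"
 shows "\<bar>J (%x. w x * f x)\<bar> <= B"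
proof -
 note [continuous_intros] = dns_cont[OF w] f(1)
 have 1: "w x * f x <= B * w x" "- (B * w x) <= w x * f x" if "x \<in> box" for x
 proof -
  have "w x * f x <= w x * B" "w x*(- B) <= w x * f x"
   using f(2)[OF that] dns_pos[OF w that] by (intro mult_left_mono; simp add: abs_le_iff)+
  thus "w x * f x <= B * w x" "- (B * w x) <= w x * f x" by (auto simp: mult.commute)
 qed
 have "J (%x. w x * f x) <= J (%x. B * w x)"
  using 1 by (intro J_mono continuous_intros) auto
 moreover have "J (%x. - (B * w x)) <= J (%x. w x * f x)"
  using 1 by (intro J_mono continuous_intros) auto
 ultimately show ?thesis using dns_one[OF w] by simp
qed

lemma mean_bound: "dns w ==> i < n ==> \<bar>mean w i\<bar> <= R"
 unfolding mean_def by (intro J_dns_bound continuous_intros boxD)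

lemma ctr_bound: "dns w ==> i < n ==> x \<in> box ==> \<bar>ctr w i x\<bar> <= 2 * R"
 using mean_bound[of w i] boxD[of x i] unfolding ctr_def by linarith

lemma J_ctr: "dns w ==> J (%x. w x * ctr w i x) = 0"
proof -
 assume w: "dns w"
 note [continuous_intros] = dns_cont[OF w]
 have "J (%x. w x * ctr w i x) = J (%x. w x * x i - mean w i * w x)"
  by (intro J_cong) (simp add: ctr_def algebra_simps)
 also have "... = mean w i - mean w i * J w"
  by (subst J_diff) (auto intro!: continuous_intros simp: mean_def)
 finally show ?thesis using dns_one[OF w] by simp
qed

lemma rok_ctr: "dns w ==> i < n ==> rok r ==> x \<in> box ==> \<bar>r * ctr w i x\<bar> <= 1/4"
proof -
 assume "dns w" "i < n" "rok r" "x \<in> box"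
 hence "\<bar>r\<bar>*\<bar>ctr w i x\<bar> <= \<bar>r\<bar>*(2 * R)"
  by (intro mult_left_mono ctr_bound) auto
 thus ?thesis using \<open>rok r\<close> unfolding rok_def abs_mult by linarith
qed

lemma J_tilt:
 assumes w: "dns w" and f: "continuous_on box f"
 shows "J (%x. tilt r i w x * f x) = J (%x. w x * f x) + r * J (%x. w x*(ctr w i x * f x))"
proof -
 note [continuous_intros] = dns_cont[OF w] f
 have "J (%x. tilt r i w x * f x) = J (%x. w x * f x + r*(w x*(ctr w i x * f x)))"
  by (intro J_cong) (simp add: tilt_def algebra_simps)
 thus ?thesis by (subst (asm) J_add) (auto intro!: continuous_intros)
qed

lemma tilt_dns:
 assumes w: "dns w" and "i < n" "rok r"
 shows "dns (tilt r i w)"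
 unfolding dns_def
proof (intro conjI ballI)
 note [continuous_intros] = dns_cont[OF w]
 show "continuous_on box (tilt r i w)"
  unfolding tilt_def[abs_def] by (intro continuous_intros)
 show "0 < tilt r i w x" if x: "x \<in> box" for x
  unfolding tilt_def using dns_pos[OF w x] rok_ctr[OF assms x] by (intro mult_pos_pos) (auto simp: abs_le_iff)
 show "J (tilt r i w) = 1"
  using J_tilt[OF w, of "%_. 1" r i] J_ctr[OF w, of i] dns_one[OF w] by simp
qed

lemma E_simps:
 assumes w: "dns w"
 shows "continuous_on box f ==> continuous_on box g ==>
   J (%x. w x*(f x + g x)) = J (%x. w x * f x) + J (%x. w x * g x)"
  "J (%x. w x*(c * f x)) = c * J (%x. w x * f x)"
  "J (%x. w x * ctr w i x) = 0" "J (%x. w x*1) = 1"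
proof -
 show "J (%x. w x*(f x + g x)) = J (%x. w x * f x) + J (%x. w x * g x)"
  if "continuous_on box f" "continuous_on box g"
  unfolding distrib_left by (intro J_add continuous_intros that dns_cont[OF w])
 show "J (%x. w x*(c * f x)) = c * J (%x. w x * f x)"
  unfolding mult.left_commute[of _ c] by simp
qed (use J_ctr[OF w] dns_one[OF w] in simp_all)

lemmas cont_simps = continuous_on_add continuous_on_mult continuous_on_const cont_ctr cont_coord

lemma mean_tilt:
 assumes w: "dns w"
 shows "mean (tilt r i w) j = mean w j + r * cov w i j"
proof -
 note [continuous_intros] = dns_cont[OF w]
 have "J (%x. w x*(ctr w i x * x j)) = J (%x. w x*(ctr w i x * ctr w j x) + mean w j*(w x * ctr w i x))"
  by (intro J_cong) (simp add: ctr_def algebra_simps)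
 also have "... = cov w i j + mean w j * J (%x. w x * ctr w i x)"
  by (subst J_add) (auto intro!: continuous_intros simp: cov_def)
 finally show ?thesis
  using J_tilt[OF w cont_coord, of r i j] J_ctr[OF w] by (simp add: mean_def)
qed

lemma cov_sym: "cov w i j = cov w j i"
 unfolding cov_def by (intro J_cong) simp

lemma trd_sym: "trd w i j k = trd w i k j" "trd w i j k = trd w j i k"
 unfolding trd_def by (intro J_cong; simp)+

text \<open>No remainder arises: raw moments are affine in \<open>r\<close>, and the only quadratic
  contribution is the product of the two shifts of the mean.\<close>

lemma cov_tilt:
 assumes w: "dns w"
 shows "cov (tilt r i w) j k = cov w j k + r * trd w i j k - r\<^sup>2*(cov w i j * cov w i k)"
proof -
 note [continuous_intros] = dns_cont[OF w]
 have c: "ctr (tilt r i w) j x = ctr w j x - r * cov w i j" for j x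
  unfolding ctr_def mean_tilt[OF w] by simp
 let ?z = "ctr w" and ?a = "cov w i j" and ?b = "cov w i k"
 let ?f = "%x. ctr (tilt r i w) j x * ctr (tilt r i w) k x"
 have 1: "J (%x. w x*?f x) = cov w j k + r^2*(?a*?b)"
 proof -
  have "J (%x. w x*?f x) = J (%x. w x*((?z j x*?z k x + (- r*?b)*?z j x) + ((- r*?a)*?z k x + (r^2*(?a*?b))*1)))"
   unfolding c by (intro J_cong arg_cong[where f = "%y. w _ * y"]) (simp add: algebra_simps power2_eq_square)
  thus ?thesis
   by (simp only: E_simps[OF w] cont_simps cov_def[symmetric]; simp)
 qed
 have 2: "J (%x. w x*(?z i x*?f x)) = trd w i j k - 2 * r*(?a*?b)"
 proof -
  have "J (%x. w x*(?z i x*?f x)) = J (%x. w x*((?z i x*?z j x*?z k x + (- r*?b)*(?z i x*?z j x))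
    + ((- r*?a)*(?z i x*?z k x) + (r^2*(?a*?b))*?z i x)))"
   unfolding c by (intro J_cong arg_cong[where f = "%y. w _ * y"]) (simp add: algebra_simps power2_eq_square)
  thus ?thesis
   by (simp only: E_simps[OF w] cont_simps cov_def[symmetric] trd_def[symmetric]; simp)
 qed
 have "cov (tilt r i w) j k = J (%x. w x*?f x) + r * J (%x. w x*(?z i x*?f x))"
  unfolding cov_def by (intro J_tilt w continuous_intros)
 thus ?thesis unfolding 1 2 by (simp add: algebra_simps power2_eq_square)
qed

text \<open>One constant for all densities on the box: this uniformity is what allows the errors of
  many successive tilts to be added.\<close>

definition lipf :: "(((nat => real) => real) => real) => bool" where
 "lipf F \<longleftrightarrow> (EX K. (ALL w. dns w --> \<bar>F w\<bar> <= K) &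
  (ALL w r i. dns w --> rok r --> i < n --> \<bar>F (tilt r i w) - F w\<bar> <= K*\<bar>r\<bar>))"

lemma lipfI:
 assumes "!!w. dns w ==> \<bar>F w\<bar> <= K" "!!w r i. dns w ==> rok r ==> i < n ==> \<bar>F (tilt r i w) - F w\<bar> <= K'*\<bar>r\<bar>"
 shows "lipf F"
proof -
 have "\<bar>F (tilt r i w) - F w\<bar> <= max K K'*\<bar>r\<bar>" if "dns w" "rok r" "i < n" for w r i
  using assms(2)[OF that] mult_right_mono[of K' "max K K'" "\<bar>r\<bar>"] by simp
 moreover have "\<bar>F w\<bar> <= max K K'" if "dns w" for w using assms(1)[OF that] by simp
 ultimately show ?thesis unfolding lipf_def by blast
qed

lemma lipfE:
 assumes "lipf F"
 shows "EX K>=0. (ALL w. dns w --> \<bar>F w\<bar> <= K) &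
  (ALL w r i. dns w --> rok r --> i < n --> \<bar>F (tilt r i w) - F w\<bar> <= K*\<bar>r\<bar>)"
proof -
 obtain K where K: "ALL w. dns w --> \<bar>F w\<bar> <= K"
  "ALL w r i. dns w --> rok r --> i < n --> \<bar>F (tilt r i w) - F w\<bar> <= K*\<bar>r\<bar>"
  using assms unfolding lipf_def by blast
 show ?thesis
 proof (intro exI[of _ "\<bar>K\<bar>"] conjI allI impI)
  show "\<bar>F w\<bar> <= \<bar>K\<bar>" if "dns w" for w using K(1) that abs_ge_self[of K] order_trans by blast
  show "\<bar>F (tilt r i w) - F w\<bar> <= \<bar>K\<bar>*\<bar>r\<bar>" if "dns w" "rok r" "i < n" for w r i
   using K(2) that mult_right_mono[OF abs_ge_self[of K], of "\<bar>r\<bar>"] order_trans by (meson abs_ge_zero)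
 qed simp
qed

lemma lipf_const: "lipf (%_. c)"
 by (rule lipfI[where K = "\<bar>c\<bar>" and K' = 0]) auto

lemma lipf_add:
 assumes "lipf F" "lipf G" shows "lipf (%w. F w + G w)"
proof -
 obtain K where K: "K >= 0" "!!w. dns w ==> \<bar>F w\<bar> <= K" "!!w r i. dns w ==> rok r ==> i < n ==> \<bar>F (tilt r i w) - F w\<bar> <= K*\<bar>r\<bar>"
  using lipfE[OF assms(1)] by blast
 obtain L where L: "L >= 0" "!!w. dns w ==> \<bar>G w\<bar> <= L" "!!w r i. dns w ==> rok r ==> i < n ==> \<bar>G (tilt r i w) - G w\<bar> <= L*\<bar>r\<bar>"
  using lipfE[OF assms(2)] by blast
 show ?thesis
 proof (rule lipfI[where K = "K + L" and K' = "K + L"])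
  show "\<bar>F w + G w\<bar> <= K + L" if "dns w" for w using K(2)[OF that] L(2)[OF that] by linarith
  show "\<bar>F (tilt r i w) + G (tilt r i w) - (F w + G w)\<bar> <= (K + L)*\<bar>r\<bar>" if "dns w" "rok r" "i < n" for w r i
   using K(3)[OF that] L(3)[OF that] unfolding distrib_right by linarith
 qed
qed

lemma lipf_mult:
 assumes "lipf F" "lipf G" shows "lipf (%w. F w * G w)"
proof -
 obtain K where K: "K >= 0" "!!w. dns w ==> \<bar>F w\<bar> <= K" "!!w r i. dns w ==> rok r ==> i < n ==> \<bar>F (tilt r i w) - F w\<bar> <= K*\<bar>r\<bar>"
  using lipfE[OF assms(1)] by blast
 obtain L where L: "L >= 0" "!!w. dns w ==> \<bar>G w\<bar> <= L" "!!w r i. dns w ==> rok r ==> i < n ==> \<bar>G (tilt r i w) - G w\<bar> <= L*\<bar>r\<bar>"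
  using lipfE[OF assms(2)] by blast
 show ?thesis
 proof (rule lipfI[where K = "K * L" and K' = "2*(K * L)"])
  show "\<bar>F w * G w\<bar> <= K * L" if "dns w" for w
   unfolding abs_mult using K(1) K(2)[OF that] L(2)[OF that] by (intro mult_mono) auto
  show "\<bar>F (tilt r i w) * G (tilt r i w) - F w * G w\<bar> <= 2*(K * L)*\<bar>r\<bar>" if "dns w" "rok r" "i < n" for w r i
  proof -
   have "F (tilt r i w) * G (tilt r i w) - F w * G w =
     (F (tilt r i w) - F w) * G (tilt r i w) + F w*(G (tilt r i w) - G w)" by (simp add: algebra_simps)
   moreover have "\<bar>(F (tilt r i w) - F w) * G (tilt r i w)\<bar> <= (K*\<bar>r\<bar>) * L"
    unfolding abs_mult using K(1) K(3)[OF that] L(2)[OF tilt_dns[OF that(1,3,2)]] by (intro mult_mono) auto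
   moreover have "\<bar>F w*(G (tilt r i w) - G w)\<bar> <= K*(L*\<bar>r\<bar>)"
    unfolding abs_mult using K(1) K(2)[OF that(1)] L(3)[OF that] by (intro mult_mono) auto
   ultimately show ?thesis by (simp add: algebra_simps)
  qed
 qed
qed

lemma lipf_minus: "lipf F ==> lipf G ==> lipf (%w. F w - G w)"
 using lipf_add[OF _ lipf_mult[OF lipf_const[of "-1"]]] by simp

lemma lipf_raw:
 assumes f: "continuous_on box f"
 shows "lipf (%w. J (%x. w x * f x))"
proof -
 obtain B where B: "B > 0" "!!x. x \<in> box ==> \<bar>f x\<bar> <= B" using bounded_cont[OF f] by blast
 show ?thesis
 proof (rule lipfI)
  show "\<bar>J (%x. w x * f x)\<bar> <= B" if "dns w" for w by (rule J_dns_bound[OF that f B(2)])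
  show "\<bar>J (%x. tilt r i w x * f x) - J (%x. w x * f x)\<bar> <= (2 * R * B)*\<bar>r\<bar>" if "dns w" "rok r" "i < n" for w r i
  proof -
   have "\<bar>J (%x. w x*(ctr w i x * f x))\<bar> <= 2 * R * B"
    using that(1,3) R_pos B
    by (intro J_dns_bound continuous_intros f) (auto simp: abs_mult intro!: mult_mono ctr_bound)
   hence "\<bar>r\<bar>*\<bar>J (%x. w x*(ctr w i x * f x))\<bar> <= \<bar>r\<bar>*(2 * R * B)" by (intro mult_left_mono) auto
   thus ?thesis unfolding J_tilt[OF that(1) f] by (simp add: abs_mult mult.commute)
  qed
 qed
qed

lemma lipf_mean: "lipf (%w. mean w i)"
 unfolding mean_def by (intro lipf_raw continuous_intros)

lemma lipf_cong: "(!!w. dns w ==> F w = G w) ==> lipf G ==> lipf F"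
 unfolding lipf_def using tilt_dns by (metis (no_types, lifting))

lemma cov_raw: "dns w ==> cov w i j = J (%x. w x*(x i * x j)) - mean w i * mean w j"
proof -
 assume w: "dns w"
 have "J (%x. w x*(x i * x j)) = J (%x. w x*((ctr w i x * ctr w j x + mean w i * ctr w j x)
   + (mean w j * ctr w i x + (mean w i * mean w j)*1)))"
  by (intro J_cong arg_cong[where f = "%y. w _ * y"]) (simp add: ctr_def algebra_simps)
 thus ?thesis
  by (simp only: E_simps[OF w] cont_simps cov_def[symmetric]; simp)
qed

lemma lipf_cov: "lipf (%w. cov w i j)"
 by (rule lipf_cong[OF cov_raw], assumption)
  (intro lipf_minus lipf_mult lipf_mean lipf_raw continuous_intros)

lemma trd_raw: "dns w ==> trd w i j k = J (%x. w x*(x i * x j * x k)) - mean w i * cov w j k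
 - mean w j * cov w i k - mean w k * cov w i j - mean w i * mean w j * mean w k"
proof -
 assume w: "dns w"
 let ?m = "mean w" and ?z = "ctr w"
 have "J (%x. w x*(x i * x j * x k)) = J (%x. w x*((?z i x*?z j x*?z k x + (?m i*(?z j x*?z k x)
   + ?m j*(?z i x*?z k x))) + (?m k*(?z i x*?z j x)
   + (((?m i*?m j)*?z k x + (?m i*?m k)*?z j x) + ((?m j*?m k)*?z i x + (?m i*?m j*?m k)*1)))))"
  by (intro J_cong arg_cong[where f = "%y. w _ * y"]) (simp add: ctr_def algebra_simps)
 thus ?thesis
  by (simp only: E_simps[OF w] cont_simps cov_def[symmetric] trd_def[symmetric]; simp)
qed

lemma lipf_trd: "lipf (%w. trd w i j k)"
 by (rule lipf_cong[OF trd_raw], assumption)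
  (intro lipf_minus lipf_mult lipf_mean lipf_cov lipf_raw continuous_intros)

end

section \<open>Second-order expansions under tilts and random sweeps\<close>

context cube
begin

text \<open>A discrete Ito expansion. \<open>D i\<close> and \<open>G i\<close> are the plain
  coefficients of \<open>r\<close> and \<open>r^2\<close>, so no factor 1/2 occurs; the Lipschitz
  property of \<open>G i\<close> is used to freeze it during a sweep.\<close>

definition ito where
 "ito F D G \<longleftrightarrow> lipf F & (ALL i<n. lipf (D i) & lipf (G i)) &
  (EX K>=0. ALL w r i. dns w --> rok r --> i < n -->
   \<bar>F (tilt r i w) - (F w + r * D i w + r^2 * G i w)\<bar> <= K*\<bar>r\<bar> ^ 3)"

lemma rok_bound: "rok r ==> \<bar>r\<bar> <= 1/(8 * R)"
 using R_pos unfolding rok_def by (simp add: field_simps)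

lemma lipf_bounds_set:
 assumes S: "finite S" and D: "!!i. i \<in> S ==> lipf (D i)"
 shows "EX K>=0. (\<forall>i\<in>S. ALL w. dns w --> \<bar>D i w\<bar> <= K) &
  (\<forall>j\<in>S. ALL w r i. dns w --> rok r --> i < n --> \<bar>D j (tilt r i w) - D j w\<bar> <= K*\<bar>r\<bar>)"
proof -
 have "ALL i. EX K>=0. i \<in> S --> (ALL w. dns w --> \<bar>D i w\<bar> <= K) &
  (ALL w r j. dns w --> rok r --> j < n --> \<bar>D i (tilt r j w) - D i w\<bar> <= K*\<bar>r\<bar>)"
  using lipfE[OF D] by (metis order_refl)
 then obtain K where K: "!!i. K i >= 0" "!!i w. i \<in> S ==> dns w ==> \<bar>D i w\<bar> <= K i"
  "!!i w r j. i \<in> S ==> dns w ==> rok r ==> j < n ==> \<bar>D i (tilt r j w) - D i w\<bar> <= K i*\<bar>r\<bar>"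
  by metis
 have le: "K i <= sum K S" if "i \<in> S" for i using that K(1) S by (intro member_le_sum) auto
 show ?thesis
 proof (intro exI[of _ "sum K S"] conjI allI impI ballI)
  show "0 <= sum K S" by (intro sum_nonneg K(1))
  show "\<bar>D i w\<bar> <= sum K S" if "i \<in> S" "dns w" for i w
   using K(2)[OF that] le[OF that(1)] by linarith
  show "\<bar>D j (tilt r i w) - D j w\<bar> <= sum K S*\<bar>r\<bar>" if "j \<in> S" "dns w" "rok r" "i < n" for j w r i
   using K(3)[OF that] mult_right_mono[OF le[OF that(1)], of "\<bar>r\<bar>"] by linarith
 qed
qed

lemma lipf_bounds:
 assumes "!!i. i < n ==> lipf (D i)"
 shows "EX K>=0. (ALL i<n. ALL w. dns w --> \<bar>D i w\<bar> <= K) &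
  (ALL j<n. ALL w r i. dns w --> rok r --> i < n --> \<bar>D j (tilt r i w) - D j w\<bar> <= K*\<bar>r\<bar>)"
 using lipf_bounds_set[of "{..<n}" D] assms by auto

lemma ito_const: "ito (%_. c) (%_ _. 0) (%_ _. 0)"
 unfolding ito_def by (auto intro: lipf_const)

lemma ito_add:
 assumes "ito F D G" "ito F' D' G'"
 shows "ito (%w. F w + F' w) (%i w. D i w + D' i w) (%i w. G i w + G' i w)"
proof -
 obtain K where K: "!!w r i. dns w ==> rok r ==> i < n ==> \<bar>F (tilt r i w) - (F w + r * D i w + r^2 * G i w)\<bar> <= K*\<bar>r\<bar> ^ 3" "K >= 0"
  using assms(1) unfolding ito_def by blast
 obtain L where L: "!!w r i. dns w ==> rok r ==> i < n ==> \<bar>F' (tilt r i w) - (F' w + r * D' i w + r^2 * G' i w)\<bar> <= L*\<bar>r\<bar> ^ 3" "L >= 0"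
  using assms(2) unfolding ito_def by blast
 show ?thesis
  unfolding ito_def
 proof (intro conjI allI impI exI[of _ "K + L"])
  fix w r i assume *: "dns w" "rok r" "i < n"
  have "F (tilt r i w) + F' (tilt r i w) - (F w + F' w + r*(D i w + D' i w) + r^2*(G i w + G' i w)) =
   (F (tilt r i w) - (F w + r * D i w + r^2 * G i w)) + (F' (tilt r i w) - (F' w + r * D' i w + r^2 * G' i w))"
   by (simp add: algebra_simps)
  thus "\<bar>F (tilt r i w) + F' (tilt r i w) - (F w + F' w + r*(D i w + D' i w) + r^2*(G i w + G' i w))\<bar>
    <= (K + L)*\<bar>r\<bar> ^ 3"
   using K(1)[OF *] L(1)[OF *] unfolding distrib_right by linarith
 qed (use assms K L in \<open>auto simp: ito_def intro: lipf_add\<close>)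
qed

lemma mult_expansion:
 fixes a b p q f d g f' d' g' r r0 K L :: real
 assumes b: "\<bar>f\<bar> <= K" "\<bar>d\<bar> <= K" "\<bar>g\<bar> <= K" "\<bar>f'\<bar> <= L" "\<bar>d'\<bar> <= L" "\<bar>g'\<bar> <= L" "\<bar>b\<bar> <= L"
  and r: "\<bar>r\<bar> <= r0"
  and a: "\<bar>a - (f + r * d + r^2 * g)\<bar> <= K*\<bar>r\<bar> ^ 3" and bb: "\<bar>b - (f' + r * d' + r^2 * g')\<bar> <= L*\<bar>r\<bar> ^ 3"
 shows "\<bar>a * b - (f * f' + r*(f * d' + d * f') + r^2*((f * g' + g * f') + d * d'))\<bar> <= (K * L*(4 + 2 * r0 + r0^2))*\<bar>r\<bar> ^ 3"
proof -
 have K: "0 <= K" and L: "0 <= L" and r0: "0 <= r0" using b r by linarith+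
 define P where "P = f + r * d + r^2 * g"
 define Q where "Q = f' + r * d' + r^2 * g'"
 have rr: "\<bar>r^2\<bar> <= r0^2" using power_mono[OF r abs_ge_zero, of 2] by simp
 have P: "\<bar>P\<bar> <= K*(1 + r0 + r0^2)"
 proof -
  have "\<bar>r * d\<bar> <= r0 * K" unfolding abs_mult by (rule mult_mono[OF r b(2) r0]) simp
  moreover have "\<bar>r^2 * g\<bar> <= r0^2 * K" unfolding abs_mult by (rule mult_mono[OF rr b(3)]) simp_all
  ultimately have "\<bar>f + r * d + r^2 * g\<bar> <= K + r0 * K + r0^2 * K" using b(1) by linarith
  thus ?thesis unfolding P_def by (simp add: algebra_simps)
 qed
 have 1: "\<bar>(a - P) * b\<bar> <= (K*\<bar>r\<bar> ^ 3) * L"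
  unfolding abs_mult P_def by (rule mult_mono[OF a b(7)]) (use K in simp_all)
 have 2: "\<bar>P*(b - Q)\<bar> <= (K*(1 + r0 + r0^2))*(L*\<bar>r\<bar> ^ 3)"
  unfolding abs_mult by (rule mult_mono[OF P bb[folded Q_def]]) (use K r0 in simp_all)
 have 3: "\<bar>r ^ 3*(d * g' + g * d')\<bar> <= \<bar>r\<bar> ^ 3*(2*(K * L))"
 proof -
  have "\<bar>d * g'\<bar> <= K * L" "\<bar>g * d'\<bar> <= K * L"
   unfolding abs_mult by (rule mult_mono[OF b(2) b(6) K abs_ge_zero], rule mult_mono[OF b(3) b(5) K abs_ge_zero])
  hence "\<bar>d * g' + g * d'\<bar> <= 2*(K * L)" by linarith
  thus ?thesis unfolding abs_mult power_abs by (rule mult_left_mono) simp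
 qed
 have 4: "\<bar>r ^ 3*(r*(g * g'))\<bar> <= \<bar>r\<bar> ^ 3*(r0*(K * L))"
  unfolding abs_mult power_abs
  by (rule mult_left_mono[OF mult_mono[OF r mult_mono[OF b(3) b(6) K abs_ge_zero] r0]]) simp_all
 have "a * b - (f * f' + r*(f * d' + d * f') + r^2*((f * g' + g * f') + d * d')) =
  (a - P) * b + P*(b - Q) + r ^ 3*(d * g' + g * d') + r ^ 3*(r*(g * g'))"
  unfolding P_def Q_def by (simp add: algebra_simps power2_eq_square power3_eq_cube)
 also have "\<bar>...\<bar> <= (K*\<bar>r\<bar> ^ 3) * L + (K*(1 + r0 + r0^2))*(L*\<bar>r\<bar> ^ 3) + \<bar>r\<bar> ^ 3*(2*(K * L)) + \<bar>r\<bar> ^ 3*(r0*(K * L))"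
  using 1 2 3 4 by linarith
 also have "... = (K * L*(4 + 2 * r0 + r0^2))*\<bar>r\<bar> ^ 3" by (simp add: algebra_simps)
 finally show ?thesis .
qed

lemma ito_bounds:
 assumes "ito F D G"
 shows "EX K>=0. (ALL w. dns w --> \<bar>F w\<bar> <= K) & (ALL w i. dns w --> i < n --> \<bar>D i w\<bar> <= K & \<bar>G i w\<bar> <= K) &
  (ALL w r i. dns w --> rok r --> i < n --> \<bar>F (tilt r i w) - (F w + r * D i w + r^2 * G i w)\<bar> <= K*\<bar>r\<bar> ^ 3)"
proof -
 obtain K where K: "!!w r i. dns w ==> rok r ==> i < n ==> \<bar>F (tilt r i w) - (F w + r * D i w + r^2 * G i w)\<bar> <= K*\<bar>r\<bar> ^ 3" "K >= 0"
  using assms(1) unfolding ito_def by blast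
 obtain A where A: "A >= 0" "!!w. dns w ==> \<bar>F w\<bar> <= A"
  using assms lipfE[of F] unfolding ito_def by blast
 obtain B where B: "B >= 0" "!!w i. i < n ==> dns w ==> \<bar>D i w\<bar> <= B"
  using assms lipf_bounds[of D] unfolding ito_def by blast
 obtain C where C: "C >= 0" "!!w i. i < n ==> dns w ==> \<bar>G i w\<bar> <= C"
  using assms lipf_bounds[of G] unfolding ito_def by blast
 show ?thesis
 proof (intro exI[of _ "K + A + B + C"] conjI allI impI)
  show "\<bar>F (tilt r i w) - (F w + r * D i w + r^2 * G i w)\<bar> <= (K + A + B + C)*\<bar>r\<bar> ^ 3"
   if "dns w" "rok r" "i < n" for w r i
   using K(1)[OF that] mult_right_mono[of K "K + A + B + C" "\<bar>r\<bar> ^ 3"] A B C by simp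
 qed (use K(2) A B C in \<open>fastforce+\<close>)
qed

text \<open>The term \<open>D i w * D' i w\<close> in the second-order coefficient is the quadratic
  covariation of the two functionals.\<close>

lemma ito_mult:
 assumes "ito F D G" "ito F' D' G'"
 shows "ito (%w. F w * F' w) (%i w. F w * D' i w + D i w * F' w)
  (%i w. (F w * G' i w + G i w * F' w) + D i w * D' i w)"
proof -
 obtain K where K: "K >= 0" "!!w. dns w ==> \<bar>F w\<bar> <= K" "!!w i. dns w ==> i < n ==> \<bar>D i w\<bar> <= K & \<bar>G i w\<bar> <= K"
  "!!w r i. dns w ==> rok r ==> i < n ==> \<bar>F (tilt r i w) - (F w + r * D i w + r^2 * G i w)\<bar> <= K*\<bar>r\<bar> ^ 3"
  using ito_bounds[OF assms(1)] by metis
 obtain L where L: "L >= 0" "!!w. dns w ==> \<bar>F' w\<bar> <= L" "!!w i. dns w ==> i < n ==> \<bar>D' i w\<bar> <= L & \<bar>G' i w\<bar> <= L"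
  "!!w r i. dns w ==> rok r ==> i < n ==> \<bar>F' (tilt r i w) - (F' w + r * D' i w + r^2 * G' i w)\<bar> <= L*\<bar>r\<bar> ^ 3"
  using ito_bounds[OF assms(2)] by metis
 let ?r0 = "1/(8 * R)"
 show ?thesis
  unfolding ito_def
 proof (intro conjI allI impI exI[of _ "K * L*(4 + 2*?r0 + ?r0^2)"])
  show "0 <= K * L*(4 + 2*?r0 + ?r0^2)" using K(1) L(1) R_pos by (intro mult_nonneg_nonneg add_nonneg_nonneg) auto
  fix w r i assume *: "dns w" "rok r" "i < n"
  show "\<bar>F (tilt r i w) * F' (tilt r i w) -
    (F w * F' w + r*(F w * D' i w + D i w * F' w) + r^2*((F w * G' i w + G i w * F' w) + D i w * D' i w))\<bar>
    <= K * L*(4 + 2*?r0 + ?r0^2)*\<bar>r\<bar> ^ 3"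
   by (rule mult_expansion)
    (use K L * rok_bound tilt_dns[OF *(1,3,2)] in auto)
 qed (use assms in \<open>auto simp: ito_def intro!: lipf_add lipf_mult\<close>)
qed

lemma ito_sum:
 "(!!l. l \<in> S ==> ito (F l) (D l) (G l)) ==>
  ito (%w. \<Sum>l\<in>S. F l w) (%i w. \<Sum>l\<in>S. D l i w) (%i w. \<Sum>l\<in>S. G l i w)"
proof (induction S rule: infinite_finite_induct)
 case (insert x A)
 hence "ito (%w. F x w + (\<Sum>l\<in>A. F l w)) (%i w. D x i w + (\<Sum>l\<in>A. D l i w)) (%i w. G x i w + (\<Sum>l\<in>A. G l i w))"
  by (intro ito_add) auto
 with insert.hyps show ?case by simp
qed (simp_all add: ito_const)

lemma ito_cov: "ito (%w. cov w j k) (%i w. trd w i j k) (%i w. - (cov w i j * cov w i k))"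
proof -
 have "lipf (%w. - (cov w i j * cov w i k))" for i
  using lipf_minus[OF lipf_const[of 0] lipf_mult[OF lipf_cov lipf_cov], of i j i k] by simp
 thus ?thesis
  unfolding ito_def by (auto simp: cov_tilt lipf_cov lipf_trd)
qed

text \<open>
 The expectation of \<open>F\<close> after one random tilt along each coordinate in the list: \<open>w\<close> is the mean
 of its two tilts, so mixtures, and hence integrals against \<open>w\<close>, are preserved.
\<close>

fun sw :: "real => nat list => (((nat => real) => real) => real) => ((nat => real) => real) => real" where
 "sw d [] F w = F w"
| "sw d (i # is) F w = (sw d is F (tilt (sqrt d) i w) + sw d is F (tilt (- sqrt d) i w))/2"

lemma sw_lin: "sw d is (%w. a * F w + b * G w + c) w = a * sw d is F w + b * sw d is G w + c"
 by (induction "is" arbitrary: w) (auto simp: field_simps)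

lemma sw_J:
 assumes "dns w" "rok (sqrt d)" "set is \<subseteq> {..<n}" "continuous_on box f"
 shows "sw d is (%w. J (%x. w x * f x)) w = J (%x. w x * f x)"
 using assms
proof (induction "is" arbitrary: w)
 case (Cons i "is")
 have "rok (- sqrt d)" using Cons.prems unfolding rok_def by simp
 thus ?case
  using Cons.prems Cons.IH[of "tilt (sqrt d) i w"] Cons.IH[of "tilt (- sqrt d) i w"]
   tilt_dns[of w i "sqrt d"] tilt_dns[of w i "- sqrt d"]
  by (simp add: J_tilt)
qed simp

text \<open>Averaging over the two signs of \<open>sqrt d\<close> kills the odd term of each tilt.
  The coefficients \<open>G j\<close> of later coordinates move by \<open>O (sqrt d)\<close> only
  and are multiplied by \<open>d\<close>, so they may be evaluated at the initial density.\<close>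

lemma sweep_expansion:
 fixes K L d :: real
 assumes K: "!!w i. dns w ==> i < n ==>
   \<bar>(F (tilt (sqrt d) i w) + F (tilt (- sqrt d) i w))/2 - (F w + d * G i w)\<bar> <= K*(d * sqrt d)" "K >= 0"
  and L: "!!j w r i. j < n ==> dns w ==> rok r ==> i < n ==> \<bar>G j (tilt r i w) - G j w\<bar> <= L*\<bar>r\<bar>" "L >= 0"
  and d: "d >= 0" "rok (sqrt d)"
  and "is": "set is \<subseteq> {..<n}" and w: "dns w"
 shows "\<bar>sw d is F w - (F w + d*(\<Sum>i\<leftarrow>is. G i w))\<bar> <= length is*(K + length is * L)*(d * sqrt d)"
 using "is" w
proof (induction "is" arbitrary: w)
 case (Cons i "is")
 note w = Cons.prems(2)
 have i: "i < n" using Cons.prems by simp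
 have d': "rok (- sqrt d)" using d(2) unfolding rok_def by simp
 let ?S = "%w. \<Sum>i\<leftarrow>is. G i w"
 let ?C = "length is*(K + length is * L)"
 have S: "\<bar>?S (tilt r i w) - ?S w\<bar> <= length is * L*\<bar>r\<bar>" if "rok r" for r
 proof -
  have "set js \<subseteq> {..<n} ==> \<bar>(\<Sum>j\<leftarrow>js. G j (tilt r i w)) - (\<Sum>j\<leftarrow>js. G j w)\<bar> <= length js * L*\<bar>r\<bar>" for js
  proof (induction js)
   case (Cons j js)
   thus ?case using L(1)[of j w r i] w i that by (simp add: algebra_simps abs_le_iff)
  qed simp
  thus ?thesis using Cons.prems by simp
 qed
 define p m where "p = tilt (sqrt d) i w" and "m = tilt (- sqrt d) i w"
 have pm: "dns p" "dns m" unfolding p_def m_def using tilt_dns w i d d' by auto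
 have 1: "\<bar>sw d is F p - (F p + d*?S p)\<bar> <= ?C*(d * sqrt d)" "\<bar>sw d is F m - (F m + d*?S m)\<bar> <= ?C*(d * sqrt d)"
  using Cons.IH pm Cons.prems(1) by auto
 have 2: "\<bar>d*(?S p - ?S w)\<bar> <= length is * L*(d * sqrt d)" "\<bar>d*(?S m - ?S w)\<bar> <= length is * L*(d * sqrt d)"
  using mult_left_mono[OF S[OF d(2)], of d] mult_left_mono[OF S[OF d'], of d] d
  unfolding p_def m_def abs_mult by (auto simp: mult_ac)
 have 3: "\<bar>(F p + F m)/2 - (F w + d * G i w)\<bar> <= K*(d * sqrt d)"
  using K(1)[OF w i] unfolding p_def m_def .
 have aux: "\<bar>x1/2 + x2/2 + x3/2 + x4/2 + x5\<bar> <= a + b + c"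
  if "\<bar>x1\<bar> <= a" "\<bar>x2\<bar> <= a" "\<bar>x3\<bar> <= c" "\<bar>x4\<bar> <= c" "\<bar>x5\<bar> <= b"
  for x1 x2 x3 x4 x5 a b c :: real
  using that by linarith
 have e: "sw d (i # is) F w - (F w + d*(\<Sum>i\<leftarrow>i # is. G i w)) =
  (sw d is F p - (F p + d*?S p))/2 + (sw d is F m - (F m + d*?S m))/2 + d*(?S p - ?S w)/2 + d*(?S m - ?S w)/2
  + ((F p + F m)/2 - (F w + d * G i w))"
  unfolding sw.simps p_def[symmetric] m_def[symmetric] by (simp add: field_simps)
 have "\<bar>sw d (i # is) F w - (F w + d*(\<Sum>i\<leftarrow>i # is. G i w))\<bar> <= (?C + K + length is * L)*(d * sqrt d)"
  unfolding e distrib_right by (rule aux[OF 1 2 3])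
 also have "... <= length (i # is)*(K + length (i # is) * L)*(d * sqrt d)"
  using d L(2) by (intro mult_right_mono) (auto simp: algebra_simps)
 finally show ?case .
qed simp

lemma sweep_ito:
 assumes "ito F D G"
 shows "EX C>=0. ALL w d. dns w --> d >= 0 --> rok (sqrt d) -->
  \<bar>sw d [0..<n] F w - (F w + d*(SUM i<n. G i w))\<bar> <= C*(d * sqrt d)"
proof -
 obtain K where K: "!!w r i. dns w ==> rok r ==> i < n ==> \<bar>F (tilt r i w) - (F w + r * D i w + r^2 * G i w)\<bar> <= K*\<bar>r\<bar> ^ 3" "K >= 0"
  using assms(1) unfolding ito_def by blast
 obtain L where L: "L >= 0"
  "!!j w r i. j < n ==> dns w ==> rok r ==> i < n ==> \<bar>G j (tilt r i w) - G j w\<bar> <= L*\<bar>r\<bar>"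
  using lipf_bounds[of G] assms unfolding ito_def by metis
 have "\<bar>sw d [0..<n] F w - (F w + d*(\<Sum>i\<leftarrow>[0..<n]. G i w))\<bar> <= length [0..<n]*(K + length [0..<n] * L)*(d * sqrt d)"
  if w: "dns w" and d: "d >= 0" "rok (sqrt d)" for w d
 proof (rule sweep_expansion[OF _ K(2) L(2,1) d _ w])
  fix w i assume w: "dns w" and i: "i < n"
  have d': "rok (- sqrt d)" using d unfolding rok_def by simp
  have e: "\<bar>sqrt d\<bar> ^ 3 = d * sqrt d" "\<bar>- sqrt d\<bar> ^ 3 = d * sqrt d" "(sqrt d)^2 = d" "(- sqrt d)^2 = d"
   using d(1) by (simp_all add: power3_eq_cube)
  show "\<bar>(F (tilt (sqrt d) i w) + F (tilt (- sqrt d) i w))/2 - (F w + d * G i w)\<bar> <= K*(d * sqrt d)"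
   using K(1)[OF w d(2) i] K(1)[OF w d' i] unfolding e by (simp add: abs_le_iff field_simps)
 qed auto
 hence "EX C>=0. ALL w d. dns w --> d >= 0 --> rok (sqrt d) -->
  \<bar>sw d [0..<n] F w - (F w + d*(\<Sum>i\<leftarrow>[0..<n]. G i w))\<bar> <= C*(d * sqrt d)"
  using K(2) L(1) by (intro exI[of _ "length [0..<n]*(K + length [0..<n] * L)"]) auto
 moreover have "(\<Sum>i\<leftarrow>[0..<n]. G i w) = (SUM i<n. G i w)" for w
  by (simp add: sum_list_distinct_conv_sum_set lessThan_atLeast0)
 ultimately show ?thesis by simp
qed

end

section \<open>Strong log-concavity under tilts, covariance and third moments\<close>

context cube
begin

lemma pd_tilt_log:
 assumes w: "dns w" and i: "i < n" "rok r"
 shows "pd j (%x. ln (1 + r * ctr w i x)) (%x. if j = i then r/(1 + r * ctr w i x) else 0)"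
  "pd j (%x. if k = i then r/(1 + r * ctr w i x) else 0)
   (%x. if k = i & j = i then - (r^2/(1 + r * ctr w i x)^2) else 0)"
proof -
 have pos: "1 + r*(x i - mean w i) > 0" if "x \<in> box" for x
  using rok_ctr[OF assms that] unfolding ctr_def by auto
 show "pd j (%x. ln (1 + r * ctr w i x)) (%x. if j = i then r/(1 + r * ctr w i x) else 0)"
  unfolding pd_def ctr_def
 proof
  fix x assume x: "x \<in> box"
  show "((%s. ln (1 + r*((x(j := s)) i - mean w i))) has_real_derivative
    (if j = i then r/(1 + r*(x i - mean w i)) else 0)) (at (x j))"
   using pos[OF x] by (cases "j = i") (auto intro!: derivative_eq_intros)
 qed
 show "pd j (%x. if k = i then r/(1 + r * ctr w i x) else 0)
   (%x. if k = i & j = i then - (r^2/(1 + r * ctr w i x)^2) else 0)"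
  unfolding pd_def ctr_def
 proof
  fix x assume x: "x \<in> box"
  show "((%s. if k = i then r/(1 + r*((x(j := s)) i - mean w i)) else 0) has_real_derivative
    (if k = i & j = i then - (r^2/(1 + r*(x i - mean w i))^2) else 0)) (at (x j))"
   using pos[OF x] by (cases "j = i"; cases "k = i") (auto intro!: derivative_eq_intros simp: power2_eq_square)
 qed
qed

text \<open>The new potential is \<open>V - ln (1 + r ctr)\<close>, whose Hessian gains
  \<open>r^2 / (1 + r ctr)^2\<close> at the entry \<open>(i, i)\<close>. Since
  \<open>1 + r ctr <= 5/4\<close> and \<open>(5/4)^2 <= 2\<close>, this is at least
  \<open>r^2 / 2\<close>.\<close>

lemma slc_tilt:
 assumes s: "slc t w" and i: "i < n" "rok r"
 shows "slc (t(i := t i + r^2/2)) (tilt r i w)"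
proof -
 have w: "dns w" by (rule slc_dns[OF s])
 obtain V V1 V2 where V: "J w = 1" "pot t V V1 V2" "\<forall>x\<in>box. w x = exp (- V x)"
  using s unfolding slc_def by blast
 let ?q = "%x. 1 + r * ctr w i x"
 have q: "?q x > 0" "?q x <= 5/4" if "x \<in> box" for x
  using rok_ctr[OF w i that] by auto
 have cq [continuous_intros]: "continuous_on box ?q" by (intro continuous_intros)
 note [continuous_intros] = C1D(1)[OF potD(1)[OF V(2)]] C1D(2)[OF potD(1)[OF V(2)]] C1D(2)[OF potD(2)[OF V(2)]]
 have q0: "\<forall>x\<in>box. ?q x ~= 0" "\<forall>x\<in>box. (?q x)^2 ~= 0" using q by fastforce+
 have "pot (t(i := t i + r^2/2)) (%x. V x - ln (?q x))
   (%j x. V1 j x - (if j = i then r/?q x else 0))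
   (%j k x. V2 j k x - (if j = i & k = i then - (r^2/(?q x)^2) else 0))"
  unfolding pot_def
 proof (intro conjI allI impI ballI)
  show "C1 (%x. V x - ln (?q x)) (%j x. V1 j x - (if j = i then r/?q x else 0))"
   unfolding C1_def
  proof (intro conjI allI impI)
   show "continuous_on box (%x. V x - ln (?q x))" using q0 by (intro continuous_intros)
   show "continuous_on box (%x. V1 j x - (if j = i then r/?q x else 0))" if "j < n" for j
    using q0 that by (cases "j = i") (simp_all add: continuous_intros)
   show "pd j (%x. V x - ln (?q x)) (%x. V1 j x - (if j = i then r/?q x else 0))" if "j < n" for j
    by (intro pd_diff pd_tilt_log w i C1D(3)[OF potD(1)[OF V(2)]] that)
  qed
  show "C1 (%x. V1 j x - (if j = i then r/?q x else 0)) (%k x. V2 j k x - (if j = i & k = i then - (r^2/(?q x)^2) else 0))"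
   if j: "j < n" for j
   unfolding C1_def
  proof (intro conjI allI impI)
   show "continuous_on box (%x. V1 j x - (if j = i then r/?q x else 0))"
    using q0 j by (cases "j = i") (simp_all add: continuous_intros)
   show "continuous_on box (%x. V2 j k x - (if j = i & k = i then - (r^2/(?q x)^2) else 0))" if "k < n" for k
    using q0 j that by (cases "j = i"; cases "k = i") (simp_all add: continuous_intros)
   show "pd k (%x. V1 j x - (if j = i then r/?q x else 0)) (%x. V2 j k x - (if j = i & k = i then - (r^2/(?q x)^2) else 0))"
    if "k < n" for k
    by (intro pd_diff pd_tilt_log w i C1D(3)[OF potD(2)[OF V(2)]] that j)
  qed
  fix x and v :: "nat => real" assume x: "x \<in> box"
  have "(SUM j<n. (t(i := t i + r^2/2)) j*(v j)^2) = (SUM j<n. t j*(v j)^2 + (if j = i then r^2/2*(v i)^2 else 0))"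
   by (intro sum.cong) (auto simp: algebra_simps)
  also have "... = (SUM j<n. t j*(v j)^2) + r^2/2*(v i)^2" using i by (simp add: sum.distrib)
  also have "... <= (SUM j<n. SUM k<n. V2 j k x * v j * v k) + r^2/(?q x)^2*(v i)^2"
  proof (intro add_mono potD(3)[OF V(2) x] mult_right_mono)
   have "(?q x)^2 <= (5/4)^2" using q[OF x] by (intro power_mono) auto
   also have "... <= (2::real)" by (simp add: power2_eq_square)
   finally show "r^2/2 <= r^2/(?q x)^2" using q(1)[OF x] by (intro divide_left_mono) auto
  qed auto
  also have "... = (SUM j<n. SUM k<n. (V2 j k x - (if j = i & k = i then - (r^2/(?q x)^2) else 0)) * v j * v k)"
  proof -
   have "(SUM j<n. SUM k<n. (V2 j k x - (if j = i & k = i then - (r^2/(?q x)^2) else 0)) * v j * v k) =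
    (SUM j<n. SUM k<n. V2 j k x * v j * v k + (if k = i then if j = i then r^2/(?q x)^2*(v i)^2 else 0 else 0))"
    by (intro sum.cong refl) (auto simp: power2_eq_square algebra_simps)
   thus ?thesis using i by (simp add: sum.distrib)
  qed
  finally show "(SUM j<n. (t(i := t i + r^2/2)) j*(v j)^2) <=
   (SUM j<n. SUM k<n. (V2 j k x - (if j = i & k = i then - (r^2/(?q x)^2) else 0)) * v j * v k)" .
 qed
 moreover have "\<forall>x\<in>box. tilt r i w x = exp (- (V x - ln (?q x)))"
  using V(3) q(1) by (simp add: tilt_def exp_diff exp_minus divide_inverse)
 ultimately show ?thesis
  using dns_one[OF tilt_dns[OF w i]] unfolding slc_def by blast
qed

lemma slc_cong: "(!!i. i < n ==> t i = t' i) ==> slc t w ==> slc t' w"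
proof -
 assume t: "!!i. i < n ==> t i = t' i" and s: "slc t w"
 have "(SUM i<n. t i*(v i)^2) = (SUM i<n. t' i*(v i)^2)" for v
  using t by (intro sum.cong) auto
 with s show "slc t' w" unfolding slc_def pot_def by simp
qed

text \<open>Every density reached at the end of the sweep has gained \<open>d / 2\<close> in a
  coordinate for each visit, whatever the signs; the comparison of \<open>F\<close> and
  \<open>G\<close> is required for such densities only.\<close>

lemma sw_mono_slc:
 assumes "!!w. slc (%i. t i + count_list is i*(d/2)) w ==> F w <= G w"
  and "slc t w" "0 <= d" "rok (sqrt d)" "set is \<subseteq> {..<n}"
 shows "sw d is F w <= sw d is G w"
 using assms
proof (induction "is" arbitrary: t w)
 case (Cons i "is")
 have "sw d is F (tilt r i w) <= sw d is G (tilt r i w)" if r: "r = sqrt d | r = - sqrt d" for r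
 proof (rule Cons.IH)
  have rr: "rok r" "r^2 = d" using r Cons.prems by (auto simp: rok_def)
  show "slc (t(i := t i + d/2)) (tilt r i w)"
   using slc_tilt[OF Cons.prems(2), of i r] rr Cons.prems(5) by simp
  fix u assume "slc (%j. (t(i := t i + d/2)) j + count_list is j*(d/2)) u"
  thus "F u <= G u"
   by (intro Cons.prems(1)) (erule slc_cong[rotated], auto simp: algebra_simps)
 qed (use Cons.prems in auto)
 from this[of "sqrt d"] this[of "- sqrt d"] show ?case by simp
qed (use slc_cong in force)

lemma sweep_mono:
 assumes "!!w. slc (%_. t + d/2) w ==> F w <= G w"
  and "slc (%_. t) w" "0 <= d" "rok (sqrt d)"
 shows "sw d [0..<n] F w <= sw d [0..<n] G w"
proof (rule sw_mono_slc[OF _ assms(2-4)])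
 fix u assume "slc (%i. t + count_list [0..<n] i*(d/2)) u"
 moreover have "count_list [0..<m] i = (if i < m then 1 else 0)" for i m
  by (induction m) auto
 ultimately have "slc (%_. t + d/2) u" by (elim slc_cong[rotated]) simp
 thus "F u <= G u" by (rule assms(1))
qed auto

definition lin :: "((nat => real) => real) => (nat => real) => (nat => real) => real" where
 "lin w v x = (SUM i<n. v i * ctr w i x)"

lemma cont_lin [continuous_intros]: "continuous_on A (%x. lin w v x)"
 unfolding lin_def by (intro continuous_intros)

lemma J_lin_mult:
 assumes w: "dns w" and f: "continuous_on box f"
 shows "J (%x. w x*(lin w v x * f x)) = (SUM i<n. v i * J (%x. w x*(ctr w i x * f x)))"
proof -
 note [continuous_intros] = dns_cont[OF w] f
 have "J (%x. w x*(lin w v x * f x)) = J (%x. SUM i<n. v i*(w x*(ctr w i x * f x)))"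
  unfolding lin_def by (intro J_cong) (simp add: sum_distrib_left mult_ac)
 also have "... = (SUM i<n. v i * J (%x. w x*(ctr w i x * f x)))"
  by (subst J_sum) (auto intro!: continuous_intros)
 finally show ?thesis .
qed

lemma J_lin2:
 assumes w: "dns w"
 shows "J (%x. w x*(lin w u x * lin w v x)) = (SUM i<n. SUM j<n. u i * v j * cov w i j)"
proof -
 have 1: "J (%x. w x*(ctr w i x * lin w v x)) = (SUM j<n. v j * cov w i j)" for i
 proof -
  have "J (%x. w x*(ctr w i x * lin w v x)) = J (%x. w x*(lin w v x * ctr w i x))"
   by (intro J_cong) simp
  also have "... = (SUM j<n. v j * cov w j i)"
   unfolding cov_def by (intro J_lin_mult w continuous_intros)
  finally show ?thesis by (simp add: cov_sym[of w i])
 qed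
 show ?thesis
  by (subst J_lin_mult[OF w]) (auto intro!: continuous_intros simp: 1 sum_distrib_left mult.assoc)
qed

lemma slc_PI:
 assumes s: "slc (%_. t) w" and t: "t > 0" and a: "a >= 0"
  "!!v. (SUM i<n. SUM j<n. v i * v j * cov w i j) <= a*(SUM i<n. (v i)^2)"
  and g: "C1 g g1"
 shows "J (%x. w x*(g x - J (%x. w x * g x))^2) <= sqrt (a/t) * J (%x. w x*(SUM i<n. (g1 i x)^2))"
  "J (%x. w x*(g x - J (%x. w x * g x))^2) <= 1/t * J (%x. w x*(SUM i<n. (g1 i x)^2))"
proof -
 have w: "dns w" by (rule slc_dns[OF s])
 obtain V V1 V2 where V: "J w = 1" "pot (%_. t) V V1 V2" "\<forall>x\<in>box. w x = exp (- V x)"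
  using s unfolding slc_def by blast
 have e: "J (%x. exp (- V x) * f x) = J (%x. w x * f x)" for f
  using V(3) by (intro J_cong) auto
 have e1: "J (%x. exp (- V x)) = 1" using e[of "%_. 1"] V(1) by simp
 have m: "mean (%x. exp (- V x)) i = mean w i" for i unfolding mean_def e ..
 have c: "J (%x. exp (- V x)*(SUM i<n. v i*(x i - mean (%x. exp (- V x)) i))^2) <= a*(SUM i<n. (v i)^2)" for v
  using a(2)[of v] J_lin2[OF w, of v v] unfolding e m lin_def ctr_def power2_eq_square by simp
 from improved_poincare[OF V(2) t e1 c a(1)] g
 show "J (%x. w x*(g x - J (%x. w x * g x))^2) <= sqrt (a/t) * J (%x. w x*(SUM i<n. (g1 i x)^2))"
  "J (%x. w x*(g x - J (%x. w x * g x))^2) <= 1/t * J (%x. w x*(SUM i<n. (g1 i x)^2))"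
  unfolding PI_def e by blast+
qed

text \<open>A crude bound. It supplies an \<open>a\<close> for \<open>slc_PI\<close> in a place
  where the value of \<open>a\<close> does not enter the conclusion.\<close>

lemma cov_quad_bound:
 assumes w: "dns w"
 shows "(SUM i<n. SUM j<n. v i * v j * cov w i j) <= (n*(2 * R)^2)*(SUM i<n. (v i)^2)"
proof -
 note [continuous_intros] = dns_cont[OF w]
 have "(SUM i<n. SUM j<n. v i * v j * cov w i j) = J (%x. w x*(lin w v x * lin w v x))"
  using J_lin2[OF w] by simp
 also have "... <= (n*(2 * R)^2)*(SUM i<n. (v i)^2)"
 proof (rule order_trans[OF abs_ge_self], rule J_dns_bound[OF w])
  show "\<bar>lin w v x * lin w v x\<bar> <= (n*(2 * R)^2)*(SUM i<n. (v i)^2)" if x: "x \<in> box" for x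
  proof -
   have "(lin w v x)^2 <= (SUM i<n. (v i)^2)*(SUM i<n. (ctr w i x)^2)"
    unfolding lin_def by (rule sum_cauchy)
   also have "... <= (SUM i<n. (v i)^2)*(SUM i<n. (2 * R)^2)"
   proof (intro mult_left_mono sum_mono)
    fix i assume "i \<in> {..<n}"
    hence "\<bar>ctr w i x\<bar> <= \<bar>2 * R\<bar>" using ctr_bound[OF w _ x, of i] by simp
    thus "(ctr w i x)^2 <= (2 * R)^2" by (simp only: abs_le_square_iff)
   qed (simp add: sum_nonneg)
   finally show ?thesis by (simp add: power2_eq_square mult_ac)
  qed
 qed (intro continuous_intros)
 finally show ?thesis .
qed

text \<open>The Poincare inequality with constant \<open>1 / t\<close>, applied to linear functions,
  whose gradients are constant.\<close>

lemma cov_slc: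
 assumes s: "slc (%_. t) w" and t: "t > 0"
 shows "(SUM i<n. SUM j<n. v i * v j * cov w i j) <= 1/t*(SUM i<n. (v i)^2)"
proof -
 have w: "dns w" by (rule slc_dns[OF s])
 let ?g = "%x. SUM i<n. v i * x i"
 have g: "C1 ?g (%j x. SUM i<n. v i*(if j = i then 1 else 0))"
  unfolding C1_def by (intro conjI allI impI pd_sum pd_cmult pd_coord continuous_intros)
 have m: "J (%x. w x*?g x) = (SUM i<n. v i * mean w i)"
 proof -
  have "J (%x. w x*?g x) = J (%x. SUM i<n. v i*(w x * x i))"
   by (intro J_cong) (simp add: sum_distrib_left mult_ac)
  thus ?thesis
   by (subst (asm) J_sum) (auto intro!: continuous_intros dns_cont[OF w] simp: mean_def)
 qed
 have "J (%x. w x*(?g x - J (%x. w x*?g x))^2) <= 1/t * J (%x. w x*(SUM j<n. (SUM i<n. v i*(if j = i then 1 else 0))^2))"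
  by (rule slc_PI(2)[OF s t _ cov_quad_bound[OF w] g]) simp
 also have "J (%x. w x*(SUM j<n. (SUM i<n. v i*(if j = i then 1 else 0))^2)) = (SUM i<n. (v i)^2)"
  using dns_one[OF w] by (simp add: if_distrib cong: if_cong)
 also have "J (%x. w x*(?g x - J (%x. w x*?g x))^2) = J (%x. w x*(lin w v x * lin w v x))"
  unfolding m by (intro J_cong) (simp add: lin_def ctr_def power2_eq_square algebra_simps sum_subtractf)
 finally show ?thesis using J_lin2[OF w] by simp
qed

text \<open>Let \<open>T\<close> be the matrix of third moments contracted with \<open>v\<close>,
  and \<open>q\<close> the quadratic form with matrix \<open>T\<close>. The sum of squares
  \<open>N\<close> of \<open>T\<close> is the covariance of \<open>lin w v\<close> and
  \<open>q\<close>. Poincare bounds the variance of \<open>q\<close> through its gradient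
  \<open>2 lin w (T j)\<close>, whose second moment is at most \<open>4 a N\<close>; one factor
  \<open>N\<close> cancels.\<close>

lemma trd_bound:
 assumes s: "slc (%_. t) w" and t: "t > 0" and a: "a >= 0"
  "!!v. (SUM i<n. SUM j<n. v i * v j * cov w i j) <= a*(SUM i<n. (v i)^2)"
 shows "(SUM i<n. SUM k<n. (SUM l<n. v l * trd w l i k)^2) <= 4 * sqrt (a/t) * a*(SUM i<n. SUM j<n. v i * v j * cov w i j)"
proof -
 have w: "dns w" by (rule slc_dns[OF s])
 note [continuous_intros] = dns_cont[OF w]
 define T where "T i k = (SUM l<n. v l * trd w l i k)" for i k
 define N where "N = (SUM i<n. SUM k<n. (T i k)^2)"
 define A where "A = (SUM i<n. SUM j<n. v i * v j * cov w i j)"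
 have N0: "N >= 0" unfolding N_def by (intro sum_nonneg) auto
 have A: "A = J (%x. w x*(lin w v x)^2)"
  unfolding A_def J_lin2[OF w, symmetric] power2_eq_square ..
 have A0: "A >= 0" unfolding A using dns_pos[OF w] by (intro J_nonneg mult_nonneg_nonneg) (auto simp: less_imp_le)
 have Tsym: "T i k = T k i" for i k unfolding T_def by (simp add: trd_sym(1))
 define q where "q x = (SUM i<n. SUM k<n. T i k*(ctr w i x * ctr w k x))" for x
 have cq [continuous_intros]: "continuous_on box (%x. q x)" unfolding q_def by (intro continuous_intros)
 have T: "T i k = J (%x. w x*(lin w v x*(ctr w i x * ctr w k x)))" for i k
  unfolding T_def trd_def
  by (subst J_lin_mult[OF w]) (auto intro!: continuous_intros simp: mult.assoc)
 have N: "N = J (%x. w x*(lin w v x * q x))"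
 proof -
  have "J (%x. w x*(lin w v x * q x)) =
    J (%x. SUM i<n. SUM k<n. T i k*(w x*(lin w v x*(ctr w i x * ctr w k x))))"
   unfolding q_def by (intro J_cong) (simp add: sum_distrib_left mult_ac)
  also have "... = (SUM i<n. SUM k<n. T i k * J (%x. w x*(lin w v x*(ctr w i x * ctr w k x))))"
   by (subst J_sum, intro continuous_intros, subst J_sum) (auto intro!: continuous_intros)
  finally show ?thesis unfolding N_def T[symmetric] power2_eq_square by simp
 qed
 define qb where "qb = J (%x. w x * q x)"
 have lin0: "J (%x. w x * lin w v x) = 0"
  using J_lin_mult[OF w, of "%_. 1" v] J_ctr[OF w] by simp
 have "N = J (%x. w x*(lin w v x*(q x - qb)))"
 proof -
  have "J (%x. w x*(lin w v x*(q x - qb))) = J (%x. w x*(lin w v x * q x) - qb*(w x * lin w v x))"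
   by (intro J_cong) (simp add: algebra_simps)
  also have "... = N - qb*0"
   unfolding lin0[symmetric] N by (subst J_diff) (auto intro!: continuous_intros)
  finally show ?thesis by simp
 qed
 hence "N^2 <= A * J (%x. w x*(q x - qb)^2)"
  unfolding A using dns_pos[OF w] J_cauchy[of "lin w v" "%x. q x - qb" w]
  by (simp add: continuous_intros cont_lin less_imp_le cq)
 also have "... <= A*(sqrt (a/t)*(4 * a * N))"
 proof (rule mult_left_mono[OF _ A0])
  define q1 where "q1 j x = (SUM i<n. SUM k<n. T i k*(((if j = i then 1 else 0) - 0) * ctr w k x + ctr w i x*((if j = k then 1 else 0) - 0)))" for j x
  have "C1 q q1"
   unfolding C1_def
  proof (intro conjI allI impI)
   show "continuous_on box q" using cq by simp
   show "continuous_on box (q1 j)" for j unfolding q1_def[abs_def] by (intro continuous_intros)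
   show "pd j q (q1 j)" for j
    unfolding q_def[abs_def] q1_def[abs_def] ctr_def
    by (intro pd_sum pd_cmult pd_mult pd_diff pd_coord pd_const)
  qed
  from slc_PI(1)[OF s t a this]
  have "J (%x. w x*(q x - qb)^2) <= sqrt (a/t) * J (%x. w x*(SUM j<n. (q1 j x)^2))"
   unfolding qb_def .
  also have "J (%x. w x*(SUM j<n. (q1 j x)^2)) <= 4 * a * N"
  proof -
   have q1: "q1 j x = 2 * lin w (T j) x" if j: "j < n" for j x
   proof -
    have "q1 j x = (SUM i<n. SUM k<n. (if j = i then T j k * ctr w k x else 0) + (if j = k then T i j * ctr w i x else 0))"
     unfolding q1_def by (intro sum.cong refl) auto
    also have "... = (SUM i<n. if j = i then (SUM k<n. T j k * ctr w k x) else 0) + (SUM i<n. T i j * ctr w i x)"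
     unfolding sum.distrib using j by (intro arg_cong2[where f = "(+)"] sum.cong refl) auto
    also have "... = 2 * lin w (T j) x"
     using j unfolding lin_def by (simp add: Tsym[of _ j])
    finally show ?thesis .
   qed
   have "J (%x. w x*(SUM j<n. (q1 j x)^2)) = J (%x. SUM j<n. 4*(w x*(lin w (T j) x * lin w (T j) x)))"
    by (intro J_cong) (simp add: q1 sum_distrib_left power2_eq_square mult_ac)
   also have "... = (SUM j<n. 4*(SUM i<n. SUM k<n. T j i * T j k * cov w i k))"
    by (subst J_sum) (auto intro!: continuous_intros simp: J_lin2[OF w])
   also have "... <= (SUM j<n. 4*(a*(SUM i<n. (T j i)^2)))"
    by (intro sum_mono mult_left_mono a(2)) auto
   finally show ?thesis unfolding N_def by (simp add: sum_distrib_left mult.assoc)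
  qed
  finally show "J (%x. w x*(q x - qb)^2) <= sqrt (a/t)*(4 * a * N)"
   using a(1) t by (simp add: mult_left_mono)
 qed
 finally have "N * N <= (4 * sqrt (a/t) * a * A) * N"
  by (simp add: power2_eq_square mult_ac)
 moreover have "0 <= 4 * sqrt (a/t) * a * A" using a(1) t A0 by simp
 ultimately have "N <= 4 * sqrt (a/t) * a * A"
  using N0 by (cases "N = 0") auto
 thus ?thesis unfolding N_def A_def T_def .
qed

end

context
 fixes n :: nat
begin

section \<open>Traces of powers of symmetric matrices\<close>

definition mm :: "(nat => nat => real) => (nat => nat => real) => nat => nat => real" where
 "mm A B j k = (SUM l<n. A j l * B l k)"

text \<open>Cut off at \<open>n\<close>, as are all matrices in \<open>ss\<close>, so that matrix
  identities hold as equations between functions on all indices.\<close>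

definition idn :: "nat => nat => real" where
 "idn j k = (if j = k & j < n then 1 else 0)"

definition tr :: "(nat => nat => real) => real" where
 "tr A = (SUM j<n. A j j)"

definition ss :: "(nat => nat => real) => bool" where
 "ss A \<longleftrightarrow> (ALL j k. A j k = A k j) & (ALL j k. ~ j < n --> A j k = 0)"

fun mpow :: "(nat => nat => real) => nat => nat => nat => real" where
 "mpow A 0 = idn"
| "mpow A (Suc q) = mm A (mpow A q)"

definition sqn :: "(nat => real) => real" where
 "sqn v = (SUM j<n. (v j)^2)"

definition mv :: "(nat => nat => real) => (nat => real) => nat => real" where
 "mv A v j = (SUM k<n. A j k * v k)"

definition fr :: "(nat => nat => real) => (nat => nat => real) => real" where
 "fr A B = (SUM j<n. SUM k<n. A j k * B j k)"

lemma mm_assoc: "mm (mm A B) C = mm A (mm B C)"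
proof (intro ext)
 fix j k
 have "mm (mm A B) C j k = (SUM l<n. SUM i<n. A j i * B i l * C l k)"
  unfolding mm_def by (simp add: sum_distrib_right)
 also have "... = (SUM i<n. SUM l<n. A j i * B i l * C l k)" by (rule sum.swap)
 finally show "mm (mm A B) C j k = mm A (mm B C) j k"
  unfolding mm_def by (simp add: sum_distrib_left mult.assoc)
qed

lemma tr_comm: "tr (mm A B) = tr (mm B A)"
 unfolding tr_def mm_def by (subst sum.swap) (simp add: mult.commute)

lemma tr_fr: "ss A ==> tr (mm A B) = fr A B"
proof -
 assume "ss A"
 hence "A j k = A k j" for j k unfolding ss_def by blast
 hence "tr (mm A B) = (SUM j<n. SUM l<n. A l j * B l j)"
  unfolding tr_def mm_def by (intro sum.cong refl arg_cong2[where f = "(*)"])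
 also have "... = fr A B" unfolding fr_def by (rule sum.swap)
 finally show ?thesis .
qed

lemma mm_idn: "ss A ==> mm idn A = A" "ss A ==> mm A idn = A"
proof -
 have 1: "mm idn A j k = (if j < n then A j k else 0)" for j k
 proof -
  have "mm idn A j k = (SUM l<n. if l = j then A j k else 0)"
   unfolding mm_def idn_def by (intro sum.cong) auto
  thus ?thesis by simp
 qed
 have 2: "mm A idn j k = (if k < n then A j k else 0)" for j k
 proof -
  have "mm A idn j k = (SUM l<n. if l = k then A j k else 0)"
   unfolding mm_def idn_def by (intro sum.cong) auto
  thus ?thesis by simp
 qed
 show "ss A ==> mm idn A = A" unfolding ss_def by (intro ext) (auto simp: 1)
 show "mm A idn = A" if "ss A"
 proof (intro ext)
  fix j k
  have "A j k = A k j" "~ k < n --> A k j = 0" using that unfolding ss_def by blast+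
  thus "mm A idn j k = A j k" by (simp add: 2)
 qed
qed

lemma ss_mpow_sym:
 assumes "ss B"
 shows "mpow B q j k = mpow B q k j & (~ j < n --> mpow B q j k = 0) & mm B (mpow B q) = mm (mpow B q) B"
proof (induction q arbitrary: j k)
 case 0
 have "mm B idn = mm idn B"
  using assms by (simp add: mm_idn)
 moreover have "idn j k = idn k j" "~ j < n --> idn j k = 0" by (auto simp: idn_def)
 ultimately show ?case by simp
next
 case (Suc q)
 have c: "mm B (mpow B q) = mm (mpow B q) B" using Suc by blast
 have "mm (mpow B q) B j k = mm B (mpow B q) k j" for j k
 proof -
  have s: "mpow B q j l * B l k = B k l * mpow B q l j" for l
   using Suc[of j l] assms unfolding ss_def by simp
  show ?thesis unfolding mm_def s ..
 qed
 moreover have "mm B (mpow B q) j k = 0" if "~ j < n"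
 proof -
  have "B j l = 0" for l using assms that unfolding ss_def by blast
  thus ?thesis unfolding mm_def by simp
 qed
 moreover have "mm B (mm B (mpow B q)) = mm (mm B (mpow B q)) B"
  unfolding mm_assoc unfolding c ..
 moreover have "mm B (mpow B q) j k = mm B (mpow B q) k j"
  using \<open>!!k j. mm (mpow B q) B j k = mm B (mpow B q) k j\<close>[of j k] unfolding c .
 ultimately show ?case by simp
qed

lemma ss_mpow: "ss B ==> ss (mpow B q)"
 using ss_mpow_sym unfolding ss_def by blast

lemma mm_idn_mm: "ss A ==> mm idn (mm A B) = mm A B"
 unfolding mm_assoc[symmetric] by (simp add: mm_idn)

lemma mpow_add: "ss B ==> mm (mpow B a) (mpow B b) = mpow B (a + b)"
proof (induction a)
 case 0
 thus ?case by (simp add: mm_idn ss_mpow)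
qed (simp add: mm_assoc)

lemma mpow_add': "ss B ==> mm (mpow B a) (mm (mpow B b) C) = mm (mpow B (a + b)) C"
 by (simp add: mm_assoc[symmetric] mpow_add)

lemma fr_cauchy: "(fr A B)^2 <= fr A A * fr B B"
proof -
 have e: "fr X Y = (\<Sum>p\<in>{..<n} \<times> {..<n}. (case p of (j, k) => X j k)*(case p of (j, k) => Y j k))" for X Y
  unfolding fr_def by (simp add: sum.cartesian_product split_def)
 show ?thesis
  using Cauchy_Schwarz_ineq_sum[of "%(j, k). A j k" "%(j, k). B j k" "{..<n} \<times> {..<n}"]
  unfolding e power2_eq_square .
qed

lemma fr_nonneg: "0 <= fr A A"
 unfolding fr_def by (intro sum_nonneg) simp

lemma fr_mm_sym:
 assumes "ss A" "ss H" "ss A'" "ss B"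
 shows "fr (mm A H) (mm A' (mm H B)) = tr (mm H (mm A (mm A' (mm H B))))"
proof -
 have "mm A H j k = mm H A k j" for j k
 proof -
  have "A j l * H l k = H k l * A l j" for l
   using assms unfolding ss_def by simp
  thus ?thesis unfolding mm_def by simp
 qed
 thus ?thesis
  unfolding mm_assoc[symmetric, of H A] unfolding fr_def tr_def mm_def[of "mm H A"]
  by (subst sum.swap) simp
qed

lemma fr_sq:
 assumes "ss A" "ss H" "ss B"
 shows "fr (mm A (mm H B)) (mm A (mm H B)) = tr (mm B (mm H (mm A (mm A (mm H B)))))"
proof -
 have "mm A (mm H B) j k = mm B (mm H A) k j" for j k
 proof -
  have "mm A (mm H B) j k = (SUM l<n. SUM i<n. A j l*(H l i * B i k))"
   unfolding mm_def by (simp add: sum_distrib_left)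
  also have "... = (SUM i<n. SUM l<n. A j l*(H l i * B i k))" by (rule sum.swap)
  also have "... = (SUM i<n. SUM l<n. B k i*(H i l * A l j))"
  proof (intro sum.cong refl)
   fix i l
   have "A j l = A l j" "H l i = H i l" "B i k = B k i" using assms unfolding ss_def by blast+
   thus "A j l*(H l i * B i k) = B k i*(H i l * A l j)" by simp
  qed
  also have "... = mm B (mm H A) k j"
   unfolding mm_def by (simp add: sum_distrib_left)
  finally show ?thesis .
 qed
 hence "fr (mm A (mm H B)) (mm A (mm H B)) = tr (mm (mm B (mm H A)) (mm A (mm H B)))"
  unfolding fr_def tr_def mm_def[of "mm B (mm H A)"] by (subst sum.swap) simp
 thus ?thesis by (simp add: mm_assoc)
qed

lemma tr_fr2:
 assumes "ss B" "ss H"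
 shows "tr (mm (mpow B (2 * p)) (mm H H)) = fr (mm (mpow B p) H) (mm (mpow B p) H)"
proof -
 have "fr (mm (mpow B p) (mm H (mpow B 0))) (mm (mpow B p) (mm H (mpow B 0))) = tr (mm H (mm (mpow B p) (mm (mpow B p) H)))"
  using fr_sq[OF ss_mpow[OF assms(1)] assms(2) ss_mpow[OF assms(1)], of p 0] assms by (simp add: mm_idn mm_idn_mm)
 also have "... = tr (mm (mpow B (2 * p)) (mm H H))"
  by (subst tr_comm) (simp add: mm_assoc mpow_add' assms mult_2)
 finally show ?thesis using assms by (simp add: mm_idn)
qed

text \<open>Let \<open>f b\<close> be the trace on the left. Cauchy--Schwarz gives
  \<open>f b ^ 2 <= f 0 * f (2 b)\<close> for \<open>b <= p\<close>, and cyclicity gives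
  \<open>f (2 p - b) = f b\<close>. So the maximum \<open>M\<close> of \<open>f\<close> is attained
  at some \<open>b <= p\<close>, whence \<open>M^2 <= f 0 * M\<close>. No diagonalization is
  used.\<close>

lemma trace_interp:
 assumes B: "ss B" and H: "ss H" and b: "b <= 2 * p"
 shows "tr (mm (mpow B (2 * p - b)) (mm H (mm (mpow B b) H))) <= tr (mm (mpow B (2 * p)) (mm H H))"
  and "0 <= tr (mm (mpow B (2 * p)) (mm H H))"
proof -
 define f where "f b = tr (mm (mpow B (2 * p - b)) (mm H (mm (mpow B b) H)))" for b
 have f0: "f 0 = tr (mm (mpow B (2 * p)) (mm H H))" unfolding f_def by (simp add: mm_idn H)
 \<comment> \<open>The Frobenius product of \<open>B^p H\<close> with \<open>B^(p - b) H B^b\<close>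
   is \<open>f b\<close>; their squared norms are \<open>f 0\<close> and
   \<open>f (2 b)\<close>.\<close>
 have cs: "(f b)^2 <= f 0 * f (2 * b)" if "b <= p" for b
 proof -
  let ?X = "mm (mpow B p) (mm H (mpow B 0))" and ?Y = "mm (mpow B (p - b)) (mm H (mpow B b))"
  have X: "?X = mm (mpow B p) H" using H by (simp add: mm_idn)
  have "fr ?X ?X = tr (mm H (mm (mpow B p) (mm (mpow B p) H)))"
   using fr_sq[OF ss_mpow[OF B] H ss_mpow[OF B], of p 0] H by (simp add: mm_idn mm_idn_mm)
  also have "... = f 0"
   unfolding f0 by (subst tr_comm) (simp add: mm_assoc mpow_add' B mult_2)
  finally have 1: "fr ?X ?X = f 0" .
  have "fr ?Y ?Y = tr (mm (mpow B b) (mm H (mm (mpow B (p - b)) (mm (mpow B (p - b)) (mm H (mpow B b))))))"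
   by (rule fr_sq[OF ss_mpow[OF B] H ss_mpow[OF B]])
  also have "... = tr (mm (mm (mpow B (p - b)) (mm (mpow B (p - b)) (mm H (mpow B b)))) (mm (mpow B b) H))"
   by (subst tr_comm) (simp add: mm_assoc[symmetric])
  also have "... = f (2 * b)"
  proof -
   have e: "p - b + (p - b) = 2 * p - 2 * b" "b + b = 2 * b" by simp_all
   show ?thesis unfolding f_def mm_assoc mpow_add'[OF B] e ..
  qed
  finally have 2: "fr ?Y ?Y = f (2 * b)" .
  have "fr ?X ?Y = tr (mm H (mm (mpow B p) (mm (mpow B (p - b)) (mm H (mpow B b)))))"
   unfolding X by (rule fr_mm_sym[OF ss_mpow[OF B] H ss_mpow[OF B] ss_mpow[OF B]])
  also have "... = f b"
  proof -
   have "p + (p - b) = 2 * p - b" using that by simp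
   thus ?thesis unfolding f_def by (subst tr_comm) (simp add: mm_assoc mpow_add' B)
  qed
  finally have 3: "fr ?X ?Y = f b" .
  show ?thesis using fr_cauchy[of ?X ?Y] unfolding 1 2 3 .
 qed
 show f0': "0 <= tr (mm (mpow B (2 * p)) (mm H H))"
 proof -
  have "0 <= fr (mm (mpow B p) H) (mm (mpow B p) H)" by (rule fr_nonneg)
  thus ?thesis unfolding tr_fr2[OF B H] .
 qed
 have sym: "f (2 * p - b) = f b" if "b <= 2 * p" for b
 proof -
  have "tr (mm X (mm H (mm Y H))) = tr (mm Y (mm H (mm X H)))" for X Y
   using tr_comm[of "mm X H" "mm Y H"] by (simp add: mm_assoc)
  thus ?thesis using that unfolding f_def by simp
 qed
 define M where "M = Max (f ` {..2 * p})"
 have Mle: "f b <= M" if "b <= 2 * p" for b unfolding M_def using that by (intro Max_ge) auto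
 have "M \<in> f ` {..2 * p}" unfolding M_def by (intro Max_in) auto
 then obtain b0 where b0: "b0 <= 2 * p" "M = f b0" by auto
 obtain b1 where b1: "b1 <= p" "M = f b1"
 proof (cases "b0 <= p")
  case False
  thus ?thesis using that[of "2 * p - b0"] sym[OF b0(1)] b0 by simp
 qed (use b0 that in auto)
 have "f b <= f 0"
 proof (cases "M <= 0")
  case True
  thus ?thesis using Mle[OF b] f0' f0 by linarith
 next
  case False
  have "M * M <= f 0 * f (2 * b1)" using cs[OF b1(1)] unfolding b1(2) power2_eq_square .
  also have "... <= f 0 * M" using Mle[of "2 * b1"] b1(1) f0' f0 by (intro mult_left_mono) auto
  finally have "M <= f 0" using False by simp
  thus ?thesis using Mle[OF b] by linarith
 qed
 thus "tr (mm (mpow B (2 * p - b)) (mm H (mm (mpow B b) H))) <= tr (mm (mpow B (2 * p)) (mm H H))"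
  unfolding f0[symmetric] f_def[symmetric] .
qed

text \<open>
 \<open>LL B H q\<close> and \<open>GG B H C q\<close> are the coefficients of \<open>r\<close> and \<open>r^2\<close> in the power
 \<open>(B + r H + r^2 C)^q\<close>.
\<close>

fun LL :: "(nat => nat => real) => (nat => nat => real) => nat => nat => nat => real" where
 "LL B H 0 = (%j k. 0)"
| "LL B H (Suc q) = (%j k. mm B (LL B H q) j k + mm H (mpow B q) j k)"

fun GG :: "(nat => nat => real) => (nat => nat => real) => (nat => nat => real) => nat => nat => nat => real" where
 "GG B H C 0 = (%j k. 0)"
| "GG B H C (Suc q) = (%j k. (mm B (GG B H C q) j k + mm C (mpow B q) j k) + mm H (LL B H q) j k)"

lemma mm_add_right: "mm A (%j k. X j k + Y j k) = (%j k. mm A X j k + mm A Y j k)"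
 unfolding mm_def by (simp add: algebra_simps sum.distrib)

lemma tr_add: "tr (%j k. X j k + Y j k) = tr X + tr Y"
 unfolding tr_def by (simp add: sum.distrib)

lemma mm_zero: "mm A (%j k. 0) = (%j k. 0)" "tr (%j k. 0) = 0"
 unfolding mm_def tr_def by auto

lemma mm_mpow_Suc: "ss B ==> mm (mpow B a) (mm B C) = mm (mpow B (Suc a)) C"
 using ss_mpow_sym[of B a] by (simp add: mm_assoc[symmetric])

text \<open>The extra power \<open>b\<close> makes the induction close: the recursion of
  \<open>LL\<close> moves one factor \<open>B\<close> from \<open>LL\<close> into it, and each
  remaining word with two factors \<open>H\<close> falls under \<open>trace_interp\<close>.\<close>

lemma tr_LL_H:
 assumes B: "ss B" and H: "ss H" and "a + b + q = 2 * p + 1"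
 shows "tr (mm (mpow B a) (mm H (mm (mpow B b) (LL B H q)))) <= q * tr (mm (mpow B (2 * p)) (mm H H))"
 using assms(3)
proof (induction q arbitrary: b)
 case 0
 thus ?case by (simp add: mm_zero)
next
 case (Suc q)
 have "tr (mm (mpow B a) (mm H (mm (mpow B b) (mm H (mpow B q))))) = tr (mm (mpow B (q + a)) (mm H (mm (mpow B b) H)))"
 proof -
  have "mm (mpow B a) (mm H (mm (mpow B b) (mm H (mpow B q)))) = mm (mm (mpow B a) (mm H (mm (mpow B b) H))) (mpow B q)"
   by (simp add: mm_assoc)
  thus ?thesis by (simp add: tr_comm[of _ "mpow B q"] mpow_add' B)
 qed
 also have "q + a = 2 * p - b" using Suc.prems by simp
 also have "tr (mm (mpow B (2 * p - b)) (mm H (mm (mpow B b) H))) <= tr (mm (mpow B (2 * p)) (mm H H))"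
  using Suc.prems by (intro trace_interp B H) simp
 finally have 1: "tr (mm (mpow B a) (mm H (mm (mpow B b) (mm H (mpow B q))))) <= tr (mm (mpow B (2 * p)) (mm H H))" .
 have 2: "tr (mm (mpow B a) (mm H (mm (mpow B b) (mm B (LL B H q))))) <= q * tr (mm (mpow B (2 * p)) (mm H H))"
  using Suc.IH[of "Suc b"] Suc.prems by (simp add: mm_mpow_Suc B del: mpow.simps)
 show ?case using 1 2 by (simp add: mm_add_right tr_add algebra_simps)
qed

text \<open>In the coefficient of \<open>r^2\<close> there are at most \<open>q^2 / 2\<close> words
  with two factors \<open>H\<close>, each bounded by \<open>trace_interp\<close>, and
  \<open>q\<close> words with one factor \<open>C\<close>, all equal to each other by
  cyclicity.\<close>

lemma tr_GG:
 assumes B: "ss B" and H: "ss H" and "a + q = 2 * p + 2" "q > 0"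
 shows "tr (mm (mpow B a) (GG B H C q)) <= q^2/2 * tr (mm (mpow B (2 * p)) (mm H H)) + q * tr (mm (mpow B (2 * p + 1)) C)"
 using assms(3,4)
proof (induction q arbitrary: a)
 case (Suc q)
 let ?f = "tr (mm (mpow B (2 * p)) (mm H H))" and ?c = "tr (mm (mpow B (2 * p + 1)) C)"
 have f0: "0 <= ?f" by (rule trace_interp(2)[OF B H, of 0]) simp
 have 1: "tr (mm (mpow B a) (mm C (mpow B q))) = ?c"
 proof -
  have "q + a = 2 * p + 1" using Suc.prems by simp
  thus ?thesis
   by (subst mm_assoc[symmetric], subst tr_comm) (simp add: mpow_add' B del: mpow.simps)
 qed
 have 2: "tr (mm (mpow B a) (mm H (LL B H q))) <= q*?f"
 proof -
  have "mm H (mm (mpow B 0) (LL B H q)) = mm H (LL B H q)"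
   unfolding mm_assoc[symmetric] using H by (simp add: mm_idn)
  thus ?thesis using tr_LL_H[OF B H, of a 0 q p] Suc.prems by simp
 qed
 show ?case
 proof (cases "q = 0")
  case True
  thus ?thesis using 1 2 f0 by (simp add: tr_add mm_zero)
 next
  case False
  have "tr (mm (mpow B a) (mm B (GG B H C q))) <= q^2/2*?f + q*?c"
   using Suc.IH[of "Suc a"] Suc.prems False by (simp add: mm_mpow_Suc B del: mpow.simps)
  moreover have "(real q)^2/2*?f + q*?f <= (real (Suc q))^2/2*?f"
   using f0 by (simp add: power2_eq_square field_simps)
  ultimately show ?thesis using 1 2 by (simp add: mm_add_right tr_add algebra_simps del: mpow.simps)
 qed
qed simp

lemma tr_even: "ss B ==> tr (mpow B (2 * k)) = fr (mpow B k) (mpow B k)"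
 using tr_fr[OF ss_mpow, of B k "mpow B k"] by (simp add: mpow_add mult_2)

lemma tr_idn_mm: "tr (mm idn A) = tr A"
 unfolding tr_def
proof (intro sum.cong refl)
 fix j assume "j \<in> {..<n}"
 have "mm idn A j j = (SUM l<n. if l = j then A j j else 0)"
  unfolding mm_def idn_def by (intro sum.cong) auto
 with \<open>j \<in> _\<close> show "mm idn A j j = A j j" by simp
qed

lemma tr_log_convex:
 assumes B: "ss B"
 shows "(tr (mpow B (2 * Suc k)))^2 <= tr (mpow B (2 * k)) * tr (mpow B (2 * Suc (Suc k)))"
proof -
 have "fr (mpow B k) (mpow B (Suc (Suc k))) = tr (mpow B (2 * Suc k))"
  using tr_fr[OF ss_mpow[OF B], of k "mpow B (Suc (Suc k))"] mpow_add[OF B, of k "Suc (Suc k)"]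
  by (simp add: mult_2 del: mpow.simps)
 thus ?thesis
  using fr_cauchy[of "mpow B k" "mpow B (Suc (Suc k))"] tr_even[OF B, of k] tr_even[OF B, of "Suc (Suc k)"] by simp
qed

text \<open>The sequence \<open>c k = 16^k tr (B^(2 k))\<close> is log-convex, so a descent from
  \<open>c k\<close> to \<open>c (k + 1)\<close> is possible only if it has been descending since
  \<open>c 0 = n\<close>. Hence \<open>c k\<close> is at most \<open>n\<close> or at most
  \<open>c (k + 1)\<close>.\<close>

lemma tr_interp_low:
 assumes B: "ss B"
 shows "4 ^ (2 * Suc k) * tr (mpow B (2 * k)) <= 16*(n + 4 ^ (2 * Suc k) * tr (mpow B (2 * Suc k)))"
proof -
 define c where "c k = 16 ^ k * tr (mpow B (2 * k))" for k
 have c0: "c k >= 0" for k unfolding c_def tr_even[OF B] using fr_nonneg by simp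
 have lc: "(c (Suc k))^2 <= c k * c (Suc (Suc k))" for k
  using mult_left_mono[OF tr_log_convex[OF B, of k], of "(16 ^ Suc k)^2"] unfolding c_def
  by (simp add: power2_eq_square mult_ac)
 have desc: "c (Suc k) < c k ==> c k <= c 0" for k
 proof (induction k)
  case (Suc k)
  have "c (Suc k) > 0" using Suc.prems c0[of "Suc (Suc k)"] by linarith
  have "c (Suc k) < c k"
  proof (rule ccontr)
   assume "~ c (Suc k) < c k"
   hence "c k * c (Suc (Suc k)) <= c (Suc k) * c (Suc (Suc k))" using c0 by (intro mult_right_mono) auto
   also have "... < c (Suc k) * c (Suc k)" using Suc.prems \<open>c (Suc k) > 0\<close> by simp
   finally show False using lc[of k] by (simp add: power2_eq_square)
  qed
  thus ?case using Suc.IH by simp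
 qed simp
 have "tr idn = n" unfolding tr_def idn_def by simp
 hence "c 0 = n" unfolding c_def by simp
 hence "c k <= n + c (Suc k)" using desc[of k] c0[of "Suc k"] c0[of 0] by (cases "c (Suc k) < c k") auto
 moreover have "(4::real) ^ (2 * Suc k) = 16*16 ^ k" by (simp add: power_mult)
 ultimately show ?thesis unfolding c_def by simp
qed

lemma mv_mm: "mv (mm A B) v = mv A (mv B v)"
proof
 fix j
 have "mv (mm A B) v j = (SUM k<n. SUM l<n. A j l*(B l k * v k))"
  unfolding mv_def mm_def by (simp add: sum_distrib_right mult.assoc)
 also have "... = (SUM l<n. SUM k<n. A j l*(B l k * v k))" by (rule sum.swap)
 finally show "mv (mm A B) v j = mv A (mv B v) j"
  unfolding mv_def by (simp add: sum_distrib_left)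
qed

lemma ip_sym: "ss A ==> (SUM j<n. mv A u j * v j) = (SUM j<n. u j * mv A v j)"
proof -
 assume A: "ss A"
 have "(SUM j<n. mv A u j * v j) = (SUM j<n. SUM k<n. A j k * u k * v j)"
  unfolding mv_def by (simp add: sum_distrib_right)
 also have "... = (SUM k<n. SUM j<n. A j k * u k * v j)" by (rule sum.swap)
 also have "... = (SUM j<n. u j * mv A v j)"
 proof -
  have e: "A j k * u k * v j = u k*(A k j * v j)" for j k
  proof -
   have "A j k = A k j" using A unfolding ss_def by blast
   thus ?thesis by simp
  qed
  show ?thesis unfolding mv_def sum_distrib_left e ..
 qed
 finally show ?thesis .
qed

lemma sqn_nonneg: "0 <= sqn v"
 unfolding sqn_def by (intro sum_nonneg) simp

lemma ip_cauchy: "(SUM j<n. u j * v j)^2 <= sqn u * sqn v"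
 unfolding sqn_def by (rule Cauchy_Schwarz_ineq_sum)

lemma sqn_mv_fr: "sqn (mv A v) <= fr A A * sqn v"
proof -
 have "sqn (mv A v) <= (SUM j<n. (SUM k<n. (A j k)^2) * sqn v)"
  unfolding sqn_def[of "mv A v"] mv_def sqn_def[of v] by (intro sum_mono Cauchy_Schwarz_ineq_sum)
 thus ?thesis unfolding fr_def by (simp add: sum_distrib_right power2_eq_square)
qed

text \<open>With \<open>g k\<close> the squared length of \<open>B^k v\<close>, Cauchy--Schwarz
  gives \<open>g k ^ 2 <= g (2 k) * sqn v\<close>. Repeated doubling reaches the power
  \<open>2^m\<close>, where the Frobenius norm bounds the action on \<open>v\<close>; this is where
  the exponent has to be a power of two.\<close>

lemma op_bound:
 assumes B: "ss B" and \<beta>: "\<beta> >= 0" "tr (mpow B (2 ^ Suc m)) <= \<beta> ^ (2 ^ Suc m)"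
 shows "sqn (mv B v) <= \<beta>^2 * sqn v"
proof -
 define g where "g k = sqn (mv (mpow B k) v)" for k
 have g0: "g k >= 0" for k unfolding g_def by (rule sqn_nonneg)
 have cs: "(g k)^2 <= g (2 * k) * sqn v" for k
 proof -
  have "g k = (SUM j<n. mv (mpow B k) v j * mv (mpow B k) v j)" unfolding g_def sqn_def by (simp add: power2_eq_square)
  also have "... = (SUM j<n. v j * mv (mpow B (2 * k)) v j)"
   by (subst ip_sym[OF ss_mpow[OF B]]) (simp add: mv_mm[symmetric] mpow_add[OF B] mult_2)
  finally show ?thesis
   using ip_cauchy[of v "mv (mpow B (2 * k)) v"] unfolding g_def by (simp add: mult.commute)
 qed
 have "(g 1) ^ (2 ^ i) <= g (2 ^ i)*(sqn v) ^ (2 ^ i - 1)" for i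
 proof (induction i)
  case (Suc i)
  have "(g 1) ^ (2 ^ Suc i) = ((g 1) ^ (2 ^ i))^2" by (simp add: power_mult[symmetric] mult.commute)
  also have "... <= (g (2 ^ i)*(sqn v) ^ (2 ^ i - 1))^2" using Suc g0 by (intro power_mono) auto
  also have "... = (g (2 ^ i))^2*(sqn v) ^ (2*(2 ^ i - 1))" by (simp add: power_mult_distrib power_mult[symmetric] mult.commute)
  also have "... <= (g (2*2 ^ i) * sqn v)*(sqn v) ^ (2*(2 ^ i - 1))"
   using cs by (intro mult_right_mono) auto
  also have "... = g (2 ^ Suc i)*(sqn v) ^ Suc (2*(2 ^ i - 1))" by simp
  also have "Suc (2*(2 ^ i - 1)) = 2 ^ Suc i - 1"
  proof -
   obtain k where "(2::nat) ^ i = Suc k" using not0_implies_Suc[of "2 ^ i"] by auto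
   thus ?thesis by simp
  qed
  finally show ?case .
 qed simp
 from this[of m] have "(g 1) ^ (2 ^ m) <= g (2 ^ m)*(sqn v) ^ (2 ^ m - 1)" .
 also have "... <= (fr (mpow B (2 ^ m)) (mpow B (2 ^ m)) * sqn v)*(sqn v) ^ (2 ^ m - 1)"
  unfolding g_def using sqn_mv_fr sqn_nonneg by (intro mult_right_mono) auto
 also have "... = tr (mpow B (2 ^ Suc m))*(sqn v) ^ (2 ^ m)"
  using tr_even[OF B, of "2 ^ m"] power_minus_mult[of "2 ^ m" "sqn v"] by (simp add: mult_ac)
 also have "... <= \<beta> ^ (2 ^ Suc m)*(sqn v) ^ (2 ^ m)"
  using \<beta> sqn_nonneg by (intro mult_right_mono) auto
 also have "... = (\<beta>^2 * sqn v) ^ (2 ^ m)" by (simp add: power_mult_distrib power_mult)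
 finally have "g 1 <= \<beta>^2 * sqn v"
  by (rule power_mono_iff[THEN iffD1, rotated 3]) (use g0 sqn_nonneg in auto)
 moreover have "mv (mpow B 1) v = mv B v" using B by (simp add: mm_idn)
 ultimately show ?thesis unfolding g_def by simp
qed

end

section \<open>The potential\<close>

context cube
begin

definition Bm :: "((nat => real) => real) => nat => nat => real" where
 "Bm w j k = (if j < n & k < n then cov w j k + - (if j = k then 1 else 0) else 0)"

definition Hm :: "((nat => real) => real) => nat => nat => nat => real" where
 "Hm w i j k = (if j < n & k < n then trd w i j k else 0)"

definition Cm :: "((nat => real) => real) => nat => nat => nat => real" where
 "Cm w i j k = (if j < n & k < n then - (cov w i j * cov w i k) else 0)"

definition Phi :: "nat => ((nat => real) => real) => real" where
 "Phi q w = tr n (mpow n (Bm w) q)"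

text \<open>The factor \<open>4^q\<close> turns the threshold \<open>Phi <= (1/2)^q\<close> into
  \<open>4^q Phi <= 2^q\<close>. The summand \<open>n\<close> is the loss in
  \<open>tr_interp_low\<close>, so that the drift can be bounded by a multiple of \<open>Psi\<close>
  itself.\<close>

definition Psi :: "nat => ((nat => real) => real) => real" where
 "Psi q w = 4 ^ q * Phi q w + n"

lemma ss_Bm: "ss n (Bm w)"
 unfolding ss_def Bm_def by (auto simp: cov_sym)

lemma ss_Hm: "ss n (Hm w i)"
 unfolding ss_def Hm_def by (auto simp: trd_sym(1))

lemma ito_Bm: "ito (%w. Bm w j k) (%i w. Hm w i j k) (%i w. Cm w i j k)"
proof (cases "j < n & k < n")
 case True
 thus ?thesis
  using ito_add[OF ito_cov[of j k] ito_const[of "- (if j = k then 1 else 0)"]]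
  unfolding Bm_def Hm_def Cm_def by simp
next
 case False
 thus ?thesis
  using ito_const[of 0] unfolding Bm_def Hm_def Cm_def by auto
qed

lemma ito_mpow: "ito (%w. mpow n (Bm w) q j k) (%i w. LL n (Bm w) (Hm w i) q j k) (%i w. GG n (Bm w) (Hm w i) (Cm w i) q j k)"
proof (induction q arbitrary: j k)
 case 0
 show ?case using ito_const[of "idn n j k"] by simp
next
 case (Suc q)
 have "ito (%w. SUM l<n. Bm w j l * mpow n (Bm w) q l k)
  (%i w. SUM l<n. Bm w j l * LL n (Bm w) (Hm w i) q l k + Hm w i j l * mpow n (Bm w) q l k)
  (%i w. SUM l<n. (Bm w j l * GG n (Bm w) (Hm w i) (Cm w i) q l k + Cm w i j l * mpow n (Bm w) q l k) + Hm w i j l * LL n (Bm w) (Hm w i) q l k)"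
  by (intro ito_sum ito_mult ito_Bm Suc)
 thus ?case
  by (simp add: mm_def[abs_def] sum.distrib)
qed

lemma ito_Phi: "ito (%w. Phi q w) (%i w. tr n (LL n (Bm w) (Hm w i) q)) (%i w. tr n (GG n (Bm w) (Hm w i) (Cm w i) q))"
 unfolding Phi_def tr_def by (intro ito_sum ito_mpow)

lemma good_op:
 assumes "Phi (2 ^ Suc m) w <= \<beta> ^ (2 ^ Suc m)" "\<beta> >= 0"
 shows "sqn n (mv n (Bm w) v) <= \<beta>^2 * sqn n v"
 using op_bound[OF ss_Bm assms(2) assms(1)[unfolded Phi_def]] .

lemma good_diag:
 assumes "Phi (2 ^ Suc m) w <= \<beta> ^ (2 ^ Suc m)" "\<beta> >= 0" and j: "j < n"
 shows "\<bar>cov w j j - 1\<bar> <= \<beta>"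
proof -
 let ?e = "%k. if k = j then 1 else (0::real)"
 have "sqn n ?e = (SUM k<n. if k = j then 1 else 0)" unfolding sqn_def by (intro sum.cong) auto
 hence e: "sqn n ?e = 1" using j by simp
 have "mv n (Bm w) ?e j = (SUM k<n. if k = j then Bm w j k else 0)" unfolding mv_def by (intro sum.cong) auto
 hence b: "mv n (Bm w) ?e j = cov w j j - 1" using j by (simp add: Bm_def)
 have "(mv n (Bm w) ?e j)^2 <= sqn n (mv n (Bm w) ?e)"
  unfolding sqn_def using j by (intro member_le_sum) auto
 also have "... <= \<beta>^2" using good_op[OF assms(1,2), of ?e] e by simp
 finally show ?thesis unfolding b using assms(2) by (simp add: abs_le_square_iff[symmetric])
qed

lemma cov_quad: "(SUM i<n. SUM j<n. v i * v j * cov w i j) = sqn n v + (SUM i<n. v i * mv n (Bm w) v i)"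
proof -
 have "(SUM i<n. v i * mv n (Bm w) v i) = (SUM i<n. SUM j<n. v i * v j * cov w i j - (if j = i then v i * v j else 0))"
  unfolding mv_def sum_distrib_left by (intro sum.cong refl) (auto simp: Bm_def algebra_simps)
 also have "... = (SUM i<n. SUM j<n. v i * v j * cov w i j) - sqn n v"
  by (simp add: sum_subtractf sqn_def power2_eq_square)
 finally show ?thesis by simp
qed

lemma quad_op:
 assumes "!!v. sqn n (mv n B v) <= \<beta>^2 * sqn n v" "\<beta> >= 0"
 shows "\<bar>SUM i<n. v i * mv n B v i\<bar> <= \<beta> * sqn n v"
proof -
 have "(SUM i<n. v i * mv n B v i)^2 <= sqn n v * sqn n (mv n B v)" by (rule ip_cauchy)
 also have "... <= sqn n v * (\<beta>^2 * sqn n v)" using assms(1) sqn_nonneg by (intro mult_left_mono)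
 also have "... = (\<beta> * sqn n v)^2" by (simp add: power2_eq_square)
 finally have "\<bar>SUM i<n. v i * mv n B v i\<bar> <= \<bar>\<beta> * sqn n v\<bar>" by (simp add: abs_le_square_iff)
 thus ?thesis using assms(2) sqn_nonneg[of n v] by simp
qed

lemma good_quad:
 assumes "Phi (2 ^ Suc m) w <= (1/2) ^ (2 ^ Suc m)"
 shows "(SUM i<n. SUM j<n. v i * v j * cov w i j) <= 3/2 * sqn n v" "1/2 * sqn n v <= (SUM i<n. SUM j<n. v i * v j * cov w i j)"
 using quad_op[OF good_op[OF assms], of v] unfolding cov_quad by auto

text \<open>The weights are optimal when \<open>b\<close> has half the length of \<open>a\<close>:
  they then give the factor \<open>3/2 + 3/4 = (3/2)^2\<close>.\<close>

lemma sqn_add: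
 assumes "!!j. j < n ==> c j = a j + b j"
 shows "sqn n c <= 3/2 * sqn n a + 3 * sqn n b"
proof -
 have "sqn n c <= (SUM j<n. 3/2*(a j)^2 + 3*(b j)^2)"
  unfolding sqn_def
 proof (intro sum_mono)
  fix j assume "j \<in> {..<n}"
  moreover have "0 <= (a j - 2 * b j)^2" by simp
  ultimately show "(c j)^2 <= 3/2*(a j)^2 + 3*(b j)^2" by (simp add: assms power2_eq_square algebra_simps)
 qed
 thus ?thesis unfolding sqn_def by (simp add: sum.distrib sum_distrib_left)
qed

text \<open>With \<open>q = 2 p + 2\<close> everything is reduced to
  \<open>X = tr (B^(2 p))\<close>. The third moments contribute \<open>45/8 q^2 X / sqrt t\<close>,
  the term \<open>- cov cov\<close> at most \<open>9/8 q^2 X / sqrt t\<close>, in total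
  \<open>27/4\<close>. Passing from \<open>4^q X\<close> to \<open>Psi\<close> costs 16, and
  \<open>16 * 27/4 = 108\<close>.\<close>

lemma potential_drift:
 assumes s: "slc (%_. t) w" and t: "t > 0" "t <= 1" and good: "Phi (2 ^ Suc m) w <= (1/2) ^ (2 ^ Suc m)"
 defines "q \<equiv> 2 ^ Suc m :: nat"
 shows "4 ^ q*(SUM i<n. tr n (GG n (Bm w) (Hm w i) (Cm w i) q)) <= 108*(real q)^2/sqrt t * Psi q w"
proof -
 define p :: nat where "p = 2 ^ m - 1"
 have q: "q = 2 * Suc p" unfolding q_def p_def by simp
 define B where "B = Bm w"
 have B: "ss n B" unfolding B_def by (rule ss_Bm)
 define X where "X = tr n (mpow n B (2 * p))"
 have Xfr: "X = fr n (mpow n B p) (mpow n B p)" unfolding X_def by (rule tr_even[OF B])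
 have X0: "X >= 0" unfolding Xfr by (rule fr_nonneg)
 define v where "v l j = mpow n B p l j" for l j
 have Xv: "X = (SUM l<n. sqn n (v l))" unfolding Xfr fr_def sqn_def v_def by (simp add: power2_eq_square)
 have op: "sqn n (mv n B u) <= (1/2)^2 * sqn n u" for u
  unfolding B_def by (rule good_op[OF good]) simp
 have GGle: "tr n (GG n B (Hm w i) (Cm w i) q) <=
   (real q)^2/2 * tr n (mm n (mpow n B (2 * p)) (mm n (Hm w i) (Hm w i))) + q * tr n (mm n (mpow n B (2 * p + 1)) (Cm w i))" for i
  using tr_GG[OF B ss_Hm, of 0 q p w i "Cm w i"] q by (simp add: tr_idn_mm del: GG.simps)
 \<comment> \<open>The rows \<open>v l\<close> of \<open>B^p\<close> serve as test vectors in
   \<open>trd_bound\<close> with \<open>a = 3/2\<close>; the factor 9 is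
   \<open>4 * 3/2 * 3/2\<close>.\<close>
 have H: "(SUM i<n. tr n (mm n (mpow n B (2 * p)) (mm n (Hm w i) (Hm w i)))) <= 9 * sqrt (3/2/t) * X"
 proof -
  have "(SUM i<n. tr n (mm n (mpow n B (2 * p)) (mm n (Hm w i) (Hm w i)))) =
    (SUM i<n. SUM l<n. SUM k<n. (SUM j<n. v l j * trd w j i k)^2)"
  proof (intro sum.cong refl)
   fix i assume i: "i \<in> {..<n}"
   have "mm n (mpow n B p) (Hm w i) l k = (SUM j<n. v l j * trd w j i k)" if "k < n" for l k
    unfolding mm_def v_def using that i by (intro sum.cong refl) (simp add: Hm_def trd_sym(2))
   thus "tr n (mm n (mpow n B (2 * p)) (mm n (Hm w i) (Hm w i))) = (SUM l<n. SUM k<n. (SUM j<n. v l j * trd w j i k)^2)"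
    unfolding tr_fr2[OF B ss_Hm] fr_def power2_eq_square by simp
  qed
  also have "... = (SUM l<n. SUM i<n. SUM k<n. (SUM j<n. v l j * trd w j i k)^2)" by (rule sum.swap)
  also have "... <= (SUM l<n. 4 * sqrt (3/2/t)*(3/2)*(3/2 * sqn n (v l)))"
  proof (intro sum_mono)
   fix l
   have "(SUM i<n. SUM k<n. (SUM j<n. v l j * trd w j i k)^2) <=
     4 * sqrt (3/2/t)*(3/2)*(SUM i<n. SUM j<n. v l i * v l j * cov w i j)"
    using good_quad(1)[OF good] unfolding sqn_def by (intro trd_bound[OF s t(1)]) auto
   also have "... <= 4 * sqrt (3/2/t)*(3/2)*(3/2 * sqn n (v l))"
    using t by (intro mult_left_mono good_quad(1)[OF good]) auto
   finally show "(SUM i<n. SUM k<n. (SUM j<n. v l j * trd w j i k)^2) <= 4 * sqrt (3/2/t)*(3/2)*(3/2 * sqn n (v l))" .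
  qed
  also have "... = 9 * sqrt (3/2/t) * X" unfolding Xv sum_distrib_left by (intro sum.cong refl) simp
  finally show ?thesis .
 qed
 \<comment> \<open>\<open>Cm w i\<close> is minus the rank-one matrix of the \<open>i\<close>-th row
   of the covariance. With \<open>u i\<close> the image of that row under \<open>B^p\<close>, the
   trace is minus the quadratic form of \<open>B\<close> at \<open>u i\<close>, hence at most
   \<open>1/2 sqn (u i)\<close>. The sum of these squares is the squared Frobenius norm of
   \<open>B^p cov = B^p + B^(p + 1)\<close>.\<close>
 have C: "(SUM i<n. tr n (mm n (mpow n B (2 * p + 1)) (Cm w i))) <= 9/8 * X"
 proof -
  define u where "u i j = mv n (mpow n B p) (%k. cov w i k) j" for i j
  have "tr n (mm n (mpow n B (2 * p + 1)) (Cm w i)) <= 1/2 * sqn n (u i)" for i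
  proof -
   let ?a = "%k. cov w i k"
   have "tr n (mm n (mpow n B (2 * p + 1)) (Cm w i)) = (SUM j<n. SUM k<n. - (?a j*(mpow n B (2 * p + 1) j k*?a k)))"
    unfolding tr_def mm_def by (intro sum.cong refl) (simp add: Cm_def)
   also have "... = - (SUM j<n. ?a j * mv n (mpow n B (2 * p + 1)) ?a j)"
    unfolding mv_def by (simp add: sum_distrib_left sum_negf del: mpow.simps)
   also have "mv n (mpow n B (2 * p + 1)) ?a = mv n (mpow n B p) (mv n B (u i))"
   proof -
    have "mpow n B (2 * p + 1) = mm n (mpow n B p) (mm n B (mpow n B p))"
     using mpow_add[OF B, of p "Suc p"] by (simp add: mult_2)
    thus ?thesis unfolding u_def by (simp add: mv_mm)
   qed
   also have "(SUM j<n. ?a j * mv n (mpow n B p) (mv n B (u i)) j) = (SUM j<n. u i j * mv n B (u i) j)"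
    using ip_sym[OF ss_mpow[OF B], of p ?a "mv n B (u i)"] unfolding u_def by simp
   also have "- ... <= 1/2 * sqn n (u i)" using quad_op[OF op, of "u i"] by simp
   finally show ?thesis .
  qed
  hence "(SUM i<n. tr n (mm n (mpow n B (2 * p + 1)) (Cm w i))) <= 1/2*(SUM i<n. sqn n (u i))"
   unfolding sum_distrib_left by (intro sum_mono)
  also have "(SUM i<n. sqn n (u i)) = (SUM j<n. SUM i<n. (u i j)^2)" unfolding sqn_def by (rule sum.swap)
  also have "... = (SUM j<n. sqn n (%i. u i j))" unfolding sqn_def ..
  also have "... <= (SUM j<n. 9/4 * sqn n (v j))"
  proof (intro sum_mono)
   fix j
   have "u i j = v j i + mv n B (v j) i" if i: "i < n" for i
   proof -
    have "u i j = (SUM k<n. v j k * Bm w i k + (if k = i then v j k else 0))"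
     unfolding u_def mv_def v_def using i by (intro sum.cong refl) (auto simp: Bm_def algebra_simps)
    thus ?thesis using i unfolding mv_def B_def by (simp add: sum.distrib mult.commute)
   qed
   hence "sqn n (%i. u i j) <= 3/2 * sqn n (v j) + 3 * sqn n (mv n B (v j))" by (rule sqn_add)
   also have "... <= 9/4 * sqn n (v j)" using op[of "v j"] by (simp add: power2_eq_square)
   finally show "sqn n (%i. u i j) <= 9/4 * sqn n (v j)" .
  qed
  also have "... = 9/4 * X" unfolding Xv by (simp add: sum_distrib_left)
  finally show ?thesis by simp
 qed
 have st: "sqrt t > 0" "sqrt t <= 1" using t by auto
 have q1: "real q >= 1" unfolding q by simp
 have sq: "sqrt (3/2/t) <= 5/4/sqrt t"
 proof -
  have "sqrt (3/2) <= 5/(4::real)" by (rule real_le_lsqrt) (auto simp: power2_eq_square)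
  thus ?thesis unfolding real_sqrt_divide using st by (intro divide_right_mono) auto
 qed
 have "(SUM i<n. tr n (GG n B (Hm w i) (Cm w i) q)) <=
   (real q)^2/2*(SUM i<n. tr n (mm n (mpow n B (2 * p)) (mm n (Hm w i) (Hm w i)))) + q*(SUM i<n. tr n (mm n (mpow n B (2 * p + 1)) (Cm w i)))"
  unfolding sum_distrib_left sum.distrib[symmetric] by (intro sum_mono GGle)
 also have "... <= (real q)^2/2*(9*(5/4/sqrt t) * X) + q*(9/8 * X)"
 proof (intro add_mono mult_left_mono C)
  have "9 * sqrt (3/2/t) * X <= 9*(5/4/sqrt t) * X" using sq X0 by (intro mult_right_mono mult_left_mono) auto
  thus "(SUM i<n. tr n (mm n (mpow n B (2 * p)) (mm n (Hm w i) (Hm w i)))) <= 9*(5/4/sqrt t) * X"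
   using H by linarith
 qed auto
 also have "... <= 27/4*(real q)^2/sqrt t * X"
 proof -
  have "sqrt t <= real q" using q1 st by linarith
  hence "1 <= real q/sqrt t" using st by simp
  hence "real q*1 <= real q*(real q/sqrt t)" by (rule mult_left_mono) simp
  hence "real q * X <= (real q)^2/sqrt t * X" using X0 by (intro mult_right_mono) (auto simp: power2_eq_square)
  hence "9/8*(real q * X) <= 9/8*((real q)^2/sqrt t * X)" by (rule mult_left_mono) simp
  hence "q*(9/8 * X) <= 9/8*((real q)^2/sqrt t * X)" by (simp only: mult.left_commute)
  moreover have "(real q)^2/2*(9*(5/4/sqrt t) * X) = 45/8*((real q)^2/sqrt t * X)" by simp
  ultimately show ?thesis by (simp add: algebra_simps)
 qed
 finally have 1: "(SUM i<n. tr n (GG n B (Hm w i) (Cm w i) q)) <= 27/4*(real q)^2/sqrt t * X" .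
 have "4 ^ q * X <= 16 * Psi q w"
  using tr_interp_low[OF B, of p] unfolding X_def Psi_def Phi_def B_def q by (simp del: mpow.simps)
 hence "27/4*(real q)^2/sqrt t*(4 ^ q * X) <= 27/4*(real q)^2/sqrt t*(16 * Psi q w)"
  using st by (intro mult_left_mono) auto
 moreover have "4 ^ q*(SUM i<n. tr n (GG n B (Hm w i) (Cm w i) q)) <= 4 ^ q*(27/4*(real q)^2/sqrt t * X)"
  using 1 by (intro mult_left_mono) auto
 ultimately show ?thesis unfolding B_def by (simp add: mult_ac)
qed

lemma potential_sweep:
 "EX C>=0. ALL t w d. slc (%_. t) w --> 0 < t --> t <= 1 --> Phi (2 ^ Suc m) w <= (1/2) ^ (2 ^ Suc m) -->
  0 <= d --> rok (sqrt d) -->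
  sw d [0..<n] (Psi (2 ^ Suc m)) w <= (1 + d*(108*(2 ^ Suc m)^2/sqrt t)) * Psi (2 ^ Suc m) w + C*(d * sqrt d)"
proof -
 let ?q = "2 ^ Suc m :: nat"
 obtain C where C: "C >= 0" "!!w d. dns w ==> d >= 0 ==> rok (sqrt d) ==>
  \<bar>sw d [0..<n] (Phi ?q) w - (Phi ?q w + d*(SUM i<n. tr n (GG n (Bm w) (Hm w i) (Cm w i) ?q)))\<bar> <= C*(d * sqrt d)"
  using sweep_ito[OF ito_Phi[of ?q]] by auto
 show ?thesis
 proof (intro exI[of _ "4 ^ ?q * C"] conjI allI impI)
  fix t w d
  assume s: "slc (%_. t) w" and t: "0 < t" "t <= 1" and g: "Phi ?q w <= (1/2) ^ ?q" and d: "0 <= d" "rok (sqrt d)"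
  let ?S = "SUM i<n. tr n (GG n (Bm w) (Hm w i) (Cm w i) ?q)"
  have "sw d [0..<n] (Psi ?q) w = 4 ^ ?q * sw d [0..<n] (Phi ?q) w + n"
   using sw_lin[of d "[0..<n]" "4 ^ ?q" "Phi ?q" 0 "%_. 0" "real n" w] unfolding Psi_def[abs_def] by simp
  also have "... <= 4 ^ ?q*(Phi ?q w + d*?S + C*(d * sqrt d)) + n"
   using C(2)[OF slc_dns[OF s] d] by (intro add_right_mono mult_left_mono) auto
  also have "... = Psi ?q w + d*(4 ^ ?q*?S) + 4 ^ ?q * C*(d * sqrt d)"
   unfolding Psi_def by (simp add: algebra_simps)
  also have "d*(4 ^ ?q*?S) <= d*(108*(real ?q)^2/sqrt t * Psi ?q w)"
   using potential_drift[OF s t g] d by (intro mult_left_mono) auto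
  finally show "sw d [0..<n] (Psi ?q) w <= (1 + d*(108*(2 ^ Suc m)^2/sqrt t)) * Psi ?q w + 4 ^ ?q * C*(d * sqrt d)"
   by (simp add: algebra_simps)
 qed (use C in simp)
qed

end

abbreviation nd :: "real => real measure" where
 "nd t \<equiv> density lborel (%s. ennreal (normal_density 0 (sqrt t) s))"

section \<open>Gaussian measures\<close>

lemma prob_nd: "0 < t ==> prob_space (nd t)"
 by (rule prob_space_normal_density) simp

lemma nd_affine:
 assumes t: "0 < t" and c: "c ~= 0"
 shows "distr (nd t) borel (%z. y + c * z) = density lborel (%x. ennreal (normal_density y (\<bar>c\<bar> * sqrt t) x))"
proof -
 interpret prob_space "nd t" by (rule prob_nd[OF t])
 have "distributed (nd t) lborel (%z. z) (%s. ennreal (normal_density 0 (sqrt t) s))"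
  unfolding distributed_def by (auto simp: distr_id2)
 from normal_density_affine[OF this _ c, of y] t show ?thesis
  unfolding distributed_def by (simp add: distr_cong[OF refl sets_lborel refl])
qed

lemma nd_tilt:
 "density (nd 1) (%y. ennreal (exp (b * y - b\<^sup>2/2))) = density lborel (%x. ennreal (normal_density b 1 x))"
proof -
 have "normal_density 0 (sqrt 1) x * exp (b * x - b\<^sup>2/2) = normal_density b 1 x" for x
 proof -
  have "- (x^2)/2 + (b * x - b\<^sup>2/2) = - ((x - b)^2)/2" by (simp add: power2_eq_square field_simps)
  thus ?thesis unfolding normal_density_def by (simp add: exp_add[symmetric])
 qed
 thus ?thesis by (subst density_density_eq) (auto simp: ennreal_mult[symmetric] simp del: real_sqrt_one)
qed

lemma density_PiM:
 fixes M :: "nat => 'a measure" and g :: "nat => 'a => ennreal"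
 assumes M: "product_sigma_finite M" and I: "finite I"
  and g: "!!i. i \<in> I ==> g i \<in> borel_measurable (M i)" and p: "!!i. prob_space (density (M i) (g i))"
 shows "density (Pi\<^sub>M I M) (%x. \<Prod>i\<in>I. g i (x i)) = Pi\<^sub>M I (%i. density (M i) (g i))" (is "?R = _")
proof -
 interpret M: product_sigma_finite M by fact
 interpret product_sigma_finite "%i. density (M i) (g i)"
  unfolding product_sigma_finite_def using p prob_space_imp_sigma_finite by blast
 have gm: "(%x. \<Prod>i\<in>I. g i (x i)) \<in> borel_measurable (Pi\<^sub>M I M)"
  using g by measurable
 show ?thesis
 proof (rule PiM_eqI)
  fix A assume "!!i. i \<in> I ==> A i \<in> sets (density (M i) (g i))"
  hence A: "!!i. i \<in> I ==> A i \<in> sets (M i)" by simp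
  have P: "Pi\<^sub>E I A \<in> sets (Pi\<^sub>M I M)" using I A by (intro sets_PiM_I_finite) auto
  have "emeasure ?R (Pi\<^sub>E I A) = (nn_integral (Pi\<^sub>M I M) (%x. (\<Prod>i\<in>I. g i (x i)) * indicator (Pi\<^sub>E I A) x))"
   by (rule emeasure_density[OF gm P])
  also have "... = (nn_integral (Pi\<^sub>M I M) (%x. (\<Prod>i\<in>I. g i (x i) * indicator (A i) (x i))))"
  proof (intro nn_integral_cong)
   fix x assume "x \<in> space (Pi\<^sub>M I M)"
   hence "indicator (Pi\<^sub>E I A) x = (\<Prod>i\<in>I. indicator (A i) (x i) :: ennreal)"
    using I by (auto simp: indicator_def space_PiM PiE_iff prod_eq_1_iff)
   thus "(\<Prod>i\<in>I. g i (x i)) * indicator (Pi\<^sub>E I A) x = (\<Prod>i\<in>I. g i (x i) * indicator (A i) (x i))"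
    by (simp add: prod.distrib)
  qed
  also have "... = (\<Prod>i\<in>I. \<integral>\<^sup>+x. g i x * indicator (A i) x \<partial>M i)"
   by (rule M.product_nn_integral_prod[OF I]) (use g A in auto)
  also have "... = (\<Prod>i\<in>I. emeasure (density (M i) (g i)) (A i))"
   using A g by (intro prod.cong refl) (simp add: emeasure_density)
  finally show "emeasure ?R (Pi\<^sub>E I A) = (\<Prod>i\<in>I. emeasure (density (M i) (g i)) (A i))" .
 qed (simp_all add: I cong: sets_PiM_cong)
qed

lemma nd_conv:
 assumes f [measurable]: "f \<in> borel_measurable borel" and st: "0 < s" "0 < t"
 shows "(\<integral>\<^sup>+x. \<integral>\<^sup>+y. f (x + y) \<partial>nd t \<partial>nd s) = (nn_integral (nd (s + t)) (%y. f y))"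
proof -
 interpret s: prob_space "nd s" by (rule prob_nd[OF st(1)])
 interpret t: prob_space "nd t" by (rule prob_nd[OF st(2)])
 have "nd s \<star> nd t = density lborel (%x. \<integral>\<^sup>+y. ennreal (normal_density 0 (sqrt s) (x - y)) * ennreal (normal_density 0 (sqrt t) y) \<partial>lborel)"
  by (rule convolution_density) auto
 also have "... = nd (s + t)"
  using conv_normal_density_zero_mean[of "sqrt s" "sqrt t"] st
  by (simp add: ennreal_mult[symmetric])
 finally have "(nn_integral (nd (s + t)) (%y. f y)) = (nn_integral (nd s \<star> nd t) (%y. f y))" by simp
 also have "... = (\<integral>\<^sup>+x. \<integral>\<^sup>+y. f (x + y) \<partial>nd t \<partial>nd s)"
  by (rule nn_integral_convolution) auto
 finally show ?thesis ..
qed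

lemma nd_exp: "integrable (nd 1) (%y. exp (c * y))"
proof -
 have "(nn_integral (nd 1) (%y. ennreal (exp (c * y)))) = (nn_integral (nd 1) (%y. ennreal (exp (c^2/2))*(ennreal (exp (c * y - c\<^sup>2/2))*1)))"
  by (intro nn_integral_cong) (simp add: ennreal_mult[symmetric] exp_add[symmetric])
 also have "... = ennreal (exp (c^2/2))*(nn_integral (nd 1) (%y. ennreal (exp (c * y - c\<^sup>2/2))*1))"
  by (rule nn_integral_cmult) measurable
 also have "(nn_integral (nd 1) (%y. ennreal (exp (c * y - c\<^sup>2/2))*1)) = emeasure (density (nd 1) (%y. ennreal (exp (c * y - c\<^sup>2/2)))) UNIV"
  by (subst emeasure_density) auto
 also have "... = 1"
  unfolding nd_tilt using prob_space.emeasure_space_1[OF prob_space_normal_density[of 1 c]] by simp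
 finally show ?thesis by (intro integrableI_nonneg) auto
qed

lemma nd_exp_abs: "integrable (nd 1) (%y. exp (c*\<bar>y\<bar>))"
proof (rule Bochner_Integration.integrable_bound)
 show "integrable (nd 1) (%y. exp (c * y) + exp (- c * y))"
  by (intro Bochner_Integration.integrable_add nd_exp)
 show "AE y in nd 1. norm (exp (c*\<bar>y\<bar>)) <= norm (exp (c * y) + exp (- c * y))"
 proof (rule AE_I2)
  fix y
  have "exp (c*\<bar>y\<bar>) <= exp (c * y) + exp (- c * y)"
   by (cases "0 <= y") auto
  also have "... = \<bar>exp (c * y) + exp (- c * y)\<bar>" by (rule abs_of_pos[symmetric]) (intro add_pos_pos exp_gt_zero)
  finally show "norm (exp (c*\<bar>y\<bar>)) <= norm (exp (c * y) + exp (- c * y))" by simp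
 qed
qed measurable

section \<open>Product Gaussian measures: scaling, shifts and convolution\<close>

context
 fixes n :: nat
begin

abbreviation G :: "real => (nat => real) measure" where
 "G t \<equiv> gaussian_Rn n t"

lemma prob_G: "0 < t ==> prob_space (G t)"
 unfolding gaussian_Rn_def by (intro prob_space_PiM prob_nd)

lemma sets_G [measurable_cong]: "sets (G t) = sets (Bn n)"
 unfolding gaussian_Rn_def by (intro sets_PiM_cong) auto

lemma G_prod:
 assumes "0 < t" "!!i. i < n ==> f i \<in> borel_measurable borel"
 shows "(nn_integral (G t) (%x. (PROD i<n. f i (x i)))) = (PROD i<n. \<integral>\<^sup>+y. f i y \<partial>nd t)"
proof -
 interpret prob_space "nd t" by (rule prob_nd[OF assms(1)])
 interpret product_sigma_finite "%_::nat. nd t" by standard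
 show ?thesis unfolding gaussian_Rn_def
  by (rule product_nn_integral_prod) (use assms in auto)
qed

lemma ind_PiE: "indicator (Pi\<^sub>E {..<n} A) (\<lambda>i\<in>{..<n}. y i) = (PROD i<n. indicator (A i) (y i) :: ennreal)"
proof (cases "ALL i<n. y i \<in> A i")
 case True
 hence "(\<lambda>i\<in>{..<n}. y i) \<in> Pi\<^sub>E {..<n} A" by auto
 with True show ?thesis by simp
next
 case False
 then obtain i where i: "i < n" "y i \<notin> A i" by auto
 hence "(\<lambda>i\<in>{..<n}. y i) \<notin> Pi\<^sub>E {..<n} A" by auto
 moreover have "(PROD i<n. indicator (A i) (y i) :: ennreal) = 0" using i by (intro prod_zero bexI[of _ i]) auto
 ultimately show ?thesis by simp
qed

lemma G_affine:
 assumes t: "0 < t" and c: "!!i. c i ~= 0"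
 shows "distr (G t) (Bn n) (%z. \<lambda>i\<in>{..<n}. y i + c i * z i) =
  (\<Pi>\<^sub>M i\<in>{..<n}. density lborel (%x. ennreal (normal_density (y i) (\<bar>c i\<bar> * sqrt t) x)))" (is "?L = Pi\<^sub>M _ ?M")
proof -
 interpret product_sigma_finite ?M
  unfolding product_sigma_finite_def using c t by (auto intro!: prob_space_imp_sigma_finite prob_space_normal_density)
 have m: "(%z. \<lambda>i\<in>{..<n}. y i + c i * z i) \<in> measurable (G t) (Bn n)"
  by (intro measurable_restrict) measurable
 show ?thesis
 proof (rule PiM_eqI)
  fix A assume "!!i. i \<in> {..<n} ==> A i \<in> sets (?M i)"
  hence A [measurable]: "!!i. i < n ==> A i \<in> sets borel" by simp
  have iA: "(%z. indicator (A i) (y i + c i * z) :: ennreal) \<in> borel_measurable borel" if "i < n" for i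
   using borel_measurable_indicator[OF A[OF that]] by (rule measurable_compose[rotated]) simp
  have "emeasure ?L (Pi\<^sub>E {..<n} A) = (nn_integral ?L (%z. indicator (Pi\<^sub>E {..<n} A) z))" by simp
  also have "... = (nn_integral (G t) (%z. (PROD i<n. indicator (A i) (y i + c i * z i))))"
   by (subst nn_integral_distr[OF m]) (auto simp: ind_PiE)
  also have "... = (PROD i<n. \<integral>\<^sup>+z. indicator (A i) (y i + c i * z) \<partial>nd t)"
   by (rule G_prod[OF t iA])
  also have "... = (PROD i<n. emeasure (?M i) (A i))"
  proof (intro prod.cong refl)
   fix i assume "i \<in> {..<n}"
   hence Ai: "A i \<in> sets borel" by simp
   have "(nn_integral (nd t) (%z. indicator (A i) (y i + c i * z))) = (nn_integral (distr (nd t) borel (%z. y i + c i * z)) (%x. indicator (A i) x))"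
    using Ai by (intro nn_integral_distr[symmetric]) auto
   thus "(nn_integral (nd t) (%z. indicator (A i) (y i + c i * z))) = emeasure (?M i) (A i)"
    unfolding nd_affine[OF t c] using Ai by simp
  qed
  finally show "emeasure ?L (Pi\<^sub>E {..<n} A) = (\<Prod>i\<in>{..<n}. emeasure (?M i) (A i))" .
 qed (simp_all cong: sets_PiM_cong)
qed

text \<open>Only the squares of the factors are prescribed, so reflections of single coordinates are
  included with \<open>d = 1\<close>.\<close>

lemma G_scale:
 assumes t: "0 < t" and c: "!!i. (c i)^2 = d" and d: "0 < d"
 shows "distr (G t) (Bn n) (%z. \<lambda>i\<in>{..<n}. c i * z i) = G (d * t)"
proof -
 have "c i ~= 0" for i using c[of i] d by auto
 moreover have "\<bar>c i\<bar> = sqrt d" for i using c[of i] by (metis real_sqrt_abs)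
 ultimately show ?thesis
  using G_affine[OF t, of c "%_. 0"] unfolding gaussian_Rn_def by (simp add: real_sqrt_mult)
qed

text \<open>The Cameron--Martin formula: it moves a translation from the argument of a function into
  a smooth density.\<close>

lemma G_shift:
 "distr (G 1) (Bn n) (%z. \<lambda>i\<in>{..<n}. z i + b i) =
 density (G 1) (%z. PROD i<n. ennreal (exp (b i * z i - (b i)\<^sup>2/2)))"
proof -
 interpret prob_space "nd 1" by (rule prob_nd) simp
 have "product_sigma_finite (%_::nat. nd 1)" by standard
 hence "density (G 1) (%z. PROD i<n. ennreal (exp (b i * z i - (b i)\<^sup>2/2))) =
   (\<Pi>\<^sub>M i\<in>{..<n}. density (nd 1) (%y. ennreal (exp (b i * y - (b i)\<^sup>2/2))))"
  unfolding gaussian_Rn_def by (rule density_PiM) (simp_all add: nd_tilt prob_space_normal_density del: real_sqrt_one)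
 thus ?thesis
  using G_affine[of 1 "%_. 1" b] unfolding nd_tilt by (simp add: add.commute)
qed

lemma G_conv:
 assumes st: "0 < s" "0 < t" and f [measurable]: "f \<in> borel_measurable (Bn n)"
 shows "(\<integral>\<^sup>+x. \<integral>\<^sup>+y. f (\<lambda>i\<in>{..<n}. x i + y i) \<partial>G t \<partial>G s) = (nn_integral (G (s + t)) (%x. f x))"
proof -
 interpret s: prob_space "G s" by (rule prob_G[OF st(1)])
 interpret t: prob_space "G t" by (rule prob_G[OF st(2)])
 interpret nt: prob_space "nd t" by (rule prob_nd[OF st(2)])
 have st': "0 < s + t" using st by simp
 interpret prob_space "nd (s + t)" by (rule prob_nd[OF st'])
 interpret product_sigma_finite "%_::nat. nd (s + t)" by standard
 let ?T = "%(x, y). \<lambda>i\<in>{..<n}. x i + (y i :: real)"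
 have m [measurable]: "?T \<in> measurable (G s \<Otimes>\<^sub>M G t) (Bn n)"
  unfolding split_def by (intro measurable_restrict) measurable
 have "distr (G s \<Otimes>\<^sub>M G t) (Bn n) ?T = G (s + t)"
  unfolding gaussian_Rn_def[of n "s + t"]
 proof (rule PiM_eqI)
  show "sets (distr (G s \<Otimes>\<^sub>M G t) (Bn n) ?T) = sets (\<Pi>\<^sub>M i\<in>{..<n}. nd (s + t))"
   by (simp cong: sets_PiM_cong)
  fix A assume "!!i. i \<in> {..<n} ==> A i \<in> sets (nd (s + t))"
  hence A [measurable]: "!!i. i < n ==> A i \<in> sets borel" by simp
  have P: "Pi\<^sub>E {..<n} A \<in> sets (Bn n)" by (intro sets_PiM_I_finite) auto
  have "emeasure (distr (G s \<Otimes>\<^sub>M G t) (Bn n) ?T) (Pi\<^sub>E {..<n} A) =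
    (nn_integral (distr (G s \<Otimes>\<^sub>M G t) (Bn n) ?T) (%z. indicator (Pi\<^sub>E {..<n} A) z))"
   by simp
  also have "... = (nn_integral (G s \<Otimes>\<^sub>M G t) (%p. indicator (Pi\<^sub>E {..<n} A) (?T p)))"
   by (subst nn_integral_distr[OF m]) auto
  also have "... = (\<integral>\<^sup>+x. \<integral>\<^sup>+y. indicator (Pi\<^sub>E {..<n} A) (?T (x, y)) \<partial>G t \<partial>G s)"
   using P by (subst t.nn_integral_fst[symmetric]) auto
  also have "... = (\<integral>\<^sup>+x. (PROD i<n. \<integral>\<^sup>+v. indicator (A i) (x i + v) \<partial>nd t) \<partial>G s)"
  proof (intro nn_integral_cong)
   fix x
   have "(nn_integral (G t) (%y. indicator (Pi\<^sub>E {..<n} A) (?T (x, y)))) = (nn_integral (G t) (%y. (PROD i<n. indicator (A i) (x i + y i))))"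
    by (simp add: ind_PiE)
   also have "... = (PROD i<n. \<integral>\<^sup>+v. indicator (A i) (x i + v) \<partial>nd t)"
    using A by (intro G_prod[OF st(2), of "%i v. indicator (A i) (x i + v)"]) measurable
   finally show "(nn_integral (G t) (%y. indicator (Pi\<^sub>E {..<n} A) (?T (x, y)))) = (PROD i<n. \<integral>\<^sup>+v. indicator (A i) (x i + v) \<partial>nd t)" .
  qed
  also have "... = (PROD i<n. \<integral>\<^sup>+u. \<integral>\<^sup>+v. indicator (A i) (u + v) \<partial>nd t \<partial>nd s)"
   using A by (intro G_prod[OF st(1), of "%i u. \<integral>\<^sup>+v. indicator (A i) (u + v) \<partial>nd t"]) measurable
  also have "... = (PROD i<n. emeasure (nd (s + t)) (A i))"
   by (intro prod.cong refl) (simp add: nd_conv[OF _ st])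
  finally show "emeasure (distr (G s \<Otimes>\<^sub>M G t) (Bn n) ?T) (Pi\<^sub>E {..<n} A) = (\<Prod>i\<in>{..<n}. emeasure (nd (s + t)) (A i))" .
 qed simp
 hence "(nn_integral (G (s + t)) (%x. f x)) = (nn_integral (G s \<Otimes>\<^sub>M G t) (%p. f (?T p)))"
  using nn_integral_distr[OF m, of f] by simp
 also have "... = (\<integral>\<^sup>+x. \<integral>\<^sup>+y. f (?T (x, y)) \<partial>G t \<partial>G s)"
  by (subst t.nn_integral_fst[symmetric]) auto
 finally show ?thesis by simp
qed

lemma G_exp_abs: "integrable (G 1) (%z. exp (c*(SUM i<n. \<bar>z i\<bar>)))"
proof -
 interpret prob_space "nd 1" by (rule prob_nd) simp
 interpret product_sigma_finite "%_::nat. nd 1" by standard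
 have "integrable (G 1) (%z. PROD i<n. exp (c*\<bar>z i\<bar>))"
  unfolding gaussian_Rn_def by (rule product_integrable_prod) (simp, rule nd_exp_abs)
 thus ?thesis by (simp add: exp_sum sum_distrib_left)
qed

end

text \<open>Expansion of the Cameron--Martin density in the length \<open>\<beta>\<close> of the
  shift \<open>b\<close>: \<open>u\<close> stands for \<open>b . z\<close>, \<open>v\<close> for
  \<open>|b|^2\<close> and \<open>S\<close> for the l1 norm of \<open>z\<close>. Since
  \<open>v\<close> is already of second order, \<open>u v\<close> and \<open>v^2\<close> join the
  cubic remainder.\<close>

lemma exp_shift_expansion:
 fixes u v \<beta> S :: real
 assumes u: "\<bar>u\<bar> <= \<beta> * S" and v: "0 <= v" "v <= \<beta>^2" and \<beta>: "0 <= \<beta>" "\<beta> <= 1" and S: "0 <= S"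
 shows "\<bar>exp (u - v/2) - (1 + u + (u^2 - v)/2)\<bar> <= 4*\<beta> ^ 3 * exp (2 * S)"
proof -
 define r where "r = u - v/2"
 obtain t where t: "\<bar>t\<bar> <= \<bar>r\<bar>" "exp r = (SUM m<3. r ^ m/fact m) + exp t/fact 3 * r ^ 3"
  using Maclaurin_exp_le[of r 3] by blast
 have T: "exp r = 1 + r + r^2/2 + exp t/6 * r ^ 3"
  using t(2) by (simp add: numeral_eq_Suc)
 have \<beta>2: "\<beta>^2 <= \<beta>" using \<beta> by (simp add: power2_eq_square mult_left_le)
 have rb: "\<bar>r\<bar> <= \<beta>*(S + 1/2)"
  using u v \<beta>2 unfolding r_def by (simp add: abs_le_iff algebra_simps)
 also have "... <= 1*(S + 1/2)" using \<beta> S by (intro mult_right_mono) auto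
 finally have r1: "\<bar>r\<bar> <= S + 1/2" by simp
 have cube: "(S + 1/2) ^ 3 <= 6 * exp (S + 1/2)"
 proof -
  obtain t' where "exp (S + 1/2) = (SUM m<4. (S + 1/2) ^ m/fact m) + exp t'/fact 4*(S + 1/2) ^ 4"
   using Maclaurin_exp_le[of "S + 1/2" 4] by blast
  moreover have "0 <= exp t'/fact 4*(S + 1/2) ^ 4" by simp
  moreover have "(S + 1/2) ^ 3/6 <= (SUM m<4. (S + 1/2) ^ m/fact m)"
   using S by (simp add: numeral_eq_Suc)
  ultimately have "(S + 1/2) ^ 3/6 <= exp (S + 1/2)" by linarith
  thus ?thesis by simp
 qed
 have e1: "exp 1 <= (3::real)" using exp_le by simp
 have R: "\<bar>exp t/6 * r ^ 3\<bar> <= \<beta> ^ 3*(3 * exp (2 * S))"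
 proof -
  have "\<bar>exp t/6 * r ^ 3\<bar> = exp t/6*\<bar>r\<bar> ^ 3" by (simp add: abs_mult power_abs)
  also have "... <= exp (S + 1/2)/6*(\<beta>*(S + 1/2)) ^ 3"
   using rb r1 t(1) by (intro mult_mono power_mono) auto
  also have "... = \<beta> ^ 3*(exp (S + 1/2)/6*(S + 1/2) ^ 3)" by (simp add: power_mult_distrib)
  also have "... <= \<beta> ^ 3*(exp (S + 1/2)/6*(6 * exp (S + 1/2)))"
   using cube \<beta> by (intro mult_left_mono) auto
  also have "exp (S + 1/2)/6*(6 * exp (S + 1/2)) = exp 1 * exp (2 * S)"
   by (simp add: exp_add[symmetric])
  also have "\<beta> ^ 3*(exp 1 * exp (2 * S)) <= \<beta> ^ 3*(3 * exp (2 * S))"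
   using e1 \<beta> by (intro mult_left_mono mult_right_mono) auto
  finally show ?thesis .
 qed
 have S1: "S + 1 <= exp (2 * S)" using exp_ge_add_one_self[of "2 * S"] S by linarith
 have uv: "\<bar>u * v\<bar> <= \<beta> ^ 3 * S"
 proof -
  have "\<bar>u * v\<bar> <= (\<beta> * S)*\<beta>^2" unfolding abs_mult using u v \<beta> S by (intro mult_mono) auto
  thus ?thesis by (simp add: power2_eq_square power3_eq_cube mult_ac)
 qed
 have vv: "v^2 <= \<beta> ^ 3"
 proof -
  have "v^2 <= \<beta>^2*\<beta>" unfolding power2_eq_square[of v] using v \<beta> \<beta>2 by (intro mult_mono) auto
  thus ?thesis by (simp add: power2_eq_square power3_eq_cube)
 qed
 have b3: "0 <= \<beta> ^ 3" using \<beta> by simp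
 have "exp (u - v/2) - (1 + u + (u^2 - v)/2) = exp t/6 * r ^ 3 - u * v/2 + v^2/8"
  using T unfolding r_def by (simp add: power2_eq_square field_simps)
 also have "\<bar>...\<bar> <= \<beta> ^ 3*(3 * exp (2 * S)) + \<beta> ^ 3 * S/2 + \<beta> ^ 3/8"
  using R uv vv zero_le_power2[of v] by linarith
 also have "... = \<beta> ^ 3*(3 * exp (2 * S) + S/2 + 1/8)" by (simp add: algebra_simps)
 also have "... <= \<beta> ^ 3*(4 * exp (2 * S))" using S1 S b3 by (intro mult_left_mono) auto
 finally show ?thesis by (simp add: mult_ac)
qed

lemma measurable_id_borel:
 "(%x. x) \<in> measurable (Bn n) (borel :: (nat => real) measure)"
proof -
 have "(%x. x) \<in> measurable (Bn n) (\<Pi>\<^sub>M i\<in>UNIV. borel :: real measure)"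
 proof (rule measurable_PiM_single')
  fix i :: nat
  show "(%x. x i) \<in> measurable (Bn n) (borel :: real measure)"
  proof (cases "i < n")
   case True
   thus ?thesis by simp
  next
   case False
   hence "!!x. (x :: nat => real) \<in> space (Bn n) ==> x i = undefined"
    by (auto simp: space_PiM PiE_iff extensional_def)
   hence "(%x. x i) \<in> measurable (Bn n) (borel :: real measure) \<longleftrightarrow>
     (%x. undefined :: real) \<in> measurable (Bn n) (borel :: real measure)"
    by (rule measurable_cong)
   thus ?thesis by simp
  qed
 qed auto
 thus ?thesis
  using measurable_cong_sets[OF refl sets_PiM_equal_borel] by blast
qed

lemma measure_G [simp]: "0 < t ==> measure (G n t) (space (G n t)) = 1"
 by (rule prob_space.prob_space[OF prob_G])

lemma int_abs_le:
 fixes f g :: "'a => real"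
 assumes "integrable M f" "integrable M g" "!!x. \<bar>f x\<bar> <= g x"
 shows "\<bar>\<integral>x. f x \<partial>M\<bar> <= (LINT x|M. g x)"
 by (rule order_trans[OF integral_abs_bound integral_mono]) (use assms in auto)

section \<open>Gauge functions and their heat flow\<close>

text \<open>The function is carried over to all of \<open>nat => real\<close> and depends on the
  first \<open>n\<close> coordinates only, so that sums and multiples need no restriction.\<close>

locale gauge =
 fixes n :: nat and N :: "(nat => real) => real"
 assumes N_nonneg: "0 <= N x"
  and N_add: "N (%i. x i + y i) <= N x + N y"
  and N_scale: "0 <= c ==> N (%i. c * x i) = c * N x"
  and N_cong: "(!!i. i < n ==> x i = y i) ==> N x = N y"
begin

definition eb :: "nat => nat => real" where "eb i j = (if j = i then 1 else 0)"

text \<open>A Lipschitz constant of \<open>N\<close> with respect to the l1 norm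
  \<open>ab\<close>.\<close>

definition m :: real where "m = (SUM i<n. N (eb i) + N (%j. - eb i j))"

definition ab :: "(nat => real) => real" where "ab x = (SUM i<n. \<bar>x i\<bar>)"

lemma ab_nonneg: "0 <= ab x" unfolding ab_def by (intro sum_nonneg) simp

lemma m_nonneg: "0 <= m" unfolding m_def by (intro sum_nonneg add_nonneg_nonneg N_nonneg)

lemma N_le: "N x <= m * ab x"
proof -
 have "N (%j. if j < k then x j else 0) <= (SUM i<k. (N (eb i) + N (%j. - eb i j))*\<bar>x i\<bar>)" for k
 proof (induction k)
  case 0
  thus ?case using N_scale[of 0 "%_. 0"] by simp
 next
  case (Suc k)
  have "N (%j. x k * eb k j) <= (N (eb k) + N (%j. - eb k j))*\<bar>x k\<bar>"
  proof (cases "0 <= x k")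
   case True
   thus ?thesis using N_scale[OF True, of "eb k"] N_nonneg[of "%j. - eb k j"] by (simp add: algebra_simps)
  next
   case False
   have "N (%j. x k * eb k j) = N (%j. (- x k)*(- eb k j))" by simp
   also have "... = (- x k) * N (%j. - eb k j)" using False by (intro N_scale) simp
   finally show ?thesis using False N_nonneg[of "eb k"] by (simp add: algebra_simps mult_nonpos_nonneg)
  qed
  moreover have "(%j. if j < Suc k then x j else 0) = (%j. (if j < k then x j else 0) + x k * eb k j)"
   by (auto simp: eb_def less_Suc_eq)
  ultimately show ?case using Suc N_add[of "%j. if j < k then x j else 0" "%j. x k * eb k j"] by simp
 qed
 from this[of n] have "N x <= (SUM i<n. (N (eb i) + N (%j. - eb i j))*\<bar>x i\<bar>)"
  using N_cong[of x "%j. if j < n then x j else 0"] by simp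
 also have "... <= (SUM i<n. m*\<bar>x i\<bar>)"
  unfolding m_def
  by (intro sum_mono mult_right_mono member_le_sum) (auto intro!: add_nonneg_nonneg N_nonneg)
 finally show ?thesis unfolding ab_def by (simp add: sum_distrib_left)
qed

lemma N_lip: "\<bar>N x - N y\<bar> <= m * ab (%i. x i - y i)"
proof -
 have "N x <= N y + N (%i. x i - y i)" "N y <= N x + N (%i. y i - x i)"
  using N_add[of y "%i. x i - y i"] N_add[of x "%i. y i - x i"] by simp_all
 moreover have "ab (%i. y i - x i) = ab (%i. x i - y i)" unfolding ab_def by (simp add: abs_minus_commute)
 ultimately show ?thesis using N_le[of "%i. x i - y i"] N_le[of "%i. y i - x i"] by (simp add: abs_le_iff)
qed

lemma N_cont: "continuous_on A N"
proof -
 have "(N \<longlongrightarrow> N a) (at a)" for a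
 proof -
  have c: "continuous_on UNIV (%x :: nat => real. x i)" for i
   by (rule continuous_on_product_coordinates)
  have "continuous_on UNIV (%x :: nat => real. m * ab (%i. x i - a i))"
   unfolding ab_def by (intro continuous_intros c)
  hence "((%x. m * ab (%i. x i - a i)) \<longlongrightarrow> m * ab (%i. a i - a i)) (at a)"
   unfolding continuous_on_def by (rule bspec) simp
  hence "((%x. m * ab (%i. x i - a i)) \<longlongrightarrow> 0) (at a)" by (simp add: ab_def)
  moreover have "\<forall>\<^sub>F x in at a. norm (N x - N a) <= m * ab (%i. x i - a i)"
   using N_lip by (intro always_eventually) simp
  ultimately have "((%x. N x - N a) \<longlongrightarrow> 0) (at a)" by (rule Lim_null_comparison[rotated])
  thus ?thesis by (simp add: LIM_zero_iff)
 qed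
 thus ?thesis unfolding continuous_on_def by (auto intro: tendsto_within_subset)
qed

lemma N_meas [measurable]: "N \<in> borel_measurable (Bn n)"
proof -
 have "N \<in> borel_measurable borel" by (rule borel_measurable_continuous_onI[OF N_cont])
 from measurable_compose[OF measurable_id_borel this] show ?thesis .
qed

lemma restrict_meas:
 assumes "!!i. i < n ==> f i \<in> borel_measurable M"
 shows "(%z. \<lambda>i\<in>{..<n}. f i z) \<in> measurable M (Bn n)"
 using assms by (intro measurable_restrict) auto

lemma N_restrict: "N (\<lambda>i\<in>{..<n}. x i) = N x"
 by (rule N_cong) simp

lemma N_shift_meas:
 assumes "!!i. i < n ==> f i \<in> borel_measurable M"
 shows "(%z. N (%i. f i z)) \<in> borel_measurable M"
proof -
 have "(%z. N (\<lambda>i\<in>{..<n}. f i z)) \<in> borel_measurable M"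
  by (rule measurable_compose[OF restrict_meas N_meas]) (rule assms)
 thus ?thesis unfolding N_restrict .
qed

lemma G_coord [measurable]: "i < n ==> (%z. z i) \<in> borel_measurable (G n t)"
 using measurable_component_singleton[of i "{..<n}" "%_. borel :: real measure"]
  measurable_cong_sets[OF sets_G[of n t] refl, of borel] by simp

definition sh :: "real => (nat => real) => (nat => real) => real" where
 "sh s x z = N (%i. x i + sqrt s * z i)"

definition U :: "real => (nat => real) => real" where
 "U s x = (LINT z|G n 1. sh s x z)"

definition E :: "real => real" where
 "E c = (LINT z|G n 1. exp (c * ab z))"

definition gN :: real where
 "gN = (LINT z|G n 1. N z)"

lemma sh_meas [measurable]: "(%z. sh s x z) \<in> borel_measurable (G n t)"
 unfolding sh_def by (intro N_shift_meas) measurable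

lemma exp_ab_int: "integrable (G n 1) (%z. exp (c * ab z))"
 unfolding ab_def by (rule G_exp_abs)

lemma E_nonneg: "0 <= E c" unfolding E_def by (intro Bochner_Integration.integral_nonneg) simp

lemma sh_nonneg: "0 <= sh s x z" unfolding sh_def by (rule N_nonneg)

lemma ab_exp: "ab z <= exp (ab z)" "1 <= exp (ab z)"
 using exp_ge_add_one_self[of "ab z"] ab_nonneg[of z] by linarith+

lemma sh_le: "0 <= s ==> sh s x z <= N x + sqrt s * m * ab z"
proof -
 assume s: "0 <= s"
 have "sh s x z <= N x + N (%i. sqrt s * z i)" unfolding sh_def by (rule N_add)
 also have "N (%i. sqrt s * z i) = sqrt s * N z" using s by (intro N_scale) simp
 also have "... <= sqrt s*(m * ab z)" using s N_le by (intro mult_left_mono) auto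
 finally show ?thesis by simp
qed

lemma sh_le_exp: "0 <= s ==> sh s x z <= (N x + sqrt s * m) * exp (ab z)"
proof -
 assume s: "0 <= s"
 have "N x*1 <= N x * exp (ab z)" using N_nonneg ab_exp by (intro mult_left_mono) auto
 moreover have "(sqrt s * m) * ab z <= (sqrt s * m) * exp (ab z)"
  using ab_exp m_nonneg s by (intro mult_left_mono) auto
 ultimately show ?thesis using sh_le[OF s, of x z] by (simp add: algebra_simps)
qed

lemma sh_prod_int:
 assumes s: "0 <= s" and f [measurable]: "f \<in> borel_measurable (G n 1)"
  and b: "!!z. \<bar>f z\<bar> <= C * exp (c * ab z)"
 shows "integrable (G n 1) (%z. sh s x z * f z)"
  "\<bar>\<integral>z. sh s x z * f z \<partial>G n 1\<bar> <= (N x + sqrt s * m) * C * E (c + 1)"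
proof -
 have b': "norm (sh s x z * f z) <= (N x + sqrt s * m) * C * exp ((c + 1) * ab z)" for z
 proof -
  have "\<bar>sh s x z\<bar>*\<bar>f z\<bar> <= ((N x + sqrt s * m) * exp (ab z))*(C * exp (c * ab z))"
   using sh_le_exp[OF s] sh_nonneg N_nonneg m_nonneg s by (intro mult_mono b) auto
  also have "... = (N x + sqrt s * m) * C*(exp (ab z) * exp (c * ab z))" by simp
  also have "exp (ab z) * exp (c * ab z) = exp ((c + 1) * ab z)" by (simp add: exp_add[symmetric] algebra_simps)
  finally show ?thesis by (simp add: abs_mult)
 qed
 have int: "integrable (G n 1) (%z. (N x + sqrt s * m) * C * exp ((c + 1) * ab z))"
  by (intro integrable_mult_right exp_ab_int)
 show "integrable (G n 1) (%z. sh s x z * f z)"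
  by (rule Bochner_Integration.integrable_bound[OF int])
   ((measurable)[1], rule AE_I2, rule order_trans[OF b'], simp)
 have "\<bar>\<integral>z. sh s x z * f z \<partial>G n 1\<bar> <= (LINT z|G n 1. (N x + sqrt s * m) * C * exp ((c + 1) * ab z))"
  by (rule int_abs_le) (use \<open>integrable _ (%z. sh s x z * f z)\<close> int b' in auto)
 thus "\<bar>\<integral>z. sh s x z * f z \<partial>G n 1\<bar> <= (N x + sqrt s * m) * C * E (c + 1)"
  unfolding E_def by simp
qed

lemma sh_int: "0 <= s ==> integrable (G n 1) (%z. sh s x z)"
 using sh_prod_int(1)[of s "%_. 1" 1 0 x] by simp

lemma N_int: "integrable (G n 1) (%z. N z)"
 using sh_int[of 1 "%_. 0"] unfolding sh_def by simp

lemma one_int: "(LINT z|G n 1. c) = (c :: real)" "integrable (G n 1) (%_. c)"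
proof -
 interpret prob_space "G n 1" by (rule prob_G) simp
 show "(LINT z|G n 1. c) = c" "integrable (G n 1) (%_. c)" by auto
qed

lemma gN_nonneg: "0 <= gN"
 unfolding gN_def by (intro Bochner_Integration.integral_nonneg N_nonneg)

lemma U_le: "0 <= s ==> U s x <= N x + sqrt s * gN"
proof -
 assume s: "0 <= s"
 have "U s x <= (LINT z|G n 1. N x + sqrt s * N z)"
  unfolding U_def
 proof (rule integral_mono[OF sh_int[OF s]])
  show "integrable (G n 1) (%z. N x + sqrt s * N z)"
   by (intro Bochner_Integration.integrable_add one_int integrable_mult_right N_int)
  show "sh s x z <= N x + sqrt s * N z" for z
   using N_add[of x "%i. sqrt s * z i"] N_scale[of "sqrt s" z] s unfolding sh_def by simp
 qed
 also have "... = N x + sqrt s * gN"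
  by (subst Bochner_Integration.integral_add) (auto simp: one_int gN_def intro: N_int)
 finally show ?thesis .
qed

lemma U_lip: "0 <= s ==> \<bar>U s x - U s y\<bar> <= m * ab (%i. x i - y i)"
proof -
 assume s: "0 <= s"
 have "\<bar>U s x - U s y\<bar> = \<bar>\<integral>z. sh s x z - sh s y z \<partial>G n 1\<bar>"
  unfolding U_def by (subst Bochner_Integration.integral_diff) (auto intro: sh_int s)
 also have "... <= (LINT z|G n 1. m * ab (%i. x i - y i))"
 proof (rule int_abs_le)
  show "\<bar>sh s x z - sh s y z\<bar> <= m * ab (%i. x i - y i)" for z
   using N_lip[of "%i. x i + sqrt s * z i" "%i. y i + sqrt s * z i"] unfolding sh_def by simp
 qed (auto intro: sh_int s one_int Bochner_Integration.integrable_diff)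
 finally show ?thesis by simp
qed

lemma U_sym: "(LINT z|G n 1. sh s x (%i. - z i)) = U s x"
proof -
 have m: "(%z. \<lambda>i\<in>{..<n}. - 1 * z i) \<in> measurable (G n 1) (Bn n)"
  by (intro restrict_meas) measurable
 have s: "(%z. sh s x z) \<in> borel_measurable (Bn n)"
  by simp
 have "U s x = (LINT z|distr (G n 1) (Bn n) (%z. \<lambda>i\<in>{..<n}. - 1 * z i). sh s x z)"
  unfolding U_def using G_scale[of 1 "%_. -1" 1 n] by simp
 also have "... = (LINT z|G n 1. sh s x (\<lambda>i\<in>{..<n}. - 1 * z i))"
  by (rule integral_distr[OF m s])
 also have "... = (LINT z|G n 1. sh s x (%i. - z i))"
  unfolding sh_def by (intro Bochner_Integration.integral_cong refl N_cong) simp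
 finally show ?thesis ..
qed

lemma sh_neg_int: "0 <= s ==> integrable (G n 1) (%z. sh s x (%i. - z i))"
proof (rule Bochner_Integration.integrable_bound[OF integrable_mult_right[OF exp_ab_int[of 1]], of _ "N x + sqrt s * m"])
 assume s: "0 <= s"
 show "(%z. sh s x (%i. - z i)) \<in> borel_measurable (G n 1)"
  unfolding sh_def by (intro N_shift_meas) measurable
 have "ab (%i. - z i) = ab z" for z unfolding ab_def by simp
 thus "AE z in G n 1. norm (sh s x (%i. - z i)) <= norm ((N x + sqrt s * m) * exp (1 * ab z))"
  using sh_le_exp[OF s, of x "%i. - _ i"] sh_nonneg by (intro AE_I2) (simp add: order_trans[OF _ abs_ge_self])
qed

text \<open>Jensen for a symmetric law: the contributions of \<open>z\<close> and \<open>- z\<close>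
  are paired, and subadditivity is applied to their sum.\<close>

lemma U_ge: "0 <= s ==> N x <= U s x"
proof -
 assume s: "0 <= s"
 have "(LINT z|G n 1. 2 * N x) <= (LINT z|G n 1. sh s x z + sh s x (%i. - z i))"
 proof (rule integral_mono)
  show "2 * N x <= sh s x z + sh s x (%i. - z i)" for z
   using N_add[of "%i. x i + sqrt s * z i" "%i. x i + sqrt s * - z i"] N_scale[of 2 x]
   unfolding sh_def by simp
 qed (intro Bochner_Integration.integrable_add one_int sh_int sh_neg_int s)+
 also have "... = 2 * U s x"
  by (subst Bochner_Integration.integral_add) (auto simp: U_sym U_def[symmetric] intro: sh_int sh_neg_int s)
 finally show ?thesis by simp
qed

lemma U_midpoint: "0 <= s ==> 2 * U s x <= U s (%i. x i + h i) + U s (%i. x i - h i)"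
proof -
 assume s: "0 <= s"
 have "(LINT z|G n 1. 2 * sh s x z) <= (LINT z|G n 1. sh s (%i. x i + h i) z + sh s (%i. x i - h i) z)"
 proof (rule integral_mono)
  show "2 * sh s x z <= sh s (%i. x i + h i) z + sh s (%i. x i - h i) z" for z
  proof -
   have "2 * N (%i. x i + sqrt s * z i) = N (%i. 2*(x i + sqrt s * z i))" by (rule N_scale[symmetric]) simp
   also have "... = N (%i. (x i + h i + sqrt s * z i) + (x i - h i + sqrt s * z i))" by (rule N_cong) simp
   also have "... <= N (%i. x i + h i + sqrt s * z i) + N (%i. x i - h i + sqrt s * z i)" by (rule N_add)
   finally show ?thesis unfolding sh_def .
  qed
 qed (auto intro: sh_int s)
 also have "... = U s (%i. x i + h i) + U s (%i. x i - h i)"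
  unfolding U_def by (rule Bochner_Integration.integral_add) (auto intro: sh_int s)
 finally show ?thesis unfolding U_def by simp
qed

text \<open>The source of all smoothness of \<open>U s\<close>: \<open>N\<close> is merely
  Lipschitz, but after the shift the displacement \<open>h\<close> occurs only in an exponential
  density.\<close>

lemma U_shift:
 assumes s: "0 < s"
 shows "U s (%i. x i + h i) = (LINT z|G n 1. sh s x z * exp ((SUM i<n. h i/sqrt s * z i) - (SUM i<n. (h i/sqrt s)^2)/2))"
proof -
 define b where "b i = h i/sqrt s" for i
 have m: "(%z. \<lambda>i\<in>{..<n}. z i + b i) \<in> measurable (G n 1) (Bn n)"
  by (intro restrict_meas) measurable
 have shm: "(%z. sh s x z) \<in> borel_measurable (Bn n)"
  by simp
 have "U s (%i. x i + h i) = (LINT z|G n 1. sh s x (\<lambda>i\<in>{..<n}. z i + b i))"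
  unfolding U_def sh_def using s
  by (intro Bochner_Integration.integral_cong refl N_cong) (simp add: b_def algebra_simps)
 also have "... = (LINT z|distr (G n 1) (Bn n) (%z. \<lambda>i\<in>{..<n}. z i + b i). sh s x z)"
  by (rule integral_distr[OF m shm, symmetric])
 also have "... = (LINT z|density (G n 1) (%z. ennreal (exp ((SUM i<n. b i * z i) - (SUM i<n. (b i)^2)/2))). sh s x z)"
 proof -
  have "(PROD i<n. ennreal (exp (b i * z i - (b i)\<^sup>2/2))) = ennreal (exp ((SUM i<n. b i * z i) - (SUM i<n. (b i)^2)/2))" for z
   by (simp add: prod_ennreal exp_sum[symmetric] sum_subtractf sum_divide_distrib)
  thus ?thesis unfolding G_shift by simp
 qed
 also have "... = (LINT z|G n 1. exp ((SUM i<n. b i * z i) - (SUM i<n. (b i)^2)/2) *\<^sub>R sh s x z)"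
  by (rule integral_density) auto
 finally show ?thesis unfolding b_def by (simp add: mult.commute)
qed

end

section \<open>Positive semidefinite forms and traces of products\<close>

definition psd_on :: "nat set => (nat => nat => real) => bool" where
 "psd_on S P \<longleftrightarrow> (ALL v. 0 <= (\<Sum>i\<in>S. \<Sum>j\<in>S. v i * v j * P i j))"

lemma psd_on_insert_sum:
 fixes P :: "nat => nat => real"
 assumes "finite S" "a \<notin> S" "!!i j. P i j = P j i"
 shows "(\<Sum>i\<in>insert a S. \<Sum>j\<in>insert a S. v i * v j * P i j) =
  (v a)^2 * P a a + 2 * v a*(\<Sum>i\<in>S. v i * P a i) + (\<Sum>i\<in>S. \<Sum>j\<in>S. v i * v j * P i j)"
proof -
 have "(\<Sum>i\<in>S. v i * v a * P i a) = v a*(\<Sum>i\<in>S. v i * P a i)"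
  using assms(3) by (simp add: sum_distrib_left mult_ac)
 moreover have "(\<Sum>j\<in>S. v a * v j * P a j) = v a*(\<Sum>i\<in>S. v i * P a i)"
  by (simp add: sum_distrib_left mult_ac)
 ultimately show ?thesis
  using assms(1,2) by (simp add: sum.distrib power2_eq_square)
qed

lemma psd_on_subset:
 assumes "psd_on T P" "S \<subseteq> T" "finite T"
 shows "psd_on S P"
 unfolding psd_on_def
proof
 fix v :: "nat => real"
 let ?v = "%i. if i \<in> S then v i else 0"
 have "(\<Sum>i\<in>T. \<Sum>j\<in>T. ?v i*?v j * P i j) = (\<Sum>i\<in>S. \<Sum>j\<in>T. ?v i*?v j * P i j)"
  using assms by (intro sum.mono_neutral_right) auto
 also have "... = (\<Sum>i\<in>S. \<Sum>j\<in>S. v i * v j * P i j)"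
 proof (rule sum.cong[OF refl])
  fix i assume "i \<in> S"
  hence "(\<Sum>j\<in>T. ?v i*?v j * P i j) = (\<Sum>j\<in>S. ?v i*?v j * P i j)"
   using assms by (intro sum.mono_neutral_right) auto
  thus "(\<Sum>j\<in>T. ?v i*?v j * P i j) = (\<Sum>j\<in>S. v i * v j * P i j)" using \<open>i \<in> S\<close> by simp
 qed
 finally show "0 <= (\<Sum>i\<in>S. \<Sum>j\<in>S. v i * v j * P i j)"
  using assms(1)[unfolded psd_on_def, rule_format, of ?v] by simp
qed

text \<open>Induction on the index set by Schur complements: splitting off the index
  \<open>a\<close> writes \<open>P\<close> as a rank-one form plus a semidefinite form on the
  remaining indices, and the rank-one part is a value of the form \<open>M\<close>.\<close>

lemma psd_trace:
 fixes P M :: "nat => nat => real"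
 assumes "finite S" "!!i j. P i j = P j i" "!!i j. M i j = M j i" "psd_on S P" "psd_on S M"
 shows "0 <= (\<Sum>i\<in>S. \<Sum>j\<in>S. P i j * M i j)"
 using assms
proof (induction S arbitrary: P rule: finite_induct)
 case (insert a S)
 note ins = psd_on_insert_sum[OF insert.hyps(1,2)]
 note sym = insert.prems(1,2)
 have P: "0 <= (v a)^2 * P a a + 2 * v a*(\<Sum>i\<in>S. v i * P a i) + (\<Sum>i\<in>S. \<Sum>j\<in>S. v i * v j * P i j)" for v
  using insert.prems(3) unfolding psd_on_def ins[of P, OF sym(1)] by blast
 have M: "0 <= (v a)^2 * M a a + 2 * v a*(\<Sum>i\<in>S. v i * M a i) + (\<Sum>i\<in>S. \<Sum>j\<in>S. v i * v j * M i j)" for v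
  using insert.prems(4) unfolding psd_on_def ins[of M, OF sym(2)] by blast
 have MS: "psd_on S M" by (rule psd_on_subset[OF insert.prems(4)]) (use insert.hyps in auto)
 have PM: "(\<Sum>i\<in>insert a S. \<Sum>j\<in>insert a S. P i j * M i j) =
  P a a * M a a + 2*(\<Sum>i\<in>S. P a i * M a i) + (\<Sum>i\<in>S. \<Sum>j\<in>S. P i j * M i j)"
 proof -
  have "(\<Sum>i\<in>S. P i a * M i a) = (\<Sum>i\<in>S. P a i * M a i)" using sym by simp
  thus ?thesis using insert.hyps by (simp add: sum.distrib)
 qed
 have Paa: "0 <= P a a"
  using P[of "%i. if i = a then 1 else 0"] insert.hyps by (simp add: if_distrib sum.neutral cong: if_cong)
 show ?case
 proof (cases "P a a = 0")
  case True
  \<comment> \<open>A zero diagonal entry of a semidefinite form forces its row to vanish; otherwise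
    a large multiple of that basis vector would make the form negative.\<close>
  have Pa0: "P a i = 0" if i: "i \<in> S" for i
  proof (rule ccontr)
   assume ne: "P a i ~= 0"
   have ia: "i ~= a" using i insert.hyps by auto
   have "0 <= 2 * c * P a i + P i i" for c
   proof -
    let ?v = "%k. if k = a then c else if k = i then 1 else 0"
    have v: "?v k = (if k = i then 1 else 0)" if "k \<in> S" for k using that insert.hyps by auto
    have "(\<Sum>k\<in>S. ?v k * P a k) = (\<Sum>k\<in>S. if k = i then P a i else 0)" by (intro sum.cong refl) (simp add: v)
    moreover have "(\<Sum>k\<in>S. \<Sum>j\<in>S. ?v k*?v j * P k j) = (\<Sum>k\<in>S. \<Sum>j\<in>S. if j = i then (if k = i then P i i else 0) else 0)"
     by (intro sum.cong refl) (simp add: v)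
    ultimately show ?thesis using P[of ?v] True i ia insert.hyps by simp
   qed
   from this[of "- (P i i + 1)/(2 * P a i)"] ne show False by (simp add: field_simps)
  qed
  have "psd_on S P" by (rule psd_on_subset[OF insert.prems(3)]) (use insert.hyps in auto)
  hence "0 <= (\<Sum>i\<in>S. \<Sum>j\<in>S. P i j * M i j)" by (intro insert.IH sym MS)
  thus ?thesis unfolding PM using True Pa0 by simp
 next
  case False
  hence Pp: "0 < P a a" using Paa by simp
  \<comment> \<open>The Schur complement of the entry \<open>P a a\<close>; it is semidefinite
    because \<open>v a\<close> may be chosen so as to minimize the form of \<open>P\<close>.\<close>
  define P' where "P' i j = P i j - P a i * P a j/P a a" for i j
  have "psd_on S P'"
   unfolding psd_on_def
  proof
   fix v :: "nat => real"
   define L where "L = (\<Sum>i\<in>S. v i * P a i)"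
   let ?v = "v(a := - L/P a a)"
   have v: "?v k = v k" if "k \<in> S" for k using that insert.hyps by auto
   have e: "(\<Sum>i\<in>S. \<Sum>j\<in>S. v i * v j * P' i j) = (\<Sum>i\<in>S. \<Sum>j\<in>S. v i * v j * P i j) - L * L/P a a"
    unfolding P'_def L_def sum_product
    by (simp add: right_diff_distrib sum_subtractf sum_divide_distrib mult_ac)
   have "0 <= (L/P a a)^2 * P a a - 2*(L/P a a) * L + (\<Sum>i\<in>S. \<Sum>j\<in>S. v i * v j * P i j)"
    using P[of ?v] v unfolding L_def by (simp cong: sum.cong)
   also have "(L/P a a)^2 * P a a - 2*(L/P a a) * L = - (L * L/P a a)"
    using Pp by (simp add: power2_eq_square)
   finally show "0 <= (\<Sum>i\<in>S. \<Sum>j\<in>S. v i * v j * P' i j)" unfolding e by simp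
  qed
  moreover have P's: "P' i j = P' j i" for i j unfolding P'_def using sym(1)[of i j] by simp
  ultimately have 1: "0 <= (\<Sum>i\<in>S. \<Sum>j\<in>S. P' i j * M i j)"
   by (intro insert.IH[OF _ sym(2) _ MS]) (rule P's)
  have 2: "0 <= (P a a)^2 * M a a + 2 * P a a*(\<Sum>i\<in>S. P a i * M a i) + (\<Sum>i\<in>S. \<Sum>j\<in>S. P a i * P a j * M i j)"
   using M[of "P a"] .
  have e: "(\<Sum>i\<in>S. \<Sum>j\<in>S. P i j * M i j) = (\<Sum>i\<in>S. \<Sum>j\<in>S. P' i j * M i j) + (\<Sum>i\<in>S. \<Sum>j\<in>S. P a i * P a j * M i j)/P a a"
   unfolding P'_def by (simp add: left_diff_distrib sum_subtractf sum_divide_distrib)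
  have "(\<Sum>i\<in>insert a S. \<Sum>j\<in>insert a S. P i j * M i j) = (\<Sum>i\<in>S. \<Sum>j\<in>S. P' i j * M i j) +
   ((P a a)^2 * M a a + 2 * P a a*(\<Sum>i\<in>S. P a i * M a i) + (\<Sum>i\<in>S. \<Sum>j\<in>S. P a i * P a j * M i j))/P a a"
   unfolding PM e using Pp by (simp add: field_simps power2_eq_square)
  thus ?thesis using 1 2 Pp by simp
 qed
qed simp

text \<open>With \<open>P\<close> a Hessian and \<open>A\<close> the covariance, the triple sum is
  \<open>tr (P A^T A)\<close>. A comparison of \<open>A^T A\<close> with \<open>c\<close> as
  quadratic forms is turned into a comparison of traces by \<open>psd_trace\<close>.\<close>

lemma psd_trace_gram:
 fixes P A :: "nat => nat => real"
 assumes P: "!!i j. P i j = P j i" "psd_on {..<n} P"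
 shows "(!!v. (SUM i<n. (SUM j<n. A i j * v j)^2) <= c*(SUM i<n. (v i)^2)) ==>
   (SUM i<n. SUM j<n. SUM k<n. P j k*(A i j * A i k)) <= c*(SUM i<n. P i i)"
  "(!!v. c*(SUM i<n. (v i)^2) <= (SUM i<n. (SUM j<n. A i j * v j)^2)) ==>
   c*(SUM i<n. P i i) <= (SUM i<n. SUM j<n. SUM k<n. P j k*(A i j * A i k))"
proof -
 define M where "M j k = (SUM i<n. A i j * A i k)" for j k
 define D where "D j k = (if j = k then c else 0)" for j k :: nat
 have Ms: "M j k = M k j" "D j k = D k j" for j k unfolding M_def D_def by (auto simp: mult.commute)
 have Mv: "(SUM j<n. SUM k<n. v j * v k * M j k) = (SUM i<n. (SUM j<n. A i j * v j)^2)" for v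
 proof -
  have "(SUM i<n. (SUM j<n. A i j * v j)^2) = (SUM i<n. SUM j<n. SUM k<n. v j * v k*(A i j * A i k))"
   unfolding power2_eq_square sum_product by (simp add: mult_ac)
  also have "... = (SUM j<n. SUM i<n. SUM k<n. v j * v k*(A i j * A i k))" by (rule sum.swap)
  also have "... = (SUM j<n. SUM k<n. SUM i<n. v j * v k*(A i j * A i k))" by (intro sum.cong refl sum.swap)
  finally show ?thesis unfolding M_def by (simp add: sum_distrib_left)
 qed
 have Dv: "(SUM j<n. SUM k<n. v j * v k * D j k) = c*(SUM i<n. (v i)^2)" for v :: "nat => real"
  unfolding D_def by (simp add: if_distrib sum_distrib_left power2_eq_square mult_ac cong: if_cong)
 have PM: "(SUM i<n. SUM j<n. SUM k<n. P j k*(A i j * A i k)) = (SUM j<n. SUM k<n. P j k * M j k)"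
 proof -
  have "(SUM i<n. SUM j<n. SUM k<n. P j k*(A i j * A i k)) = (SUM j<n. SUM i<n. SUM k<n. P j k*(A i j * A i k))" by (rule sum.swap)
  also have "... = (SUM j<n. SUM k<n. SUM i<n. P j k*(A i j * A i k))" by (intro sum.cong refl sum.swap)
  finally show ?thesis unfolding M_def by (simp add: sum_distrib_left)
 qed
 have PD: "(SUM j<n. SUM k<n. P j k * D j k) = c*(SUM i<n. P i i)"
  unfolding D_def by (simp add: if_distrib sum_distrib_left mult_ac cong: if_cong)
 {
  assume a: "!!v. (SUM i<n. (SUM j<n. A i j * v j)^2) <= c*(SUM i<n. (v i)^2)"
  have "0 <= (SUM j<n. SUM k<n. P j k*(D j k - M j k))"
   by (rule psd_trace[OF _ P(1) _ P(2)])
    (use a in \<open>simp_all add: psd_on_def right_diff_distrib sum_subtractf Mv Dv Ms\<close>)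
  thus "(SUM i<n. SUM j<n. SUM k<n. P j k*(A i j * A i k)) <= c*(SUM i<n. P i i)"
   unfolding PM by (simp add: right_diff_distrib sum_subtractf PD)
 next
  assume a: "!!v. c*(SUM i<n. (v i)^2) <= (SUM i<n. (SUM j<n. A i j * v j)^2)"
  have "0 <= (SUM j<n. SUM k<n. P j k*(M j k - D j k))"
   by (rule psd_trace[OF _ P(1) _ P(2)])
    (use a in \<open>simp_all add: psd_on_def right_diff_distrib sum_subtractf Mv Dv Ms\<close>)
  thus "c*(SUM i<n. P i i) <= (SUM i<n. SUM j<n. SUM k<n. P j k*(A i j * A i k))"
   unfolding PM by (simp add: right_diff_distrib sum_subtractf PD)
 }
qed

section \<open>Gradient, Hessian and Taylor expansion of the heat flow\<close>

context gauge
begin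

text \<open>This is \<open>sqrt s\<close> times the gradient of \<open>U s\<close> at
  \<open>x\<close>, with the derivative moved onto the Gaussian weight.\<close>

definition e1 :: "real => (nat => real) => nat => real" where
 "e1 s x i = (LINT z|G n 1. sh s x z * z i)"

text \<open>The Hessian of \<open>U s\<close> at \<open>x\<close>, with both derivatives moved onto
  the Gaussian weight, where they become a Hermite polynomial of degree two.\<close>

definition Q :: "real => (nat => real) => nat => nat => real" where
 "Q s x i j = (LINT z|G n 1. sh s x z*(z i * z j - (if i = j then 1 else 0)))/s"

lemma coord_le_ab: "i < n ==> \<bar>z i\<bar> <= ab z"
 unfolding ab_def by (rule member_le_sum) auto

lemma lin_bound: "i < n ==> \<bar>z i\<bar> <= 1 * exp (1 * ab z)"
proof -
 assume "i < n"
 hence "\<bar>z i\<bar> <= ab z" by (rule coord_le_ab)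
 thus ?thesis using ab_exp(1)[of z] by simp
qed

lemma quad_bound: "i < n ==> j < n ==> \<bar>z i * z j - (if i = j then 1 else 0)\<bar> <= 3 * exp (1 * ab z)"
proof -
 assume "i < n" "j < n"
 hence "\<bar>z i\<bar>*\<bar>z j\<bar> <= ab z * ab z" by (intro mult_mono coord_le_ab ab_nonneg) auto
 moreover have "ab z * ab z <= 2 * exp (ab z)"
  using exp_lower_Taylor_quadratic[OF ab_nonneg[of z]] ab_nonneg[of z] by (simp add: power2_eq_square)
 ultimately have "\<bar>z i * z j\<bar> <= 2 * exp (ab z)" unfolding abs_mult by linarith
 moreover have "\<bar>z i * z j - (if i = j then 1 else 0)\<bar> <= \<bar>z i * z j\<bar> + 1"
  using abs_triangle_ineq4[of "z i * z j" "if i = j then 1 else 0"] by (simp split: if_splits)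
 moreover have "\<bar>z i * z j\<bar> + 1 <= 3 * exp (1 * ab z)" if "\<bar>z i * z j\<bar> <= 2 * exp (ab z)"
  using that exp_ge_add_one_self[of "ab z"] ab_nonneg[of z] unfolding mult_1 by linarith
 ultimately show ?thesis by (meson order_trans)
qed

lemma e1_int: "0 <= s ==> i < n ==> integrable (G n 1) (%z. sh s x z * z i)"
 by (rule sh_prod_int(1)[OF _ _ lin_bound]) auto

lemma Q_int: "0 <= s ==> i < n ==> j < n ==> integrable (G n 1) (%z. sh s x z*(z i * z j - (if i = j then 1 else 0)))"
 by (rule sh_prod_int(1)[OF _ _ quad_bound]) auto

lemma e1_bound: "0 <= s ==> i < n ==> \<bar>e1 s x i\<bar> <= (N x + sqrt s * m) * E 2"
proof -
 assume a: "0 <= s" "i < n"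
 have "\<bar>e1 s x i\<bar> <= (N x + sqrt s * m)*1 * E (1 + 1)"
  unfolding e1_def by (rule sh_prod_int(2)[OF a(1) _ lin_bound[OF a(2)]]) (use a in measurable)
 thus ?thesis by simp
qed

lemma Q_bound: "0 < s ==> i < n ==> j < n ==> \<bar>Q s x i j\<bar> <= (N x + sqrt s * m)*3 * E 2/s"
proof -
 assume a: "0 < s" "i < n" "j < n"
 have "\<bar>\<integral>z. sh s x z*(z i * z j - (if i = j then 1 else 0)) \<partial>G n 1\<bar> <= (N x + sqrt s * m)*3 * E (1 + 1)"
  by (rule sh_prod_int(2)[OF _ _ quad_bound[OF a(2,3)]]) (use a in \<open>auto\<close>)
 thus ?thesis using a(1) unfolding Q_def by (simp add: divide_right_mono)
qed

lemma Q_lip: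
 assumes s: "0 < s" and ij: "i < n" "j < n"
 shows "\<bar>Q s x i j - Q s y i j\<bar> <= m * ab (%i. x i - y i)*3 * E 1/s"
proof -
 define f where "f z = z i * z j - (if i = j then 1 else 0)" for z :: "nat => real"
 have s0: "0 <= s" using s by simp
 have int: "integrable (G n 1) (%z. sh s x z * f z)" for x
  unfolding f_def by (rule Q_int[OF s0 ij])
 have bnd: "\<bar>sh s x z * f z - sh s y z * f z\<bar> <= m * ab (%i. x i - y i)*3 * exp (1 * ab z)" for z
 proof -
  have "\<bar>sh s x z - sh s y z\<bar> <= m * ab (%i. x i - y i)"
   using N_lip[of "%i. x i + sqrt s * z i" "%i. y i + sqrt s * z i"] unfolding sh_def by simp
  hence "\<bar>sh s x z - sh s y z\<bar>*\<bar>f z\<bar> <= (m * ab (%i. x i - y i))*(3 * exp (1 * ab z))"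
   using quad_bound[OF ij, of z] ab_nonneg m_nonneg unfolding f_def by (intro mult_mono) auto
  thus ?thesis by (simp add: abs_mult[symmetric] left_diff_distrib mult.assoc)
 qed
 have "\<bar>\<integral>z. sh s x z * f z - sh s y z * f z \<partial>G n 1\<bar> <=
   (LINT z|G n 1. m * ab (%i. x i - y i)*3 * exp (1 * ab z))"
  by (rule int_abs_le[OF _ _ bnd]) (intro Bochner_Integration.integrable_diff int integrable_mult_right exp_ab_int)+
 also have "(LINT z|G n 1. sh s x z * f z - sh s y z * f z) = s*(Q s x i j - Q s y i j)"
  unfolding Bochner_Integration.integral_diff[OF int int] unfolding f_def Q_def using s by (simp add: right_diff_distrib)
 finally have "s*\<bar>Q s x i j - Q s y i j\<bar> <= m * ab (%i. x i - y i)*3 * E 1"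
  using s unfolding E_def by simp
 thus ?thesis using s by (simp add: field_simps)
qed

lemma Q_sym: "Q s x i j = Q s x j i"
 unfolding Q_def by (simp add: mult.commute eq_commute)

definition tay :: "real => (nat => real) => (nat => real) => real" where
 "tay s x h = U s x + (SUM i<n. h i * e1 s x i)/sqrt s + (SUM i<n. SUM j<n. h i * h j * Q s x i j)/2"

text \<open>The Taylor polynomial is the integral of \<open>N\<close> against the second-order part
  of the Cameron--Martin density, so its error is governed by
  \<open>exp_shift_expansion\<close>.\<close>

lemma tay_int:
 fixes h :: "nat => real"
 assumes s: "0 < s"
 defines "b \<equiv> %i. h i/sqrt s"
 defines "f \<equiv> %z. 1 + (SUM i<n. b i * z i) + ((SUM i<n. b i * z i)^2 - (SUM i<n. (b i)^2))/2"
 shows "tay s x h = (LINT z|G n 1. sh s x z * f z)" "integrable (G n 1) (%z. sh s x z * f z)"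
proof -
 have f: "sh s x z * f z = sh s x z + (SUM i<n. b i*(sh s x z * z i)) +
   (SUM i<n. SUM j<n. (b i * b j/2)*(sh s x z*(z i * z j - (if i = j then 1 else 0))))" for z
 proof -
  have 1: "(SUM i<n. b i * z i)^2 = (SUM i<n. SUM j<n. b i * b j*(z i * z j))"
   by (simp add: power2_eq_square sum_product mult_ac)
  have 2: "(SUM i<n. (b i)^2) = (SUM i<n. SUM j<n. b i * b j*(if i = j then 1 else 0))"
   by (simp add: power2_eq_square if_distrib cong: if_cong)
  have "(SUM i<n. b i * z i)^2 - (SUM i<n. (b i)^2) = (SUM i<n. SUM j<n. b i * b j*(z i * z j - (if i = j then 1 else 0)))"
   unfolding 1 2 by (simp add: sum_subtractf[symmetric] right_diff_distrib)
  thus ?thesis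
   unfolding f_def by (simp add: sum_distrib_left algebra_simps diff_divide_distrib)
 qed
 have "has_bochner_integral (G n 1) (%z. sh s x z * f z)
   (U s x + (SUM i<n. b i * e1 s x i) + (SUM i<n. SUM j<n. (b i * b j/2)*(s * Q s x i j)))"
  unfolding f by (intro has_bochner_integral_add has_bochner_integral_sum has_bochner_integral_mult_right)
   (use s in \<open>auto simp: has_bochner_integral_iff sh_int e1_int Q_int U_def e1_def Q_def\<close>)
 moreover have "U s x + (SUM i<n. b i * e1 s x i) + (SUM i<n. SUM j<n. (b i * b j/2)*(s * Q s x i j)) = tay s x h"
 proof -
  have "sqrt s * sqrt s = s" using s by simp
  hence "b i * b j/2*(s * Q s x i j) = h i * h j * Q s x i j/2" for i j
   using s unfolding b_def by simp
  thus ?thesis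
   unfolding tay_def by (simp only: sum_divide_distrib) (simp add: b_def)
 qed
 ultimately show "tay s x h = (LINT z|G n 1. sh s x z * f z)" "integrable (G n 1) (%z. sh s x z * f z)"
  by (simp_all add: has_bochner_integral_iff)
qed

text \<open>The first summand serves displacements with \<open>ab h <= sqrt s\<close>. The other
  three bound the increment, the gradient term and the Hessian term separately for larger
  displacements, where lower powers of \<open>ab h / sqrt s0\<close> are dominated by the
  cube.\<close>

definition KU :: "real => real => real => real" where
 "KU s0 s1 M = 4*(M + sqrt s1 * m) * E 3/(s0 * sqrt s0) + m/s0 + (M + sqrt s1 * m) * E 2/(s0 * sqrt s0)
  + 3*(M + sqrt s1 * m) * E 2/(2*(s0 * sqrt s0))"

text \<open>The error constant depends only on bounds for \<open>s\<close> and \<open>N x\<close>.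
  The lower bound \<open>s0\<close> is essential: the expansion degenerates as the heat time tends
  to zero.\<close>

lemma U_expand:
 assumes s: "0 < s0" "s0 <= s" "s <= s1" and M: "N x <= M"
 shows "\<bar>U s (%i. x i + h i) - tay s x h\<bar> <= KU s0 s1 M * ab h ^ 3"
proof -
 define A where "A = M + sqrt s1 * m"
 have sp: "0 < s" using s by linarith
 have Mn: "0 <= M" using M N_nonneg[of x] by linarith
 have A0: "0 <= A" unfolding A_def using Mn m_nonneg s by (intro add_nonneg_nonneg mult_nonneg_nonneg) auto
 have NA: "N x + sqrt s * m <= A" unfolding A_def using M m_nonneg s by (intro add_mono mult_right_mono) auto
 have ss: "s0 * sqrt s0 > 0" "s0 * sqrt s0 <= s * sqrt s" using s by (auto intro!: mult_mono)
 have parts: "0 <= 4 * A * E 3/(s0 * sqrt s0)" "0 <= m/s0" "0 <= A * E 2/(s0 * sqrt s0)" "0 <= 3 * A * E 2/(2*(s0 * sqrt s0))"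
  using A0 E_nonneg m_nonneg ss s by auto
 define b where "b i = h i/sqrt s" for i
 define \<beta> where "\<beta> = ab h/sqrt s"
 have \<beta>0: "0 <= \<beta>" unfolding \<beta>_def using ab_nonneg sp by (intro divide_nonneg_nonneg) auto
 have \<beta>3: "\<beta> ^ 3 <= ab h ^ 3/(s0 * sqrt s0)"
 proof -
  have "\<beta> ^ 3 = ab h ^ 3/(s * sqrt s)" using sp unfolding \<beta>_def by (simp add: power3_eq_cube)
  also have "... <= ab h ^ 3/(s0 * sqrt s0)" using ss ab_nonneg[of h] by (intro divide_left_mono) auto
  finally show ?thesis .
 qed
 show ?thesis
 proof (cases "\<beta> <= 1")
  case True
  let ?f = "%z. 1 + (SUM i<n. b i * z i) + ((SUM i<n. b i * z i)^2 - (SUM i<n. (b i)^2))/2"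
  let ?e = "%z. exp ((SUM i<n. b i * z i) - (SUM i<n. (b i)^2)/2)"
  have ab_b: "(SUM i<n. \<bar>b i\<bar>) = \<beta>" unfolding b_def \<beta>_def ab_def using sp by (simp add: sum_divide_distrib)
  have bnd: "\<bar>?e z - ?f z\<bar> <= (4*\<beta> ^ 3) * exp (2 * ab z)" for z
  proof (rule exp_shift_expansion)
   have "\<bar>SUM i<n. b i * z i\<bar> <= (SUM i<n. \<bar>b i\<bar> * ab z)"
    by (rule order_trans[OF sum_abs]) (auto intro!: sum_mono mult_left_mono coord_le_ab simp: abs_mult)
   thus "\<bar>SUM i<n. b i * z i\<bar> <= \<beta> * ab z" unfolding ab_b[symmetric] by (simp add: sum_distrib_right)
   have "(SUM i<n. (b i)^2) <= (SUM i<n. \<bar>b i\<bar>*\<beta>)"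
    unfolding ab_b[symmetric] power2_eq_square
   proof (intro sum_mono)
    fix i assume "i \<in> {..<n}"
    hence "\<bar>b i\<bar> <= (SUM i<n. \<bar>b i\<bar>)" by (intro member_le_sum) auto
    hence "\<bar>b i\<bar>*\<bar>b i\<bar> <= \<bar>b i\<bar>*(SUM i<n. \<bar>b i\<bar>)" by (intro mult_left_mono) auto
    thus "b i * b i <= \<bar>b i\<bar>*(SUM i<n. \<bar>b i\<bar>)" by simp
   qed
   thus "(SUM i<n. (b i)^2) <= \<beta>^2"
    unfolding sum_distrib_right[symmetric] ab_b by (simp add: power2_eq_square)
  qed (use \<beta>0 True ab_nonneg in \<open>auto intro: sum_nonneg\<close>)
  have fm: "(%z. ?e z - ?f z) \<in> borel_measurable (G n 1)" by measurable
  have eq: "U s (%i. x i + h i) - tay s x h = (LINT z|G n 1. sh s x z*(?e z - ?f z))"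
  proof -
   have i1: "integrable (G n 1) (%z. sh s x z*(?e z - ?f z))"
    by (rule sh_prod_int(1)[OF less_imp_le[OF sp] fm bnd])
   have i2: "integrable (G n 1) (%z. sh s x z*?f z)"
    using tay_int(2)[OF sp, of x h] unfolding b_def .
   have "U s (%i. x i + h i) = (LINT z|G n 1. sh s x z*(?e z - ?f z) + sh s x z*?f z)"
    unfolding U_shift[OF sp] b_def by (intro Bochner_Integration.integral_cong refl) (simp add: algebra_simps)
   also have "... = (LINT z|G n 1. sh s x z*(?e z - ?f z)) + (LINT z|G n 1. sh s x z*?f z)"
    by (rule Bochner_Integration.integral_add[OF i1 i2])
   also have "(LINT z|G n 1. sh s x z*?f z) = tay s x h"
    using tay_int(1)[OF sp, of x h] unfolding b_def by simp
   finally show ?thesis by simp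
  qed
  have "\<bar>U s (%i. x i + h i) - tay s x h\<bar> <= (N x + sqrt s * m)*(4*\<beta> ^ 3) * E (2 + 1)"
   unfolding eq by (rule sh_prod_int(2)[OF less_imp_le[OF sp] fm bnd])
  also have "... <= A*(4*(ab h ^ 3/(s0 * sqrt s0))) * E (2 + 1)"
  proof -
   have "(N x + sqrt s * m)*(4*\<beta> ^ 3) <= A*(4*(ab h ^ 3/(s0 * sqrt s0)))"
   proof (rule mult_mono[OF NA _ A0])
    show "4*\<beta> ^ 3 <= 4*(ab h ^ 3/(s0 * sqrt s0))" using \<beta>3 by linarith
    show "0 <= 4*\<beta> ^ 3" using zero_le_power[OF \<beta>0, of 3] by linarith
   qed
   thus ?thesis by (rule mult_right_mono[OF _ E_nonneg])
  qed
  also have "... = 4 * A * E 3/(s0 * sqrt s0) * ab h ^ 3" by simp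
  also have "... <= KU s0 s1 M * ab h ^ 3"
   unfolding KU_def A_def[symmetric] using parts ab_nonneg[of h] by (intro mult_right_mono) (linarith, simp)
  finally show ?thesis .
 next
  case False
  define a where "a = ab h"
  have as: "sqrt s0 <= a"
  proof -
   have "sqrt s <= a" using False sp unfolding \<beta>_def a_def by simp
   thus ?thesis using real_sqrt_le_mono[OF s(2)] by linarith
  qed
  have a0: "0 <= a" unfolding a_def by (rule ab_nonneg)
  have r0: "0 < sqrt s0" using s by simp
  have a1: "1 <= a/sqrt s0" using as r0 by simp
  have a2: "a^2 <= a ^ 3/sqrt s0"
  proof -
   have "a^2*1 <= a^2*(a/sqrt s0)" using a1 by (intro mult_left_mono) auto
   thus ?thesis by (simp add: power2_eq_square power3_eq_cube)
  qed
  have a3: "a <= a ^ 3/s0"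
  proof -
   have "(a/sqrt s0)*1 <= (a/sqrt s0)*(a/sqrt s0)" using a1 by (intro mult_left_mono) auto
   hence "1 <= (a/sqrt s0)*(a/sqrt s0)" using a1 by linarith
   hence "a*1 <= a*((a/sqrt s0)*(a/sqrt s0))" using a0 by (intro mult_left_mono) auto
   thus ?thesis using s(1) by (simp add: power3_eq_cube)
  qed
  have 1: "\<bar>U s (%i. x i + h i) - U s x\<bar> <= m/s0 * a ^ 3"
  proof -
   have "\<bar>U s (%i. x i + h i) - U s x\<bar> <= m * a"
    using U_lip[of s "%i. x i + h i" x] sp unfolding a_def by simp
   also have "... <= m*(a ^ 3/s0)" using a3 m_nonneg by (intro mult_left_mono)
   finally show ?thesis by simp
  qed
  have 2: "\<bar>(SUM i<n. h i * e1 s x i)/sqrt s\<bar> <= A * E 2/(s0 * sqrt s0) * a ^ 3"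
  proof -
   have "\<bar>SUM i<n. h i * e1 s x i\<bar> <= (SUM i<n. \<bar>h i\<bar>*(A * E 2))"
   proof (rule order_trans[OF sum_abs], intro sum_mono)
    fix i assume "i \<in> {..<n}"
    hence "\<bar>e1 s x i\<bar> <= (N x + sqrt s * m) * E 2" using sp by (intro e1_bound) auto
    also have "... <= A * E 2" using NA E_nonneg by (intro mult_right_mono)
    finally show "\<bar>h i * e1 s x i\<bar> <= \<bar>h i\<bar>*(A * E 2)" unfolding abs_mult by (intro mult_left_mono) auto
   qed
   also have "... = a*(A * E 2)" unfolding a_def ab_def by (simp add: sum_distrib_right)
   finally have "\<bar>(SUM i<n. h i * e1 s x i)/sqrt s\<bar> <= a*(A * E 2)/sqrt s"
    using sp by (simp add: divide_right_mono)
   also have "... <= a*(A * E 2)/sqrt s0"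
    using r0 s A0 E_nonneg a0 by (intro divide_left_mono) auto
   also have "... <= (a ^ 3/s0)*(A * E 2)/sqrt s0"
    using a3 A0 E_nonneg r0 by (intro divide_right_mono mult_right_mono) auto
   finally show ?thesis by (simp add: mult_ac)
  qed
  have 3: "\<bar>(SUM i<n. SUM j<n. h i * h j * Q s x i j)/2\<bar> <= 3 * A * E 2/(2*(s0 * sqrt s0)) * a ^ 3"
  proof -
   have "\<bar>SUM i<n. SUM j<n. h i * h j * Q s x i j\<bar> <= (SUM i<n. SUM j<n. \<bar>h i\<bar>*\<bar>h j\<bar>*(A*3 * E 2/s0))"
   proof (rule order_trans[OF sum_abs], intro sum_mono, rule order_trans[OF sum_abs], intro sum_mono)
    fix i j assume ij: "i \<in> {..<n}" "j \<in> {..<n}"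
    hence "\<bar>Q s x i j\<bar> <= (N x + sqrt s * m)*3 * E 2/s" using sp by (intro Q_bound) auto
    also have "... <= A*3 * E 2/s0"
     using NA E_nonneg A0 s by (intro frac_le mult_right_mono mult_nonneg_nonneg) auto
    finally show "\<bar>h i * h j * Q s x i j\<bar> <= \<bar>h i\<bar>*\<bar>h j\<bar>*(A*3 * E 2/s0)"
     unfolding abs_mult by (intro mult_left_mono) auto
   qed
   also have "... = a^2*(A*3 * E 2/s0)"
    unfolding a_def ab_def power2_eq_square sum_product by (simp only: sum_distrib_right)
   also have "... <= (a ^ 3/sqrt s0)*(A*3 * E 2/s0)"
    using a2 A0 E_nonneg s by (intro mult_right_mono) auto
   finally show ?thesis by (simp add: field_simps)
  qed
  have "\<bar>U s (%i. x i + h i) - tay s x h\<bar> <= (m/s0 + A * E 2/(s0 * sqrt s0) + 3 * A * E 2/(2*(s0 * sqrt s0))) * a ^ 3"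
  proof -
   have tri: "\<bar>u - (v + b + c)\<bar> <= X + Y + Z" if "\<bar>u - v\<bar> <= X" "\<bar>b\<bar> <= Y" "\<bar>c\<bar> <= Z" for u v b c X Y Z :: real
    using that by linarith
   show ?thesis unfolding tay_def distrib_right by (rule tri[OF 1 2 3])
  qed
  also have "... <= KU s0 s1 M * a ^ 3"
   unfolding KU_def A_def[symmetric] using parts a0 by (intro mult_right_mono) (linarith, simp)
  finally show ?thesis unfolding a_def .
 qed
qed

lemma KU_nonneg: "0 < s0 ==> s0 <= s1 ==> 0 <= M ==> 0 <= KU s0 s1 M"
 unfolding KU_def using E_nonneg m_nonneg by (intro add_nonneg_nonneg divide_nonneg_nonneg mult_nonneg_nonneg) auto

end

section \<open>First and second moments of the standard Gaussian\<close>

lemma nd_int: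
 assumes f: "f \<in> borel_measurable borel"
 shows "integrable (nd 1) f \<longleftrightarrow> integrable lborel (%y. std_normal_density y * f y)"
  "(LINT y|nd 1. f y) = (LINT y|lborel. std_normal_density y * f y)"
 using f by (simp_all add: integrable_density integral_density)

lemma nd_moments:
 "integrable (nd 1) (%y. y)" "(LINT y|nd 1. y) = 0"
 "integrable (nd 1) (%y. y^2)" "(LINT y|nd 1. y^2) = 1"
 "(LINT y|nd 1. \<bar>y\<bar>) = sqrt (2/pi)"
proof -
 have 1: "has_bochner_integral lborel (%y. std_normal_density y * y) 0"
  using std_normal_moment_odd[of 0] by simp
 have 2: "has_bochner_integral lborel (%y. std_normal_density y * y^2) 1"
  using std_normal_moment_even[of 1] by simp
 have 3: "has_bochner_integral lborel (%y. std_normal_density y*\<bar>y\<bar>) (sqrt (2/pi))"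
  using std_normal_moment_abs_odd[of 0] by simp
 show "integrable (nd 1) (%y. y)" "(LINT y|nd 1. y) = 0"
  using 1 by (auto simp only: nd_int[OF measurable_ident_sets[OF refl]] has_bochner_integral_iff)
 show "integrable (nd 1) (%y. y^2)" "(LINT y|nd 1. y^2) = 1"
  using 2 nd_int[of "%y. y^2"] by (auto simp only: has_bochner_integral_iff) measurable
 show "(LINT y|nd 1. \<bar>y\<bar>) = sqrt (2/pi)"
  using 3 nd_int[of "%y. \<bar>y\<bar>"] by (auto simp only: has_bochner_integral_iff) measurable
qed

context
 fixes n :: nat
begin

lemma G_coord_prod:
 fixes f :: "nat => real => real"
 assumes f: "!!k. k < n ==> integrable (nd 1) (f k)"
 shows "integrable (G n 1) (%z. PROD k<n. f k (z k))"
  "(LINT z|G n 1. (PROD k<n. f k (z k))) = (PROD k<n. \<integral>y. f k y \<partial>nd 1)"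
proof -
 interpret prob_space "nd 1" by (rule prob_nd) simp
 interpret product_sigma_finite "%_::nat. nd 1" by standard
 show "integrable (G n 1) (%z. PROD k<n. f k (z k))"
  unfolding gaussian_Rn_def by (rule product_integrable_prod) (use f in auto)
 show "(LINT z|G n 1. (PROD k<n. f k (z k))) = (PROD k<n. \<integral>y. f k y \<partial>nd 1)"
  unfolding gaussian_Rn_def by (rule product_integral_prod) (use f in auto)
qed

lemma G_marginal:
 fixes f :: "real => real"
 assumes i: "i < n" and f: "integrable (nd 1) f"
 shows "integrable (G n 1) (%z. f (z i))" "(LINT z|G n 1. f (z i)) = (LINT y|nd 1. f y)"
proof -
 interpret prob_space "nd 1" by (rule prob_nd) simp
 have one: "integrable (nd 1) (%_. 1 :: real)" by (rule integrable_const)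
 define g where "g k = (if k = i then f else (%_. 1))" for k
 have g: "integrable (nd 1) (g k)" for k using f one unfolding g_def by (cases "k = i") (simp_all only: refl if_True if_False)
 have p: "(PROD k<n. g k (z k)) = f (z i)" for z
 proof -
  have "(PROD k<n. g k (z k)) = (PROD k<n. if k = i then f (z i) else 1)" by (rule prod.cong) (auto simp: g_def)
  thus ?thesis using i by simp
 qed
 have pu: "measure (nd 1) UNIV = 1" using prob_space by (simp del: real_sqrt_one)
 have q: "(PROD k<n. \<integral>y. g k y \<partial>nd 1) = (LINT y|nd 1. f y)"
 proof -
  have "(PROD k<n. \<integral>y. g k y \<partial>nd 1) = (PROD k<n. if k = i then (LINT y|nd 1. f y) else 1)"
   by (rule prod.cong) (auto simp: g_def pu simp del: real_sqrt_one)
  thus ?thesis using i by simp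
 qed
 show "integrable (G n 1) (%z. f (z i))" "(LINT z|G n 1. f (z i)) = (LINT y|nd 1. f y)"
  using G_coord_prod[of g, OF g] unfolding p q by auto
qed

lemma G_moments:
 assumes ij: "i < n" "j < n"
 shows "integrable (G n 1) (%z. z i * z j)"
  "(LINT z|G n 1. z i * z j) = (if i = j then 1 else 0)"
proof -
 interpret prob_space "nd 1" by (rule prob_nd) simp
 have "integrable (G n 1) (%z. z i * z j) & (LINT z|G n 1. z i * z j) = (if i = j then 1 else 0)"
 proof (cases "i = j")
  case True
  thus ?thesis
   using G_marginal[OF ij(1) nd_moments(3)] nd_moments(4) by (simp add: power2_eq_square)
 next
  case False
  have one: "integrable (nd 1) (%_. 1 :: real)" by (rule integrable_const)
  define g :: "nat => real => real" where "g k = (if k = i | k = j then (%y. y) else (%_. 1))" for k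
  have g: "integrable (nd 1) (g k)" for k using nd_moments(1) one unfolding g_def by (cases "k = i | k = j") (simp_all only: refl if_True if_False)
  have p: "(PROD k<n. g k (z k)) = z i * z j" for z
  proof -
   have "(PROD k<n. g k (z k)) = (PROD k<n. (if k = i then z i else 1)*(if k = j then z j else 1))"
    by (rule prod.cong) (use False in \<open>auto simp: g_def\<close>)
   thus ?thesis using ij by (simp add: prod.distrib)
  qed
  have q: "(PROD k<n. \<integral>y. g k y \<partial>nd 1) = 0"
  proof (rule prod_zero)
   have "(LINT y|nd 1. g i y) = 0" unfolding g_def using nd_moments(2) by (simp only: simp_thms if_True)
   thus "\<exists>a\<in>{..<n}. (LINT y|nd 1. g a y) = 0" using ij by blast
  qed simp
  show ?thesis using G_coord_prod[of g, OF g] False unfolding p q by auto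
 qed
 thus "integrable (G n 1) (%z. z i * z j)"
  "(LINT z|G n 1. z i * z j) = (if i = j then 1 else 0)" by auto
qed

end

section \<open>Convexity, semigroup property and heat equation of the flow\<close>

context gauge
begin

lemma ab_scale: "ab (%i. c * z i) = \<bar>c\<bar> * ab z"
 unfolding ab_def by (simp add: abs_mult sum_distrib_left)

text \<open>Midpoint convexity of \<open>U s\<close> is compared with the Taylor expansion at the
  two displacements \<open>\<epsilon> v\<close> and \<open>- \<epsilon> v\<close>. The linear terms
  cancel, and division by \<open>\<epsilon>^2\<close> leaves the form up to
  \<open>2 \<epsilon> K\<close>.\<close>

lemma Q_psd:
 assumes s: "0 < s"
 shows "0 <= (SUM i<n. SUM j<n. v i * v j * Q s x i j)"
proof -
 define q where "q = (SUM i<n. SUM j<n. v i * v j * Q s x i j)"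
 define K where "K = KU s s (N x) * ab v ^ 3"
 have K0: "0 <= K" unfolding K_def using KU_nonneg[OF s order_refl N_nonneg[of x]] ab_nonneg[of v] by simp
 have "- q <= 0 + e" if e: "0 < e" for e
 proof -
  define \<epsilon> where "\<epsilon> = e/(2 * K + 1)"
  have \<epsilon>: "0 < \<epsilon>" unfolding \<epsilon>_def using e K0 by simp
  define T where "T = (SUM i<n. \<epsilon> * v i * e1 s x i)/sqrt s"
  have t1: "tay s x (%i. \<epsilon> * v i) = U s x + T + \<epsilon>^2 * q/2"
   unfolding tay_def T_def q_def by (simp add: sum_distrib_left power2_eq_square mult_ac)
  have t2: "tay s x (%i. - (\<epsilon> * v i)) = U s x - T + \<epsilon>^2 * q/2"
   unfolding tay_def T_def q_def by (simp add: sum_distrib_left power2_eq_square mult_ac sum_negf)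
  have a: "ab (%i. \<epsilon> * v i) = \<epsilon> * ab v" "ab (%i. - (\<epsilon> * v i)) = \<epsilon> * ab v"
   using ab_scale[of \<epsilon> v] ab_scale[of "-\<epsilon>" v] \<epsilon> by simp_all
  have "\<bar>U s (%i. x i + \<epsilon> * v i) - (U s x + T + \<epsilon>^2 * q/2)\<bar> <= \<epsilon> ^ 3 * K"
   using U_expand[OF s order_refl order_refl order_refl, of x "%i. \<epsilon> * v i"] unfolding t1 a K_def by (simp add: power_mult_distrib mult_ac)
  moreover have "\<bar>U s (%i. x i - \<epsilon> * v i) - (U s x - T + \<epsilon>^2 * q/2)\<bar> <= \<epsilon> ^ 3 * K"
   using U_expand[OF s order_refl order_refl order_refl, of x "%i. - (\<epsilon> * v i)"] unfolding t2 a K_def by (simp add: power_mult_distrib mult_ac)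
  moreover have "2 * U s x <= U s (%i. x i + \<epsilon> * v i) + U s (%i. x i - \<epsilon> * v i)"
   using s by (intro U_midpoint) simp
  ultimately have "0 <= \<epsilon>^2 * q + 2*(\<epsilon> ^ 3 * K)" by linarith
  also have "... = \<epsilon>^2*(q + 2*\<epsilon> * K)" by (simp add: power2_eq_square power3_eq_cube algebra_simps)
  finally have "0 <= q + 2*\<epsilon> * K" using \<epsilon> by (simp add: zero_le_mult_iff)
  moreover have "2*\<epsilon> * K <= e" unfolding \<epsilon>_def using e K0 by (simp add: field_simps)
  ultimately show ?thesis by linarith
 qed
 hence "- q <= 0" by (rule field_le_epsilon)
 thus ?thesis unfolding q_def by simp
qed

lemma U_meas [measurable]: "U s \<in> borel_measurable (Bn n)" if "0 <= s"
proof -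
 have "(U s \<longlongrightarrow> U s a) (at a)" for a
 proof -
  have c: "continuous_on UNIV (%x :: nat => real. x i)" for i
   by (rule continuous_on_product_coordinates)
  have "continuous_on UNIV (%x :: nat => real. m * ab (%i. x i - a i))"
   unfolding ab_def by (intro continuous_intros c)
  hence "((%x. m * ab (%i. x i - a i)) \<longlongrightarrow> m * ab (%i. a i - a i)) (at a)"
   unfolding continuous_on_def by (rule bspec) simp
  hence "((%x. m * ab (%i. x i - a i)) \<longlongrightarrow> 0) (at a)" by (simp add: ab_def)
  moreover have "\<forall>\<^sub>F x in at a. norm (U s x - U s a) <= m * ab (%i. x i - a i)"
   using U_lip[OF that] by (intro always_eventually) simp
  ultimately have "((%x. U s x - U s a) \<longlongrightarrow> 0) (at a)" by (rule Lim_null_comparison[rotated])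
  thus ?thesis by (simp add: LIM_zero_iff)
 qed
 hence "continuous_on UNIV (U s)" unfolding continuous_on_def by simp
 hence "U s \<in> borel_measurable borel" by (rule borel_measurable_continuous_onI)
 from measurable_compose[OF measurable_id_borel this] show ?thesis .
qed

lemma U_nonneg: "0 <= U s x"
 unfolding U_def by (intro Bochner_Integration.integral_nonneg sh_nonneg)

lemma U_cong: "(!!i. i < n ==> x i = y i) ==> U s x = U s y"
 unfolding U_def sh_def by (intro Bochner_Integration.integral_cong refl N_cong) simp

lemma U_nn:
 assumes s: "0 < s"
 shows "ennreal (U s x) = (nn_integral (G n s) (%y. ennreal (N (%i. x i + y i))))"
proof -
 have m: "(%z. \<lambda>i\<in>{..<n}. sqrt s * z i) \<in> measurable (G n 1) (Bn n)"
  by (intro restrict_meas) measurable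
 have Nm: "(%y. ennreal (N (%i. x i + y i))) \<in> borel_measurable (Bn n)"
  by (intro measurable_compose[OF _ measurable_ennreal] N_shift_meas) measurable
 have "ennreal (U s x) = (nn_integral (G n 1) (%z. ennreal (sh s x z)))"
  unfolding U_def using s by (intro nn_integral_eq_integral[symmetric] sh_int AE_I2 sh_nonneg) simp
 also have "... = (nn_integral (G n 1) (%z. ennreal (N (%i. x i + (\<lambda>i\<in>{..<n}. sqrt s * z i) i))))"
  unfolding sh_def by (intro nn_integral_cong arg_cong[of _ _ ennreal] N_cong) simp
 also have "... = (nn_integral (distr (G n 1) (Bn n) (%z. \<lambda>i\<in>{..<n}. sqrt s * z i)) (%y. ennreal (N (%i. x i + y i))))"
  by (rule nn_integral_distr[OF m, symmetric]) (use Nm in simp)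
 also have "distr (G n 1) (Bn n) (%z. \<lambda>i\<in>{..<n}. sqrt s * z i) = G n s"
  using G_scale[of 1 "%_. sqrt s" s n] s by simp
 finally show ?thesis .
qed

lemma U_zero: "0 <= s ==> U s (%_. 0) = sqrt s * gN"
proof -
 assume "0 <= s"
 hence "sh s (%_. 0) z = sqrt s * N z" for z unfolding sh_def using N_scale[of "sqrt s" z] by simp
 hence "sh s (%_. 0) = (%z. sqrt s * N z)" by (intro ext)
 thus ?thesis unfolding U_def gN_def by simp
qed

lemma gauge_nn: "0 < s ==> (nn_integral (G n s) (%y. ennreal (N y))) = ennreal (sqrt s * gN)"
 using U_nn[of s "%_. 0"] U_zero[of s] by simp

lemma U_semigroup:
 assumes s: "0 < s" "0 < \<theta>"
 shows "U (s + \<theta>) x = (LINT z|G n 1. U s (%i. x i + sqrt \<theta> * z i))"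
  "integrable (G n 1) (%z. U s (%i. x i + sqrt \<theta> * z i))"
proof -
 have s0: "0 <= s" using s by simp
 let ?g = "%z. U s (%i. x i + sqrt \<theta> * z i)"
 have gm: "?g \<in> borel_measurable (G n 1)"
 proof -
  have "(%z. U s (\<lambda>i\<in>{..<n}. x i + sqrt \<theta> * z i)) \<in> borel_measurable (G n 1)"
   by (rule measurable_compose[OF restrict_meas U_meas[OF s0]]) measurable
  moreover have "U s (\<lambda>i\<in>{..<n}. x i + sqrt \<theta> * z i) = ?g z" for z by (rule U_cong) simp
  ultimately show ?thesis by simp
 qed
 show int: "integrable (G n 1) ?g"
 proof (rule Bochner_Integration.integrable_bound[OF _ gm AE_I2])
  show "integrable (G n 1) (%z. sh \<theta> x z + sqrt s * gN)"
   by (intro Bochner_Integration.integrable_add sh_int one_int) (use s in simp)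
  show "norm (?g z) <= norm (sh \<theta> x z + sqrt s * gN)" for z
   using U_le[OF s0, of "%i. x i + sqrt \<theta> * z i"] U_nonneg[of s "%i. x i + sqrt \<theta> * z i"] unfolding sh_def by simp
 qed
 have m: "(%z. \<lambda>i\<in>{..<n}. sqrt \<theta> * z i) \<in> measurable (G n 1) (Bn n)"
  by (intro restrict_meas) measurable
 have Nm: "(%y. ennreal (N (%i. x i + y i))) \<in> borel_measurable (Bn n)"
  by (intro measurable_compose[OF _ measurable_ennreal] N_shift_meas) measurable
 have Um: "(%y. ennreal (U s (%i. x i + y i))) \<in> borel_measurable (Bn n)"
 proof -
  have "(%y. U s (\<lambda>i\<in>{..<n}. x i + y i)) \<in> borel_measurable (Bn n)"
   by (rule measurable_compose[OF restrict_meas U_meas[OF s0]]) measurable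
  moreover have "U s (\<lambda>i\<in>{..<n}. x i + y i) = U s (%i. x i + y i)" for y by (rule U_cong) simp
  ultimately show ?thesis by simp
 qed
 have "ennreal (U (s + \<theta>) x) = (nn_integral (G n (\<theta> + s)) (%y. ennreal (N (%i. x i + y i))))"
  using U_nn[of "s + \<theta>" x] s by (simp add: add.commute)
 also have "... = (\<integral>\<^sup>+a. \<integral>\<^sup>+b. ennreal (N (%i. x i + (\<lambda>i\<in>{..<n}. a i + b i) i)) \<partial>G n s \<partial>G n \<theta>)"
  by (rule G_conv[OF s(2,1) Nm, symmetric])
 also have "... = (\<integral>\<^sup>+a. \<integral>\<^sup>+b. ennreal (N (%i. (x i + a i) + b i)) \<partial>G n s \<partial>G n \<theta>)"
  by (intro nn_integral_cong arg_cong[of _ _ ennreal] N_cong) simp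
 also have "... = (nn_integral (G n \<theta>) (%a. ennreal (U s (%i. x i + a i))))"
  unfolding U_nn[OF s(1)] ..
 also have "... = (nn_integral (distr (G n 1) (Bn n) (%z. \<lambda>i\<in>{..<n}. sqrt \<theta> * z i)) (%a. ennreal (U s (%i. x i + a i))))"
  using G_scale[of 1 "%_. sqrt \<theta>" \<theta> n] s by simp
 also have "... = (nn_integral (G n 1) (%z. ennreal (U s (%i. x i + (\<lambda>i\<in>{..<n}. sqrt \<theta> * z i) i))))"
  by (rule nn_integral_distr[OF m]) (use Um in simp)
 also have "... = (nn_integral (G n 1) (%z. ennreal (?g z)))"
  by (intro nn_integral_cong arg_cong[of _ _ ennreal] U_cong) simp
 also have "... = ennreal (LINT z|G n 1. ?g z)"
  by (rule nn_integral_eq_integral[OF int]) (simp add: U_nonneg)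
 finally show "U (s + \<theta>) x = (LINT z|G n 1. ?g z)"
  by (subst (asm) ennreal_inj) (auto intro!: Bochner_Integration.integral_nonneg U_nonneg)
qed

lemma coord_int: "i < n ==> integrable (G n 1) (%z. z i)" "i < n ==> (LINT z|G n 1. z i) = 0"
 using G_marginal[of i n "%y. y"] nd_moments(1,2) by auto

lemma ab3: "ab z ^ 3 <= 6 * exp (1 * ab z)"
proof -
 obtain t where t: "exp (ab z) = (SUM m<4. ab z ^ m/fact m) + exp t/fact 4 * ab z ^ 4"
  using Maclaurin_exp_le[of "ab z" 4] by blast
 have "0 <= exp t/fact 4 * ab z ^ 4" by simp
 moreover have "ab z ^ 3/6 <= (SUM m<4. ab z ^ m/fact m)"
  using ab_nonneg[of z] by (simp add: numeral_eq_Suc fact_reduce)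
 ultimately have "ab z ^ 3/6 <= exp (ab z)" unfolding t by linarith
 thus ?thesis by simp
qed

text \<open>By the semigroup property \<open>U (s + \<theta>)\<close> averages \<open>U s\<close>
  over the displacements \<open>sqrt \<theta> z\<close>. In the Taylor polynomial the linear part
  averages to zero and the quadratic part to the trace; the cubic error contributes
  \<open>\<theta> * sqrt \<theta>\<close>.\<close>

lemma heat:
 assumes s: "0 < s0" "s0 <= s" "s <= s1" and M: "N x <= M" and \<theta>: "0 < \<theta>"
 shows "\<bar>U (s + \<theta>) x - (U s x + \<theta>/2*(SUM i<n. Q s x i i))\<bar> <= 6 * E 1 * KU s0 s1 M*(\<theta> * sqrt \<theta>)"
proof -
 have sp: "0 < s" using s by simp
 have K0: "0 <= KU s0 s1 M" using s M N_nonneg[of x] by (intro KU_nonneg) auto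
 let ?h = "%z i. sqrt \<theta> * z i"
 let ?T = "%z. tay s x (?h z)"
 have Tz: "?T = (%z. U s x + ((SUM i<n. (sqrt \<theta> * e1 s x i/sqrt s) * z i) + (SUM i<n. SUM j<n. (\<theta> * Q s x i j/2)*(z i * z j))))"
 proof
  fix z
  have e: "?h z i*?h z j * Q s x i j = \<theta> * Q s x i j*(z i * z j)" for i j
  proof -
   have "?h z i*?h z j * Q s x i j = (sqrt \<theta> * sqrt \<theta>) * Q s x i j*(z i * z j)" by (simp only: mult_ac)
   thus ?thesis using \<theta> by simp
  qed
  show "?T z = U s x + ((SUM i<n. (sqrt \<theta> * e1 s x i/sqrt s) * z i) + (SUM i<n. SUM j<n. (\<theta> * Q s x i j/2)*(z i * z j)))"
   unfolding tay_def e by (simp add: sum_divide_distrib mult_ac)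
 qed
 have "has_bochner_integral (G n 1) ?T (U s x + ((SUM i<n. (sqrt \<theta> * e1 s x i/sqrt s)*0) +
   (SUM i<n. SUM j<n. (\<theta> * Q s x i j/2)*(if i = j then 1 else 0))))"
  unfolding Tz by (intro has_bochner_integral_add has_bochner_integral_sum has_bochner_integral_mult_right)
   (auto simp only: has_bochner_integral_iff one_int coord_int G_moments lessThan_iff)
 hence iT: "integrable (G n 1) ?T" and e: "(LINT z|G n 1. ?T z) = U s x + \<theta>/2*(SUM i<n. Q s x i i)"
  by (simp_all add: has_bochner_integral_iff sum_distrib_left if_distrib cong: if_cong)
 have "\<bar>U (s + \<theta>) x - (U s x + \<theta>/2*(SUM i<n. Q s x i i))\<bar> =
   \<bar>\<integral>z. U s (%i. x i + ?h z i) - ?T z \<partial>G n 1\<bar>"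
  unfolding Bochner_Integration.integral_diff[OF U_semigroup(2)[OF sp \<theta>] iT] e U_semigroup(1)[OF sp \<theta>] ..
 also have "... <= (LINT z|G n 1. (6 * KU s0 s1 M*(\<theta> * sqrt \<theta>)) * exp (1 * ab z))"
 proof (rule int_abs_le)
  show "\<bar>U s (%i. x i + ?h z i) - ?T z\<bar> <= (6 * KU s0 s1 M*(\<theta> * sqrt \<theta>)) * exp (1 * ab z)" for z
  proof -
   have "ab (?h z) ^ 3 = (\<theta> * sqrt \<theta>) * ab z ^ 3"
    unfolding ab_scale using \<theta> by (simp add: power3_eq_cube)
   also have "... <= (\<theta> * sqrt \<theta>)*(6 * exp (1 * ab z))" using \<theta> by (intro mult_left_mono ab3) simp
   finally have "KU s0 s1 M * ab (?h z) ^ 3 <= KU s0 s1 M*((\<theta> * sqrt \<theta>)*(6 * exp (1 * ab z)))"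
    using K0 by (simp add: mult_left_mono)
   with U_expand[OF s M, of "?h z"] show ?thesis by simp
  qed
 qed (intro Bochner_Integration.integrable_diff U_semigroup sp \<theta> iT integrable_mult_right exp_ab_int)+
 also have "... = 6 * E 1 * KU s0 s1 M*(\<theta> * sqrt \<theta>)" unfolding E_def by simp
 finally show ?thesis .
qed

text \<open>Reflecting all coordinates except the \<open>i\<close>-th preserves the Gaussian, and
  \<open>z\<close> plus its reflection is \<open>2 z_i\<close> times the \<open>i\<close>-th basis
  vector. Subadditivity and integration give \<open>sqrt (2 / pi)\<close> times the sum on the left
  as a lower bound for \<open>2 gN\<close>.\<close>

lemma eb_gN: "i < n ==> N (eb i) + N (%j. - eb i j) <= 3 * gN"
proof -
 assume i: "i < n"
 let ?G = "G n 1"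
 let ?c = "%k. if k = i then 1 else -1 :: real"
 let ?A = "N (eb i)" and ?B = "N (%j. - eb i j)"
 have m: "(%z. \<lambda>k\<in>{..<n}. ?c k * z k) \<in> measurable ?G (Bn n)"
  by (intro restrict_meas) measurable
 have flip: "distr ?G (Bn n) (%z. \<lambda>k\<in>{..<n}. ?c k * z k) = ?G"
  using G_scale[of 1 ?c 1 n] by simp
 have f1: "gN = (LINT z|?G. N (\<lambda>k\<in>{..<n}. ?c k * z k))"
  unfolding gN_def by (subst flip[symmetric], rule integral_distr[OF m N_meas])
 have f2: "integrable ?G (%z. N (\<lambda>k\<in>{..<n}. ?c k * z k))"
  using integrable_distr_eq[OF m N_meas] N_int flip by simp
 have "(LINT z|?G. \<bar>z i\<bar>*(?A + ?B) + z i*(?A - ?B)) <= (LINT z|?G. N z + N (\<lambda>k\<in>{..<n}. ?c k * z k))"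
 proof (rule integral_mono)
  have "integrable (nd 1) (%y. \<bar>y\<bar>)" using nd_moments(1) by (rule integrable_abs)
  hence "integrable ?G (%z. \<bar>z i\<bar>)" using G_marginal(1)[OF i, of "%y. \<bar>y\<bar>"] by simp
  thus "integrable ?G (%z. \<bar>z i\<bar>*(?A + ?B) + z i*(?A - ?B))"
   using coord_int(1)[OF i] by (intro Bochner_Integration.integrable_add integrable_mult_left)
  show "integrable ?G (%z. N z + N (\<lambda>k\<in>{..<n}. ?c k * z k))" by (intro Bochner_Integration.integrable_add N_int f2)
  fix z
  have "N (%j. 2 * z i * eb i j) = N (%j. z j + (\<lambda>k\<in>{..<n}. ?c k * z k) j)"
   by (rule N_cong) (auto simp: eb_def)
  also have "... <= N z + N (\<lambda>k\<in>{..<n}. ?c k * z k)" by (rule N_add)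
  also have "N (%j. 2 * z i * eb i j) = \<bar>z i\<bar>*(?A + ?B) + z i*(?A - ?B)"
  proof (cases "0 <= z i")
   case True
   hence "N (%j. 2 * z i * eb i j) = (2 * z i)*?A" by (intro N_scale) simp
   thus ?thesis using True by (simp add: algebra_simps)
  next
   case False
   hence "N (%j. (- 2 * z i)*(- eb i j)) = (- 2 * z i)*?B" by (intro N_scale) simp
   thus ?thesis using False by (simp add: algebra_simps)
  qed
  finally show "\<bar>z i\<bar>*(?A + ?B) + z i*(?A - ?B) <= N z + N (\<lambda>k\<in>{..<n}. ?c k * z k)" .
 qed
 also have "(LINT z|?G. \<bar>z i\<bar>*(?A + ?B) + z i*(?A - ?B)) = sqrt (2/pi)*(?A + ?B)"
 proof -
  have ia: "integrable (nd 1) (%y. \<bar>y\<bar>)" using nd_moments(1) by (rule integrable_abs)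
  have a: "integrable ?G (%z. \<bar>z i\<bar>)" "(LINT z|?G. \<bar>z i\<bar>) = sqrt (2/pi)"
   using G_marginal[OF i ia] nd_moments(5) by auto
  show ?thesis
   using Bochner_Integration.integral_add[OF integrable_mult_left[OF a(1), of "?A + ?B"] integrable_mult_left[OF coord_int(1)[OF i], of "?A - ?B"]]
   by (simp add: a(2) coord_int(2)[OF i])
 qed
 also have "(LINT z|?G. N z + N (\<lambda>k\<in>{..<n}. ?c k * z k)) = 2 * gN"
  unfolding Bochner_Integration.integral_add[OF N_int f2] f1[symmetric] by (simp add: gN_def)
 finally have 1: "sqrt (2/pi)*(?A + ?B) <= 2 * gN" .
 have "2/3 <= sqrt (2/pi)"
 proof (rule real_le_rsqrt)
  have "pi <= 4" using pi_less_4 by simp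
  hence "2/4 <= 2/pi" by (intro divide_left_mono) auto
  thus "(2/3)^2 <= 2/pi" unfolding power2_eq_square by linarith
 qed
 hence "2/3*(?A + ?B) <= sqrt (2/pi)*(?A + ?B)"
  using N_nonneg[of "eb i"] N_nonneg[of "%j. - eb i j"] by (intro mult_right_mono) auto
 thus ?thesis using 1 by simp
qed

text \<open>Makes the Lipschitz constant comparable to the Gaussian mean, so that error terms in
  \<open>m\<close> can be absorbed; the factor \<open>n\<close> is harmless against the polynomially
  small tail.\<close>

lemma m_gN: "m <= 3 * n * gN"
proof -
 have "m <= (SUM i<n. 3 * gN)" unfolding m_def by (intro sum_mono eb_gN) simp
 thus ?thesis by simp
qed

end

section \<open>Comparison along the localization\<close>

context cube
begin

abbreviation cov2 where "cov2 w v \<equiv> SUM i<n. (SUM j<n. cov w i j * v j)^2"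

lemma good_cov2:
 assumes "Phi (2 ^ Suc m) w <= (1/2) ^ (2 ^ Suc m)"
 shows "cov2 w v <= 9/4*(SUM i<n. (v i)^2)"
  "1/4*(SUM i<n. (v i)^2) <= cov2 w v"
proof -
 define a where "a i = (SUM j<n. cov w i j * v j)" for i
 define b where "b = mv n (Bm w) v"
 have ab: "a i = v i + b i" if "i < n" for i
 proof -
  have "a i = (SUM j<n. Bm w i j * v j + (if j = i then v i else 0))"
   unfolding a_def using that by (intro sum.cong refl) (auto simp: Bm_def algebra_simps)
  thus ?thesis using that unfolding b_def mv_def by (simp add: sum.distrib)
 qed
 have op: "sqn n b <= 1/4 * sqn n v"
  using good_op[OF assms, of v] unfolding b_def by (simp add: power2_eq_square)
 have "sqn n a <= 3/2 * sqn n v + 3 * sqn n b" using ab by (rule sqn_add)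
 thus "cov2 w v <= 9/4*(SUM i<n. (v i)^2)"
  using op unfolding sqn_def a_def[symmetric] by simp
 have "sqn n v <= (SUM i<n. 2*(a i)^2 + 2*(b i)^2)"
  unfolding sqn_def
 proof (intro sum_mono)
  fix i assume "i \<in> {..<n}"
  moreover have "0 <= (a i + b i)^2" by simp
  ultimately show "(v i)^2 <= 2*(a i)^2 + 2*(b i)^2"
   using ab[of i] by (simp add: power2_eq_square algebra_simps)
 qed
 also have "... = 2 * sqn n a + 2 * sqn n b" unfolding sqn_def by (simp add: sum.distrib sum_distrib_left)
 finally show "1/4*(SUM i<n. (v i)^2) <= cov2 w v"
  using op unfolding sqn_def a_def[symmetric] by simp
qed

text \<open>For \<open>u = cov v\<close> the squared length of \<open>u\<close> is the covariance
  form at \<open>(u, v)\<close>. Cauchy--Schwarz for this form and the bound \<open>1 / t\<close> at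
  both arguments give the claim.\<close>

lemma slc_cov2:
 assumes s: "slc (%_. t) w" and t: "t > 0"
 shows "cov2 w v <= (1/t)^2*(SUM i<n. (v i)^2)"
proof -
 have w: "dns w" by (rule slc_dns[OF s])
 define u where "u i = (SUM j<n. cov w i j * v j)" for i
 have cauchy: "(SUM i<n. SUM j<n. u i * v j * cov w i j)^2 <=
   (SUM i<n. SUM j<n. u i * u j * cov w i j)*(SUM i<n. SUM j<n. v i * v j * cov w i j)"
  unfolding J_lin2[OF w, symmetric]
  using dns_pos[OF w] J_cauchy[of "lin w u" "lin w v" w]
  by (simp add: power2_eq_square less_imp_le dns_cont[OF w] cont_lin)
 define X Y where "X = (SUM i<n. (u i)^2)" and "Y = (SUM i<n. (v i)^2)"
 have X0: "0 <= X" "0 <= Y" unfolding X_def Y_def by (auto intro: sum_nonneg)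
 have "(SUM i<n. SUM j<n. u i * v j * cov w i j) = X"
  unfolding X_def u_def power2_eq_square by (simp add: sum_distrib_left mult_ac)
 hence "X^2 <= (SUM i<n. SUM j<n. u i * u j * cov w i j)*(SUM i<n. SUM j<n. v i * v j * cov w i j)"
  using cauchy by simp
 also have "... <= (1/t * X)*(1/t * Y)"
 proof (rule mult_mono)
  show "(SUM i<n. SUM j<n. u i * u j * cov w i j) <= 1/t * X" unfolding X_def by (rule cov_slc[OF s t])
  show "(SUM i<n. SUM j<n. v i * v j * cov w i j) <= 1/t * Y" unfolding Y_def by (rule cov_slc[OF s t])
  show "0 <= (SUM i<n. SUM j<n. v i * v j * cov w i j)"
   unfolding J_lin2[OF w, symmetric] using dns_pos[OF w]
   by (intro J_nonneg) (auto simp: less_imp_le intro!: continuous_intros dns_cont[OF w])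
 qed (use X0 t in auto)
 also have "... = X*((1/t)^2 * Y)" by (simp add: power2_eq_square)
 finally have "X * X <= X*((1/t)^2 * Y)" by (simp only: power2_eq_square)
 hence "X <= (1/t)^2 * Y"
  using X0 by (cases "X = 0") auto
 thus ?thesis unfolding X_def Y_def u_def .
qed

end

locale gauge_cube = cube n R + gauge n N for n R N

context gauge_cube
begin

text \<open>The coefficient of \<open>d\<close> when \<open>U s\<close> at the mean is averaged over
  the two tilts along \<open>i\<close>: the mean moves by the \<open>i\<close>-th row of the
  covariance times the tilt parameter.\<close>

definition drift :: "real => nat => ((nat => real) => real) => real" where
 "drift s i w = (SUM j<n. SUM k<n. Q s (mean w) j k*(cov w i j * cov w i k))/2"

lemma N_mean_le: "dns w ==> N (mean w) <= m*(n * R)"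
proof -
 assume w: "dns w"
 have "ab (mean w) <= (SUM i<n. R)" unfolding ab_def by (intro sum_mono mean_bound[OF w]) simp
 hence "m * ab (mean w) <= m*(n * R)" using m_nonneg by (intro mult_left_mono) auto
 thus ?thesis using N_le[of "mean w"] by linarith
qed

lemma cov_bounds:
 "EX C>=0. (ALL w i j. dns w --> i < n --> j < n --> \<bar>cov w i j\<bar> <= C) &
  (ALL w i j k. dns w --> i < n --> j < n --> k < n --> \<bar>cov w i j * cov w i k\<bar> <= C) &
  (ALL w r l i j k. dns w --> rok r --> l < n --> i < n --> j < n --> k < n -->
   \<bar>cov (tilt r l w) i j * cov (tilt r l w) i k - cov w i j * cov w i k\<bar> <= C*\<bar>r\<bar>)"
proof -
 let ?S = "{..<n} \<times> {..<n} \<times> {..<n}"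
 have "EX K>=0. (\<forall>a\<in>?S. ALL w. dns w --> \<bar>(%(i, j, k) w. cov w i j * cov w i k) a w\<bar> <= K) &
  (\<forall>a\<in>?S. ALL w r l. dns w --> rok r --> l < n --> \<bar>(%(i, j, k) w. cov w i j * cov w i k) a (tilt r l w) - (%(i, j, k) w. cov w i j * cov w i k) a w\<bar> <= K*\<bar>r\<bar>)"
  by (rule lipf_bounds_set) (auto intro: lipf_mult lipf_cov)
 then obtain K where K: "K >= 0" "ALL i<n. ALL j<n. ALL k<n. ALL w. dns w --> \<bar>cov w i j * cov w i k\<bar> <= K"
  "ALL i<n. ALL j<n. ALL k<n. ALL w r l. dns w --> rok r --> l < n --> \<bar>cov (tilt r l w) i j * cov (tilt r l w) i k - cov w i j * cov w i k\<bar> <= K*\<bar>r\<bar>"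
  by auto
 let ?T = "{..<n} \<times> {..<n}"
 have "EX K>=0. (\<forall>a\<in>?T. ALL w. dns w --> \<bar>(%(i, j) w. cov w i j) a w\<bar> <= K) &
  (\<forall>a\<in>?T. ALL w r l. dns w --> rok r --> l < n --> \<bar>(%(i, j) w. cov w i j) a (tilt r l w) - (%(i, j) w. cov w i j) a w\<bar> <= K*\<bar>r\<bar>)"
  by (rule lipf_bounds_set) (auto intro: lipf_cov)
 then obtain L where L: "L >= 0" "ALL i<n. ALL j<n. ALL w. dns w --> \<bar>cov w i j\<bar> <= L"
  by auto
 show ?thesis
 proof (intro exI[of _ "K + L"] conjI allI impI)
  show "\<bar>cov w i j\<bar> <= K + L" if "dns w" "i < n" "j < n" for w i j
   using L that K(1) by (meson add_increasing order_trans)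
  show "\<bar>cov w i j * cov w i k\<bar> <= K + L" if "dns w" "i < n" "j < n" "k < n" for w i j k
   using K(2)[rule_format, OF that(2,3,4,1)] L(1) by linarith
  show "\<bar>cov (tilt r l w) i j * cov (tilt r l w) i k - cov w i j * cov w i k\<bar> <= (K + L)*\<bar>r\<bar>"
   if "dns w" "rok r" "l < n" "i < n" "j < n" "k < n" for w r l i j k
   using K(3)[rule_format, OF that(4,5,6,1,2,3)] mult_right_mono[of K "K + L" "\<bar>r\<bar>"] L(1) by linarith
 qed (use K L in auto)
qed

text \<open>The mean moves exactly linearly under a tilt, so the expansion of \<open>U s\<close>
  applies with the displacement \<open>sqrt d\<close> times a row of the covariance. On the box all
  quantities in its error are bounded independently of \<open>s\<close>, \<open>w\<close> and
  \<open>d\<close>.\<close>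

lemma U_sweep:
 assumes s: "0 < s0" "s0 <= s1"
 shows "EX C>=0. ALL s w d. s0 <= s --> s <= s1 --> dns w --> 0 <= d --> rok (sqrt d) -->
  \<bar>sw d [0..<n] (%w. U s (mean w)) w - (U s (mean w) + d*(SUM i<n. drift s i w))\<bar> <= C*(d * sqrt d)"
proof -
 obtain C where C: "C >= 0" "!!w i j. dns w ==> i < n ==> j < n ==> \<bar>cov w i j\<bar> <= C"
  "!!w i j k. dns w ==> i < n ==> j < n ==> k < n ==> \<bar>cov w i j * cov w i k\<bar> <= C"
  "!!w r l i j k. dns w ==> rok r ==> l < n ==> i < n ==> j < n ==> k < n ==>
   \<bar>cov (tilt r l w) i j * cov (tilt r l w) i k - cov w i j * cov w i k\<bar> <= C*\<bar>r\<bar>"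
  using cov_bounds by blast
 define M where "M = m*(n * R)"
 have M: "N (mean w) <= M" if "dns w" for w unfolding M_def by (rule N_mean_le[OF that])
 have M0: "0 <= M" unfolding M_def using m_nonneg R_pos by simp
 define KQ where "KQ = (M + sqrt s1 * m)*3 * E 2/s0"
 define KL where "KL = m*(n * C)*3 * E 1/s0"
 have s10: "0 < s1" using s by simp
 have KQ0: "0 <= KQ" "0 <= KL" unfolding KQ_def KL_def using M0 m_nonneg E_nonneg C(1) s s10
  by (auto intro!: add_nonneg_nonneg)
 define K where "K = KU s0 s1 M*(n * C) ^ 3"
 have K0: "0 <= K" unfolding K_def using KU_nonneg[OF s M0] C(1) by simp
 define L where "L = n*(n*(KL * C + KQ * C))"
 have L0: "0 <= L" unfolding L_def using KQ0 C(1) by simp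
 have tilt_mean: "mean (tilt r l w) i = mean w i + r * cov w l i" if "dns w" "rok r" "l < n" "i < n" for r l w i
  using mean_tilt that by blast
 have step: "\<bar>sw d [0..<n] (%w. U s (mean w)) w - (U s (mean w) + d*(\<Sum>i\<leftarrow>[0..<n]. drift s i w))\<bar>
   <= length [0..<n]*(K + length [0..<n] * L)*(d * sqrt d)"
  if ss: "s0 <= s" "s <= s1" and w: "dns w" and d: "0 <= d" "rok (sqrt d)" for s w d
 proof (rule sweep_expansion[OF _ K0 _ L0 d _ w])
  have sp: "0 < s" using ss s by simp
  have d': "rok (- sqrt d)" using d unfolding rok_def by simp
  show "\<bar>(U s (mean (tilt (sqrt d) i w)) + U s (mean (tilt (- sqrt d) i w)))/2 - (U s (mean w) + d * drift s i w)\<bar> <= K*(d * sqrt d)"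
   if w: "dns w" and i: "i < n" for w i
  proof -
   let ?x = "mean w" and ?h = "%j. sqrt d * cov w i j"
   have e: "U s (mean (tilt (sqrt d) i w)) = U s (%j. ?x j + ?h j)" "U s (mean (tilt (- sqrt d) i w)) = U s (%j. ?x j + - ?h j)"
    using tilt_mean[OF w d(2) i] tilt_mean[OF w d' i] by (auto intro!: U_cong)
   have abh: "ab ?h <= sqrt d*(n * C)" "ab (%j. - ?h j) <= sqrt d*(n * C)"
   proof -
    have "ab (cov w i) <= (SUM j<n. C)" unfolding ab_def by (intro sum_mono C(2) w i) simp
    hence "\<bar>sqrt d\<bar> * ab (cov w i) <= sqrt d*(n * C)" using d(1) by (intro mult_mono) (auto simp: ab_nonneg)
    thus "ab ?h <= sqrt d*(n * C)" "ab (%j. - ?h j) <= sqrt d*(n * C)"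
     unfolding ab_scale[symmetric] by (auto simp: ab_def)
   qed
   have cube: "ab h ^ 3 <= (n * C) ^ 3*(d * sqrt d)" if "ab h <= sqrt d*(n * C)" for h
   proof -
    have "ab h ^ 3 <= (sqrt d*(n * C)) ^ 3" using that ab_nonneg by (intro power_mono)
    also have "... = (n * C) ^ 3*(sqrt d * sqrt d * sqrt d)" by (simp only: power_mult_distrib power3_eq_cube mult_ac)
    finally show ?thesis using d(1) by simp
   qed
   have KUn: "0 <= KU s0 s1 M" by (rule KU_nonneg[OF s M0])
   have b: "\<bar>U s (%j. ?x j + h j) - tay s ?x h\<bar> <= K*(d * sqrt d)" if "ab h <= sqrt d*(n * C)" for h
    using U_expand[OF s(1) ss M[OF w], of h] mult_left_mono[OF cube[OF that] KUn] unfolding K_def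
    by (simp add: mult.assoc)
   have t: "(tay s ?x ?h + tay s ?x (%j. - ?h j))/2 = U s ?x + d * drift s i w"
   proof -
    have e: "sqrt d * a*(sqrt d * b) * c = d*(c*(a * b))" for a b c
    proof -
     have "sqrt d * a*(sqrt d * b) * c = (sqrt d * sqrt d)*(c*(a * b))" by (simp only: mult_ac)
     thus ?thesis using d(1) by simp
    qed
    have q: "(SUM j<n. SUM k<n. ?h j*?h k * Q s ?x j k) = d*(2 * drift s i w)"
     unfolding drift_def e by (simp add: sum_distrib_left[symmetric])
    have q': "(SUM j<n. SUM k<n. - ?h j * - ?h k * Q s ?x j k) = d*(2 * drift s i w)"
     using q by simp
    have "(SUM j<n. - ?h j * e1 s ?x j) = - (SUM j<n. ?h j * e1 s ?x j)" by (simp add: sum_negf)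
    thus ?thesis
     unfolding tay_def q q' by simp
   qed
   show ?thesis
    using b[OF abh(1)] b[OF abh(2)] unfolding e t[symmetric] by (simp add: abs_le_iff field_simps)
  qed
  show "\<bar>drift s j (tilt r i w) - drift s j w\<bar> <= L*\<bar>r\<bar>"
   if j: "j < n" and w: "dns w" and r: "rok r" and i: "i < n" for j w r i
  proof -
   let ?w = "tilt r i w"
   have w': "dns ?w" by (rule tilt_dns) (use w r i in auto)
   have q: "\<bar>Q s (mean ?w) a b*(cov ?w j a * cov ?w j b) - Q s (mean w) a b*(cov w j a * cov w j b)\<bar> <= (KL * C + KQ * C)*\<bar>r\<bar>"
    if ab': "a < n" "b < n" for a b
   proof -
    have "ab (%k. mean ?w k - mean w k) <= (SUM k<n. \<bar>r\<bar> * C)"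
     unfolding ab_def
    proof (intro sum_mono)
     fix k assume "k \<in> {..<n}"
     thus "\<bar>mean ?w k - mean w k\<bar> <= \<bar>r\<bar> * C"
      using tilt_mean[OF w r i, of k] C(2)[OF w i, of k] by (simp add: abs_mult mult_left_mono)
    qed
    hence "m * ab (%k. mean ?w k - mean w k)*3 * E 1/s <= m*(n*(\<bar>r\<bar> * C))*3 * E 1/s0"
     using ss s m_nonneg E_nonneg C(1) by (intro frac_le mult_right_mono mult_left_mono mult_nonneg_nonneg) auto
    hence 1: "\<bar>Q s (mean ?w) a b - Q s (mean w) a b\<bar> <= KL*\<bar>r\<bar>"
     using Q_lip[OF sp ab', of "mean ?w" "mean w"] unfolding KL_def by (simp add: mult_ac)
    have 2: "\<bar>Q s (mean w) a b\<bar> <= KQ"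
    proof -
     have "(N (mean w) + sqrt s * m)*3 * E 2/s <= KQ"
      unfolding KQ_def using ss s M[OF w] M0 m_nonneg E_nonneg
      by (intro frac_le mult_right_mono add_mono mult_nonneg_nonneg add_nonneg_nonneg) auto
     thus ?thesis using Q_bound[OF sp ab', of "mean w"] by linarith
    qed
    have "Q s (mean ?w) a b*(cov ?w j a * cov ?w j b) - Q s (mean w) a b*(cov w j a * cov w j b) =
     (Q s (mean ?w) a b - Q s (mean w) a b)*(cov ?w j a * cov ?w j b) + Q s (mean w) a b*(cov ?w j a * cov ?w j b - cov w j a * cov w j b)"
     by (simp add: algebra_simps)
    also have "\<bar>...\<bar> <= (KL*\<bar>r\<bar>) * C + KQ*(C*\<bar>r\<bar>)"
     using 1 2 C(3)[OF w' j ab'] C(4)[OF w r i j ab'] KQ0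
     by (intro order_trans[OF abs_triangle_ineq] add_mono) (simp_all only: abs_mult, auto intro!: mult_mono)
    finally show ?thesis by (simp add: algebra_simps)
   qed
   have "\<bar>(SUM a<n. SUM b<n. Q s (mean ?w) a b*(cov ?w j a * cov ?w j b)) - (SUM a<n. SUM b<n. Q s (mean w) a b*(cov w j a * cov w j b))\<bar>
     <= (SUM a<n. SUM b<n. (KL * C + KQ * C)*\<bar>r\<bar>)"
    unfolding sum_subtractf[symmetric]
    by (intro order_trans[OF sum_abs] sum_mono q) auto
   also have "... = L*\<bar>r\<bar>" unfolding L_def by simp
   finally show ?thesis using L0 unfolding drift_def by (simp add: abs_le_iff)
  qed
 qed auto
 have sl: "(\<Sum>i\<leftarrow>[0..<n]. drift s i w) = (SUM i<n. drift s i w)" for s w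
  by (simp add: sum_list_distinct_conv_sum_set lessThan_atLeast0)
 show ?thesis
  using step K0 L0 unfolding sl by (intro exI[of _ "length [0..<n]*(K + length [0..<n] * L)"]) auto
qed

lemma trQ_nonneg: "0 < s ==> 0 <= (SUM i<n. Q s x i i)"
proof (intro sum_nonneg)
 fix i assume s: "0 < s" and i: "i \<in> {..<n}"
 have "(SUM a<n. SUM b<n. eb i a * eb i b * Q s x a b) = Q s x i i"
 proof -
  have "(SUM a<n. SUM b<n. eb i a * eb i b * Q s x a b) = (SUM a<n. SUM b<n. if b = i then if a = i then Q s x i i else 0 else 0)"
   by (intro sum.cong refl) (simp add: eb_def)
  thus ?thesis using i by simp
 qed
 thus "0 <= Q s x i i" using Q_psd[OF s, of "eb i" x] by simp
qed

text \<open>Heat flow for a time \<open>\<theta>\<close> adds \<open>\<theta> / 2 * tr Q\<close>,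
  while a sweep adds \<open>d / 2 * tr (Q cov^2)\<close>; \<open>psd_trace_gram\<close> compares the
  two. The bound \<open>\<Lambda>\<close> makes the error of the heat flow comparable to
  \<open>d * sqrt d\<close> too.\<close>

lemma U_step:
 assumes s: "0 < s0" "s0 <= s1" and \<Lambda>: "0 <= \<Lambda>"
 shows "EX C>=0. \<forall>s w d \<theta> c. s0 <= s --> s <= s1 --> dns w --> 0 <= d --> rok (sqrt d) --> 0 < \<theta> --> \<theta> <= \<Lambda> * d -->
  ((ALL v. c*(SUM i<n. (v i)^2) <= cov2 w v) --> \<theta> <= c * d -->
   U (s + \<theta>) (mean w) <= sw d [0..<n] (%w. U s (mean w)) w + C*(d * sqrt d)) &
  ((ALL v. cov2 w v <= c*(SUM i<n. (v i)^2)) --> c * d <= \<theta> -->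
   sw d [0..<n] (%w. U s (mean w)) w <= U (s + \<theta>) (mean w) + C*(d * sqrt d))"
proof -
 obtain C where C: "C >= 0" "!!s w d. s0 <= s ==> s <= s1 ==> dns w ==> 0 <= d ==> rok (sqrt d) ==>
  \<bar>sw d [0..<n] (%w. U s (mean w)) w - (U s (mean w) + d*(SUM i<n. drift s i w))\<bar> <= C*(d * sqrt d)"
  using U_sweep[OF s] by blast
 define M where "M = m*(n * R)"
 have M: "N (mean w) <= M" if "dns w" for w unfolding M_def by (rule N_mean_le[OF that])
 have M0: "0 <= M" unfolding M_def using m_nonneg R_pos by simp
 define K where "K = 6 * E 1 * KU s0 s1 M"
 have K0: "0 <= K" unfolding K_def using KU_nonneg[OF s M0] E_nonneg[of 1] by simp
 show ?thesis
 proof (rule exI[of _ "C + K*(\<Lambda> * sqrt \<Lambda>)"], rule conjI, use C(1) K0 \<Lambda> in simp, intro allI impI)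
  fix s w d \<theta> c assume ss: "s0 <= s" "s <= s1" and w: "dns w" and d: "0 <= d" "rok (sqrt d)" and \<theta>: "0 < \<theta>" "\<theta> <= \<Lambda> * d"
  let ?T = "SUM i<n. Q s (mean w) i i" and ?D = "SUM i<n. drift s i w"
  have "\<theta> * sqrt \<theta> <= (\<Lambda> * d) * sqrt (\<Lambda> * d)" using \<theta> by (intro mult_mono) auto
  also have "... = (\<Lambda> * sqrt \<Lambda>)*(d * sqrt d)" by (simp add: real_sqrt_mult)
  finally have "K*(\<theta> * sqrt \<theta>) <= K*((\<Lambda> * sqrt \<Lambda>)*(d * sqrt d))" using K0 by (rule mult_left_mono)
  with heat[OF s(1) ss M[OF w] \<theta>(1)]
  have h: "\<bar>U (s + \<theta>) (mean w) - (U s (mean w) + \<theta>/2*?T)\<bar> <= K*((\<Lambda> * sqrt \<Lambda>)*(d * sqrt d))"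
   unfolding K_def by (rule order_trans)
  have e: "(C + K*(\<Lambda> * sqrt \<Lambda>))*(d * sqrt d) = C*(d * sqrt d) + K*((\<Lambda> * sqrt \<Lambda>)*(d * sqrt d))"
   by (simp only: distrib_right mult.assoc)
  have sp: "0 < s" using ss s by simp
  have psd: "psd_on {..<n} (Q s (mean w))" unfolding psd_on_def using Q_psd[OF sp] by blast
  have D: "(SUM i<n. SUM j<n. SUM k<n. Q s (mean w) j k*(cov w i j * cov w i k)) = 2*?D"
   unfolding drift_def sum_divide_distrib[symmetric] by simp
  note g = psd_trace_gram[OF Q_sym psd, where A = "cov w", unfolded D]
  have up: "d*?D <= \<theta>/2*?T" if "ALL v. cov2 w v <= c*(SUM i<n. (v i)^2)" "c * d <= \<theta>"
   using mult_left_mono[OF g(1)[OF that(1)[rule_format]] d(1)] mult_right_mono[OF that(2) trQ_nonneg[OF sp, of "mean w"]]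
   by (simp add: mult_ac)
  have lo: "\<theta>/2*?T <= d*?D" if "ALL v. c*(SUM i<n. (v i)^2) <= cov2 w v" "\<theta> <= c * d"
   using mult_left_mono[OF g(2)[OF that(1)[rule_format]] d(1)] mult_right_mono[OF that(2) trQ_nonneg[OF sp, of "mean w"]]
   by (simp add: mult_ac)
  show "((ALL v. c*(SUM i<n. (v i)^2) <= cov2 w v) --> \<theta> <= c * d -->
    U (s + \<theta>) (mean w) <= sw d [0..<n] (%w. U s (mean w)) w + (C + K*(\<Lambda> * sqrt \<Lambda>))*(d * sqrt d)) &
   ((ALL v. cov2 w v <= c*(SUM i<n. (v i)^2)) --> c * d <= \<theta> -->
    sw d [0..<n] (%w. U s (mean w)) w <= U (s + \<theta>) (mean w) + (C + K*(\<Lambda> * sqrt \<Lambda>))*(d * sqrt d))"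
   unfolding e using C(2)[OF ss w d] h lo up by (smt (verit, best))
 qed
qed

end

section \<open>Tangent planes of the heat flow\<close>

context gauge
begin

lemma U_convex:
 assumes s: "0 <= s" and e: "0 <= e" "e <= 1"
 shows "U s (%i. x i + e * h i) <= (1 - e) * U s x + e * U s (%i. x i + h i)"
proof -
 have "U s (%i. x i + e * h i) <= (LINT z|G n 1. (1 - e) * sh s x z + e * sh s (%i. x i + h i) z)"
  unfolding U_def
 proof (rule integral_mono)
  show "sh s (%i. x i + e * h i) z <= (1 - e) * sh s x z + e * sh s (%i. x i + h i) z" for z
  proof -
   have "N (%i. x i + e * h i + sqrt s * z i) = N (%i. (1 - e)*(x i + sqrt s * z i) + e*(x i + h i + sqrt s * z i))"
    by (rule N_cong) (simp add: algebra_simps)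
   also have "... <= N (%i. (1 - e)*(x i + sqrt s * z i)) + N (%i. e*(x i + h i + sqrt s * z i))" by (rule N_add)
   finally show ?thesis unfolding sh_def using N_scale e by simp
  qed
 qed (intro Bochner_Integration.integrable_add integrable_mult_right sh_int s)+
 also have "... = (1 - e) * U s x + e * U s (%i. x i + h i)"
  unfolding U_def by (subst Bochner_Integration.integral_add) (auto intro!: sh_int s)
 finally show ?thesis .
qed

text \<open>Convexity along the segment bounds \<open>U s\<close> at the fraction \<open>e\<close>
  of the displacement by the chord, and the Taylor expansion there identifies the slope as
  \<open>e\<close> tends to zero.\<close>

lemma U_grad:
 assumes s: "0 < s"
 shows "U s x + (SUM i<n. h i * e1 s x i)/sqrt s <= U s (%i. x i + h i)"
proof -
 define g where "g = (SUM i<n. h i * e1 s x i)/sqrt s"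
 define q where "q = (SUM i<n. SUM j<n. h i * h j * Q s x i j)/2"
 define K where "K = KU s s (N x) * ab h ^ 3"
 have K0: "0 <= K" unfolding K_def using KU_nonneg[OF s order_refl N_nonneg[of x]] ab_nonneg[of h] by simp
 have q0: "0 <= q" unfolding q_def using Q_psd[OF s, of h x] by simp
 have "U s x + g <= U s (%i. x i + h i) + \<epsilon>" if \<epsilon>: "0 < \<epsilon>" for \<epsilon>
 proof -
  define e where "e = min 1 (\<epsilon>/(K + 1))"
  have e: "0 < e" "e <= 1" "e * K <= \<epsilon>"
  proof -
   show "0 < e" "e <= 1" unfolding e_def using \<epsilon> K0 by auto
   have "e * K <= \<epsilon>/(K + 1) * K" unfolding e_def using K0 by (intro mult_right_mono) auto
   also have "... <= \<epsilon>" using \<epsilon> K0 by (simp add: field_simps)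
   finally show "e * K <= \<epsilon>" .
  qed
  have t: "tay s x (%i. e * h i) = U s x + e * g + e^2 * q"
   unfolding tay_def g_def q_def by (simp add: sum_distrib_left power2_eq_square mult_ac)
  have a: "ab (%i. e * h i) = e * ab h" using ab_scale[of e h] e by simp
  have "\<bar>U s (%i. x i + e * h i) - (U s x + e * g + e^2 * q)\<bar> <= e ^ 3 * K"
   using U_expand[OF s order_refl order_refl order_refl, of x "%i. e * h i"] unfolding t a K_def by (simp add: power_mult_distrib mult_ac)
  moreover have "U s (%i. x i + e * h i) <= (1 - e) * U s x + e * U s (%i. x i + h i)"
   using s e by (intro U_convex) auto
  moreover have "0 <= e^2 * q" using q0 by simp
  moreover have "e ^ 3 * K <= e*\<epsilon>"
  proof -
   have "e^2 * K <= e * K" using e K0 by (intro mult_right_mono) (auto simp: power2_eq_square)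
   hence "e^2 * K <= \<epsilon>" using e(3) by linarith
   hence "e*(e^2 * K) <= e*\<epsilon>" using e(1) by (intro mult_left_mono) auto
   thus ?thesis by (simp add: power2_eq_square power3_eq_cube mult_ac)
  qed
  ultimately have "e*(U s x + g) <= e*(U s (%i. x i + h i) + \<epsilon>)"
   unfolding left_diff_distrib distrib_left by linarith
  thus ?thesis using e(1) by simp
 qed
 thus ?thesis unfolding g_def[symmetric] by (rule field_le_epsilon)
qed

end

section \<open>Backward induction over sweeps, and bounds outside the good event\<close>

context cube
begin

text \<open>Backward induction in time. A sweep of size \<open>d\<close> raises the log-concavity by
  \<open>d / 2\<close>, so \<open>L\<close> sweeps with \<open>L * (d / 2) = T - t0\<close> end
  exactly at \<open>T\<close>, and the errors add up to \<open>2 (T - t0) C sqrt d\<close>. The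
  first alternative in \<open>step\<close> stops a branch at once; this is compatible with later
  averages because sweeps preserve integrals against \<open>f\<close>.\<close>

lemma engine:
 assumes t: "t0 < T" and C: "0 <= C" "0 < d0" and f: "continuous_on box f"
  and step: "!!t w d. t0 <= t ==> t + d/2 <= T ==> slc (%_. t) w ==> 0 < d ==> d <= d0 ==> rok (sqrt d) ==>
   V t w <= J (%x. w x * f x) | V t w <= sw d [0..<n] (V (t + d/2)) w + C*(d * sqrt d)"
  and fin: "!!w. slc (%_. T) w ==> V T w <= J (%x. w x * f x)"
  and w: "slc (%_. t0) w"
 shows "V t0 w <= J (%x. w x * f x)"
proof (rule field_le_epsilon)
 fix \<epsilon> :: real assume \<epsilon>: "0 < \<epsilon>"
 define a where "a = 2*(T - t0) * C"
 \<comment> \<open>The three bounds ensure that the step size is allowed, that the tilts are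
   admissible, and that the total error \<open>a * sqrt d\<close> is at most
   \<open>\<epsilon>\<close>.\<close>
 define \<delta> where "\<delta> = min d0 (min ((1/(8 * R))^2) ((\<epsilon>/(a + 1))^2))"
 have a0: "0 <= a" unfolding a_def using t C by simp
 have \<delta>: "0 < \<delta>" unfolding \<delta>_def using C(2) R_pos \<epsilon> a0 by simp
 obtain L :: nat where L: "2*(T - t0)/\<delta> < L" using reals_Archimedean2 by blast
 have Lp: "0 < real L" using L \<delta> t by (smt (verit) divide_pos_pos)
 define d where "d = 2*(T - t0)/L"
 have d: "0 < d" "d <= \<delta>" "L*(d/2) = T - t0"
  using L Lp \<delta> t unfolding d_def by (auto simp: field_simps)
 have dd: "d <= d0" using d(2) unfolding \<delta>_def by simp
 have sd: "sqrt d <= 1/(8 * R)" "sqrt d <= \<epsilon>/(a + 1)"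
 proof -
  have "d <= (1/(8 * R))^2" "d <= (\<epsilon>/(a + 1))^2" using d(2) unfolding \<delta>_def by auto
  thus "sqrt d <= 1/(8 * R)" "sqrt d <= \<epsilon>/(a + 1)"
   using R_pos \<epsilon> a0 by (auto intro!: real_le_lsqrt)
 qed
 have rk: "rok (sqrt d)" using sd(1) R_pos d(1) unfolding rok_def by (simp add: field_simps)
 define e where "e = C*(d * sqrt d)"
 define tt where "tt k = t0 + real k*(d/2)" for k
 have ttS: "tt k + d/2 = tt (Suc k)" for k unfolding tt_def by (simp add: algebra_simps)
 have ttL: "tt L = T" unfolding tt_def d(3) by simp
 have "ALL w. slc (%_. tt k) w --> V (tt k) w <= J (%x. w x * f x) + real (L - k) * e" if "k <= L" for k
  using that
 proof (induction k rule: inc_induct)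
  case base
  thus ?case using fin unfolding ttL by simp
 next
  case (step k)
  show ?case
  proof (intro allI impI)
   fix w assume w: "slc (%_. tt k) w"
   have dw: "dns w" by (rule slc_dns[OF w])
   have e0: "0 <= e" unfolding e_def using C d by simp
   have "tt k <= T"
   proof -
    have "real k*(d/2) <= real L*(d/2)" using step(2) d(1) by (intro mult_right_mono) auto
    thus ?thesis unfolding tt_def using d(3) by simp
   qed
   have tT: "tt k + d/2 <= T"
   proof -
    have "real (Suc k)*(d/2) <= real L*(d/2)" using step(2) d(1) by (intro mult_right_mono) auto
    thus ?thesis unfolding ttS unfolding tt_def using d(3) by simp
   qed
   have t0k: "t0 <= tt k" unfolding tt_def using d(1) by simp
   from assms(5)[OF t0k tT w d(1) dd rk]
   show "V (tt k) w <= J (%x. w x * f x) + real (L - k) * e"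
   proof
    assume "V (tt k) w <= J (%x. w x * f x)"
    moreover have "0 <= real (L - k) * e" using e0 by simp
    ultimately show ?thesis by linarith
   next
    assume 1: "V (tt k) w <= sw d [0..<n] (V (tt k + d/2)) w + C*(d * sqrt d)"
    have "sw d [0..<n] (V (tt (Suc k))) w <= sw d [0..<n] (%w. 1 * J (%x. w x * f x) + 0 * J (%x. w x * f x) + real (L - Suc k) * e) w"
    proof (rule sweep_mono[OF _ w _ rk])
     fix u assume "slc (%_. tt k + d/2) u"
     thus "V (tt (Suc k)) u <= 1 * J (%x. u x * f x) + 0 * J (%x. u x * f x) + real (L - Suc k) * e"
      using step.IH unfolding ttS by simp
    qed (use d in simp)
    also have "... = J (%x. w x * f x) + real (L - Suc k) * e"
     unfolding sw_lin by (subst (1 2) sw_J[OF dw rk _ f]) auto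
    finally have "V (tt k) w <= J (%x. w x * f x) + real (L - Suc k) * e + e"
     using 1 unfolding ttS e_def by linarith
    moreover have "real (L - k) = real (L - Suc k) + 1" using step(2) by simp
    ultimately show ?thesis by (simp only: distrib_right mult_1)
   qed
  qed
 qed
 from this[of 0] w have "V t0 w <= J (%x. w x * f x) + real L * e" unfolding tt_def by simp
 moreover have "real L * e = a * sqrt d"
 proof -
  have "real L * e = 2*(L*(d/2))*(C * sqrt d)" unfolding e_def by simp
  thus ?thesis unfolding d(3) a_def by simp
 qed
 moreover have "a * sqrt d <= a*(\<epsilon>/(a + 1))" using sd a0 by (intro mult_left_mono) auto
 moreover have "a*(\<epsilon>/(a + 1)) <= \<epsilon>" using a0 \<epsilon> by (simp add: field_simps)
 ultimately show "V t0 w <= J (%x. w x * f x) + \<epsilon>" by linarith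
qed

lemma Phi_nonneg: "0 <= Phi (2 ^ Suc p) w"
 unfolding Phi_def using tr_even[OF ss_Bm, of w "2 ^ p"] fr_nonneg by simp

lemma bad_Psi:
 assumes "~ Phi (2 ^ Suc p) w <= (1/2) ^ (2 ^ Suc p)"
 shows "2 ^ (2 ^ Suc p) <= Psi (2 ^ Suc p) w"
proof -
 let ?q = "2 ^ Suc p :: nat"
 have "4 ^ ?q*(1/2) ^ ?q <= 4 ^ ?q * Phi ?q w" using assms by (intro mult_left_mono) auto
 moreover have "4 ^ ?q*(1/2) ^ ?q = (2 ^ ?q :: real)" by (simp add: power_mult_distrib[symmetric])
 ultimately show ?thesis unfolding Psi_def by (simp del: power_Suc)
qed

text \<open>With \<open>\<beta> = Psi / 2^q >= 1\<close> one has
  \<open>Phi <= \<beta> <= \<beta>^q\<close>, so the variances are at most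
  \<open>1 + \<beta>\<close>. The result is linear in \<open>Psi\<close>, as needed for a bound
  whose growth is controlled on average.\<close>

lemma bad_cov:
 assumes bad: "~ Phi (2 ^ Suc p) w <= (1/2) ^ (2 ^ Suc p)" and j: "j < n"
 shows "sqrt (cov w j j) <= 2 * Psi (2 ^ Suc p) w/2 ^ (2 ^ Suc p)"
proof -
 let ?q = "2 ^ Suc p :: nat"
 define \<beta> where "\<beta> = Psi ?q w/2 ^ ?q"
 have b1: "1 <= \<beta>" unfolding \<beta>_def using bad_Psi[OF bad] by simp
 have P0: "0 <= Psi ?q w" unfolding Psi_def using Phi_nonneg[of p w] by simp
 have "Phi ?q w <= Psi ?q w/4 ^ ?q" unfolding Psi_def by (simp add: field_simps)
 also have "... <= \<beta>" unfolding \<beta>_def using P0 by (intro divide_left_mono power_mono) auto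
 also have "\<beta> <= \<beta> ^ ?q" using self_le_power[OF b1, of ?q] by simp
 finally have "\<bar>cov w j j - 1\<bar> <= \<beta>" using good_diag[of p w \<beta> j] b1 j by simp
 moreover have "\<beta>*1 <= \<beta>*\<beta>" using b1 by (intro mult_left_mono) auto
 ultimately have "cov w j j <= 4*(\<beta>*\<beta>)" using b1 by linarith
 hence "cov w j j <= (2*\<beta>)^2" by (simp add: power2_eq_square)
 hence "sqrt (cov w j j) <= 2*\<beta>" using b1 by (intro real_le_lsqrt) auto
 thus ?thesis unfolding \<beta>_def by simp
qed

lemma abs_dev:
 assumes w: "dns w" and j: "j < n"
 shows "J (%x. w x*\<bar>ctr w j x\<bar>) <= sqrt (cov w j j)"
proof -
 have "(J (%x. w x*(\<bar>ctr w j x\<bar>*1)))^2 <= J (%x. w x*\<bar>ctr w j x\<bar>^2) * J (%x. w x*1^2)"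
  using dns_pos[OF w] by (intro J_cauchy continuous_intros dns_cont[OF w]) (auto simp: less_imp_le)
 also have "J (%x. w x*\<bar>ctr w j x\<bar>^2) = cov w j j" unfolding cov_def by (intro J_cong) (simp add: power2_eq_square)
 also have "J (%x. w x*1^2) = 1" using dns_one[OF w] by simp
 finally show ?thesis by (intro real_le_rsqrt) simp
qed

lemma cov_diag_slc:
 assumes s: "slc (%_. t) w" and t: "t > 0" and j: "j < n"
 shows "cov w j j <= 1/t"
proof -
 let ?e = "%i. if i = j then 1 else 0 :: real"
 have "(SUM a<n. SUM b<n. ?e a*?e b * cov w a b) = (SUM a<n. SUM b<n. if b = j then if a = j then cov w j j else 0 else 0)"
  by (intro sum.cong refl) simp
 moreover have "(SUM i<n. (?e i)^2) = (SUM i<n. if i = j then 1 else 0)" by (intro sum.cong refl) simp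
 ultimately show ?thesis using cov_slc[OF s t, of ?e] j by simp
qed

end

context gauge_cube
begin

text \<open>A tangent plane is taken to the smooth function \<open>U s\<close> at the mean;
  \<open>s\<close> is chosen so small that \<open>U s\<close> exceeds \<open>N\<close> by at most
  \<open>\<epsilon>\<close>.\<close>

lemma jensen:
 assumes w: "dns w"
 shows "N (mean w) <= J (%x. w x * N x)"
proof (rule field_le_epsilon)
 fix \<epsilon> :: real assume \<epsilon>: "0 < \<epsilon>"
 define s where "s = (\<epsilon>/(gN + 1))^2"
 have s: "0 < s" "sqrt s = \<epsilon>/(gN + 1)" unfolding s_def using \<epsilon> gN_nonneg by auto
 have sg: "sqrt s * gN <= \<epsilon>" unfolding s using \<epsilon> gN_nonneg by (simp add: field_simps)
 define c where "c i = e1 s (mean w) i/sqrt s" for i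
 note [continuous_intros] = dns_cont[OF w]
 have lin: "J (%x. w x*(SUM i<n. ctr w i x * c i)) = 0"
 proof -
  have "J (%x. w x*(SUM i<n. ctr w i x * c i)) = J (%x. SUM i<n. c i*(w x * ctr w i x))"
   by (intro J_cong) (simp add: sum_distrib_left mult_ac)
  also have "... = (SUM i<n. c i * J (%x. w x * ctr w i x))"
   by (subst J_sum) (auto intro!: continuous_intros)
  finally show ?thesis using J_ctr[OF w] by simp
 qed
 have "N (mean w) <= U s (mean w)" using s by (intro U_ge) simp
 also have "... = J (%x. w x * U s (mean w)) + J (%x. w x*(SUM i<n. ctr w i x * c i))"
  unfolding lin using dns_one[OF w] by simp
 also have "... = J (%x. w x * U s (mean w) + w x*(SUM i<n. ctr w i x * c i))"
  by (subst J_add) (auto intro!: continuous_intros)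
 also have "... <= J (%x. w x * N x + w x*\<epsilon>)"
 proof (rule J_mono)
  fix x assume x: "x \<in> box"
  have "U s (mean w) + (SUM i<n. ctr w i x * c i) <= U s (%i. mean w i + ctr w i x)"
   using U_grad[OF s(1), of "mean w" "%i. ctr w i x"] by (simp add: sum_divide_distrib c_def)
  also have "... = U s x" by (rule U_cong) (simp add: ctr_def)
  also have "... <= N x + \<epsilon>" using U_le[of s x] s(1) sg by simp
  finally have "w x*(U s (mean w) + (SUM i<n. ctr w i x * c i)) <= w x*(N x + \<epsilon>)"
   using dns_pos[OF w x] by (intro mult_left_mono) auto
  thus "w x * U s (mean w) + w x*(SUM i<n. ctr w i x * c i) <= w x * N x + w x*\<epsilon>"
   by (simp only: distrib_left)
 qed (intro continuous_intros N_cont)+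
 also have "... = J (%x. w x * N x) + J (%x. w x*\<epsilon>)"
  by (subst J_add) (auto intro!: continuous_intros N_cont)
 also have "J (%x. w x*\<epsilon>) = \<epsilon>" using dns_one[OF w] by simp
 finally show "N (mean w) <= J (%x. w x * N x) + \<epsilon>" .
qed

lemma J_N_dev:
 assumes w: "dns w"
 shows "J (%x. w x * N x) <= N (mean w) + m*(SUM j<n. sqrt (cov w j j))"
proof -
 note [continuous_intros] = dns_cont[OF w]
 have "J (%x. w x * N x) <= J (%x. w x * N (mean w) + (SUM j<n. m*(w x*\<bar>ctr w j x\<bar>)))"
 proof (rule J_mono)
  fix x assume x: "x \<in> box"
  have "N x <= N (mean w) + m * ab (%j. ctr w j x)"
   using N_lip[of x "mean w"] unfolding ctr_def by (simp add: abs_le_iff)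
  hence "w x * N x <= w x*(N (mean w) + m * ab (%j. ctr w j x))"
   using dns_pos[OF w x] by (intro mult_left_mono) auto
  thus "w x * N x <= w x * N (mean w) + (SUM j<n. m*(w x*\<bar>ctr w j x\<bar>))"
   unfolding ab_def by (simp add: distrib_left sum_distrib_left mult_ac)
 qed (intro continuous_intros N_cont)+
 also have "... = J (%x. w x * N (mean w)) + (SUM j<n. m * J (%x. w x*\<bar>ctr w j x\<bar>))"
 proof -
  have "J (%x. SUM j<n. m*(w x*\<bar>ctr w j x\<bar>)) = (SUM j<n. J (%x. m*(w x*\<bar>ctr w j x\<bar>)))"
   by (rule J_sum) (auto intro!: continuous_intros)
  thus ?thesis by (subst J_add) (auto intro!: continuous_intros)
 qed
 also have "J (%x. w x * N (mean w)) = N (mean w)" using dns_one[OF w] by simp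
 also have "(SUM j<n. m * J (%x. w x*\<bar>ctr w j x\<bar>)) <= (SUM j<n. m * sqrt (cov w j j))"
  using m_nonneg by (intro sum_mono mult_left_mono abs_dev[OF w]) auto
 finally show ?thesis by (simp add: sum_distrib_left)
qed

end

text \<open>The factor 27/55 lies slightly below the 1/2 of the derivative, which leaves room for
  the second-order term. It fits the constant in \<open>kap\<close>:
  \<open>440 * 27/55 = 2 * 108\<close>, for a time step \<open>h = d / 2\<close>.\<close>

lemma sqrt_step:
 fixes t h :: real
 assumes "0 < t" "0 <= h" "20 * h <= t"
 shows "27/55 * h/sqrt t <= sqrt (t + h) - sqrt t"
proof -
 have st: "sqrt t * sqrt t = t" "0 < sqrt t" using assms by auto
 have "(sqrt t + 27/55 * h/sqrt t)^2 = t + 54/55 * h + (27/55)^2*(h * h/t)"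
 proof -
  have e: "(u + 27/55 * h/u)^2 = u * u + 54/55 * h + (27/55)^2*(h * h/(u * u))" if "0 < u" for u
   using that by (simp add: power2_eq_square field_simps)
  show ?thesis using e[OF st(2)] unfolding st(1) .
 qed
 also have "h * h/t <= h/20" using assms mult_mono[of "20 * h" t h h] by (simp add: field_simps)
 hence "t + 54/55 * h + (27/55)^2*(h * h/t) <= t + 54/55 * h + (27/55)^2*(h/20)"
  by (intro add_left_mono mult_left_mono) auto
 also have "... <= t + h" using assms(2) by (simp add: power2_eq_square)
 finally have "sqrt t + 27/55 * h/sqrt t <= sqrt (t + h)" by (rule real_le_rsqrt)
 thus ?thesis by simp
qed

section \<open>Comparison from below and from above, with the potential as error term\<close>

context gauge_cube
begin

text \<open>
 An integrating factor: along a sweep the potential \<open>Psi q\<close> grows at most by the factor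
 \<open>1 + 108 d q^2 / sqrt t\<close>, and \<open>kap\<close> decreases fast enough in \<open>t\<close> to absorb it.
\<close>

definition kap :: "real => nat => real => real" where
 "kap T q t = exp (440*(real q)^2*(sqrt T - sqrt t))"

lemma kap_step:
 assumes t: "0 < t" "0 <= d" "10 * d <= t"
 shows "kap T q (t + d/2)*(1 + d*(108*(real q)^2/sqrt t)) <= kap T q t"
proof -
 let ?x = "440*(real q)^2*(sqrt (t + d/2) - sqrt t)"
 have "440*(real q)^2*(27/55*(d/2)/sqrt t) <= ?x"
  using sqrt_step[of t "d/2"] t by (intro mult_left_mono) auto
 hence "1 + d*(108*(real q)^2/sqrt t) <= exp ?x"
 proof -
  have "440*(real q)^2*(27/55*(d/2)/sqrt t) = d*(108*(real q)^2/sqrt t)" by simp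
  moreover assume "440*(real q)^2*(27/55*(d/2)/sqrt t) <= ?x"
  ultimately show ?thesis using exp_ge_add_one_self[of ?x] by linarith
 qed
 hence "kap T q (t + d/2)*(1 + d*(108*(real q)^2/sqrt t)) <= kap T q (t + d/2) * exp ?x"
  unfolding kap_def by (intro mult_left_mono) auto
 also have "... = kap T q t" unfolding kap_def exp_add[symmetric] by (simp add: right_diff_distrib)
 finally show ?thesis .
qed

lemma kap_ge1: "t <= T ==> 1 <= kap T q t"
 unfolding kap_def by simp

text \<open>Since \<open>3520 = 8 * 440\<close>, the hypothesis on \<open>T\<close> keeps the total
  growth exponent below \<open>q / 8\<close>, well below the \<open>q * ln 2\<close> that the
  threshold \<open>2^q\<close> provides.\<close>

lemma kap_le:
 assumes "0 <= t" "0 <= T" "sqrt T*(3520 * real q) <= 1"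
 shows "kap T q t <= exp (real q/8)"
proof -
 have "440*(real q)^2*(sqrt T - sqrt t) <= 440*(real q)^2 * sqrt T"
  using assms by (intro mult_left_mono) auto
 also have "... = (real q/8)*(sqrt T*(3520 * real q))" by (simp add: power2_eq_square)
 also have "... <= (real q/8)*1" using assms(3) by (intro mult_left_mono) auto
 finally show ?thesis unfolding kap_def by simp
qed

lemma J_uminus_N: "J (%x. w x * - N x) = - J (%x. w x * N x)"
 by simp

lemma psi_term_step:
 "EX C>=0. ALL t w d. slc (%_. t) w --> 0 < t --> t + d/2 <= T --> T <= 1 --> Phi (2 ^ Suc p) w <= (1/2) ^ (2 ^ Suc p) -->
  0 < d --> 10 * d <= t --> rok (sqrt d) -->
  kap T (2 ^ Suc p) (t + d/2) * sw d [0..<n] (Psi (2 ^ Suc p)) w <=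
   kap T (2 ^ Suc p) t * Psi (2 ^ Suc p) w + kap T (2 ^ Suc p) 0 * C*(d * sqrt d)"
proof -
 let ?q = "2 ^ Suc p :: nat"
 obtain C where C: "C >= 0" "!!t w d. slc (%_. t) w ==> 0 < t ==> t <= 1 ==> Phi ?q w <= (1/2) ^ ?q ==>
  0 <= d ==> rok (sqrt d) ==>
  sw d [0..<n] (Psi ?q) w <= (1 + d*(108*(2 ^ Suc p)^2/sqrt t)) * Psi ?q w + C*(d * sqrt d)"
  using potential_sweep[of p] by blast
 show ?thesis
 proof (intro exI[of _ C] conjI allI impI C(1))
  fix t w d
  assume a: "slc (%_. t) w" "0 < t" "t + d/2 <= T" "T <= 1" "Phi ?q w <= (1/2) ^ ?q" "0 < d" "10 * d <= t" "rok (sqrt d)"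
  have P0: "0 <= Psi ?q w" unfolding Psi_def using Phi_nonneg[of p w] by simp
  have k0: "0 <= kap T ?q (t + d/2)" unfolding kap_def by simp
  have rq: "real ?q = 2 ^ Suc p" by simp
  have "sw d [0..<n] (Psi ?q) w <= (1 + d*(108*(real ?q)^2/sqrt t)) * Psi ?q w + C*(d * sqrt d)"
   unfolding rq by (rule C(2)[OF a(1,2) _ a(5) _ a(8)]) (use a in auto)
  hence "kap T ?q (t + d/2) * sw d [0..<n] (Psi ?q) w <=
    kap T ?q (t + d/2)*((1 + d*(108*(real ?q)^2/sqrt t)) * Psi ?q w + C*(d * sqrt d))"
   using k0 by (rule mult_left_mono)
  also have "... = (kap T ?q (t + d/2)*(1 + d*(108*(real ?q)^2/sqrt t))) * Psi ?q w + kap T ?q (t + d/2)*(C*(d * sqrt d))"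
   by (simp only: distrib_left[of "kap T ?q (t + d/2)" "(1 + d*(108*(real ?q)^2/sqrt t)) * Psi ?q w"] mult.assoc)
  also have "... <= kap T ?q t * Psi ?q w + kap T ?q 0*(C*(d * sqrt d))"
  proof (rule add_mono)
   show "(kap T ?q (t + d/2)*(1 + d*(108*(real ?q)^2/sqrt t))) * Psi ?q w <= kap T ?q t * Psi ?q w"
    using a P0 by (intro mult_right_mono kap_step) auto
   have "kap T ?q (t + d/2) <= kap T ?q 0" unfolding kap_def using a by simp
   thus "kap T ?q (t + d/2)*(C*(d * sqrt d)) <= kap T ?q 0*(C*(d * sqrt d))"
    using C(1) a by (intro mult_right_mono) auto
  qed
  finally show "kap T ?q (t + d/2) * sw d [0..<n] (Psi ?q) w <= kap T ?q t * Psi ?q w + kap T ?q 0 * C*(d * sqrt d)"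
   by (simp only: mult.assoc)
 qed
qed

text \<open>The compensated functional \<open>F - B * kap * Psi\<close> satisfies the step condition
  of \<open>engine\<close>. In a good state the decrease of \<open>kap\<close> pays for the growth
  of \<open>Psi\<close>; in a bad state \<open>kap >= 1\<close> and the hypothesis
  \<open>bad\<close> give the conclusion at once.\<close>

lemma potential_engine:
 assumes w: "slc (%_. t0) w" and t: "0 < t0" "t0 < T" "T <= 1" and q: "sqrt T*(3520*2 ^ Suc p) <= 1"
  and B: "0 <= B" and C: "0 <= C" and f: "continuous_on box f"
  and good: "!!r w d. t0 <= r ==> r + d/2 <= T ==> dns w ==> 0 < d ==> rok (sqrt d) ==>
   Phi (2 ^ Suc p) w <= (1/2) ^ (2 ^ Suc p) ==> F r w <= sw d [0..<n] (F (r + d/2)) w + C*(d * sqrt d)"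
  and bad: "!!r w. t0 <= r ==> r <= T ==> dns w ==> ~ Phi (2 ^ Suc p) w <= (1/2) ^ (2 ^ Suc p) ==>
   F r w <= J (%x. w x * f x) + B * Psi (2 ^ Suc p) w"
  and fin: "!!w. slc (%_. T) w ==> F T w <= J (%x. w x * f x)"
 shows "F t0 w <= J (%x. w x * f x) + B * exp (2 ^ Suc p/8) * Psi (2 ^ Suc p) w"
proof -
 let ?q = "2 ^ Suc p :: nat"
 \<comment> \<open>The explicit coefficients match the shape of \<open>sw_lin\<close>.\<close>
 define V where "V t w = 1 * F t w + (- B * kap T ?q t) * Psi ?q w + 0" for t w
 obtain D where D: "D >= 0" "!!t w d. slc (%_. t) w ==> 0 < t ==> t + d/2 <= T ==> T <= 1 ==> Phi ?q w <= (1/2) ^ ?q ==>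
  0 < d ==> 10 * d <= t ==> rok (sqrt d) ==>
  kap T ?q (t + d/2) * sw d [0..<n] (Psi ?q) w <= kap T ?q t * Psi ?q w + kap T ?q 0 * D*(d * sqrt d)"
  using psi_term_step[of T p] by blast
 have k0: "0 <= kap T ?q r" for r unfolding kap_def by simp
 have P0: "0 <= Psi ?q w" for w unfolding Psi_def using Phi_nonneg[of p w] by simp
 have "V t0 w <= J (%x. w x * f x)"
 proof (rule engine[OF t(2) _ _ f _ _ w, of "C + B*(kap T ?q 0 * D)" "t0/10"])
  show "0 <= C + B*(kap T ?q 0 * D)" using C D(1) B k0 by simp
  show "0 < t0/10" using t by simp
 next
  fix r w d assume r: "t0 <= r" "r + d/2 <= T" and w: "slc (%_. r) w" and d: "0 < d" "d <= t0/10" and rk: "rok (sqrt d)"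
  have dw: "dns w" by (rule slc_dns[OF w])
  show "V r w <= J (%x. w x * f x) | V r w <= sw d [0..<n] (V (r + d/2)) w + (C + B*(kap T ?q 0 * D))*(d * sqrt d)"
  proof (cases "Phi ?q w <= (1/2) ^ ?q")
   case True
   have "B*(kap T ?q (r + d/2) * sw d [0..<n] (Psi ?q) w) <= B*(kap T ?q r * Psi ?q w + kap T ?q 0 * D*(d * sqrt d))"
    by (intro mult_left_mono D(2)) (use w r t d True rk B in auto)
   hence "V r w <= sw d [0..<n] (V (r + d/2)) w + (C + B*(kap T ?q 0 * D))*(d * sqrt d)"
    using good[OF r dw d(1) rk True]
    unfolding V_def sw_lin by (simp add: distrib_left distrib_right mult.assoc del: power_Suc)
   thus ?thesis by simp
  next
   case False
   have "B*(1 * Psi ?q w) <= B*(kap T ?q r * Psi ?q w)"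
    using P0 r d B by (intro mult_left_mono mult_right_mono kap_ge1) auto
   hence "V r w <= J (%x. w x * f x)"
    unfolding V_def using bad[OF r(1) _ dw False] r d by (simp add: mult.assoc del: power_Suc)
   thus ?thesis by simp
  qed
 next
  fix w assume w: "slc (%_. T) w"
  have "0 <= B * kap T ?q T * Psi ?q w" using B k0 P0 by (intro mult_nonneg_nonneg)
  thus "V T w <= J (%x. w x * f x)" unfolding V_def using fin[OF w] by simp
 qed
 moreover have "B * kap T ?q t0 * Psi ?q w <= B * exp (2 ^ Suc p/8) * Psi ?q w"
  using kap_le[of t0 T ?q] t q B P0 by (intro mult_right_mono mult_left_mono) auto
 ultimately show ?thesis unfolding V_def by (simp del: power_Suc)
qed

text \<open>In a good state the squared covariance is at least 1/4, so a sweep, which takes time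
  \<open>d / 2\<close>, pays for heat time \<open>d / 4\<close>; hence the rate 1/2. In a bad state
  the heat flow exceeds \<open>N\<close> by at most \<open>sqrt (s + T) * gN\<close>, and
  \<open>Psi >= 2^q\<close> covers this by the choice of \<open>B\<close>. The offset
  \<open>s\<close> keeps the heat time positive up to the end and costs
  \<open>sqrt s * gN\<close>.\<close>

lemma lower_main:
 assumes w: "slc (%_. t0) w" and t: "0 < t0" "t0 < T" "T <= 1" and q: "sqrt T*(3520*2 ^ Suc p) <= 1" and s: "0 < s"
 shows "U (s + (T - t0)/2) (mean w) <= J (%x. w x * N x) + sqrt s * gN
  + sqrt (s + T) * gN/2 ^ (2 ^ Suc p) * exp (2 ^ Suc p/8) * Psi (2 ^ Suc p) w"
proof -
 define B where "B = sqrt (s + T) * gN/2 ^ (2 ^ Suc p)"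
 define b where "b = sqrt s * gN"
 define F where "F t w = 1 * U (s + (T - t)/2) (mean w) + 0 * U s (mean w) + (- b)" for t w
 have B0: "0 <= B" "0 <= b" unfolding B_def b_def using s t gN_nonneg by auto
 obtain C where C: "C >= 0" "!!\<sigma> w d \<theta> c. s <= \<sigma> ==> \<sigma> <= s + T ==> dns w ==> 0 <= d ==> rok (sqrt d) ==> 0 < \<theta> ==> \<theta> <= 1 * d ==>
  (ALL v. c*(SUM i<n. (v i)^2) <= cov2 w v) ==> \<theta> <= c * d ==>
  U (\<sigma> + \<theta>) (mean w) <= sw d [0..<n] (%w. U \<sigma> (mean w)) w + C*(d * sqrt d)"
  using U_step[OF s, of "s + T" 1] t by fastforce
 have "F t0 w <= J (%x. w x * N x) + B * exp (2 ^ Suc p/8) * Psi (2 ^ Suc p) w"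
 proof (rule potential_engine[OF w t q B0(1) C(1) N_cont])
  fix r w d assume r: "t0 <= r" "r + d/2 <= T" and d: "dns w" "0 < d" "rok (sqrt d)" and good: "Phi (2 ^ Suc p) w <= (1/2) ^ (2 ^ Suc p)"
  have "U ((s + (T - (r + d/2))/2) + d/4) (mean w) <= sw d [0..<n] (%w. U (s + (T - (r + d/2))/2) (mean w)) w + C*(d * sqrt d)"
   by (rule C(2)[where c = "1/4"]) (use r t d good_cov2(2)[OF good] in auto)
  moreover have "(s + (T - (r + d/2))/2) + d/4 = s + (T - r)/2" by (simp add: field_simps)
  ultimately show "F r w <= sw d [0..<n] (F (r + d/2)) w + C*(d * sqrt d)" unfolding F_def sw_lin by simp
 next
  fix r w assume r: "t0 <= r" "r <= T" and dw: "dns w" and bad: "~ Phi (2 ^ Suc p) w <= (1/2) ^ (2 ^ Suc p)"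
  have "U (s + (T - r)/2) (mean w) <= N (mean w) + sqrt (s + (T - r)/2) * gN" using s r by (intro U_le) auto
  moreover have "sqrt (s + (T - r)/2) * gN <= sqrt (s + T) * gN" using gN_nonneg r t by (intro mult_right_mono) auto
  moreover have "... = B*2 ^ (2 ^ Suc p)" unfolding B_def by simp
  moreover have "... <= B * Psi (2 ^ Suc p) w" using bad_Psi[OF bad] B0(1) by (rule mult_left_mono)
  ultimately show "F r w <= J (%x. w x * N x) + B * Psi (2 ^ Suc p) w"
   unfolding F_def using B0(2) jensen[OF dw] by simp
 next
  fix w assume w: "slc (%_. T) w"
  have "U s (mean w) <= N (mean w) + b" unfolding b_def using s by (intro U_le) simp
  thus "F T w <= J (%x. w x * N x)" unfolding F_def using jensen[OF slc_dns[OF w]] by simp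
 qed
 thus ?thesis unfolding F_def B_def b_def by simp
qed

text \<open>After time \<open>T\<close> the bound \<open>1 / t\<close> on the covariance takes the
  place of the potential. The required heat time stays finite because \<open>1 / t^2\<close> is
  integrable at infinity.\<close>

lemma upper_late:
 assumes w: "slc (%_. T) w" and T: "0 < T"
 shows "J (%x. w x * N x) <= U (4/T) (mean w)"
proof (rule field_le_epsilon)
 fix \<epsilon> :: real assume \<epsilon>: "0 < \<epsilon>"
 \<comment> \<open>The end is so late that the standard deviations, at most
   \<open>sqrt (1 / \<tau>)\<close> each, cost at most \<open>b <= \<epsilon>\<close> in the
   integral of \<open>N\<close>.\<close>
 define \<tau> where "\<tau> = T + 1 + ((m * n + 1)/\<epsilon>)^2"
 have \<tau>: "T < \<tau>" "0 < \<tau>" unfolding \<tau>_def using T by (auto intro: add_pos_nonneg)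
 define b where "b = m*(n * sqrt (1/\<tau>))"
 have b\<epsilon>: "b <= \<epsilon>"
 proof -
  have mn: "0 <= m * n" using m_nonneg by simp
  have "((m * n + 1)/\<epsilon>)^2 <= \<tau>" unfolding \<tau>_def using T by simp
  hence "(m * n + 1)/\<epsilon> <= sqrt \<tau>" using mn \<epsilon> by (intro real_le_rsqrt)
  hence "m * n + 1 <= sqrt \<tau>*\<epsilon>" using \<epsilon> by (simp add: field_simps)
  hence "m * n <= sqrt \<tau>*\<epsilon>" by simp
  hence "m * n/sqrt \<tau> <= \<epsilon>" using \<tau> by (simp add: field_simps)
  thus ?thesis unfolding b_def by (simp add: real_sqrt_divide)
 qed
 \<comment> \<open>During a sweep from time \<open>r\<close> the heat time \<open>\<sigma>\<close>
   drops by \<open>3 (d/2) / (r (r + d/2))\<close>, while \<open>d / r^2\<close> is needed. The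
   numerator 3, where 2 would do in the limit, makes this true for \<open>d <= T <= r\<close>. The
   summand \<open>1 / T\<close> keeps the heat time away from zero.\<close>
 define \<sigma> where "\<sigma> t = 1/T + 3/t" for t
 define V where "V t w = (-1) * U (\<sigma> t) (mean w) + 0 * U (\<sigma> t) (mean w) + (- b)" for t w
 have TT: "1/T <= 4/T" using T by (simp add: field_simps)
 obtain C where C: "C >= 0" "!!\<sigma> w d \<theta> c. 1/T <= \<sigma> ==> \<sigma> <= 4/T ==> dns w ==> 0 <= d ==> rok (sqrt d) ==> 0 < \<theta> ==> \<theta> <= 2/T^2 * d ==>
  (ALL v. cov2 w v <= c*(SUM i<n. (v i)^2)) ==> c * d <= \<theta> ==>
  sw d [0..<n] (%w. U \<sigma> (mean w)) w <= U (\<sigma> + \<theta>) (mean w) + C*(d * sqrt d)"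
  using U_step[of "1/T" "4/T" "2/T^2"] T TT by fastforce
 have "V T w <= J (%x. w x * - N x)"
 proof (rule engine[OF \<tau>(1) C(1) T _ _ _ w])
  show "continuous_on box (%x. - N x)" by (intro continuous_intros N_cont)
 next
  fix r w d assume r: "T <= r" "r + d/2 <= \<tau>" and w: "slc (%_. r) w" and d: "0 < d" "d <= T" and rk: "rok (sqrt d)"
  have dw: "dns w" by (rule slc_dns[OF w])
  have rp: "0 < r" using r T by simp
  define \<theta> where "\<theta> = 3*(d/2)/(r*(r + d/2))"
  have \<theta>: "0 < \<theta>" unfolding \<theta>_def using rp d by simp
  have \<theta>1: "\<theta> <= 2/T^2 * d"
  proof -
   have "\<theta> <= 3*(d/2)/(T * T)"
    unfolding \<theta>_def using r d by (intro divide_left_mono mult_mono mult_pos_pos) auto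
   also have "... <= 2/T^2 * d" using T d by (simp add: power2_eq_square field_simps)
   finally show ?thesis .
  qed
  have \<theta>2: "(1/r)^2 * d <= \<theta>"
  proof -
   have "d*(r + d/2) <= 3*(d/2) * r"
   proof -
    have "r + d/2 <= 3/2 * r" using r d by simp
    hence "d*(r + d/2) <= d*(3/2 * r)" using d by (intro mult_left_mono) auto
    thus ?thesis by simp
   qed
   hence "(d*(r + d/2))/(r * r*(r + d/2)) <= (3*(d/2) * r)/(r * r*(r + d/2))"
    using d by (intro divide_right_mono) auto
   moreover have "(d*(r + d/2))/(r * r*(r + d/2)) = (1/r)^2 * d"
    using rp d by (simp add: power2_eq_square)
   moreover have "(3*(d/2) * r)/(r * r*(r + d/2)) = \<theta>"
    unfolding \<theta>_def by simp
   ultimately show ?thesis by simp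
  qed
  have \<sigma>\<theta>: "\<sigma> (r + d/2) + \<theta> = \<sigma> r" 
  proof -
   have "\<theta> = 3/r - 3/(r + d/2)" unfolding \<theta>_def using rp d by (simp add: field_simps)
   thus ?thesis unfolding \<sigma>_def by simp
  qed
  have "sw d [0..<n] (%w. U (\<sigma> (r + d/2)) (mean w)) w <= U (\<sigma> (r + d/2) + \<theta>) (mean w) + C*(d * sqrt d)"
  proof (rule C(2)[OF _ _ dw _ rk \<theta> \<theta>1 _ \<theta>2])
   show "1/T <= \<sigma> (r + d/2)" unfolding \<sigma>_def using rp d by simp
   have "3/(r + d/2) <= 3/T" using r d by (intro divide_left_mono) auto
   thus "\<sigma> (r + d/2) <= 4/T" unfolding \<sigma>_def by simp
  qed (use d slc_cov2[OF w rp] in auto)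
  hence "V r w <= sw d [0..<n] (V (r + d/2)) w + C*(d * sqrt d)"
   unfolding V_def sw_lin \<sigma>\<theta> by simp
  thus "V r w <= J (%x. w x * - N x) | V r w <= sw d [0..<n] (V (r + d/2)) w + C*(d * sqrt d)" by simp
 next
  fix w assume w: "slc (%_. \<tau>) w"
  have dw: "dns w" by (rule slc_dns[OF w])
  have "J (%x. w x * N x) <= N (mean w) + m*(SUM j<n. sqrt (cov w j j))" by (rule J_N_dev[OF dw])
  also have "m*(SUM j<n. sqrt (cov w j j)) <= m*(SUM j<n. sqrt (1/\<tau>))"
   using cov_diag_slc[OF w \<tau>(2)] m_nonneg by (intro mult_left_mono sum_mono) auto
  also have "... = b" unfolding b_def by simp
  also have "N (mean w) <= U (\<sigma> \<tau>) (mean w)" using \<tau> T unfolding \<sigma>_def by (intro U_ge) simp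
  finally have "J (%x. w x * N x) <= U (\<sigma> \<tau>) (mean w) + b" by simp
  thus "V \<tau> w <= J (%x. w x * - N x)" unfolding V_def by simp
 qed
 moreover have "\<sigma> T = 4/T" unfolding \<sigma>_def by simp
 ultimately have "J (%x. w x * N x) <= U (4/T) (mean w) + b" unfolding V_def by simp
 thus "J (%x. w x * N x) <= U (4/T) (mean w) + \<epsilon>" using b\<epsilon> by simp
qed

text \<open>In a good state the squared covariance is at most 9/4, so a sweep of time
  \<open>d / 2\<close> needs heat time \<open>9/4 d\<close>; hence the rate 9/2. In a bad state the
  integral of \<open>N\<close> exceeds \<open>N\<close> at the mean by at most \<open>m\<close>
  times the sum of the standard deviations, and \<open>bad_cov\<close> bounds these by
  \<open>Psi\<close>. The offset \<open>4 / T\<close> is reserved for the times after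
  \<open>T\<close>.\<close>

lemma upper_main:
 assumes w: "slc (%_. t0) w" and t: "0 < t0" "t0 < T" "T <= 1" and q: "sqrt T*(3520*2 ^ Suc p) <= 1"
 shows "J (%x. w x * N x) <= U (4/T + 9/2*(T - t0)) (mean w)
  + 2 * n * m/2 ^ (2 ^ Suc p) * exp (2 ^ Suc p/8) * Psi (2 ^ Suc p) w"
proof -
 define B where "B = 2 * n * m/2 ^ (2 ^ Suc p)"
 define \<sigma> where "\<sigma> t = 4/T + 9/2*(T - t)" for t
 define F where "F t w = (-1) * U (\<sigma> t) (mean w) + 0 * U 1 (mean w) + 0" for t w
 have B0: "0 <= B" unfolding B_def using m_nonneg by simp
 have T: "0 < T" using t by simp
 obtain C where C: "C >= 0" "!!\<sigma> w d \<theta> c. 4/T <= \<sigma> ==> \<sigma> <= 4/T + 9/2 * T ==> dns w ==> 0 <= d ==> rok (sqrt d) ==> 0 < \<theta> ==> \<theta> <= 9/4 * d ==>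
  (ALL v. cov2 w v <= c*(SUM i<n. (v i)^2)) ==> c * d <= \<theta> ==>
  sw d [0..<n] (%w. U \<sigma> (mean w)) w <= U (\<sigma> + \<theta>) (mean w) + C*(d * sqrt d)"
  using U_step[of "4/T" "4/T + 9/2 * T" "9/4"] T by fastforce
 have "F t0 w <= J (%x. w x * - N x) + B * exp (2 ^ Suc p/8) * Psi (2 ^ Suc p) w"
 proof (rule potential_engine[OF w t q B0 C(1)])
  show "continuous_on box (%x. - N x)" by (intro continuous_intros N_cont)
 next
  fix r w d assume r: "t0 <= r" "r + d/2 <= T" and d: "dns w" "0 < d" "rok (sqrt d)" and good: "Phi (2 ^ Suc p) w <= (1/2) ^ (2 ^ Suc p)"
  have "\<sigma> (r + d/2) + 9/4 * d = \<sigma> r" unfolding \<sigma>_def by (simp add: field_simps)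
  moreover have "sw d [0..<n] (%w. U (\<sigma> (r + d/2)) (mean w)) w <= U (\<sigma> (r + d/2) + 9/4 * d) (mean w) + C*(d * sqrt d)"
   by (rule C(2)[where c = "9/4"]) (use r t d good_cov2(1)[OF good] in \<open>auto simp: \<sigma>_def\<close>)
  ultimately show "F r w <= sw d [0..<n] (F (r + d/2)) w + C*(d * sqrt d)" unfolding F_def sw_lin by simp
 next
  fix r w assume r: "t0 <= r" "r <= T" and dw: "dns w" and bad: "~ Phi (2 ^ Suc p) w <= (1/2) ^ (2 ^ Suc p)"
  have "J (%x. w x * N x) <= N (mean w) + m*(SUM j<n. sqrt (cov w j j))" by (rule J_N_dev[OF dw])
  also have "m*(SUM j<n. sqrt (cov w j j)) <= m*(SUM j<n. 2 * Psi (2 ^ Suc p) w/2 ^ (2 ^ Suc p))"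
   using bad_cov[OF bad] m_nonneg by (intro mult_left_mono sum_mono) auto
  also have "... = B * Psi (2 ^ Suc p) w" unfolding B_def by simp
  also have "N (mean w) <= U (\<sigma> r) (mean w)" using T r unfolding \<sigma>_def by (intro U_ge) simp
  finally show "F r w <= J (%x. w x * - N x) + B * Psi (2 ^ Suc p) w" unfolding F_def by simp
 next
  fix w assume "slc (%_. T) w"
  thus "F T w <= J (%x. w x * - N x)" unfolding F_def J_uminus_N \<sigma>_def using upper_late[OF _ T] by simp
 qed
 thus ?thesis unfolding F_def B_def \<sigma>_def J_uminus_N by simp
qed

end

section \<open>The Prekopa--Leindler inequality\<close>

lemma emeasure_half_affine:
 fixes A :: "real set"
 assumes "A \<in> sets borel"
 shows "emeasure lborel A = 2 * emeasure lborel ((%y. - b + 2 * y) -` A)" "(%y. - b + 2 * y) -` A \<in> sets borel"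
proof -
 have m: "(%y. - b + 2 * y :: real) \<in> borel_measurable borel" by measurable
 show p: "(%y. - b + 2 * y) -` A \<in> sets borel"
  using measurable_sets[OF m assms] by simp
 have "emeasure lborel A = (nn_integral lborel (%x. indicator A x))" using assms by simp
 also have "... = ennreal \<bar>2\<bar>*(nn_integral lborel (%y. indicator A (- b + 2 * y)))"
  using assms by (intro nn_integral_real_affine) auto
 also have "(nn_integral lborel (%y. indicator A (- b + 2 * y))) = (nn_integral lborel (%y. indicator ((%y. - b + 2 * y) -` A) y))"
  by (intro nn_integral_cong) (simp add: indicator_def)
 finally show "emeasure lborel A = 2 * emeasure lborel ((%y. - b + 2 * y) -` A)" using p by simp
qed

text \<open>Take \<open>a\<close> near the supremum of \<open>A\<close> and \<open>b\<close> near
  the infimum of \<open>B\<close>. The sets \<open>(A + b) / 2\<close> and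
  \<open>(a + B) / 2\<close> lie in \<open>C\<close>, have half the measures, and overlap only in a
  short interval.\<close>

lemma midpoint_set_measure:
 fixes A B C :: "real set"
 assumes A: "A \<in> sets borel" "A ~= {}" "bdd_above A" and B: "B \<in> sets borel" "B ~= {}" "bdd_below B"
  and C: "C \<in> sets borel" "!!a b. a \<in> A ==> b \<in> B ==> (a + b)/2 \<in> C"
 shows "emeasure lborel A + emeasure lborel B <= 2 * emeasure lborel C"
proof (rule ennreal_le_epsilon)
 fix e :: real assume e: "0 < e"
 define \<delta> where "\<delta> = e/2"
 have \<delta>: "0 < \<delta>" unfolding \<delta>_def using e by simp
 obtain a where a: "a \<in> A" "Sup A - \<delta> < a" using less_cSup_iff[OF A(2,3), of "Sup A - \<delta>"] \<delta> by auto
 obtain b where b: "b \<in> B" "b < Inf B + \<delta>" using cInf_less_iff[OF B(2,3), of "Inf B + \<delta>"] \<delta> by auto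
 define A' where "A' = (%y. - b + 2 * y) -` A"
 define B' where "B' = (%y. - a + 2 * y) -` B"
 have A': "emeasure lborel A = 2 * emeasure lborel A'" "A' \<in> sets borel"
  unfolding A'_def by (rule emeasure_half_affine[OF A(1)])+
 have B': "emeasure lborel B = 2 * emeasure lborel B'" "B' \<in> sets borel"
  unfolding B'_def by (rule emeasure_half_affine[OF B(1)])+
 have sub: "A' \<union> B' \<subseteq> C"
 proof
  fix y assume "y \<in> A' \<union> B'"
  thus "y \<in> C"
  proof
   assume "y \<in> A'"
   thus "y \<in> C" using C(2)[of "- b + 2 * y" b] b by (simp add: A'_def)
  next
   assume "y \<in> B'"
   thus "y \<in> C" using C(2)[of a "- a + 2 * y"] a by (simp add: B'_def)
  qed
 qed
 have int: "A' \<inter> B' \<subseteq> {(a + Inf B)/2 .. (Sup A + b)/2}"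
  using cSup_upper[OF _ A(3)] cInf_lower[OF _ B(3)] unfolding A'_def B'_def by (fastforce simp: field_simps)
 have "emeasure lborel (A' \<inter> B') <= emeasure lborel {(a + Inf B)/2 .. (Sup A + b)/2}"
  using int by (intro emeasure_mono) auto
 also have "... <= ennreal \<delta>"
 proof (cases "(a + Inf B)/2 <= (Sup A + b)/2")
  case True
  thus ?thesis using a b by (simp add: field_simps ennreal_leI)
 qed simp
 finally have ib: "emeasure lborel (A' \<inter> B') <= ennreal \<delta>" .
 have "emeasure lborel A' + emeasure lborel B' = emeasure lborel (A' \<union> B') + emeasure lborel (A' \<inter> B')"
 proof -
  have "A' \<union> B' = A' \<union> (B' - A')" "A' \<inter> (B' - A') = {}" by auto
  hence 1: "emeasure lborel (A' \<union> B') = emeasure lborel A' + emeasure lborel (B' - A')"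
   using plus_emeasure[of A' lborel "B' - A'"] A'(2) B'(2) by simp
  have "B' = (B' - A') \<union> (A' \<inter> B')" "(B' - A') \<inter> (A' \<inter> B') = {}" by auto
  hence "emeasure lborel B' = emeasure lborel (B' - A') + emeasure lborel (A' \<inter> B')"
   using plus_emeasure[of "B' - A'" lborel "A' \<inter> B'"] A'(2) B'(2) by simp
  thus ?thesis unfolding 1 by simp
 qed
 also have "... <= emeasure lborel C + ennreal \<delta>"
  using sub C(1) ib by (intro add_mono emeasure_mono) auto
 finally have "2*(emeasure lborel A' + emeasure lborel B') <= 2*(emeasure lborel C + ennreal \<delta>)"
  by (rule mult_left_mono) simp
 also have "... = 2 * emeasure lborel C + ennreal e"
  unfolding \<delta>_def using e by (simp add: distrib_left ennreal_mult'[symmetric] flip: ennreal_numeral)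
 finally show "emeasure lborel A + emeasure lborel B <= 2 * emeasure lborel C + ennreal e"
  unfolding A' B' distrib_left .
qed

lemma layer_cake:
 fixes f :: "real => real"
 assumes f [measurable]: "f \<in> borel_measurable borel" and f0: "!!x. 0 <= f x"
 shows "(nn_integral lborel (%x. ennreal (f x))) = (nn_integral lborel (%r. indicator {0..} r * emeasure lborel {x. r < f x}))"
proof -
 have m: "case_prod (%x r. indicator {(x, r). 0 <= r & r < f x} (x, r) :: ennreal) \<in> borel_measurable (lborel \<Otimes>\<^sub>M lborel)"
  by measurable
 have "(nn_integral lborel (%x. ennreal (f x))) = (\<integral>\<^sup>+x. \<integral>\<^sup>+r. indicator {(x, r). 0 <= r & r < f x} (x, r) \<partial>lborel \<partial>lborel)"
 proof (intro nn_integral_cong)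
  fix x
  have "(nn_integral lborel (%r. indicator {(x, r). 0 <= r & r < f x} (x, r))) = (nn_integral lborel (%r. indicator {0..<f x} r))"
   by (intro nn_integral_cong) (simp add: indicator_def)
  thus "ennreal (f x) = (nn_integral lborel (%r. indicator {(x, r). 0 <= r & r < f x} (x, r)))" using f0[of x] by simp
 qed
 also have "... = (\<integral>\<^sup>+r. \<integral>\<^sup>+x. indicator {(x, r). 0 <= r & r < f x} (x, r) \<partial>lborel \<partial>lborel)"
  by (rule lborel_pair.Fubini'[OF m, symmetric])
 also have "... = (nn_integral lborel (%r. indicator {0..} r * emeasure lborel {x. r < f x}))"
 proof (intro nn_integral_cong)
  fix r :: real
  have "(nn_integral lborel (%x. indicator {(x, r). 0 <= r & r < f x} (x, r))) = (nn_integral lborel (%x. indicator {0..} r * indicator {x. r < f x} x))"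
   by (intro nn_integral_cong) (simp add: indicator_def)
  thus "(nn_integral lborel (%x. indicator {(x, r). 0 <= r & r < f x} (x, r))) = indicator {0..} r * emeasure lborel {x. r < f x}"
   by (simp add: nn_integral_cmult)
 qed
 finally show ?thesis .
qed

text \<open>For \<open>0 <= r < 1\<close> the superlevel sets of \<open>f\<close> and
  \<open>g\<close> are nonempty, which is what the supremum 1 is for, and their midpoints lie in the
  superlevel set of \<open>h\<close>. The layer cake formula integrates this over
  \<open>r\<close>.\<close>

lemma prekopa_normalised:
 fixes f g h :: "real => real"
 assumes m [measurable]: "f \<in> borel_measurable borel" "g \<in> borel_measurable borel" "h \<in> borel_measurable borel"
  and f: "!!x. 0 <= f x" "!!x. f x <= 1" "!!r. r < 1 ==> EX x. r < f x" "!!x. \<bar>x\<bar> > k ==> f x = 0"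
  and g: "!!x. 0 <= g x" "!!x. g x <= 1" "!!r. r < 1 ==> EX x. r < g x" "!!x. \<bar>x\<bar> > k ==> g x = 0"
  and h: "!!x. 0 <= h x" "!!x y. f x * g y <= (h ((x + y)/2))^2"
 shows "(nn_integral lborel (%x. ennreal (f x))) + (nn_integral lborel (%x. ennreal (g x))) <= 2*(nn_integral lborel (%x. ennreal (h x)))"
proof -
 have em [measurable]: "(%r. indicator {0..} r * emeasure lborel {x. r < u x}) \<in> borel_measurable lborel"
  if [measurable]: "u \<in> borel_measurable borel" for u :: "real => real"
 proof -
  have [measurable]: "(%(r, x). indicator {(r, x). r < u x} (r, x) :: ennreal) \<in> borel_measurable (lborel \<Otimes>\<^sub>M lborel)" by measurable
  have "emeasure lborel {x. r < u x} = (nn_integral lborel (%x. indicator {(r, x). r < u x} (r, x)))" for r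
  proof -
   have "(nn_integral lborel (%x. indicator {(r, x). r < u x} (r, x))) = (nn_integral lborel (%x. indicator {x. r < u x} x))"
    by (intro nn_integral_cong) (simp add: indicator_def)
   thus ?thesis by simp
  qed
  thus ?thesis by simp
 qed
 have "(nn_integral lborel (%x. ennreal (f x))) + (nn_integral lborel (%x. ennreal (g x))) =
  (nn_integral lborel (%r. indicator {0..} r * emeasure lborel {x. r < f x} + indicator {0..} r * emeasure lborel {x. r < g x}))"
  unfolding layer_cake[OF m(1) f(1)] layer_cake[OF m(2) g(1)] by (rule nn_integral_add[symmetric]) measurable
 also have "... <= (nn_integral lborel (%r. 2*(indicator {0..} r * emeasure lborel {x. r < h x})))"
 proof (intro nn_integral_mono)
  fix r :: real
  show "indicator {0..} r * emeasure lborel {x. r < f x} + indicator {0..} r * emeasure lborel {x. r < g x}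
    <= 2*(indicator {0..} r * emeasure lborel {x. r < h x})"
  proof (cases "0 <= r & r < 1")
   case True
   have "emeasure lborel {x. r < f x} + emeasure lborel {x. r < g x} <= 2 * emeasure lborel {x. r < h x}"
   proof (rule midpoint_set_measure)
    have "x <= k" "- k <= x" if "r < u x" "!!x. \<bar>x\<bar> > k ==> u x = 0" for x and u :: "real => real"
     using that(2)[of x] that(1) True by (cases "\<bar>x\<bar> > k"; force)+
    thus "bdd_above {x. r < f x}" "bdd_below {x. r < g x}"
     using f(4) g(4) unfolding bdd_above_def bdd_below_def by blast+
    fix a b assume ab: "a \<in> {x. r < f x}" "b \<in> {x. r < g x}"
    have "r * r < f a * g b" using ab True by (intro mult_strict_mono) auto
    also have "... <= (h ((a + b)/2))^2" by (rule h(2))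
    finally have "r^2 < (h ((a + b)/2))^2" by (simp add: power2_eq_square)
    hence "r < h ((a + b)/2)" using h(1) by (rule power2_less_imp_less)
    thus "(a + b)/2 \<in> {x. r < h x}" by simp
   qed (use f(3)[of r] g(3)[of r] True in auto)
   thus ?thesis using True by simp
  next
   case False
   hence "r < 0 | {x. r < f x} = {} & {x. r < g x} = {}"
    using f(2) g(2) by (force simp: not_less intro: order_trans)
   thus ?thesis by auto
  qed
 qed
 also have "... = 2*(nn_integral lborel (%x. ennreal (h x)))"
  unfolding layer_cake[OF m(3) h(1)] by (rule nn_integral_cmult) measurable
 finally show ?thesis .
qed

text \<open>Dividing \<open>f\<close> and \<open>g\<close> by their suprema and \<open>h\<close> by
  the geometric mean of these gives the normalised case, and the arithmetic-geometric mean
  inequality turns the sum into a product.\<close>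

lemma prekopa_bounded:
 fixes f g h :: "real => real"
 assumes m [measurable]: "f \<in> borel_measurable borel" "g \<in> borel_measurable borel" "h \<in> borel_measurable borel"
  and f: "!!x. 0 <= f x" "!!x. f x <= k" "!!x. \<bar>x\<bar> > k ==> f x = 0"
  and g: "!!x. 0 <= g x" "!!x. g x <= k" "!!x. \<bar>x\<bar> > k ==> g x = 0"
  and h: "!!x. 0 <= h x" "!!x y. f x * g y <= (h ((x + y)/2))^2"
 shows "(nn_integral lborel (%x. ennreal (f x)))*(nn_integral lborel (%x. ennreal (g x))) <= (nn_integral lborel (%x. ennreal (h x)))^2"
proof -
 define \<alpha> \<beta> where "\<alpha> = (SUP x. f x)" and "\<beta> = (SUP x. g x)"
 have bf: "bdd_above (range f)" and bg: "bdd_above (range g)" using f(2) g(2) by (meson bdd_aboveI2)+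
 have fa: "f x <= \<alpha>" and gb: "g x <= \<beta>" for x unfolding \<alpha>_def \<beta>_def by (auto intro!: cSUP_upper bf bg)
 have a0: "0 <= \<alpha>" "0 <= \<beta>" using fa[of 0] gb[of 0] f(1)[of 0] g(1)[of 0] by linarith+
 show ?thesis
 proof (cases "\<alpha> = 0 | \<beta> = 0")
  case True
  hence "(ALL x. f x = 0) | (ALL x. g x = 0)" using fa gb f(1) g(1) by (metis order_antisym)
  thus ?thesis by auto
 next
  case False
  hence ab: "0 < \<alpha>" "0 < \<beta>" using a0 by auto
  define c where "c = sqrt (\<alpha>*\<beta>)"
  have c: "0 < c" "c^2 = \<alpha>*\<beta>" unfolding c_def using ab by auto
  have sup: "EX x. r < u x/(SUP x. u x)" if r: "r < 1" "0 < (SUP x. u x)" and b: "bdd_above (range u)" for r and u :: "real => real"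
  proof -
   have "r*(SUP x. u x) < (SUP x. u x)" using r by simp
   then obtain x where "r*(SUP x. u x) < u x" using less_cSUP_iff[OF _ b] by auto
   thus ?thesis using r(2) by (auto simp: field_simps)
  qed
  have scale: "(nn_integral lborel (%x. ennreal (u x))) = ennreal b*(nn_integral lborel (%x. ennreal (u x/b)))"
   if "0 < b" "u \<in> borel_measurable borel" "!!x. 0 <= u x" for u :: "real => real" and b
   using that by (subst nn_integral_cmult[symmetric]) (auto simp: ennreal_mult[symmetric])
  define F G H where "F = (nn_integral lborel (%x. ennreal (f x/\<alpha>)))" and "G = (nn_integral lborel (%x. ennreal (g x/\<beta>)))"
   and "H = (nn_integral lborel (%x. ennreal (h x/c)))"
  have FGH: "F + G <= 2 * H"
   unfolding F_def G_def H_def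
  proof (rule prekopa_normalised[where k = k])
   show "EX x. r < f x/\<alpha>" if "r < 1" for r using sup[OF that _ bf] ab unfolding \<alpha>_def by simp
   show "EX x. r < g x/\<beta>" if "r < 1" for r using sup[OF that _ bg] ab unfolding \<beta>_def by simp
   show "f x/\<alpha>*(g y/\<beta>) <= (h ((x + y)/2)/c)^2" for x y
    using h(2)[of x y] ab by (simp add: power_divide c(2) divide_right_mono)
  qed (use f g h fa gb ab c in auto)
  have "F * G <= H^2"
  proof (cases "H = top")
   case True thus ?thesis by (simp add: power2_eq_square ennreal_top_mult)
  next
   case False
   hence "2 * H < top" by (simp add: ennreal_mult_less_top less_top)
   hence "F < top" "G < top" using FGH by (auto simp: le_less_trans intro: le_less_trans[OF _ le_less_trans[OF FGH]])
   then obtain F' G' H' where r: "F = ennreal F'" "0 <= F'" "G = ennreal G'" "0 <= G'" "H = ennreal H'" "0 <= H'"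
    using False by (metis ennreal_cases less_top)
   have "ennreal (F' + G') <= ennreal (2 * H')"
    using FGH unfolding r using r(2,4,6) by (simp add: ennreal_mult)
   hence le: "F' + G' <= 2 * H'" using r(2,4,6) by (subst (asm) ennreal_le_iff) auto
   have "(F' + G')^2 <= (2 * H')^2" using le r by (intro power_mono) auto
   moreover have "0 <= (F' - G')^2" by simp
   ultimately have "F' * G' <= H'^2" by (simp add: power2_eq_square algebra_simps)
   thus ?thesis unfolding r using r by (simp add: ennreal_mult[symmetric] ennreal_power ennreal_leI)
  qed
  hence "ennreal (\<alpha>*\<beta>)*(F * G) <= ennreal (\<alpha>*\<beta>) * H^2" by (rule mult_left_mono) simp
  moreover have "ennreal (\<alpha>*\<beta>)*(F * G) = (ennreal \<alpha> * F)*(ennreal \<beta> * G)"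
   using ab by (simp add: ennreal_mult mult_ac)
  moreover have "ennreal (\<alpha>*\<beta>) * H^2 = (ennreal c * H)^2"
   using c by (simp add: power_mult_distrib ennreal_power)
  ultimately show ?thesis
   unfolding scale[OF ab(1) m(1) f(1)] scale[OF ab(2) m(2) g(1)] scale[OF c(1) m(3) h(1)] F_def G_def H_def by simp
 qed
qed

text \<open>Truncation in height and in space leads to \<open>prekopa_bounded\<close>; capping
  \<open>h\<close> at the same height preserves the midpoint inequality. Monotone convergence
  removes the truncation, two different levels being replaced by the larger one.\<close>

lemma prekopa_real:
 fixes f g h :: "real => ennreal"
 assumes m [measurable]: "f \<in> borel_measurable borel" "g \<in> borel_measurable borel" "h \<in> borel_measurable borel"
  and h: "!!x y. f x * g y <= (h ((x + y)/2))^2"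
 shows "(nn_integral lborel (%x. f x))*(nn_integral lborel (%x. g x)) <= (nn_integral lborel (%x. h x))^2"
proof -
 define tr where "tr k u x = min (u x) (of_nat k) * indicator {- real k..real k} x" for k :: nat and u :: "real => ennreal" and x
 have trm: "tr k u \<in> borel_measurable lborel" if "u \<in> borel_measurable borel" for k u
  using that unfolding tr_def by measurable
 have inc: "incseq (%k. tr k u)" for u
  unfolding tr_def incseq_def le_fun_def
  by (intro allI impI mult_mono min.mono) auto
 have sup: "(SUP k. tr k u x) = u x" for u x
 proof (rule antisym)
  show "(SUP k. tr k u x) <= u x" unfolding tr_def by (intro SUP_least) (auto simp: indicator_def)
  show "u x <= (SUP k. tr k u x)"
  proof (rule dense_le)
   fix y assume y: "y < u x"
   hence "y < top" by (metis less_top order_less_le_trans top_greatest)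
   then obtain k1 :: nat where k1: "y < of_nat k1" using ennreal_Ex_less_of_nat by blast
   obtain k2 :: nat where k2: "\<bar>x\<bar> <= k2" using real_arch_simple by blast
   have "y <= tr (max k1 k2) u x"
   proof -
    have "(of_nat k1 :: ennreal) <= of_nat (max k1 k2)" by simp
    hence "y <= of_nat (max k1 k2)" using k1 by (meson less_imp_le order_trans)
    moreover have "x \<in> {- real (max k1 k2)..real (max k1 k2)}" using k2 by auto
    ultimately show ?thesis unfolding tr_def using y by (simp add: min_def less_imp_le)
   qed
   thus "y <= (SUP k. tr k u x)" by (rule SUP_upper2[rotated]) simp
  qed
 qed
 have int: "(nn_integral lborel (%x. u x)) = (SUP k. \<integral>\<^sup>+x. tr k u x \<partial>lborel)" if "u \<in> borel_measurable borel" for u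
  using nn_integral_monotone_convergence_SUP[OF inc trm[OF that]] unfolding sup .
 have mono: "(nn_integral lborel (%x. tr i u x)) <= (nn_integral lborel (%x. tr j u x))" if "i <= j" for i j u
  using inc[of u] that by (intro nn_integral_mono) (auto simp: incseq_def le_fun_def)
 have fin: "tr k u x < top" for k u x
 proof -
  have "tr k u x <= of_nat k" unfolding tr_def by (auto simp: indicator_def)
  thus ?thesis by (metis le_less_trans of_nat_less_top)
 qed
 have real: "ennreal (enn2real (tr k u x)) = tr k u x" for k u x using fin by simp
 have key: "(nn_integral lborel (%x. tr k f x))*(nn_integral lborel (%x. tr k g x)) <= (nn_integral lborel (%x. h x))^2" for k
 proof -
  define hh where "hh x = min (h x) (of_nat k)" for x
  have hfin: "hh x < top" for x unfolding hh_def by (metis min_less_iff_disj of_nat_less_top)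
  have hreal: "ennreal (enn2real (hh x)) = hh x" for x using hfin by simp
  have "(nn_integral lborel (%x. ennreal (enn2real (tr k f x))))*(nn_integral lborel (%x. ennreal (enn2real (tr k g x))))
    <= (nn_integral lborel (%x. ennreal (enn2real (hh x))))^2"
  proof (rule prekopa_bounded[where k = "real k"])
   have le: "enn2real (tr k u x) <= real k" for u x
    unfolding tr_def by (intro enn2real_leI) (auto simp: indicator_def ennreal_of_nat_eq_real_of_nat)
   show "enn2real (tr k f x) <= real k" "enn2real (tr k g x) <= real k" for x by (rule le)+
   show "enn2real (tr k f x) * enn2real (tr k g y) <= (enn2real (hh ((x + y)/2)))^2" for x y
   proof -
    have fx: "tr k f x <= f x" "tr k f x <= of_nat k" "tr k g y <= g y" "tr k g y <= of_nat k"
     unfolding tr_def by (auto simp: indicator_def)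
    have "tr k f x * tr k g y <= (hh ((x + y)/2))^2"
    proof (cases "h ((x + y)/2) <= of_nat k")
     case True
     have "tr k f x * tr k g y <= f x * g y" using fx by (intro mult_mono) auto
     thus ?thesis using h[of x y] True unfolding hh_def by simp
    next
     case False
     have "tr k f x * tr k g y <= of_nat k * of_nat k" using fx by (intro mult_mono) auto
     thus ?thesis using False unfolding hh_def by (simp add: min_def power2_eq_square)
    qed
    hence "ennreal (enn2real (tr k f x) * enn2real (tr k g y)) <= ennreal ((enn2real (hh ((x + y)/2)))^2)"
     by (simp add: ennreal_mult real hreal flip: ennreal_power)
    thus ?thesis by simp
   qed
   have m0: "(%x. enn2real (tr k u x)) \<in> borel_measurable borel" if "u \<in> borel_measurable borel" for u
    using trm[OF that, of k] by simp
   show "(%x. enn2real (tr k f x)) \<in> borel_measurable borel" "(%x. enn2real (tr k g x)) \<in> borel_measurable borel"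
    by (intro m0 m)+
   show "(%x. enn2real (hh x)) \<in> borel_measurable borel" unfolding hh_def by measurable
  qed (auto simp: tr_def indicator_def)
  also have "... <= (nn_integral lborel (%x. h x))^2"
   unfolding hreal by (intro power_mono nn_integral_mono) (auto simp: hh_def)
  finally show ?thesis unfolding real .
 qed
 show ?thesis
  unfolding int[OF m(1)] int[OF m(2)] SUP_mult_right_ennreal SUP_mult_left_ennreal
 proof (intro SUP_least)
  fix i j
  have "(nn_integral lborel (%x. tr i f x))*(nn_integral lborel (%x. tr j g x)) <=
   (nn_integral lborel (%x. tr (max i j) f x))*(nn_integral lborel (%x. tr (max i j) g x))"
   by (intro mult_mono mono) auto
  also note key
  finally show "(nn_integral lborel (%x. tr i f x))*(nn_integral lborel (%x. tr j g x)) <= (nn_integral lborel (%x. h x))^2" .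
 qed
qed

text \<open>Induction on the dimension: for fixed last coordinates the slices satisfy the
  hypothesis, so the marginals satisfy that of the one-dimensional inequality.\<close>

theorem prekopa_leindler:
 fixes f g h :: "(nat => real) => ennreal"
 assumes "finite I"
  and "f \<in> borel_measurable (\<Pi>\<^sub>M i\<in>I. lborel)" "g \<in> borel_measurable (\<Pi>\<^sub>M i\<in>I. lborel)" "h \<in> borel_measurable (\<Pi>\<^sub>M i\<in>I. lborel)"
  and "!!x y. x \<in> extensional I ==> y \<in> extensional I ==> f x * g y <= (h (\<lambda>i\<in>I. (x i + y i)/2))^2"
 shows "(nn_integral (\<Pi>\<^sub>M i\<in>I. lborel) (%x. f x))*(nn_integral (\<Pi>\<^sub>M i\<in>I. lborel) (%x. g x)) <= (nn_integral (\<Pi>\<^sub>M i\<in>I. lborel) (%x. h x))^2"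
 using assms
proof (induction I arbitrary: f g h rule: finite_induct)
 case empty
 interpret product_sigma_finite "%_::nat. lborel :: real measure" by standard
 have "f (%_. undefined) * g (%_. undefined) <= (h (%_. undefined))^2"
  using empty(4)[of "%_. undefined" "%_. undefined"] by simp
 thus ?case by (simp add: PiM_empty nn_integral_count_space_finite)
next
 case (insert i I)
 interpret product_sigma_finite "%_::nat. lborel :: real measure" by standard
 interpret I: finite_product_sigma_finite "%_::nat. lborel :: real measure" I by standard (rule insert.hyps)
 note m [measurable] = insert.prems(1-3)
 have slice: "(%x. u (x(i := s))) \<in> borel_measurable (\<Pi>\<^sub>M i\<in>I. lborel)"
  if [measurable]: "u \<in> borel_measurable (\<Pi>\<^sub>M i\<in>insert i I. lborel)" for u :: "(nat => real) => ennreal" and s :: real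
  by measurable
 have marg: "(%s. \<integral>\<^sup>+x. u (x(i := s)) \<partial>(\<Pi>\<^sub>M i\<in>I. lborel)) \<in> borel_measurable borel"
  if [measurable]: "u \<in> borel_measurable (\<Pi>\<^sub>M i\<in>insert i I. lborel)" for u :: "(nat => real) => ennreal"
 proof -
  have "(%s. \<integral>\<^sup>+x. u (x(i := s)) \<partial>(\<Pi>\<^sub>M i\<in>I. lborel)) \<in> borel_measurable lborel" by measurable
  thus ?thesis by simp
 qed
 show ?case
  unfolding product_nn_integral_insert_rev[OF insert.hyps m(1)] product_nn_integral_insert_rev[OF insert.hyps m(2)]
   product_nn_integral_insert_rev[OF insert.hyps m(3)]
 proof (rule prekopa_real)
  fix s t :: real
  show "(nn_integral (\<Pi>\<^sub>M i\<in>I. lborel) (%x. f (x(i := s))))*(nn_integral (\<Pi>\<^sub>M i\<in>I. lborel) (%x. g (x(i := t))))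
   <= (nn_integral (\<Pi>\<^sub>M i\<in>I. lborel) (%x. h (x(i := (s + t)/2))))^2"
  proof (rule insert.IH)
   fix x y :: "nat => real" assume xy: "x \<in> extensional I" "y \<in> extensional I"
   have "x(i := s) \<in> extensional (insert i I)" "y(i := t) \<in> extensional (insert i I)"
    using xy by auto
   from insert.prems(4)[OF this]
   have "f (x(i := s)) * g (y(i := t)) <= (h (\<lambda>j\<in>insert i I. ((x(i := s)) j + (y(i := t)) j)/2))^2" .
   also have "(\<lambda>j\<in>insert i I. ((x(i := s)) j + (y(i := t)) j)/2) = (\<lambda>j\<in>I. (x j + y j)/2)(i := (s + t)/2)"
    by (auto simp: fun_eq_iff)
   finally show "f (x(i := s)) * g (y(i := t)) <= (h ((\<lambda>j\<in>I. (x j + y j)/2)(i := (s + t)/2)))^2" .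
  qed (intro slice m)+
 qed (intro marg m)+
qed

section \<open>Gaussian smoothing of a log-concave measure\<close>

lemma DERIV_quadratic:
 fixes f :: "real => real"
 assumes "!!h. \<bar>h\<bar> <= 1 ==> \<bar>f (x + h) - f x - h * D\<bar> <= K * h^2"
 shows "(f has_real_derivative D) (at x)"
proof -
 have "((%h. (f (x + h) - f x)/h - D) \<longlongrightarrow> 0) (at 0)"
 proof (rule Lim_null_comparison)
  show "\<forall>\<^sub>F h in at 0. norm ((f (x + h) - f x)/h - D) <= K*\<bar>h\<bar>"
   unfolding eventually_at
  proof (intro exI[of _ 1] conjI ballI impI)
   fix h :: real assume h: "h ~= 0 & dist h 0 < 1"
   have "(f (x + h) - f x)/h - D = (f (x + h) - f x - h * D)/h" using h by (simp add: field_simps)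
   also have "norm ... <= K * h^2/\<bar>h\<bar>"
    using assms[of h] h by (simp add: divide_right_mono)
   also have "h^2 = \<bar>h\<bar>*\<bar>h\<bar>" by (simp add: power2_eq_square)
   also have "K*(\<bar>h\<bar>*\<bar>h\<bar>)/\<bar>h\<bar> = K*\<bar>h\<bar>" by (simp del: abs_mult_self_eq)
   finally show "norm ((f (x + h) - f x)/h - D) <= K*\<bar>h\<bar>" .
  qed simp
  show "((%h. K*\<bar>h\<bar>) \<longlongrightarrow> 0) (at 0)" by (auto intro!: tendsto_eq_intros)
 qed
 thus ?thesis unfolding DERIV_def by (simp add: LIM_zero_iff)
qed

lemma exp_taylor3: "\<bar>exp u - (1 + u + u^2/2)\<bar> <= \<bar>u\<bar> ^ 3 * exp \<bar>u\<bar>" for u :: real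
proof -
 obtain t where t: "\<bar>t\<bar> <= \<bar>u\<bar>" "exp u = (SUM m<3. u ^ m/fact m) + exp t/fact 3 * u ^ 3"
  using Maclaurin_exp_le[of u 3] by blast
 have "exp u - (1 + u + u^2/2) = exp t/6 * u ^ 3"
  using t(2) by (simp add: numeral_eq_Suc)
 also have "\<bar>...\<bar> = \<bar>u\<bar> ^ 3*(exp t/6)" by (simp add: abs_mult power_abs)
 also have "... <= \<bar>u\<bar> ^ 3 * exp \<bar>u\<bar>"
 proof (rule mult_left_mono)
  have "exp t <= exp \<bar>u\<bar>" using t(1) by simp
  thus "exp t/6 <= exp \<bar>u\<bar>" using exp_gt_zero[of t] by linarith
 qed simp
 finally show ?thesis .
qed

locale smoothed =
 fixes n :: nat and \<mu> :: "(nat => real) measure" and a :: real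
 assumes prob: "prob_space \<mu>" and sets_mu: "sets \<mu> = sets (Bn n)" and a_pos: "0 < a"

sublocale smoothed \<subseteq> prob_space \<mu> by (rule prob)

context smoothed
begin

abbreviation l1 :: "(nat => real) => real" where "l1 y \<equiv> (SUM i<n. \<bar>y i\<bar>)"

text \<open>At most exponential growth. The class contains the polynomials produced by
  differentiating \<open>Lap\<close>, and the Gaussian factor in \<open>kern\<close> makes all its
  members integrable.\<close>

definition gr :: "((nat => real) => real) => bool" where
 "gr g \<longleftrightarrow> g \<in> borel_measurable \<mu> & (EX C c. 0 <= C & 0 <= c & (ALL y. \<bar>g y\<bar> <= C * exp (c * l1 y)))"

text \<open>Up to a constant and the factor \<open>exp (- a |x|^2 / 2)\<close> this is the Gaussian
  of variance \<open>1 / a\<close> centred at \<open>y\<close>, evaluated at \<open>x\<close>. With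
  that factor removed, derivatives in \<open>x\<close> only bring down factors
  \<open>a * y i\<close>.\<close>

definition kern :: "(nat => real) => (nat => real) => real" where
 "kern x y = exp (SUM i<n. a * x i * y i - a/2*(y i)^2)"

definition Lap :: "((nat => real) => real) => (nat => real) => real" where
 "Lap g x = (LINT y|\<mu>. g y * kern x y)"

lemma coord_l1: "i < n ==> \<bar>y i\<bar> <= l1 y" by (rule member_le_sum) auto

lemma coord_meas [measurable]: "i < n ==> (%y. y i) \<in> borel_measurable \<mu>"
 unfolding measurable_cong_sets[OF sets_mu refl] by (rule measurable_component_singleton) simp

lemma kern_meas [measurable]: "(%y. kern x y) \<in> borel_measurable \<mu>"
 unfolding kern_def by measurable

lemma gr_meas [measurable_dest]: "gr g ==> g \<in> borel_measurable \<mu>" unfolding gr_def by simp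

lemma gr_const: "gr (%_. k)"
 unfolding gr_def by (intro conjI exI[of _ "\<bar>k\<bar>"] exI[of _ 0]) auto

lemma gr_coord: "i < n ==> gr (%y. y i)"
 unfolding gr_def
proof (intro conjI exI[of _ 1] allI)
 fix y assume "i < n"
 hence "\<bar>y i\<bar> <= l1 y" by (rule coord_l1)
 thus "\<bar>y i\<bar> <= 1 * exp (1 * l1 y)" using exp_ge_add_one_self[of "l1 y"] unfolding mult_1 by linarith
qed auto

lemma gr_mult:
 assumes "gr f" "gr g"
 shows "gr (%y. f y * g y)"
proof -
 obtain C c where f: "f \<in> borel_measurable \<mu>" "0 <= C" "0 <= c" "!!y. \<bar>f y\<bar> <= C * exp (c * l1 y)"
  using assms(1) unfolding gr_def by blast
 obtain D d where g: "g \<in> borel_measurable \<mu>" "0 <= D" "0 <= d" "!!y. \<bar>g y\<bar> <= D * exp (d * l1 y)"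
  using assms(2) unfolding gr_def by blast
 show ?thesis
  unfolding gr_def
 proof (rule conjI[rotated], rule exI[of _ "C * D"], rule exI[of _ "c + d"], intro conjI allI)
  fix y
  have "\<bar>f y * g y\<bar> <= (C * exp (c * l1 y))*(D * exp (d * l1 y))"
   unfolding abs_mult using f g by (intro mult_mono) auto
  also have "... = C * D * exp ((c + d) * l1 y)" by (simp add: exp_add distrib_right)
  finally show "\<bar>f y * g y\<bar> <= C * D * exp ((c + d) * l1 y)" .
 qed (use f g in auto)
qed

lemma gr_add:
 assumes "gr f" "gr g"
 shows "gr (%y. f y + g y)"
proof -
 obtain C c where f: "f \<in> borel_measurable \<mu>" "0 <= C" "0 <= c" "!!y. \<bar>f y\<bar> <= C * exp (c * l1 y)"
  using assms(1) unfolding gr_def by blast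
 obtain D d where g: "g \<in> borel_measurable \<mu>" "0 <= D" "0 <= d" "!!y. \<bar>g y\<bar> <= D * exp (d * l1 y)"
  using assms(2) unfolding gr_def by blast
 show ?thesis
  unfolding gr_def
 proof (rule conjI[rotated], rule exI[of _ "C + D"], rule exI[of _ "c + d"], intro conjI allI)
  fix y
  have "C * exp (c * l1 y) <= C * exp ((c + d) * l1 y)" "D * exp (d * l1 y) <= D * exp ((c + d) * l1 y)"
   using f(2,3) g(2,3) by (auto intro!: mult_left_mono mult_right_mono)
  thus "\<bar>f y + g y\<bar> <= (C + D) * exp ((c + d) * l1 y)"
   using f(4)[of y] g(4)[of y] unfolding distrib_right by linarith
 qed (use f g in auto)
qed

lemma gr_abs: "gr f ==> gr (%y. \<bar>f y\<bar>)"
 unfolding gr_def by auto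

lemma gr_sum: "(!!j. j \<in> S ==> gr (f j)) ==> gr (%y. \<Sum>j\<in>S. f j y)"
 by (induction S rule: infinite_finite_induct) (auto intro: gr_const gr_add)

lemma kern_bound:
 assumes x: "!!i. i < n ==> \<bar>x i\<bar> <= B" and c: "0 <= c"
 shows "kern x y * exp (c * l1 y) <= exp (n*((a * B + c)^2/(2 * a)))"
proof -
 have "(SUM i<n. a * x i * y i - a/2*(y i)^2) + c * l1 y = (SUM i<n. a * x i * y i - a/2*(y i)^2 + c*\<bar>y i\<bar>)"
  by (simp add: sum.distrib sum_distrib_left)
 also have "... <= (SUM i<n. (a * B + c)^2/(2 * a))"
 proof (rule sum_mono)
  fix i assume "i \<in> {..<n}"
  hence "x i * y i <= B*\<bar>y i\<bar>"
   using x[of i] mult_right_mono[of "\<bar>x i\<bar>" B "\<bar>y i\<bar>"] abs_ge_self[of "x i * y i"] by (simp add: abs_mult)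
  hence "a*(x i * y i) <= a*(B*\<bar>y i\<bar>)" using a_pos by (intro mult_left_mono) auto
  moreover have "a*(B*\<bar>y i\<bar>) + c*\<bar>y i\<bar> - a/2*(y i)^2 <= (a * B + c)^2/(2 * a)"
  proof -
   have "0 <= (a*\<bar>y i\<bar> - (a * B + c))^2" by simp
   also have "... = a * a*(y i)^2 - 2 * a*(a * B + c)*\<bar>y i\<bar> + (a * B + c)^2"
    by (simp add: power2_eq_square algebra_simps)
   finally have "2 * a*(a*(B*\<bar>y i\<bar>) + c*\<bar>y i\<bar> - a/2*(y i)^2) <= (a * B + c)^2"
    by (simp add: algebra_simps)
   thus ?thesis using a_pos by (simp add: field_simps)
  qed
  ultimately show "a * x i * y i - a/2*(y i)^2 + c*\<bar>y i\<bar> <= (a * B + c)^2/(2 * a)" by simp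
 qed
 also have "... = n*((a * B + c)^2/(2 * a))" by simp
 finally show ?thesis unfolding kern_def exp_add[symmetric] by simp
qed

lemma gr_kern_bound:
 assumes "gr g"
 shows "EX K>=0. ALL x. (ALL i<n. \<bar>x i\<bar> <= B) --> (ALL y. \<bar>g y * kern x y\<bar> <= K)"
proof -
 obtain C c where g: "0 <= C" "0 <= c" "!!y. \<bar>g y\<bar> <= C * exp (c * l1 y)"
  using assms unfolding gr_def by blast
 show ?thesis
 proof (intro exI[of _ "C * exp (n*((a * B + c)^2/(2 * a)))"] conjI allI impI)
  show "0 <= C * exp (n*((a * B + c)^2/(2 * a)))" using g by simp
  fix x y :: "nat => real" assume x: "ALL i<n. \<bar>x i\<bar> <= B"
  have k: "0 < kern x y" unfolding kern_def by simp
  have "\<bar>g y * kern x y\<bar> <= (C * exp (c * l1 y)) * kern x y"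
   using g(3)[of y] k by (simp add: abs_mult)
  also have "... = C*(kern x y * exp (c * l1 y))" by simp
  also have "... <= C * exp (n*((a * B + c)^2/(2 * a)))"
   using g x by (intro mult_left_mono kern_bound) auto
  finally show "\<bar>g y * kern x y\<bar> <= C * exp (n*((a * B + c)^2/(2 * a)))" .
 qed
qed

lemma Lap_int: "gr g ==> integrable \<mu> (%y. g y * kern x y)"
proof -
 assume g: "gr g"
 have "\<bar>x i\<bar> <= l1 x" if "i < n" for i using coord_l1[OF that] .
 then obtain K where K: "!!y. \<bar>g y * kern x y\<bar> <= K" using gr_kern_bound[OF g, of "l1 x"] by blast
 show ?thesis by (rule integrable_const_bound[of _ K]) (use g K in \<open>auto\<close>)
qed

lemma kern_shift: "kern (%i. x i + s * v i) y = kern x y * exp (s*(SUM i<n. a * v i * y i))"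
 unfolding kern_def exp_add[symmetric] by (simp add: sum_distrib_left sum.distrib[symmetric] algebra_simps)

lemma gr_lin: "gr (%y. SUM i<n. a * v i * y i)"
 by (intro gr_sum gr_mult gr_const gr_coord) auto

lemma gr_exp_lin: "gr (%y. exp \<bar>SUM i<n. a * v i * y i\<bar>)"
 unfolding gr_def
proof (rule conjI[rotated], rule exI[of _ "1"], rule exI[of _ "SUM i<n. \<bar>a * v i\<bar>"], intro conjI allI)
 fix y
 have "\<bar>SUM i<n. a * v i * y i\<bar> <= (SUM i<n. \<bar>a * v i\<bar> * l1 y)"
  by (rule order_trans[OF sum_abs]) (auto intro!: sum_mono mult_left_mono coord_l1 simp: abs_mult)
 thus "\<bar>exp \<bar>SUM i<n. a * v i * y i\<bar>\<bar> <= 1 * exp ((SUM i<n. \<bar>a * v i\<bar>) * l1 y)"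
  by (simp add: sum_distrib_right)
qed (auto intro: sum_nonneg)

text \<open>Along a line the kernel is multiplied by \<open>exp (s u)\<close> with \<open>u\<close>
  linear in \<open>y\<close>. The cubic remainder is dominated by \<open>|u|^3 exp |u|\<close>,
  which still has exponential growth only.\<close>

lemma Lap_taylor:
 assumes g: "gr g"
 shows "EX K>=0. ALL s. \<bar>s\<bar> <= 1 --> \<bar>Lap g (%i. x i + s * v i) - (Lap g x + s * Lap (%y. (SUM i<n. a * v i * y i) * g y) x
  + s^2/2 * Lap (%y. (SUM i<n. a * v i * y i)^2 * g y) x)\<bar> <= K*\<bar>s\<bar> ^ 3"
proof -
 define u where "u y = (SUM i<n. a * v i * y i)" for y
 have gu: "gr u" unfolding u_def by (rule gr_lin)
 have gabs: "gr (%y. \<bar>u y\<bar>)" by (rule gr_abs[OF gu])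
 have g3: "gr (%y. \<bar>u y\<bar>*(\<bar>u y\<bar>*\<bar>u y\<bar>) * exp \<bar>u y\<bar> * g y)"
  using gr_exp_lin[of v] unfolding u_def[symmetric] by (intro gr_mult gabs g)
 have g2: "gr (%y. (u y)^2 * g y)" unfolding power2_eq_square by (intro gr_mult gu g)
 have g1: "gr (%y. u y * g y)" by (intro gr_mult gu g)
 have "\<bar>x i\<bar> <= l1 x" if "i < n" for i using coord_l1[OF that] .
 then obtain K where K: "0 <= K" "!!y. \<bar>(\<bar>u y\<bar>*(\<bar>u y\<bar>*\<bar>u y\<bar>) * exp \<bar>u y\<bar> * g y) * kern x y\<bar> <= K"
  using gr_kern_bound[OF g3, of "l1 x"] by blast
 have ig: "integrable \<mu> (%y. g y * kern (%i. x i + s * v i) y)" for s by (rule Lap_int[OF g])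
 note i0 = Lap_int[OF g, of x] and i1 = Lap_int[OF g1, of x] and i2 = Lap_int[OF g2, of x]
 show ?thesis
  unfolding u_def[symmetric]
 proof (intro exI[of _ K] conjI allI impI K(1))
  fix s :: real assume s: "\<bar>s\<bar> <= 1"
  let ?D = "%y. g y * kern (%i. x i + s * v i) y - (g y * kern x y + s*(u y * g y * kern x y) + s^2/2*((u y)^2 * g y * kern x y))"
  have ij: "integrable \<mu> (%y. g y * kern x y + s*(u y * g y * kern x y) + s^2/2*((u y)^2 * g y * kern x y))"
   by (intro Bochner_Integration.integrable_add integrable_mult_right i0 i1 i2)
  have eq: "Lap g (%i. x i + s * v i) - (Lap g x + s * Lap (%y. u y * g y) x + s^2/2 * Lap (%y. (u y)^2 * g y) x) = (LINT y|\<mu>. ?D y)"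
  proof -
   have "(LINT y|\<mu>. g y * kern x y + s*(u y * g y * kern x y) + s^2/2*((u y)^2 * g y * kern x y)) =
     Lap g x + s * Lap (%y. u y * g y) x + s^2/2 * Lap (%y. (u y)^2 * g y) x"
    unfolding Lap_def
    by (subst Bochner_Integration.integral_add, (intro Bochner_Integration.integrable_add integrable_mult_right i0 i1 i2)+,
     subst Bochner_Integration.integral_add, (intro integrable_mult_right i0 i1 i2)+, simp)
   thus ?thesis unfolding Bochner_Integration.integral_diff[OF ig ij] by (simp add: Lap_def)
  qed
  have "\<bar>\<integral>y. ?D y \<partial>\<mu>\<bar> <= (LINT y|\<mu>. K*\<bar>s\<bar> ^ 3)"
  proof (rule int_abs_le)
   show "integrable \<mu> ?D" by (intro Bochner_Integration.integrable_diff ig ij)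
   show "\<bar>?D y\<bar> <= K*\<bar>s\<bar> ^ 3" for y
   proof -
    have "?D y = g y * kern x y*(exp (s * u y) - (1 + s * u y + (s * u y)^2/2))"
     unfolding kern_shift u_def[symmetric] by (simp add: algebra_simps)
    also have "\<bar>...\<bar> <= \<bar>g y * kern x y\<bar>*(\<bar>s * u y\<bar> ^ 3 * exp \<bar>s * u y\<bar>)"
     unfolding abs_mult[of "g y * kern x y"] by (intro mult_left_mono exp_taylor3) auto
    also have "... <= \<bar>g y * kern x y\<bar>*(\<bar>s * u y\<bar> ^ 3 * exp \<bar>u y\<bar>)"
    proof -
     have "\<bar>s * u y\<bar> <= 1*\<bar>u y\<bar>" unfolding abs_mult using s by (intro mult_right_mono) auto
     thus ?thesis by (intro mult_left_mono) auto
    qed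
    also have "... = \<bar>(\<bar>u y\<bar>*(\<bar>u y\<bar>*\<bar>u y\<bar>) * exp \<bar>u y\<bar> * g y) * kern x y\<bar>*\<bar>s\<bar> ^ 3"
     by (simp add: abs_mult power3_eq_cube mult_ac)
    also have "... <= K*\<bar>s\<bar> ^ 3" using K by (intro mult_right_mono) auto
    finally show ?thesis .
   qed
  qed simp
  thus "\<bar>Lap g (%i. x i + s * v i) - (Lap g x + s * Lap (%y. u y * g y) x + s^2/2 * Lap (%y. (u y)^2 * g y) x)\<bar> <= K*\<bar>s\<bar> ^ 3"
   unfolding eq by (simp add: prob_space)
 qed
qed

lemma Lap_deriv:
 assumes g: "gr g" and i: "i < n"
 shows "((%r. Lap g (x(i := r))) has_real_derivative Lap (%y. a * y i * g y) x) (at (x i))"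
proof -
 let ?e = "%k. if k = i then 1 else 0 :: real"
 have u: "(SUM k<n. a*?e k * y k) = a * y i" for y :: "nat => real"
 proof -
  have "(SUM k<n. a*?e k * y k) = (SUM k<n. if k = i then a * y i else 0)" by (intro sum.cong refl) simp
  thus ?thesis using i by simp
 qed
 obtain K where K: "0 <= K" "!!s. \<bar>s\<bar> <= 1 ==> \<bar>Lap g (%k. x k + s*?e k) - (Lap g x + s * Lap (%y. (SUM k<n. a*?e k * y k) * g y) x
  + s^2/2 * Lap (%y. (SUM k<n. a*?e k * y k)^2 * g y) x)\<bar> <= K*\<bar>s\<bar> ^ 3"
  using Lap_taylor[OF g, of x ?e] by blast
 note K2 = K(2)[unfolded u]
 define M where "M = \<bar>Lap (%y. (a * y i)^2 * g y) x\<bar>"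
 show ?thesis
 proof (rule DERIV_quadratic)
  fix h :: real assume h: "\<bar>h\<bar> <= 1"
  have "(%k. x k + h*?e k) = x(i := x i + h)" by auto
  with K2[OF h] have "\<bar>Lap g (x(i := x i + h)) - (Lap g x + h * Lap (%y. a * y i * g y) x + h^2/2 * Lap (%y. (a * y i)^2 * g y) x)\<bar> <= K*\<bar>h\<bar> ^ 3"
   by simp
  moreover have "\<bar>h^2/2 * Lap (%y. (a * y i)^2 * g y) x\<bar> <= M * h^2"
  proof -
   have "\<bar>h^2/2 * Lap (%y. (a * y i)^2 * g y) x\<bar> = M*(h^2/2)" unfolding M_def by (simp add: abs_mult)
   also have "... <= M * h^2" unfolding M_def by (intro mult_left_mono) auto
   finally show ?thesis .
  qed
  moreover have "K*\<bar>h\<bar> ^ 3 <= K * h^2"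
  proof -
   have "\<bar>h\<bar>*\<bar>h\<bar>^2 <= 1*\<bar>h\<bar>^2" using h by (intro mult_right_mono) auto
   hence "\<bar>h\<bar> ^ 3 <= h^2" by (simp add: power3_eq_cube power2_eq_square mult_ac)
   thus ?thesis using K(1) by (rule mult_left_mono)
  qed
  ultimately show "\<bar>Lap g (x(i := x i + h)) - Lap g (x(i := x i)) - h * Lap (%y. a * y i * g y) x\<bar> <= (K + M) * h^2"
   unfolding fun_upd_triv distrib_right by linarith
 qed
qed

lemma exp_diff_le: "\<bar>exp u - exp v\<bar> <= \<bar>u - v\<bar>*(exp u + exp v)" for u v :: real
proof -
 have aux: "exp p - exp q <= (p - q) * exp p" if "q <= p" for p q :: real
 proof -
  have "exp p*(1 + (q - p)) <= exp p * exp (q - p)" by (intro mult_left_mono) auto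
  also have "... = exp q" by (simp add: exp_add[symmetric])
  finally show ?thesis by (simp add: algebra_simps)
 qed
 show ?thesis
 proof (cases "v <= u")
  case True
  have "exp u - exp v <= (u - v) * exp u" by (rule aux[OF True])
  also have "... <= (u - v)*(exp u + exp v)" using True by (intro mult_left_mono) auto
  finally show ?thesis using True by simp
 next
  case False
  hence "exp v - exp u <= (v - u) * exp v" by (intro aux) simp
  also have "... <= (v - u)*(exp u + exp v)" using False by (intro mult_left_mono) auto
  finally show ?thesis using False by simp
 qed
qed

lemma Lap_lip:
 assumes g: "gr g"
 shows "EX K>=0. ALL x x'. (ALL i<n. \<bar>x i\<bar> <= B) --> (ALL i<n. \<bar>x' i\<bar> <= B) --> \<bar>Lap g x - Lap g x'\<bar> <= K*(SUM i<n. \<bar>x i - x' i\<bar>)"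
proof -
 have "gr (%y. l1 y)" by (intro gr_sum gr_abs gr_coord) simp
 hence g1: "gr (%y. l1 y * g y)" by (rule gr_mult[OF _ g])
 obtain K where K: "0 <= K" "!!x y. ALL i<n. \<bar>x i\<bar> <= B ==> \<bar>(l1 y * g y) * kern x y\<bar> <= K"
  using gr_kern_bound[OF g1, of B] by blast
 show ?thesis
 proof (intro exI[of _ "2 * a * K"] conjI allI impI)
  show "0 <= 2 * a * K" using K a_pos by simp
  fix x x' :: "nat => real" assume x: "ALL i<n. \<bar>x i\<bar> <= B" "ALL i<n. \<bar>x' i\<bar> <= B"
  let ?d = "SUM i<n. \<bar>x i - x' i\<bar>"
  have "\<bar>\<integral>y. g y * kern x y - g y * kern x' y \<partial>\<mu>\<bar> <= (LINT y|\<mu>. 2 * a * K*?d)"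
  proof (rule int_abs_le)
   show "\<bar>g y * kern x y - g y * kern x' y\<bar> <= 2 * a * K*?d" for y
   proof -
    let ?u = "%x. SUM i<n. a * x i * y i - a/2*(y i)^2"
    have "\<bar>?u x - ?u x'\<bar> <= (SUM i<n. a*\<bar>x i - x' i\<bar> * l1 y)"
     unfolding sum_subtractf[symmetric]
    proof (rule order_trans[OF sum_abs], rule sum_mono)
     fix i assume "i \<in> {..<n}"
     hence "\<bar>y i\<bar> <= l1 y" by (intro coord_l1) simp
     hence "a*\<bar>x i - x' i\<bar>*\<bar>y i\<bar> <= a*\<bar>x i - x' i\<bar> * l1 y" using a_pos by (intro mult_left_mono) auto
     moreover have "a * x i * y i - a/2*(y i)^2 - (a * x' i * y i - a/2*(y i)^2) = a*(x i - x' i) * y i"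
      by (simp add: algebra_simps)
     ultimately show "\<bar>a * x i * y i - a/2*(y i)^2 - (a * x' i * y i - a/2*(y i)^2)\<bar> <= a*\<bar>x i - x' i\<bar> * l1 y"
      using a_pos by (simp add: abs_mult)
    qed
    also have "... = a*?d * l1 y" by (simp only: sum_distrib_left[symmetric] sum_distrib_right[symmetric])
    finally have u: "\<bar>?u x - ?u x'\<bar> <= a*?d * l1 y" .
    have "\<bar>kern x y - kern x' y\<bar> <= \<bar>?u x - ?u x'\<bar>*(kern x y + kern x' y)" unfolding kern_def by (rule exp_diff_le)
    also have "... <= a*?d * l1 y*(kern x y + kern x' y)" using u by (intro mult_right_mono) (auto simp: kern_def)
    finally have "\<bar>g y\<bar>*\<bar>kern x y - kern x' y\<bar> <= \<bar>g y\<bar>*(a*?d * l1 y*(kern x y + kern x' y))"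
     by (intro mult_left_mono) auto
    also have "... = a*?d*(\<bar>(l1 y * g y) * kern x y\<bar> + \<bar>(l1 y * g y) * kern x' y\<bar>)"
     by (simp add: abs_mult kern_def algebra_simps)
    also have "... <= a*?d*(K + K)"
     using K(2)[OF x(1), of y] K(2)[OF x(2), of y] a_pos by (intro mult_left_mono add_mono) (auto intro: sum_nonneg)
    finally show ?thesis by (simp add: abs_mult[symmetric] right_diff_distrib mult_ac)
   qed
  qed (use Lap_int[OF g] in auto)
  thus "\<bar>Lap g x - Lap g x'\<bar> <= 2 * a * K*?d"
   unfolding Lap_def Bochner_Integration.integral_diff[OF Lap_int[OF g] Lap_int[OF g]] by (simp add: prob_space)
 qed
qed

lemma Lap_pos: "0 < Lap (%_. 1) x"
 unfolding Lap_def
 by (rule expectation_greater) (use Lap_int[OF gr_const[of 1], of x] in \<open>auto simp: kern_def\<close>)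

end

section \<open>Log-concavity of the smoothed density\<close>

lemma sets_lborel_Rn: "sets (lborel_Rn n) = sets (Bn n)"
 unfolding lborel_Rn_def by (intro sets_PiM_cong) auto

lemma log_concave_midpoint:
 assumes lc: "convex_set_Rn n {x\<in>Rn n. 0 < p x}" "convex_on_Rn n {x\<in>Rn n. 0 < p x} (%x. ln (1/p x))"
  and p0: "!!x. x \<in> Rn n ==> 0 <= p x" and x: "x \<in> Rn n" and y: "y \<in> Rn n"
 shows "p x * p y <= (p (\<lambda>i\<in>{..<n}. (x i + y i)/2))^2"
proof (cases "0 < p x & 0 < p y")
 case True
 let ?S = "{x\<in>Rn n. 0 < p x}"
 let ?z = "add_Rn n (scale_Rn n (1/2) x) (scale_Rn n (1/2) y)"
 have z: "?z = (\<lambda>i\<in>{..<n}. (x i + y i)/2)"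
  unfolding add_Rn_def scale_Rn_def by (auto simp: fun_eq_iff)
 have xy: "x \<in> ?S" "y \<in> ?S" using True x y by auto
 hence zS: "?z \<in> ?S" using lc(1) unfolding convex_set_Rn_def by simp
 have "ln (1/p ?z) <= 1/2 * ln (1/p x) + 1/2 * ln (1/p y)"
  using lc(2)[unfolded convex_on_Rn_def, THEN conjunct2, rule_format, OF xy, of "1/2" "1/2"] by simp
 hence "ln (p x) + ln (p y) <= 2 * ln (p ?z)"
  using True zS by (simp add: ln_div)
 hence "ln (p x * p y) <= ln ((p ?z)^2)"
  using True zS by (simp add: ln_mult ln_realpow)
 thus ?thesis using True zS unfolding z by (subst (asm) ln_le_cancel_iff) auto
next
 case False
 hence "p x * p y <= 0" using p0[OF x] p0[OF y] by (auto simp: not_less order_antisym)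
 thus ?thesis using zero_le_power2[of "p (\<lambda>i\<in>{..<n}. (x i + y i)/2)"] by linarith
qed

text \<open>Log-concavity is kept in its midpoint form, which is the hypothesis of the
  Prekopa--Leindler inequality as stated.\<close>

locale lc_smoothed = smoothed +
 fixes p :: "(nat => real) => real"
 assumes p_meas: "p \<in> borel_measurable (lborel_Rn n)"
  and p_nonneg: "!!x. x \<in> Rn n ==> 0 <= p x"
  and mu_density: "\<mu> = density (lborel_Rn n) (%x. ennreal (p x))"
  and p_mid: "!!x y. x \<in> Rn n ==> y \<in> Rn n ==> p x * p y <= (p (\<lambda>i\<in>{..<n}. (x i + y i)/2))^2"
begin

definition gk :: "(nat => real) => (nat => real) => real" where
 "gk x y = exp (- (a/2*(SUM i<n. (x i - y i)^2)))"

lemma gk_kern: "gk x y = kern x y * exp (- (a/2*(SUM i<n. (x i)^2)))"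
proof -
 have "- (a/2*(SUM i<n. (x i - y i)^2)) = (SUM i<n. a * x i * y i - a/2*(y i)^2) + - (a/2*(SUM i<n. (x i)^2))"
  by (simp add: sum_distrib_left sum_negf[symmetric] sum.distrib[symmetric]) (intro sum.cong refl, simp add: power2_eq_square field_simps)
 thus ?thesis unfolding gk_def kern_def exp_add[symmetric] by simp
qed

definition RR :: "(nat => real) => real" where
 "RR x = Lap (%_. 1) x * exp (- (a/2*(SUM i<n. (x i)^2)))"

lemma gk_meas: "(%y. gk x y) \<in> borel_measurable \<mu>"
 unfolding gk_kern by measurable

lemma RR_nn: "ennreal (RR x) = (nn_integral (lborel_Rn n) (%y. ennreal (p y) * ennreal (gk x y)))"
proof -
 have i: "integrable \<mu> (%y. 1 * kern x y)" by (rule Lap_int[OF gr_const])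
 have "RR x = (LINT y|\<mu>. gk x y)"
  unfolding RR_def Lap_def gk_kern by simp
 also have "ennreal ... = (nn_integral \<mu> (%y. ennreal (gk x y)))"
  by (intro nn_integral_eq_integral[symmetric]) (use i in \<open>auto simp: gk_kern kern_def\<close>)
 also have "... = (nn_integral (lborel_Rn n) (%y. ennreal (p y) * ennreal (gk x y)))"
 proof (subst mu_density, rule nn_integral_density)
  show "(%x. ennreal (p x)) \<in> borel_measurable (lborel_Rn n)" using p_meas by measurable
  show "(%y. ennreal (gk x y)) \<in> borel_measurable (lborel_Rn n)"
   using gk_meas[of x] unfolding measurable_cong_sets[OF sets_mu refl] measurable_cong_sets[OF sets_lborel_Rn refl]
   by (rule measurable_compose[OF _ measurable_ennreal])
 qed
 finally show ?thesis .
qed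

text \<open>Prekopa--Leindler in the variable \<open>y\<close>, for \<open>p\<close> times the
  Gaussian kernels at \<open>x + h\<close>, \<open>x - h\<close> and \<open>x\<close>. The kernel is
  midpoint log-concave jointly in both arguments because the squared distance is convex.\<close>

lemma RR_mid: "RR (%i. x i + h i) * RR (%i. x i - h i) <= (RR x)^2"
proof -
 define F where "F x y = ennreal (p y) * ennreal (gk x y)" for x y
 have Fm: "F x \<in> borel_measurable (\<Pi>\<^sub>M i\<in>{..<n}. lborel)" for x
 proof -
  have "(%x. ennreal (p x)) \<in> borel_measurable (lborel_Rn n)" using p_meas by measurable
  moreover have "(%y. ennreal (gk x y)) \<in> borel_measurable (lborel_Rn n)"
   using gk_meas[of x] unfolding measurable_cong_sets[OF sets_mu refl] measurable_cong_sets[OF sets_lborel_Rn refl]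
   by (rule measurable_compose[OF _ measurable_ennreal])
  ultimately show ?thesis unfolding F_def lborel_Rn_def by (rule borel_measurable_times_ennreal)
 qed
 have RF: "ennreal (RR x) = (nn_integral (\<Pi>\<^sub>M i\<in>{..<n}. lborel) (%y. F x y))" for x
  unfolding RR_nn F_def lborel_Rn_def ..
 have R0: "0 <= RR x" for x unfolding RR_def using Lap_pos[of x] by simp
 have "ennreal (RR (%i. x i + h i)) * ennreal (RR (%i. x i - h i)) <= (ennreal (RR x))^2"
  unfolding RF
 proof (rule prekopa_leindler[OF _ Fm Fm Fm])
  fix y y' :: "nat => real" assume "y \<in> extensional {..<n}" "y' \<in> extensional {..<n}"
  hence y: "y \<in> Rn n" "y' \<in> Rn n" unfolding Rn_def by (simp_all add: PiE_iff)
  let ?z = "\<lambda>i\<in>{..<n}. (y i + y' i)/2"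
  have z: "?z \<in> Rn n" unfolding Rn_def by auto
  have "gk (%i. x i + h i) y * gk (%i. x i - h i) y' <= (gk x ?z)^2"
  proof -
   have "2*(SUM i<n. (x i - ?z i)^2) <= (SUM i<n. (x i + h i - y i)^2) + (SUM i<n. (x i - h i - y' i)^2)"
    unfolding sum_distrib_left sum.distrib[symmetric]
   proof (rule sum_mono)
    fix i assume "i \<in> {..<n}"
    hence "x i - ?z i = ((x i + h i - y i) + (x i - h i - y' i))/2" by (simp add: field_simps)
    moreover have "2*((A + B)/2)^2 <= A^2 + B^2" for A B :: real
     using zero_le_power2[of "A - B"] by (simp add: power2_eq_square field_simps)
    ultimately show "2*(x i - ?z i)^2 <= (x i + h i - y i)^2 + (x i - h i - y' i)^2" by metis
   qed
   hence "a/2*(2*(SUM i<n. (x i - ?z i)^2)) <= a/2*((SUM i<n. (x i + h i - y i)^2) + (SUM i<n. (x i - h i - y' i)^2))"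
    using a_pos by (intro mult_left_mono) auto
   thus ?thesis
    unfolding gk_def power2_eq_square[of "exp _"] exp_add[symmetric] by (simp add: algebra_simps)
  qed
  hence "(p y * p y')*(gk (%i. x i + h i) y * gk (%i. x i - h i) y') <= (p ?z)^2*(gk x ?z)^2"
   using p_mid[OF y] p_nonneg y by (intro mult_mono) (auto simp: gk_def)
  hence "ennreal (p y * gk (%i. x i + h i) y*(p y' * gk (%i. x i - h i) y')) <= ennreal ((p ?z * gk x ?z)^2)"
   by (intro ennreal_leI) (simp add: power_mult_distrib mult_ac)
  moreover have "F x y = ennreal (p y * gk x y)" "0 <= p y * gk x y" if "y \<in> Rn n" for x y
   unfolding F_def using p_nonneg[OF that] by (auto simp: ennreal_mult gk_def)
  ultimately show "F (%i. x i + h i) y * F (%i. x i - h i) y' <= (F x ?z)^2"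
   using y z by (simp add: ennreal_mult[symmetric] ennreal_power del: restrict_apply)
 qed simp
 hence "ennreal (RR (%i. x i + h i) * RR (%i. x i - h i)) <= ennreal ((RR x)^2)"
  using R0 by (simp add: ennreal_mult ennreal_power)
 thus ?thesis by (subst (asm) ennreal_le_iff) auto
qed

text \<open>\<open>RR\<close> differs from \<open>Lap\<close> by a Gaussian factor, and the
  parallelogram identity evaluates the quotient of these factors exactly.\<close>

lemma Lap_mid:
 "Lap (%_. 1) (%i. x i + s * v i) * Lap (%_. 1) (%i. x i - s * v i) * exp (- (a*(SUM i<n. (v i)^2) * s^2)) <= (Lap (%_. 1) x)^2"
proof -
 let ?L = "Lap (%_. 1)" and ?X = "SUM i<n. (x i)^2" and ?V = "SUM i<n. (v i)^2"
 have "(SUM i<n. (x i + s * v i)^2) + (SUM i<n. (x i - s * v i)^2) = (SUM i<n. 2*(x i)^2 + 2 * s^2*(v i)^2)"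
  unfolding sum.distrib[symmetric] by (intro sum.cong refl) (simp add: power2_eq_square algebra_simps)
 also have "... = 2*?X + 2 * s^2*?V" by (simp add: sum.distrib sum_distrib_left)
 finally have e: "(SUM i<n. (x i + s * v i)^2) + (SUM i<n. (x i - s * v i)^2) = 2*?X + 2 * s^2*?V" .
 have "exp (- (a/2*(SUM i<n. (x i + s * v i)^2))) * exp (- (a/2*(SUM i<n. (x i - s * v i)^2))) =
   exp (- (a/2*((SUM i<n. (x i + s * v i)^2) + (SUM i<n. (x i - s * v i)^2))))"
  unfolding exp_add[symmetric] by (simp add: distrib_left)
 also have "... = exp (- (a*?V * s^2))*(exp (- (a/2*?X)))^2"
  unfolding e power2_eq_square[of "exp _"] exp_add[symmetric] by (simp add: algebra_simps)
 finally have E: "exp (- (a/2*(SUM i<n. (x i + s * v i)^2))) * exp (- (a/2*(SUM i<n. (x i - s * v i)^2))) =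
   exp (- (a*?V * s^2))*(exp (- (a/2*?X)))^2" .
 have "RR (%i. x i + s * v i) * RR (%i. x i - s * v i) =
   (?L (%i. x i + s * v i)*?L (%i. x i - s * v i))*(exp (- (a/2*(SUM i<n. (x i + s * v i)^2))) * exp (- (a/2*(SUM i<n. (x i - s * v i)^2))))"
  unfolding RR_def by simp
 also have "... = (?L (%i. x i + s * v i)*?L (%i. x i - s * v i) * exp (- (a*?V * s^2)))*(exp (- (a/2*?X)))^2"
  unfolding E by simp
 finally have "(?L (%i. x i + s * v i)*?L (%i. x i - s * v i) * exp (- (a*?V * s^2)))*(exp (- (a/2*?X)))^2
   <= (?L x)^2*(exp (- (a/2*?X)))^2"
  using RR_mid[of x "%i. s * v i"] unfolding RR_def[of x] by (simp add: power_mult_distrib)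
 thus ?thesis by (rule mult_right_le_imp_le) simp
qed

text \<open>Inserting the expansions of \<open>l s\<close> and \<open>l (- s)\<close> into
  \<open>M\<close>, the terms of order zero and one cancel. Division by \<open>s^2\<close> and the
  limit at zero give the infinitesimal form: the second derivative of \<open>ln l\<close> at 0 is at
  most \<open>D\<close>.\<close>

lemma second_difference_bound:
 fixes l :: "real => real"
 assumes T: "!!s. \<bar>s\<bar> <= 1 ==> \<bar>l s - (l0 + s * d1 + s^2/2 * d2)\<bar> <= K*\<bar>s\<bar> ^ 3"
  and M: "!!s. l s * l (- s) * exp (- (D * s^2)) <= l0^2" and D: "0 <= D"
 shows "l0 * d2 - d1\<^sup>2 <= D * l0^2"
proof -
 define P where "P s = l0 + s * d1 + s^2/2 * d2" for s
 define g where "g s = (l s - P s)/s^2" for s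
 have e: "l s = P s + s^2 * g s" if "s ~= 0" for s unfolding g_def using that by simp
 have g: "\<bar>g s\<bar> <= K*\<bar>s\<bar>" if "\<bar>s\<bar> <= 1" "s ~= 0" for s
 proof -
  have "\<bar>g s\<bar> <= K*\<bar>s\<bar> ^ 3/s^2" unfolding g_def abs_divide P_def using T[OF that(1)] by (simp add: divide_right_mono)
  also have "... = K*\<bar>s\<bar>*(\<bar>s\<bar>*\<bar>s\<bar>/s^2)" by (simp add: power3_eq_cube)
  finally show ?thesis using that(2) by (simp add: power2_eq_square)
 qed
 have z: "((%s. K*\<bar>s\<bar>) \<longlongrightarrow> K*\<bar>0\<bar>) (at_right 0)" by (intro tendsto_intros)
 have g0: "((%s. g (c * s)) \<longlongrightarrow> 0) (at_right 0)" if "\<bar>c\<bar> = 1" for c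
 proof (rule Lim_null_comparison)
  show "\<forall>\<^sub>F s in at_right 0. norm (g (c * s)) <= K*\<bar>s\<bar>"
   unfolding eventually_at_right_field
  proof (intro exI[of _ 1] conjI allI impI)
   fix s :: real assume "0 < s" "s < 1"
   thus "norm (g (c * s)) <= K*\<bar>s\<bar>" using g[of "c * s"] that by (auto simp: abs_mult)
  qed simp
 qed (use z in simp)
 have "((%s. l0 * d2 - d1\<^sup>2 + s^2*(d2^2/4) + g (1 * s) * P (- s) + g (- 1 * s) * P s + s^2*(g (1 * s) * g (- 1 * s)))
   \<longlongrightarrow> l0 * d2 - d1\<^sup>2 + 0^2*(d2^2/4) + 0*(l0 + - 0 * d1 + (- 0)^2/2 * d2) + 0*(l0 + 0 * d1 + 0^2/2 * d2) + 0^2*(0*0)) (at_right 0)"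
  unfolding P_def by (intro tendsto_intros g0) auto
 moreover have "((%s. l0^2*(D + D^2 * s^2)) \<longlongrightarrow> l0^2*(D + D^2*0^2)) (at_right 0)" by (intro tendsto_intros)
 moreover have "\<forall>\<^sub>F s in at_right 0. l0 * d2 - d1\<^sup>2 + s^2*(d2^2/4) + g (1 * s) * P (- s) + g (- 1 * s) * P s + s^2*(g (1 * s) * g (- 1 * s))
   <= l0^2*(D + D^2 * s^2)"
  unfolding eventually_at_right_field
 proof (intro exI[of _ "1/(D + 1)"] conjI allI impI)
  fix s assume s: "0 < s" "s < 1/(D + 1)"
  have "s*(D + 1) < 1" using s D by (simp add: field_simps)
  moreover have "0 <= s * D" using s D by simp
  ultimately have "s * D * s <= 1*1" using s by (intro mult_mono) (auto simp: distrib_left)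
  hence Ds: "D * s^2 <= 1" "0 <= D * s^2" using D by (auto simp: power2_eq_square mult_ac)
  have "l s * l (- s) <= l0^2 * exp (D * s^2)" using M[of s] by (simp add: exp_minus field_simps)
  also have "... <= l0^2*(1 + D * s^2 + (D * s^2)^2)" using exp_bound[OF Ds(2,1)] by (intro mult_left_mono) auto
  finally have "s^2*(l0 * d2 - d1\<^sup>2 + s^2*(d2^2/4) + g s * P (- s) + g (- s) * P s + s^2*(g s * g (- s)))
    <= s^2*(l0^2*(D + D^2 * s^2))"
   using e[of s] e[of "- s"] s unfolding P_def by (simp add: power2_eq_square algebra_simps)
  thus "l0 * d2 - d1\<^sup>2 + s^2*(d2^2/4) + g (1 * s) * P (- s) + g (- 1 * s) * P s + s^2*(g (1 * s) * g (- 1 * s))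
    <= l0^2*(D + D^2 * s^2)" using s by simp
 qed (use D in simp)
 ultimately show ?thesis using tendsto_le[OF trivial_limit_at_right_real] by (fastforce simp: mult.commute)
qed

text \<open>Divided by the square of \<open>Lap (%_. 1) x\<close>, this bounds the Hessian of its
  logarithm by \<open>a\<close> in the direction \<open>v\<close>.\<close>

lemma Lap_hess:
 fixes v :: "nat => real"
 defines "u \<equiv> %y. SUM i<n. a * v i * y i"
 shows "Lap (%_. 1) x * Lap (%y. (u y)^2) x - (Lap u x)\<^sup>2 <= a*(SUM i<n. (v i)^2)*(Lap (%_. 1) x)^2"
proof -
 obtain K where K: "0 <= K" "!!s. \<bar>s\<bar> <= 1 ==> \<bar>Lap (%_. 1) (%i. x i + s * v i) - (Lap (%_. 1) x + s * Lap (%y. u y*1) x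
  + s^2/2 * Lap (%y. (u y)^2*1) x)\<bar> <= K*\<bar>s\<bar> ^ 3"
  using Lap_taylor[OF gr_const[of 1], of x v] unfolding u_def by blast
 show ?thesis
 proof (rule second_difference_bound[where l = "%s. Lap (%_. 1) (%i. x i + s * v i)" and K = K])
  show "\<bar>Lap (%_. 1) (%i. x i + s * v i) - (Lap (%_. 1) x + s * Lap u x + s^2/2 * Lap (%y. (u y)^2) x)\<bar> <= K*\<bar>s\<bar> ^ 3"
   if "\<bar>s\<bar> <= 1" for s using K(2)[OF that] by simp
  show "Lap (%_. 1) (%i. x i + s * v i) * Lap (%_. 1) (%i. x i + - s * v i) * exp (- (a*(SUM i<n. (v i)^2) * s^2)) <= (Lap (%_. 1) x)^2" for s
   using Lap_mid[of x s v] by simp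
 qed (use K(1) a_pos Lap_pos in \<open>auto intro!: mult_nonneg_nonneg sum_nonneg intro: less_imp_le\<close>)
qed

end

context cube
begin

lemma pd_ln: "pd i f f' ==> (!!x. x \<in> box ==> 0 < f x) ==> pd i (%x. ln (f x)) (%x. f' x/f x)"
 unfolding pd_def by (auto intro!: derivative_eq_intros)

lemma pd_divide: "pd i f f' ==> pd i g g' ==> (!!x. x \<in> box ==> 0 < g x) ==>
  pd i (%x. f x/g x) (%x. (f' x * g x - f x * g' x)/(g x * g x))"
 unfolding pd_def
proof (intro ballI)
 fix x assume a: "\<forall>x\<in>box. ((%r. f (x(i := r))) has_real_derivative f' x) (at (x i))"
  "\<forall>x\<in>box. ((%r. g (x(i := r))) has_real_derivative g' x) (at (x i))"
  "!!x. x \<in> box ==> 0 < g x" and x: "x \<in> box"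
 have "g (x(i := x i)) ~= 0" using a(3)[OF x] by simp
 from DERIV_divide[OF a(1)[rule_format, OF x] a(2)[rule_format, OF x] this]
 show "((%r. f (x(i := r))/g (x(i := r))) has_real_derivative (f' x * g x - f x * g' x)/(g x * g x)) (at (x i))"
  unfolding fun_upd_triv .
qed

lemma pd_sumsq: "i < n ==> pd i (%x. SUM k<n. (x k)^2) (%x. 2 * x i)"
proof -
 assume i: "i < n"
 have "pd i (%x. SUM k<n. x k * x k) (%x. SUM k<n. (if i = k then 1 else 0) * x k + x k*(if i = k then 1 else 0))"
  by (intro pd_sum pd_mult pd_coord)
 moreover have "(SUM k<n. (if i = k then 1 else 0) * x k + x k*(if i = k then 1 else 0)) = 2 * x i" for x :: "nat => real"
 proof -
  have "(SUM k<n. (if i = k then 1 else 0) * x k + x k*(if i = k then 1 else 0)) = (SUM k<n. if k = i then 2 * x i else 0)"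
   by (intro sum.cong refl) auto
  thus ?thesis using i by simp
 qed
 ultimately show ?thesis by (simp add: power2_eq_square)
qed

end

context smoothed
begin

lemma Lap_cont:
 assumes "cube R" and g: "gr g"
 shows "continuous_on (cube.box n R) (Lap g)"
 unfolding continuous_on_def
proof
 interpret cube n R by fact
 fix z assume z: "z \<in> box"
 obtain K where K: "!!x x'. ALL i<n. \<bar>x i\<bar> <= R ==> ALL i<n. \<bar>x' i\<bar> <= R ==> \<bar>Lap g x - Lap g x'\<bar> <= K*(SUM i<n. \<bar>x i - x' i\<bar>)"
  using Lap_lip[OF g, of R] by blast
 have "continuous_on UNIV (%x :: nat => real. K*(SUM i<n. \<bar>x i - z i\<bar>))"
  by (intro continuous_intros continuous_on_product_coordinates)
 hence "((%x. K*(SUM i<n. \<bar>x i - z i\<bar>)) \<longlongrightarrow> K*(SUM i<n. \<bar>z i - z i\<bar>)) (at z)"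
  unfolding continuous_on_def by (rule bspec) simp
 hence "((%x. K*(SUM i<n. \<bar>x i - z i\<bar>)) \<longlongrightarrow> 0) (at z)" by simp
 hence "((%x. K*(SUM i<n. \<bar>x i - z i\<bar>)) \<longlongrightarrow> 0) (at z within box)"
  by (rule tendsto_within_subset) simp
 moreover have "\<forall>\<^sub>F x in at z within box. norm (Lap g x - Lap g z) <= K*(SUM i<n. \<bar>x i - z i\<bar>)"
  unfolding eventually_at_filter
 proof (intro always_eventually allI impI)
  fix x assume x: "x \<in> box"
  show "norm (Lap g x - Lap g z) <= K*(SUM i<n. \<bar>x i - z i\<bar>)"
   unfolding real_norm_def using boxD[OF x] boxD[OF z] by (intro K allI impI)
 qed
 ultimately have "((%x. Lap g x - Lap g z) \<longlongrightarrow> 0) (at z within box)" by (rule Lim_null_comparison[rotated])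
 thus "(Lap g \<longlongrightarrow> Lap g z) (at z within box)" by (simp add: LIM_zero_iff)
qed

lemma Lap_sum:
 assumes "!!j. j \<in> S ==> gr (f j)"
 shows "Lap (%y. \<Sum>j\<in>S. c j * f j y) x = (\<Sum>j\<in>S. c j * Lap (f j) x)"
proof -
 have "Lap (%y. \<Sum>j\<in>S. c j * f j y) x = (LINT y|\<mu>. (\<Sum>j\<in>S. c j*(f j y * kern x y)))"
  unfolding Lap_def by (simp add: sum_distrib_right mult.assoc)
 also have "... = (\<Sum>j\<in>S. \<integral>y. c j*(f j y * kern x y) \<partial>\<mu>)"
  by (intro Bochner_Integration.integral_sum integrable_mult_right Lap_int assms)
 finally show ?thesis unfolding Lap_def by simp
qed

end

context lc_smoothed
begin

text \<open>The potential is \<open>(a + t) / 2 * |x|^2 - ln Lap\<close> plus a constant. The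
  quadratic part contributes \<open>a + t\<close> to the Hessian, and by \<open>Lap_hess\<close> the
  logarithm takes away at most \<open>a\<close>.\<close>

lemma slc_smooth:
 assumes cube: "cube R" and t: "0 <= t" and one: "(LINT x|cube.bm n R. w x) = 1"
  and w: "!!x. x \<in> cube.box n R ==> w x = exp (- C)*(exp (- ((a + t)/2*(SUM i<n. (x i)^2))) * Lap (%_. 1) x)"
 shows "cube.slc n R (%_. t) w"
proof -
 interpret cube n R by fact
 define b where "b = a + t"
 define L where "L = Lap (%_. 1)"
 define L1 where "L1 i = Lap (%y. a * y i)" for i
 define L2 where "L2 i j = Lap (%y. a * y j*(a * y i))" for i j
 have Lp: "0 < L x" for x unfolding L_def by (rule Lap_pos)
 define V where "V x = C + (b/2*(SUM i<n. (x i)^2) - ln (L x))" for x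
 define V1 where "V1 i x = b * x i - L1 i x/L x" for i x
 define V2 where "V2 i j x = b*(if j = i then 1 else 0) - (L2 i j x * L x - L1 i x * L1 j x)/(L x * L x)" for i j x
 have g1: "gr (%y. a * y i)" if "i < n" for i using that by (intro gr_mult gr_const gr_coord)
 have g2: "gr (%y. a * y j*(a * y i))" if "i < n" "j < n" for i j using that by (intro gr_mult[OF g1 g1])
 have c0: "continuous_on box L" unfolding L_def by (rule Lap_cont[OF cube gr_const])
 have c1: "continuous_on box (L1 i)" if "i < n" for i unfolding L1_def by (rule Lap_cont[OF cube g1[OF that]])
 have c2: "continuous_on box (L2 i j)" if "i < n" "j < n" for i j unfolding L2_def by (rule Lap_cont[OF cube g2[OF that]])
 have p0: "pd i L (L1 i)" if "i < n" for i
  unfolding pd_def L_def L1_def using Lap_deriv[OF gr_const[of 1] that] by simp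
 have p1: "pd j (L1 i) (L2 i j)" if "i < n" "j < n" for i j
  unfolding pd_def L1_def L2_def using Lap_deriv[OF g1[OF that(1)] that(2)] by simp
 have Lne: "\<forall>x\<in>box. L x ~= 0" "\<forall>x\<in>box. L x * L x ~= 0" using Lp by (metis less_irrefl) (metis Lp less_irrefl mult_eq_0_iff)
 have "pot (%_. t) V V1 V2"
  unfolding pot_def
 proof (intro conjI allI impI ballI)
  show "C1 V V1"
   unfolding C1_def
  proof (intro conjI allI impI)
   show "continuous_on box V" unfolding V_def by (intro continuous_intros c0 Lne cont_coord)
   fix i assume i: "i < n"
   show "continuous_on box (V1 i)" unfolding V1_def by (intro continuous_intros c0 c1 Lne cont_coord i)
   have "pd i V (%x. 0 + (b/2*(2 * x i) - L1 i x/L x))"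
    unfolding V_def by (intro pd_add pd_const pd_diff pd_cmult pd_sumsq pd_ln p0 i Lp)
   thus "pd i V (V1 i)" unfolding V1_def by simp
  qed
  show "C1 (V1 i) (V2 i)" if i: "i < n" for i
   unfolding C1_def
  proof (intro conjI allI impI)
   show "continuous_on box (V1 i)" unfolding V1_def by (intro continuous_intros c0 c1 Lne cont_coord i)
   fix j assume j: "j < n"
   show "continuous_on box (V2 i j)" unfolding V2_def by (intro continuous_intros c0 c1 c2 Lne i j)
   show "pd j (V1 i) (V2 i j)"
    unfolding V1_def V2_def by (intro pd_diff pd_cmult pd_coord pd_divide p0 p1 i j Lp)
  qed
  fix x v
  let ?u = "%y :: nat => real. SUM i<n. a * v i * y i"
  have u1: "Lap ?u x = (SUM i<n. v i * L1 i x)"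
  proof -
   have "?u = (%y. SUM i<n. v i*(a * y i))" by (simp add: mult_ac)
   thus ?thesis unfolding L1_def using Lap_sum[of "{..<n}" "%i y. a * y i" v x] g1 by simp
  qed
  have u2: "Lap (%y. (?u y)^2) x = (SUM i<n. SUM j<n. v i * v j * L2 i j x)"
  proof -
   have sq: "(%y. (?u y)^2) = (%y. SUM i<n. v i*(SUM j<n. v j*(a * y j*(a * y i))))"
    by (simp add: power2_eq_square sum_distrib_left mult_ac)
   have "Lap (%y. (?u y)^2) x = (SUM i<n. v i * Lap (%y. SUM j<n. v j*(a * y j*(a * y i))) x)"
    unfolding sq by (rule Lap_sum) (auto intro!: gr_sum gr_mult[OF gr_const] g2)
   also have "... = (SUM i<n. v i*(SUM j<n. v j * L2 i j x))"
    unfolding L2_def by (intro sum.cong refl arg_cong2[of _ _ _ _ "(*)"] Lap_sum) (auto intro: g2)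
   finally show ?thesis by (simp add: sum_distrib_left mult.assoc)
  qed
  have "L x * Lap (%y. (?u y)^2) x - (Lap ?u x)\<^sup>2 <= a*(SUM i<n. (v i)^2)*(L x)^2"
   unfolding L_def by (rule Lap_hess)
  hence h: "(L x*(SUM i<n. SUM j<n. v i * v j * L2 i j x) - (SUM i<n. v i * L1 i x)\<^sup>2)/(L x * L x) <= a*(SUM i<n. (v i)^2)"
   unfolding u1 u2 using Lp[of x] by (simp add: divide_le_eq power2_eq_square)
  have "(SUM i<n. SUM j<n. V2 i j x * v i * v j) = (SUM i<n. SUM j<n. (if j = i then b * v i * v j else 0)
    - (L x*(v i * v j * L2 i j x) - (v i * L1 i x)*(v j * L1 j x))/(L x * L x))"
   unfolding V2_def by (intro sum.cong refl) (simp add: algebra_simps)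
  also have "... = b*(SUM i<n. (v i)^2) - (L x*(SUM i<n. SUM j<n. v i * v j * L2 i j x) - (SUM i<n. v i * L1 i x)\<^sup>2)/(L x * L x)"
   by (simp add: sum_subtractf sum_divide_distrib[symmetric] sum_distrib_left[symmetric] power2_eq_square sum_product mult.assoc)
  finally show "(SUM i<n. t*(v i)^2) <= (SUM i<n. SUM j<n. V2 i j x * v i * v j)"
   using h unfolding b_def by (simp add: sum_distrib_left[symmetric] distrib_right)
 qed
 moreover have "w x = exp (- V x)" if "x \<in> box" for x
 proof -
  have "- V x = - C + (- ((a + t)/2*(SUM i<n. (x i)^2)) + ln (L x))" unfolding V_def b_def by simp
  hence "exp (- V x) = exp (- C)*(exp (- ((a + t)/2*(SUM i<n. (x i)^2))) * exp (ln (L x)))"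
   by (simp only: exp_add)
  thus ?thesis unfolding w[OF that] L_def[symmetric] using Lp[of x] by simp
 qed
 ultimately show ?thesis unfolding slc_def using one by blast
qed

end

section \<open>The convolution as a law: density and moments\<close>

lemma sigma_finite_lborel_Rn: "sigma_finite_measure (lborel_Rn n)"
proof -
 interpret product_sigma_finite "%_::nat. lborel :: real measure" by standard
 interpret finite_product_sigma_finite "%_::nat. lborel :: real measure" "{..<n}" by standard auto
 show ?thesis unfolding lborel_Rn_def by (rule sigma_finite_measure_axioms)
qed

lemma G_affine_density:
 assumes e: "0 < e"
 shows "distr (G n 1) (Bn n) (%z. \<lambda>i\<in>{..<n}. y i + e * z i) =
 density (lborel_Rn n) (%x. PROD i<n. ennreal (normal_density (y i) e (x i)))"
proof -
 have "product_sigma_finite (%_::nat. lborel :: real measure)" by standard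
 hence "density (lborel_Rn n) (%x. PROD i<n. ennreal (normal_density (y i) e (x i))) =
   (\<Pi>\<^sub>M i\<in>{..<n}. density lborel (%x. ennreal (normal_density (y i) e x)))"
  unfolding lborel_Rn_def by (rule density_PiM) (use e in \<open>auto intro: prob_space_normal_density\<close>)
 thus ?thesis using G_affine[of 1 "%_. e" n y] e by simp
qed

lemma G_affine_meas: "(%z. \<lambda>i\<in>{..<n}. y i + e * z i) \<in> measurable (G n 1) (Bn n)"
 by (intro measurable_restrict) measurable

lemma prod_normal_density_meas: "(%x. PROD i<n. ennreal (normal_density (y i) e (x i))) \<in> borel_measurable (lborel_Rn n)"
 unfolding lborel_Rn_def by measurable

lemma prod_int:
 fixes f :: "'a => real" and g :: "'b => real"
 assumes M: "prob_space M" and K: "prob_space K" and f: "integrable M f" and g: "integrable K g"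
 shows "integrable (M \<Otimes>\<^sub>M K) (%p. f (fst p) * g (snd p))"
  "(LINT p|(M \<Otimes>\<^sub>M K). f (fst p) * g (snd p)) = (LINT x|M. f x)*(LINT y|K. g y)"
proof -
 interpret M: prob_space M by fact
 interpret K: prob_space K by fact
 interpret pair_sigma_finite M K by standard
 have [measurable]: "f \<in> borel_measurable M" "g \<in> borel_measurable K" using f g by auto
 show i: "integrable (M \<Otimes>\<^sub>M K) (%p. f (fst p) * g (snd p))"
 proof (rule Fubini_integrable)
  show "integrable M (%x. \<integral>y. norm (f (fst (x, y)) * g (snd (x, y))) \<partial>K)"
   using integrable_mult_left[OF integrable_norm[OF f], of "\<integral>y. norm (g y) \<partial>K"] by (simp add: abs_mult)
  show "AE x in M. integrable K (%y. f (fst (x, y)) * g (snd (x, y)))"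
   using g by simp
 qed measurable
 have "(LINT p|(M \<Otimes>\<^sub>M K). f (fst p) * g (snd p)) = (\<integral>x. \<integral>y. f x * g y \<partial>K \<partial>M)"
  using integral_fst'[OF i] by simp
 thus "(LINT p|(M \<Otimes>\<^sub>M K). f (fst p) * g (snd p)) = (LINT x|M. f x)*(LINT y|K. g y)"
  by simp
qed

context smoothed
begin

definition eps :: real where "eps = 1/sqrt a"

definition cn :: real where "cn = (1/sqrt (2 * pi * eps^2)) ^ n"

definition dn :: "(nat => real) => real" where
 "dn x = cn*(exp (- (a/2*(SUM i<n. (x i)^2))) * Lap (%_. 1) x)"

definition smear :: "(nat => real) \<times> (nat => real) => nat => real" where
 "smear p = (\<lambda>i\<in>{..<n}. fst p i + eps * snd p i)"

definition nu :: "(nat => real) measure" where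
 "nu = distr (\<mu> \<Otimes>\<^sub>M G n 1) (Bn n) smear"

lemma eps_pos: "0 < eps" unfolding eps_def using a_pos by simp

lemma eps2: "eps^2 = 1/a" unfolding eps_def using a_pos by (simp add: power_divide)

lemma cn_pos: "0 < cn" unfolding cn_def using eps_pos by simp

lemma dn_pos: "0 < dn x" unfolding dn_def using cn_pos Lap_pos[of x] by simp

lemma prod_density: "(PROD i<n. normal_density (y i) eps (x i)) = cn*(exp (- (a/2*(SUM i<n. (x i)^2))) * kern x y)"
proof -
 have "(PROD i<n. normal_density (y i) eps (x i)) = (PROD i<n. (1/sqrt (2 * pi * eps^2)) * exp (- (a/2)*(x i - y i)^2))"
  unfolding normal_density_def eps2 by (intro prod.cong refl) simp
 also have "... = cn * exp (SUM i<n. - (a/2)*(x i - y i)^2)"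
  unfolding cn_def prod.distrib by (simp add: exp_sum)
 also have "(SUM i<n. - (a/2)*(x i - y i)^2) = - (a/2*(SUM i<n. (x i)^2)) + (SUM i<n. a * x i * y i - a/2*(y i)^2)"
  by (simp add: sum_distrib_left sum_negf[symmetric] sum.distrib[symmetric]) (intro sum.cong refl, simp add: power2_eq_square field_simps)
 finally show ?thesis unfolding kern_def exp_add .
qed

lemma dn_nn: "ennreal (dn x) = (nn_integral \<mu> (%y. (PROD i<n. ennreal (normal_density (y i) eps (x i)))))"
proof -
 have i: "integrable \<mu> (%y. 1 * kern x y)" by (rule Lap_int[OF gr_const])
 have "dn x = (LINT y|\<mu>. cn*(exp (- (a/2*(SUM i<n. (x i)^2))) * kern x y))"
  unfolding dn_def Lap_def by simp
 also have "ennreal ... = (nn_integral \<mu> (%y. ennreal (cn*(exp (- (a/2*(SUM i<n. (x i)^2))) * kern x y))))"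
  using cn_pos i by (intro nn_integral_eq_integral[symmetric]) (auto simp: kern_def)
 finally show ?thesis unfolding prod_density[symmetric] by (simp add: prod_ennreal)
qed

lemma dn_joint: "(%(x, y). PROD i<n. ennreal (normal_density (y i) eps (x i))) \<in> borel_measurable (lborel_Rn n \<Otimes>\<^sub>M \<mu>)"
proof -
 have x: "(%p. fst p i) \<in> borel_measurable (lborel_Rn n \<Otimes>\<^sub>M \<mu>)" if "i < n" for i
 proof -
  have "(%x. x i) \<in> borel_measurable (lborel_Rn n)"
   unfolding measurable_cong_sets[OF sets_lborel_Rn refl] using that by (intro measurable_component_singleton) simp
  thus ?thesis by (rule measurable_compose[OF measurable_fst])
 qed
 have y: "(%p. snd p i) \<in> borel_measurable (lborel_Rn n \<Otimes>\<^sub>M \<mu>)" if "i < n" for i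
  using that by (intro measurable_compose[OF measurable_snd coord_meas])
 have "(%p. PROD i<n. ennreal (normal_density (snd p i) eps (fst p i))) \<in> borel_measurable (lborel_Rn n \<Otimes>\<^sub>M \<mu>)"
 proof (rule borel_measurable_prod_ennreal)
  fix i assume "i \<in> {..<n}"
  hence [measurable]: "(%p. fst p i) \<in> borel_measurable (lborel_Rn n \<Otimes>\<^sub>M \<mu>)" "(%p. snd p i) \<in> borel_measurable (lborel_Rn n \<Otimes>\<^sub>M \<mu>)"
   using x y by auto
  show "(%p. ennreal (normal_density (snd p i) eps (fst p i))) \<in> borel_measurable (lborel_Rn n \<Otimes>\<^sub>M \<mu>)"
   unfolding normal_density_def by measurable
 qed
 thus ?thesis by simp
qed

lemma dn_meas: "dn \<in> borel_measurable (lborel_Rn n)"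
proof -
 have "(%x. \<integral>\<^sup>+y. (PROD i<n. ennreal (normal_density (y i) eps (x i))) \<partial>\<mu>) \<in> borel_measurable (lborel_Rn n)"
  by (rule borel_measurable_nn_integral[OF dn_joint])
 hence "(%x. enn2real (ennreal (dn x))) \<in> borel_measurable (lborel_Rn n)"
  unfolding dn_nn by (rule measurable_compose) measurable
 thus ?thesis using dn_pos by (simp add: less_imp_le)
qed

lemma smear_meas: "smear \<in> measurable (\<mu> \<Otimes>\<^sub>M G n 1) (Bn n)"
proof -
 have "(%p. \<lambda>i\<in>{..<n}. fst p i + eps * snd p i) \<in> measurable (\<mu> \<Otimes>\<^sub>M G n 1) (Bn n)"
 proof (rule measurable_restrict)
  fix i assume i: "i \<in> {..<n}"
  have [measurable]: "(%p. fst p i) \<in> borel_measurable (\<mu> \<Otimes>\<^sub>M G n 1)"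
   using i by (intro measurable_compose[OF measurable_fst coord_meas]) simp
  have "(%z. z i) \<in> borel_measurable (G n 1)"
   unfolding measurable_cong_sets[OF sets_G refl] using i by (intro measurable_component_singleton) simp
  hence [measurable]: "(%p. snd p i) \<in> borel_measurable (\<mu> \<Otimes>\<^sub>M G n 1)"
   by (rule measurable_compose[OF measurable_snd])
  show "(%p. fst p i + eps * snd p i) \<in> borel_measurable (\<mu> \<Otimes>\<^sub>M G n 1)" by measurable
 qed
 thus ?thesis unfolding smear_def .
qed

lemma nu_nn:
 assumes f: "f \<in> borel_measurable (Bn n)"
 shows "(nn_integral nu (%x. f x)) = (\<integral>\<^sup>+y. \<integral>\<^sup>+z. f (\<lambda>i\<in>{..<n}. y i + eps * z i) \<partial>G n 1 \<partial>\<mu>)"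
proof -
 interpret G: prob_space "G n 1" by (rule prob_G) simp
 have "(nn_integral nu (%x. f x)) = (nn_integral (\<mu> \<Otimes>\<^sub>M G n 1) (%p. f (smear p)))"
  unfolding nu_def by (rule nn_integral_distr[OF smear_meas]) (use f in simp)
 also have "... = (\<integral>\<^sup>+y. \<integral>\<^sup>+z. f (smear (y, z)) \<partial>G n 1 \<partial>\<mu>)"
  by (rule G.nn_integral_fst[symmetric]) (rule measurable_compose[OF smear_meas f])
 finally show ?thesis unfolding smear_def by simp
qed

lemma sets_nu: "sets nu = sets (Bn n)" unfolding nu_def by simp

lemma prob_nu: "prob_space nu"
proof -
 interpret G: prob_space "G n 1" by (rule prob_G) simp
 interpret pair_prob_space \<mu> "G n 1" by standard
 show ?thesis unfolding nu_def by (rule prob_space_distr[OF smear_meas])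
qed

lemma nu_density: "nu = density (lborel_Rn n) (%x. ennreal (dn x))"
proof (rule measure_eqI)
 show "sets nu = sets (density (lborel_Rn n) (%x. ennreal (dn x)))" by (simp add: sets_nu sets_lborel_Rn)
 fix A assume "A \<in> sets nu"
 hence A: "A \<in> sets (Bn n)" and A': "A \<in> sets (lborel_Rn n)" by (simp_all add: sets_nu sets_lborel_Rn)
 have iA: "indicator A \<in> borel_measurable (Bn n)" using A by simp
 interpret L: sigma_finite_measure "lborel_Rn n" by (rule sigma_finite_lborel_Rn)
 interpret P: pair_sigma_finite "lborel_Rn n" \<mu> by standard
 have m: "(%z. \<lambda>i\<in>{..<n}. y i + eps * z i) \<in> measurable (G n 1) (Bn n)" for y
  by (rule G_affine_meas)
 have inner: "(nn_integral (G n 1) (%z. indicator A (\<lambda>i\<in>{..<n}. y i + eps * z i))) =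
   (nn_integral (lborel_Rn n) (%x. (PROD i<n. ennreal (normal_density (y i) eps (x i))) * indicator A x))" for y
 proof -
  have "(nn_integral (G n 1) (%z. indicator A (\<lambda>i\<in>{..<n}. y i + eps * z i))) =
    (nn_integral (distr (G n 1) (Bn n) (%z. \<lambda>i\<in>{..<n}. y i + eps * z i)) (%x. indicator A x))"
   by (rule nn_integral_distr[OF m, symmetric]) (use iA in simp)
  also have "... = (nn_integral (lborel_Rn n) (%x. (PROD i<n. ennreal (normal_density (y i) eps (x i))) * indicator A x))"
   unfolding G_affine_density[OF eps_pos]
  proof (rule nn_integral_density)
   show "(%x. PROD i<n. ennreal (normal_density (y i) eps (x i))) \<in> borel_measurable (lborel_Rn n)"
    by (rule prod_normal_density_meas)
  qed (use A' in simp)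
  finally show ?thesis .
 qed
 have "emeasure nu A = (nn_integral nu (%x. indicator A x))" using A by (simp add: sets_nu)
 also have "... = (\<integral>\<^sup>+y. \<integral>\<^sup>+x. (PROD i<n. ennreal (normal_density (y i) eps (x i))) * indicator A x \<partial>lborel_Rn n \<partial>\<mu>)"
  unfolding nu_nn[OF iA] inner ..
 also have "... = (\<integral>\<^sup>+x. \<integral>\<^sup>+y. (PROD i<n. ennreal (normal_density (y i) eps (x i))) * indicator A x \<partial>\<mu> \<partial>lborel_Rn n)"
 proof (rule P.Fubini')
  have "(%p. (case p of (x, y) => PROD i<n. ennreal (normal_density (y i) eps (x i))) * indicator A (fst p)) \<in> borel_measurable (lborel_Rn n \<Otimes>\<^sub>M \<mu>)"
   using dn_joint A' by (intro borel_measurable_times_ennreal measurable_compose[OF measurable_fst] borel_measurable_indicator)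
  thus "(%(x, y). (PROD i<n. ennreal (normal_density (y i) eps (x i))) * indicator A x) \<in> borel_measurable (lborel_Rn n \<Otimes>\<^sub>M \<mu>)"
   by (simp add: split_def)
 qed
 also have "... = (nn_integral (lborel_Rn n) (%x. ennreal (dn x) * indicator A x))"
 proof (intro nn_integral_cong)
  fix x
  have "(%y. PROD i<n. ennreal (normal_density (y i) eps (x i))) \<in> borel_measurable \<mu>"
  proof (rule borel_measurable_prod_ennreal)
   fix i assume "i \<in> {..<n}"
   hence [measurable]: "(%y. y i) \<in> borel_measurable \<mu>" by (intro coord_meas) simp
   show "(%y. ennreal (normal_density (y i) eps (x i))) \<in> borel_measurable \<mu>"
    unfolding normal_density_def by measurable
  qed
  thus "(nn_integral \<mu> (%y. (PROD i<n. ennreal (normal_density (y i) eps (x i))) * indicator A x)) = ennreal (dn x) * indicator A x"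
   unfolding dn_nn by (rule nn_integral_multc)
 qed
 also have "... = emeasure (density (lborel_Rn n) (%x. ennreal (dn x))) A"
  using dn_meas A' by (intro emeasure_density[symmetric]) auto
 finally show "emeasure nu A = emeasure (density (lborel_Rn n) (%x. ennreal (dn x))) A" .
qed

lemma nu_moments:
 assumes sq: "!!i. i < n ==> integrable \<mu> (%y. (y i)^2)" and mean0: "!!i. i < n ==> (LINT y|\<mu>. y i) = 0"
  and cov: "!!i j. i < n ==> j < n ==> (LINT y|\<mu>. y i * y j) = (if i = j then 1 else 0)"
  and i: "i < n"
 shows "integrable nu (%x. x i)" "(LINT x|nu. x i) = 0"
  "j < n ==> integrable nu (%x. x i * x j)" "j < n ==> (LINT x|nu. x i * x j) = (if i = j then 1 + eps^2 else 0)"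
proof -
 let ?G = "G n 1"
 have G: "prob_space ?G" by (rule prob_G) simp
 interpret G: prob_space ?G by (rule G)
 let ?P = "\<mu> \<Otimes>\<^sub>M ?G"
 have y1: "integrable \<mu> (%y. y i)" if "i < n" for i
  by (rule square_integrable_imp_integrable[OF coord_meas[OF that] sq[OF that]])
 have y2: "integrable \<mu> (%y. y i * y j)" if ij: "i < n" "j < n" for i j
 proof (rule Bochner_Integration.integrable_bound[OF Bochner_Integration.integrable_add[OF sq[OF ij(1)] sq[OF ij(2)]]])
  show "(%y. y i * y j) \<in> borel_measurable \<mu>" using ij by measurable
  have "norm (s * t) <= norm (s^2 + t^2)" for s t :: real
   using sum_squares_bound[of s t] sum_squares_bound[of s "- t"] zero_le_power2[of s]
   unfolding real_norm_def power2_minus by linarith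
  thus "AE y in \<mu>. norm (y i * y j) <= norm ((y i)^2 + (y j)^2)" by simp
 qed
 have gz: "integrable ?G (%z. z i)" "(LINT z|?G. z i) = 0" if "i < n" for i
  using G_marginal[OF that, of "%y. y"] nd_moments(1,2) by auto
 have one: "integrable \<mu> (%_. 1 :: real)" "integrable ?G (%_. 1 :: real)" by simp_all
 have pu: "(LINT y|\<mu>. 1) = (1 :: real)" "(LINT z|?G. 1) = (1 :: real)" by (simp_all add: prob_space G.prob_space del: measure_G)
 have pi: "has_bochner_integral ?P (%p. c*(f (fst p) * g (snd p))) (c*((LINT y|\<mu>. f y)*(LINT z|?G. g z)))"
  if "integrable \<mu> f" "integrable ?G g" for f g and c :: real
  using prod_int[OF prob G that] by (simp add: has_bochner_integral_iff)
 have nu: "integrable nu f" "(LINT x|nu. f x) = c"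
  if "has_bochner_integral ?P (%p. f (smear p)) c" "f \<in> borel_measurable (Bn n)" for f and c :: real
  using that integrable_distr_eq[OF smear_meas that(2)] integral_distr[OF smear_meas that(2)] unfolding nu_def has_bochner_integral_iff by simp_all
 have cm [measurable]: "(%x. x i) \<in> borel_measurable (Bn n)" if "i < n" for i
  using that by (intro measurable_component_singleton) simp
 have "has_bochner_integral ?P (%p. 1*(fst p i*1) + eps*(1 * snd p i)) 0"
  using has_bochner_integral_add[OF pi[OF y1[OF i] one(2), of 1] pi[OF one(1) gz(1)[OF i], of eps]] mean0[OF i] gz(2)[OF i] by simp
 moreover have "smear p i = 1*(fst p i*1) + eps*(1 * snd p i)" for p unfolding smear_def using i by simp
 ultimately show "integrable nu (%x. x i)" "(LINT x|nu. x i) = 0" using nu[of "%x. x i", OF _ cm[OF i]] by simp_all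
 assume j: "j < n"
 let ?F = "%p. 1*((fst p i * fst p j)*1) + eps*(fst p i * snd p j) + eps*(fst p j * snd p i) + eps^2*(1*(snd p i * snd p j))"
 note ad = has_bochner_integral_add[OF has_bochner_integral_add[OF has_bochner_integral_add[OF
  pi[OF y2[OF i j] one(2), of 1] pi[OF y1[OF i] gz(1)[OF j], of eps]] pi[OF y1[OF j] gz(1)[OF i], of eps]] pi[OF one(1) G_moments(1)[OF i j], of "eps^2"]]
 have b: "has_bochner_integral ?P ?F (if i = j then 1 + eps^2 else 0)"
  using ad unfolding cov[OF i j] gz(2)[OF i] gz(2)[OF j] G_moments(2)[OF i j] pu by (cases "i = j") simp_all
 have e: "(%p. smear p i * smear p j) = ?F"
  unfolding smear_def using i j by (simp add: power2_eq_square algebra_simps)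
 have m: "(%x. x i * x j) \<in> borel_measurable (Bn n)" using i j by measurable
 show "integrable nu (%x. x i * x j)" "(LINT x|nu. x i * x j) = (if i = j then 1 + eps^2 else 0)"
  by (rule nu[of "%x. x i * x j", unfolded e, OF b m])+
qed

end

section \<open>Removing the cut-off\<close>

locale iso_smoothed = lc_smoothed +
 assumes sq: "!!i. i < n ==> integrable \<mu> (%y. (y i)^2)"
  and mean0: "!!i. i < n ==> (LINT y|\<mu>. y i) = 0"
  and cov1: "!!i j. i < n ==> j < n ==> (LINT y|\<mu>. y i * y j) = (if i = j then 1 else 0)"
begin

text \<open>The radius tends to infinity, while the strength \<open>tk = 1 / Rk\<close> of the
  Gaussian factor, which is the starting time of the localization, stays positive and tends to
  zero.\<close>

definition Rk :: "nat => real" where "Rk k = real (Suc k)"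
definition tk :: "nat => real" where "tk k = 1/Rk k"
definition bx :: "nat => (nat => real) set" where "bx k = cube.box n (Rk k)"
definition cc :: "nat => (nat => real) => real" where
 "cc k x = indicator (bx k) x * exp (- (tk k/2*(SUM i<n. (x i)^2)))"
definition Z :: "nat => real" where "Z k = (LINT x|nu. cc k x)"
definition ww :: "nat => (nat => real) => real" where
 "ww k x = dn x * exp (- (tk k/2*(SUM i<n. (x i)^2)))/Z k"

lemma cubeR: "cube (Rk k)" unfolding cube_def Rk_def by simp

lemma tk_pos: "0 < tk k" unfolding tk_def Rk_def by simp

lemma bx_sets: "bx k \<in> sets (Bn n)" "bx k \<in> sets (lborel_Rn n)"
proof -
 interpret cube n "Rk k" by (rule cubeR)
 show "bx k \<in> sets (lborel_Rn n)" unfolding bx_def lborel_Rn_def by (rule box_sets)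
 thus "bx k \<in> sets (Bn n)" unfolding sets_lborel_Rn .
qed

lemma sumsq_meas: "(%x. exp (- (c*(SUM i<n. (x i)^2)))) \<in> borel_measurable (Bn n)"
proof -
 have [measurable]: "(%x. x i) \<in> borel_measurable (Bn n)" if "i \<in> {..<n}" for i
  using that by (rule measurable_component_singleton)
 have "(%x. SUM i<n. (x i)^2) \<in> borel_measurable (Bn n)"
  by (rule borel_measurable_sum) measurable
 thus ?thesis by measurable
qed

lemma cc_meas: "cc k \<in> borel_measurable (Bn n)"
 unfolding cc_def using sumsq_meas bx_sets(1)[of k] by (intro borel_measurable_times borel_measurable_indicator)

lemma cc_bounds: "0 <= cc k x" "cc k x <= 1"
 unfolding cc_def using tk_pos[of k] by (auto simp: indicator_def intro!: mult_nonneg_nonneg sum_nonneg)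

lemma nu_meas: "borel_measurable nu = borel_measurable (Bn n)"
 by (rule measurable_cong_sets[OF sets_nu refl])

lemma nu_space: "space nu = (\<Pi>\<^sub>E i\<in>{..<n}. UNIV)"
 unfolding nu_def by (simp add: space_PiM)

text \<open>Dominated convergence: the cut-off has values in \<open>[0, 1]\<close>, and every point
  eventually lies in the box while the Gaussian factor tends to 1.\<close>

lemma cc_lim:
 fixes f :: "(nat => real) => real"
 assumes f: "integrable nu f"
 shows "(%k. \<integral>x. cc k x * f x \<partial>nu) \<longlonglongrightarrow> (LINT x|nu. f x)"
proof (rule integral_dominated_convergence[OF _ _ integrable_norm[OF f]])
 show "f \<in> borel_measurable nu" using f by simp
 show "(%x. cc k x * f x) \<in> borel_measurable nu" for k
  using cc_meas[of k] f unfolding nu_meas[symmetric] by (intro borel_measurable_times) auto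
 show "AE x in nu. norm (cc k x * f x) <= norm (f x)" for k
  using cc_bounds[of k] by (intro AE_I2) (simp add: abs_mult mult_left_le_one_le)
 show "AE x in nu. (%k. cc k x * f x) \<longlonglongrightarrow> f x"
 proof (rule AE_I2)
  fix x assume x: "x \<in> space nu"
  obtain K :: nat where K: "(SUM i<n. \<bar>x i\<bar>) <= K" using real_arch_simple by blast
  have bx: "x \<in> bx k" if "K <= k" for k
  proof -
   have "\<bar>x i\<bar> <= Rk k" if i: "i < n" for i
   proof -
    have "\<bar>x i\<bar> <= (SUM i<n. \<bar>x i\<bar>)" using i by (intro member_le_sum) auto
    also note K
    also have "real K <= Rk k" using \<open>K <= k\<close> unfolding Rk_def by simp
    finally show ?thesis .
   qed
   thus ?thesis
    using x unfolding nu_space bx_def cube.box_def[OF cubeR] by (simp add: PiE_iff abs_le_iff minus_le_iff)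
  qed
  have "(%k. exp (- (tk k/2*(SUM i<n. (x i)^2)))) \<longlonglongrightarrow> exp (- (0/2*(SUM i<n. (x i)^2)))"
   unfolding tk_def Rk_def by (intro tendsto_intros lim_1_over_n[THEN LIMSEQ_Suc]) simp
  hence "(%k. exp (- (tk k/2*(SUM i<n. (x i)^2)))) \<longlonglongrightarrow> 1" by simp
  hence "(%k. cc k x) \<longlonglongrightarrow> 1"
  proof (rule Lim_transform_eventually)
   show "\<forall>\<^sub>F k in sequentially. exp (- (tk k/2*(SUM i<n. (x i)^2))) = cc k x"
    unfolding eventually_sequentially using bx by (intro exI[of _ K]) (simp add: cc_def)
  qed
  hence "(%k. cc k x * f x) \<longlonglongrightarrow> 1 * f x" by (intro tendsto_intros)
  thus "(%k. cc k x * f x) \<longlonglongrightarrow> f x" by simp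
 qed
qed

lemma nu_one: "(LINT x|nu. 1) = (1 :: real)" "integrable nu (%_. 1 :: real)"
proof -
 interpret nu: prob_space nu by (rule prob_nu)
 show "(LINT x|nu. 1) = (1 :: real)" "integrable nu (%_. 1 :: real)" by (simp_all add: nu.prob_space)
qed

lemma Z_lim: "Z \<longlonglongrightarrow> 1"
 using cc_lim[OF nu_one(2)] unfolding Z_def nu_one(1) by simp

lemma bm_integral:
 "(LINT x|cube.bm n (Rk k). g x) = (LINT x|lborel_Rn n. indicator (bx k) x * g x)" for g :: "(nat => real) => real"
proof -
 have "space (lborel_Rn n) \<inter> bx k = bx k" using sets.sets_into_space[OF bx_sets(2)[of k]] by blast
 hence "bx k \<inter> space (lborel_Rn n) \<in> sets (lborel_Rn n)" using bx_sets(2)[of k] by simp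
 thus ?thesis
  unfolding cube.bm_def[OF cubeR] bx_def[symmetric] lborel_Rn_def[symmetric]
  by (subst integral_restrict_space) simp_all
qed

lemma J_ww:
 fixes f :: "(nat => real) => real"
 assumes f: "f \<in> borel_measurable (Bn n)"
 shows "(LINT x|cube.bm n (Rk k). ww k x * f x) = (LINT x|nu. cc k x * f x)/Z k"
proof -
 have m: "(%x. cc k x * f x) \<in> borel_measurable (lborel_Rn n)"
  unfolding measurable_cong_sets[OF sets_lborel_Rn refl] using cc_meas f by (intro borel_measurable_times)
 have "(LINT x|nu. cc k x * f x) = (LINT x|lborel_Rn n. dn x *\<^sub>R (cc k x * f x))"
  unfolding nu_density by (rule integral_density[OF m dn_meas]) (simp add: dn_pos less_imp_le)
 moreover have "(LINT x|cube.bm n (Rk k). ww k x * f x) = (LINT x|lborel_Rn n. (dn x *\<^sub>R (cc k x * f x))/Z k)"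
  unfolding bm_integral by (intro Bochner_Integration.integral_cong refl) (simp add: ww_def cc_def)
 ultimately show ?thesis by simp
qed

lemma ww_slc:
 assumes Zp: "0 < Z k"
 shows "cube.slc n (Rk k) (%_. tk k) (ww k)"
proof (rule slc_smooth[OF cubeR])
 show "0 <= tk k" using tk_pos[of k] by simp
 have "(%_. 1 :: real) \<in> borel_measurable (Bn n)" by simp
 from J_ww[OF this, of k] show "(LINT x|cube.bm n (Rk k). ww k x) = 1"
  using Zp unfolding Z_def by simp
 fix x
 have "exp (- ln (Z k/cn)) = cn/Z k" using Zp cn_pos by (simp add: exp_minus)
 moreover have "exp (- ((a + tk k)/2*(SUM i<n. (x i)^2))) = exp (- (a/2*(SUM i<n. (x i)^2))) * exp (- (tk k/2*(SUM i<n. (x i)^2)))"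
  unfolding exp_add[symmetric] by (simp add: field_simps)
 ultimately show "ww k x = exp (- ln (Z k/cn))*(exp (- ((a + tk k)/2*(SUM i<n. (x i)^2))) * Lap (%_. 1) x)"
  unfolding ww_def dn_def by simp
qed

lemma J_lim:
 fixes f :: "(nat => real) => real"
 assumes f: "integrable nu f"
 shows "(%k. \<integral>x. ww k x * f x \<partial>cube.bm n (Rk k)) \<longlonglongrightarrow> (LINT x|nu. f x)"
proof -
 have fm: "f \<in> borel_measurable (Bn n)" using f unfolding nu_meas[symmetric] by simp
 have "(%k. (LINT x|nu. cc k x * f x)/Z k) \<longlonglongrightarrow> (LINT x|nu. f x)/1"
  by (intro tendsto_divide cc_lim[OF f] Z_lim) simp
 thus ?thesis unfolding J_ww[OF fm] by simp
qed

lemma nu_mom: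
 "i < n ==> integrable nu (%x. x i)" "i < n ==> (LINT x|nu. x i) = 0"
 "i < n ==> j < n ==> integrable nu (%x. x i * x j)"
 "i < n ==> j < n ==> (LINT x|nu. x i * x j) = (if i = j then 1 + eps^2 else 0)"
 by (rule nu_moments; (rule sq mean0 cov1)?; assumption)+

lemma mean_lim: "i < n ==> (%k. cube.mean n (Rk k) (ww k) i) \<longlonglongrightarrow> 0"
 using J_lim[OF nu_mom(1)] nu_mom(2) unfolding cube.mean_def[OF cubeR] by simp

lemma ev_slc: "\<forall>\<^sub>F k in sequentially. 0 < Z k"
 by (rule order_tendstoD(1)[OF Z_lim]) simp

lemma cov_lim:
 assumes ij: "i < n" "j < n"
 shows "(%k. cube.cov n (Rk k) (ww k) i j) \<longlonglongrightarrow> (if i = j then 1 + eps^2 else 0)"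
proof -
 have "(%k. (LINT x|cube.bm n (Rk k). ww k x*(x i * x j)) - cube.mean n (Rk k) (ww k) i * cube.mean n (Rk k) (ww k) j)
   \<longlonglongrightarrow> (if i = j then 1 + eps^2 else 0) - 0*0"
  using J_lim[OF nu_mom(3)[OF ij]] unfolding nu_mom(4)[OF ij]
  by (intro tendsto_intros mean_lim ij)
 hence "(%k. (LINT x|cube.bm n (Rk k). ww k x*(x i * x j)) - cube.mean n (Rk k) (ww k) i * cube.mean n (Rk k) (ww k) j)
   \<longlonglongrightarrow> (if i = j then 1 + eps^2 else 0)" by simp
 thus ?thesis
 proof (rule Lim_transform_eventually)
  show "\<forall>\<^sub>F k in sequentially. (LINT x|cube.bm n (Rk k). ww k x*(x i * x j)) - cube.mean n (Rk k) (ww k) i * cube.mean n (Rk k) (ww k) j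
    = cube.cov n (Rk k) (ww k) i j"
   using ev_slc
  proof eventually_elim
   case (elim k)
   interpret cube n "Rk k" by (rule cubeR)
   show ?case using cov_raw[OF slc_dns[OF ww_slc[OF elim]], of i j] by simp
  qed
 qed
qed

lemma mpow_lim: "(%k. mpow n (cube.Bm n (Rk k) (ww k)) q i j) \<longlonglongrightarrow> (if i = j & i < n then (eps^2) ^ q else 0)"
proof (induction q arbitrary: i j)
 case 0
 have "mpow n B 0 i j = (if i = j & i < n then (eps^2) ^ 0 else 0)" for B
  by (simp add: idn_def)
 thus ?case by simp
next
 case (Suc q)
 have B: "(%k. cube.Bm n (Rk k) (ww k) i l) \<longlonglongrightarrow> (if i = l & i < n then eps^2 else 0)" for i l
 proof (cases "i < n & l < n")
  case True
  have "(%k. cube.cov n (Rk k) (ww k) i l + - (if i = l then 1 else 0)) \<longlonglongrightarrow> (if i = l then 1 + eps^2 else 0) + - (if i = l then 1 else 0)"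
   using True by (intro tendsto_intros cov_lim) auto
  moreover have "(if i = l then 1 + eps^2 else 0) + - (if i = l then 1 else 0) = (if i = l & i < n then eps^2 else 0)" using True by simp
  ultimately show ?thesis using True unfolding cube.Bm_def[OF cubeR] by simp
 next
  case False
  thus ?thesis unfolding cube.Bm_def[OF cubeR] by auto
 qed
 have "(%k. SUM l<n. cube.Bm n (Rk k) (ww k) i l * mpow n (cube.Bm n (Rk k) (ww k)) q l j) \<longlonglongrightarrow>
   (SUM l<n. (if i = l & i < n then eps^2 else 0)*(if l = j & l < n then (eps^2) ^ q else 0))"
  by (intro tendsto_intros B Suc)
 moreover have "(SUM l<n. (if i = l & i < n then eps^2 else 0)*(if l = j & l < n then (eps^2) ^ q else 0)) =
   (SUM l<n. if l = i then (if i = j then (eps^2) ^ Suc q else 0) else 0)"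
  by (intro sum.cong refl) auto
 moreover have "... = (if i = j & i < n then (eps^2) ^ Suc q else 0)" by simp
 ultimately show ?case by (simp add: mm_def)
qed

text \<open>The covariance of the convolution is \<open>1 + eps^2\<close> times the identity, so in
  the limit the centred matrix is \<open>eps^2\<close> times the identity.\<close>

lemma Psi_lim: "(%k. cube.Psi n (Rk k) q (ww k)) \<longlonglongrightarrow> 4 ^ q*(n*(eps^2) ^ q) + n"
proof -
 have "(%k. 4 ^ q*(SUM i<n. mpow n (cube.Bm n (Rk k) (ww k)) q i i) + n) \<longlonglongrightarrow> 4 ^ q*(SUM i<n. (if i = i & i < n then (eps^2) ^ q else 0)) + n"
  by (intro tendsto_intros mpow_lim)
 thus ?thesis unfolding cube.Psi_def[OF cubeR] cube.Phi_def[OF cubeR] tr_def by simp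
qed

end

section \<open>The comparisons in the limit\<close>

context iso_smoothed
begin

text \<open>Given the original point \<open>y\<close>, the conditional mean of \<open>N\<close>
  under the smoothing is \<open>U (eps^2) y\<close>, which lies between \<open>N y\<close> and
  \<open>N y + eps * gN\<close>.\<close>

lemma gauge_nu:
 assumes "gauge n N"
 shows "integrable nu N" "(nn_integral \<mu> (%y. ennreal (N y))) <= ennreal (LINT x|nu. N x)"
  "ennreal (LINT x|nu. N x) <= (nn_integral \<mu> (%y. ennreal (N y))) + ennreal (eps * gauge.gN n N)"
proof -
 interpret gauge n N by fact
 have s: "0 <= eps^2" "sqrt (eps^2) = eps" using eps_pos by auto
 have Nm: "(%x. ennreal (N x)) \<in> borel_measurable (Bn n)" by measurable
 have Nmu: "N \<in> borel_measurable \<mu>" unfolding measurable_cong_sets[OF sets_mu refl] by (rule N_meas)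
 have U1: "(nn_integral (G n 1) (%z. ennreal (N (\<lambda>i\<in>{..<n}. y i + eps * z i)))) = ennreal (U (eps^2) y)" for y
 proof -
  have "N (\<lambda>i\<in>{..<n}. y i + eps * z i) = sh (eps^2) y z" for z unfolding sh_def s(2) by (rule N_cong) simp
  thus ?thesis unfolding U_def by (simp add: nn_integral_eq_integral[OF sh_int] sh_nonneg)
 qed
 have nn: "(nn_integral nu (%x. ennreal (N x))) = (nn_integral \<mu> (%y. ennreal (U (eps^2) y)))"
  unfolding nu_nn[OF Nm] U1 ..
 have up: "(nn_integral \<mu> (%y. ennreal (U (eps^2) y))) <= (nn_integral \<mu> (%y. ennreal (N y))) + ennreal (eps * gN)"
 proof -
  have "(nn_integral \<mu> (%y. ennreal (U (eps^2) y))) <= (nn_integral \<mu> (%y. ennreal (N y) + ennreal (eps * gN)))"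
  proof (intro nn_integral_mono)
   fix y
   have "ennreal (U (eps^2) y) <= ennreal (N y + eps * gN)" using U_le[OF s(1), of y] unfolding s(2) by (rule ennreal_leI)
   thus "ennreal (U (eps^2) y) <= ennreal (N y) + ennreal (eps * gN)"
    using eps_pos gN_nonneg N_nonneg by simp
  qed
  also have "... = (nn_integral \<mu> (%y. ennreal (N y))) + (nn_integral \<mu> (%y. ennreal (eps * gN)))"
   by (rule nn_integral_add[OF measurable_compose[OF Nmu measurable_ennreal]]) simp
  finally show ?thesis by (simp add: emeasure_space_1)
 qed
 have lo: "(nn_integral \<mu> (%y. ennreal (N y))) <= (nn_integral \<mu> (%y. ennreal (U (eps^2) y)))"
  by (intro nn_integral_mono ennreal_leI U_ge s(1))
 have fin: "(nn_integral \<mu> (%y. ennreal (N y))) < \<infinity>"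
 proof -
  have i: "integrable \<mu> (%y. m * ab y)"
   unfolding ab_def
   by (intro integrable_mult_right Bochner_Integration.integrable_sum integrable_abs square_integrable_imp_integrable[OF coord_meas sq]) auto
  have "(nn_integral \<mu> (%y. ennreal (N y))) <= (nn_integral \<mu> (%y. ennreal (m * ab y)))"
   by (intro nn_integral_mono ennreal_leI N_le)
  also have "... = ennreal (LINT y|\<mu>. m * ab y)"
   by (rule nn_integral_eq_integral[OF i]) (simp add: m_nonneg ab_nonneg)
  finally show ?thesis by (simp add: le_less_trans)
 qed
 have "(nn_integral nu (%x. ennreal (N x))) <= (nn_integral \<mu> (%y. ennreal (N y))) + ennreal (eps * gN)" unfolding nn by (rule up)
 also have "... < \<infinity>" using fin by simp
 finally have nufin: "(nn_integral nu (%x. ennreal (N x))) < \<infinity>" .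
 show i: "integrable nu N"
  by (rule integrableI_nonneg) (use nufin N_nonneg in \<open>auto simp: nu_meas\<close>)
 have e: "ennreal (LINT x|nu. N x) = (nn_integral nu (%x. ennreal (N x)))"
  by (rule nn_integral_eq_integral[OF i, symmetric]) (simp add: N_nonneg)
 show "(nn_integral \<mu> (%y. ennreal (N y))) <= ennreal (LINT x|nu. N x)" unfolding e nn by (rule lo)
 show "ennreal (LINT x|nu. N x) <= (nn_integral \<mu> (%y. ennreal (N y))) + ennreal (eps * gN)" unfolding e nn by (rule up)
qed

lemma ab_mean_lim: "gauge n N ==> (%k. gauge.ab n (cube.mean n (Rk k) (ww k))) \<longlonglongrightarrow> 0"
proof -
 assume "gauge n N"
 then interpret gauge n N .
 have "(%k. SUM i<n. \<bar>cube.mean n (Rk k) (ww k) i\<bar>) \<longlonglongrightarrow> (SUM i<n. \<bar>0\<bar>)"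
  by (intro tendsto_intros mean_lim) simp
 thus ?thesis unfolding ab_def by simp
qed

lemma tk_lim: "tk \<longlonglongrightarrow> 0"
 unfolding tk_def[abs_def] Rk_def by (rule lim_1_over_n[THEN LIMSEQ_Suc])

lemma Psi_final: "eps <= 1/2 ==> 4 ^ q*(n*(eps^2) ^ q) + n <= 2 * real n"
proof -
 assume e: "eps <= 1/2"
 have "eps^2 <= (1/2)^2" using e eps_pos by (intro power_mono) auto
 hence "(4 * eps^2) ^ q <= 1" by (intro power_le_one) (auto simp: power2_eq_square)
 hence "real n*(4 * eps^2) ^ q <= real n*1" by (intro mult_left_mono) auto
 moreover have "4 ^ q*(n*(eps^2) ^ q) = real n*(4 * eps^2) ^ q" by (simp only: power_mult_distrib mult_ac)
 ultimately show ?thesis by linarith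
qed

text \<open>The signs \<open>b = 1\<close> and \<open>b = - 1\<close> cover the upper and the lower
  comparison. As the cut-off is removed, the starting time and the mean tend to zero; the Lipschitz
  bound replaces \<open>U\<close> at the mean by \<open>U\<close> at the origin, which is
  \<open>sqrt \<sigma> * gN\<close> in the limit.\<close>

lemma gauge_limit:
 assumes g: "gauge n N" and b: "\<bar>b\<bar> = 1" and T: "0 < T" and B: "0 <= B" and e: "eps <= 1/2"
  and \<sigma>: "!!t. 0 < t ==> t < T ==> 0 < \<sigma> - r * t"
  and le: "!!k. cube.slc n (Rk k) (%_. tk k) (ww k) ==> tk k < T ==> b*(LINT x|cube.bm n (Rk k). ww k x * N x) <=
   b * gauge.U n N (\<sigma> - r * tk k) (cube.mean n (Rk k) (ww k)) + c + B * cube.Psi n (Rk k) q (ww k)"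
 shows "b*(LINT x|nu. N x) <= b*(sqrt \<sigma> * gauge.gN n N) + c + B*(2 * n)"
proof -
 interpret gauge n N by fact
 define P where "P = 4 ^ q*(n*(eps^2) ^ q) + real n"
 have "b*(LINT x|nu. N x) <= b*(sqrt (\<sigma> - r*0) * gN) + m*0 + c + B * P"
 proof (rule tendsto_le[OF trivial_limit_sequentially])
  show "(%k. b*(sqrt (\<sigma> - r * tk k) * gN) + m * ab (cube.mean n (Rk k) (ww k)) + c + B * cube.Psi n (Rk k) q (ww k))
    \<longlonglongrightarrow> b*(sqrt (\<sigma> - r*0) * gN) + m*0 + c + B * P"
   unfolding P_def by (intro tendsto_intros tk_lim ab_mean_lim[OF g] Psi_lim)
  show "(%k. b*(LINT x|cube.bm n (Rk k). ww k x * N x)) \<longlonglongrightarrow> b*(LINT x|nu. N x)"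
   by (intro tendsto_intros J_lim gauge_nu(1)[OF g])
  have "\<forall>\<^sub>F k in sequentially. tk k < T" using order_tendstoD(2)[OF tk_lim T] .
  with ev_slc show "\<forall>\<^sub>F k in sequentially. b*(LINT x|cube.bm n (Rk k). ww k x * N x)
    <= b*(sqrt (\<sigma> - r * tk k) * gN) + m * ab (cube.mean n (Rk k) (ww k)) + c + B * cube.Psi n (Rk k) q (ww k)"
  proof eventually_elim
   case (elim k)
   let ?s = "\<sigma> - r * tk k" and ?x = "cube.mean n (Rk k) (ww k)"
   have s: "0 < ?s" by (rule \<sigma>[OF tk_pos elim(2)])
   have "b*(U ?s ?x - U ?s (%_. 0)) <= \<bar>b\<bar>*\<bar>U ?s ?x - U ?s (%_. 0)\<bar>" unfolding abs_mult[symmetric] by simp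
   also have "... <= m * ab ?x" using U_lip[of ?s ?x "%_. 0"] s b by simp
   finally show ?case using le[OF ww_slc[OF elim(1)] elim(2)] U_zero[of ?s] s by (simp add: right_diff_distrib)
  qed
 qed
 moreover have "B * P <= B*(2 * n)" unfolding P_def using Psi_final[OF e] B by (intro mult_left_mono) auto
 ultimately show ?thesis by simp
qed

lemma lower_limit:
 assumes g: "gauge n N" and T: "0 < T" "T <= 1" and q: "sqrt T*(3520*2 ^ Suc l) <= 1" and s: "0 < s" and e: "eps <= 1/2"
 shows "sqrt (s + T/2) * gauge.gN n N <= (LINT x|nu. N x) + sqrt s * gauge.gN n N
  + sqrt (s + T) * gauge.gN n N/2 ^ (2 ^ Suc l) * exp (2 ^ Suc l/8)*(2 * n)"
proof -
 have "-1*(LINT x|nu. N x) <= -1*(sqrt (s + T/2) * gauge.gN n N) + sqrt s * gauge.gN n N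
  + sqrt (s + T) * gauge.gN n N/2 ^ (2 ^ Suc l) * exp (2 ^ Suc l/8)*(2 * n)"
 proof (rule gauge_limit[OF g _ T(1) _ e, where r = "1/2"])
  fix k assume w: "cube.slc n (Rk k) (%_. tk k) (ww k)" "tk k < T"
  interpret gauge_cube n "Rk k" N by (intro gauge_cube.intro cubeR g)
  show "-1 * J (%x. ww k x * N x) <= -1 * U (s + T/2 - 1/2 * tk k) (mean (ww k)) + sqrt s * gN
    + sqrt (s + T) * gN/2 ^ (2 ^ Suc l) * exp (2 ^ Suc l/8) * Psi (2 ^ Suc l) (ww k)"
   using lower_main[OF w(1) tk_pos w(2) T(2) q s] by (simp add: diff_divide_distrib add_diff_eq del: power_Suc)
 qed (use s T gauge.gN_nonneg[OF g] in auto)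
 thus ?thesis by simp
qed

lemma upper_limit:
 assumes g: "gauge n N" and T: "0 < T" "T <= 1" and q: "sqrt T*(3520*2 ^ Suc l) <= 1" and e: "eps <= 1/2"
 shows "(LINT x|nu. N x) <= sqrt (4/T + 9/2 * T) * gauge.gN n N
  + 2 * n * gauge.m n N/2 ^ (2 ^ Suc l) * exp (2 ^ Suc l/8)*(2 * n)"
proof -
 have "1*(LINT x|nu. N x) <= 1*(sqrt (4/T + 9/2 * T) * gauge.gN n N) + 0
  + 2 * n * gauge.m n N/2 ^ (2 ^ Suc l) * exp (2 ^ Suc l/8)*(2 * n)"
 proof (rule gauge_limit[OF g _ T(1) _ e, where r = "9/2"])
  fix k assume w: "cube.slc n (Rk k) (%_. tk k) (ww k)" "tk k < T"
  interpret gauge_cube n "Rk k" N by (intro gauge_cube.intro cubeR g)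
  show "1 * J (%x. ww k x * N x) <= 1 * U (4/T + 9/2 * T - 9/2 * tk k) (mean (ww k)) + 0
    + 2 * n * m/2 ^ (2 ^ Suc l) * exp (2 ^ Suc l/8) * Psi (2 ^ Suc l) (ww k)"
   using upper_main[OF w(1) tk_pos w(2) T(2) q] by (simp add: right_diff_distrib add_diff_eq del: power_Suc)
 next
  show "0 < 4/T + 9/2 * T - 9/2 * t" if "t < T" for t using that T divide_pos_pos[of 4 T] by linarith
 qed (use T gauge.m_nonneg[OF g] in \<open>auto simp: add_pos_nonneg\<close>)
 thus ?thesis by simp
qed

end

section \<open>From gauge functions to the locale, and the choice of parameters\<close>

lemma gauge_function_gauge:
 assumes "gauge_function n g"
 shows "gauge n (%x. g (\<lambda>i\<in>{..<n}. x i))"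
proof
 have Rn: "(\<lambda>i\<in>{..<n}. x i) \<in> Rn n" for x unfolding Rn_def by auto
 have nn: "!!x. x \<in> Rn n ==> 0 <= g x" and cv: "convex_on_Rn n (Rn n) g"
  and hom: "!!x b. x \<in> Rn n ==> b >= 0 ==> g (scale_Rn n b x) = b * g x"
  using assms unfolding gauge_function_def by auto
 show "0 <= g (\<lambda>i\<in>{..<n}. x i)" for x by (rule nn[OF Rn])
 show sc: "g (\<lambda>i\<in>{..<n}. b * x i) = b * g (\<lambda>i\<in>{..<n}. x i)" if "0 <= b" for b x
 proof -
  have "scale_Rn n b (\<lambda>i\<in>{..<n}. x i) = (\<lambda>i\<in>{..<n}. b * x i)" unfolding scale_Rn_def by auto
  thus ?thesis using hom[OF Rn that, of x] by simp
 qed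
 \<comment> \<open>A sum is twice a midpoint, so homogeneity with factor 2 turns midpoint convexity
   into subadditivity.\<close>
 show "g (\<lambda>i\<in>{..<n}. x i + y i) <= g (\<lambda>i\<in>{..<n}. x i) + g (\<lambda>i\<in>{..<n}. y i)" for x y
 proof -
  let ?x = "\<lambda>i\<in>{..<n}. x i" and ?y = "\<lambda>i\<in>{..<n}. y i"
  have e: "scale_Rn n 2 (add_Rn n (scale_Rn n (1/2) ?x) (scale_Rn n (1/2) ?y)) = (\<lambda>i\<in>{..<n}. x i + y i)"
   unfolding scale_Rn_def add_Rn_def by auto
  have "add_Rn n (scale_Rn n (1/2) ?x) (scale_Rn n (1/2) ?y) \<in> Rn n" unfolding add_Rn_def by (rule Rn)
  from hom[OF this, of 2]
  have "g (\<lambda>i\<in>{..<n}. x i + y i) = 2 * g (add_Rn n (scale_Rn n (1/2) ?x) (scale_Rn n (1/2) ?y))" unfolding e by simp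
  also have "... <= 2*(1/2 * g ?x + 1/2 * g ?y)"
   using cv[unfolded convex_on_Rn_def, THEN conjunct2, rule_format, OF Rn Rn, of "1/2" "1/2" x y] by simp
  finally show ?thesis by simp
 qed
 show "g (\<lambda>i\<in>{..<n}. x i) = g (\<lambda>i\<in>{..<n}. y i)" if "!!i. i < n ==> x i = y i" for x y
  using that by (intro arg_cong[of _ _ g]) auto
qed

lemma restrict_nn:
 assumes "sets M = sets (Bn n)"
 shows "(nn_integral M (%x. ennreal (g x))) = (nn_integral M (%x. ennreal (g (\<lambda>i\<in>{..<n}. x i))))"
proof (intro nn_integral_cong)
 fix x assume "x \<in> space M"
 hence "x \<in> (\<Pi>\<^sub>E i\<in>{..<n}. UNIV)" using sets_eq_imp_space_eq[OF assms] by (simp add: space_PiM)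
 hence "(\<lambda>i\<in>{..<n}. x i) = x" by auto
 thus "ennreal (g x) = ennreal (g (\<lambda>i\<in>{..<n}. x i))" by simp
qed

text \<open>The least power of two above \<open>L\<close> is at most \<open>2 L\<close>. The
  exponent of the trace must be such a power, and this determines it up to a factor 2.\<close>

lemma choose_exponent:
 fixes L :: real
 assumes "2 < L"
 shows "EX l. L <= 2 ^ Suc l & 2 ^ Suc l <= 2 * L"
proof -
 obtain k where k: "L < 2 ^ k" using real_arch_pow[of 2 L] by auto
 define j where "j = (LEAST k. L <= 2 ^ k)"
 have j: "L <= 2 ^ j" unfolding j_def by (rule LeastI[of _ k]) (use k in simp)
 have "j ~= 0" using j assms by (intro notI) simp
 then obtain l where l: "j = Suc l" by (cases j) auto
 have "~ L <= 2 ^ l" using not_less_Least[of l "%k. L <= 2 ^ k"] l unfolding j_def by simp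
 thus ?thesis using j unfolding l by (intro exI[of _ l]) simp
qed

text \<open>The left side sets the growth \<open>exp (q / 8)\<close> against the threshold
  \<open>2^q\<close>. As \<open>ln 2 >= 2/3\<close>, at least \<open>exp (- q / 2)\<close> is
  gained, and \<open>q >= 32 ln n\<close> makes this \<open>n ^ (- 16)\<close>.\<close>

lemma tail_small:
 assumes n: "2 <= n" and q: "32 * ln (real n) <= real q"
 shows "exp (real q/8)/2 ^ q <= 1/real n ^ 16"
proof -
 have "exp (real q/8)/2 ^ q = exp (real q/8 - real q * ln 2)"
  by (simp add: exp_diff powr_realpow[symmetric] powr_def)
 also have "... <= exp (- (16 * ln (real n)))"
 proof -
  have "real q*(2/3) <= real q * ln 2" using ln2_ge_two_thirds by (intro mult_left_mono) auto
  thus ?thesis using q by simp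
 qed
 also have "... = 1/real n ^ 16"
  using n by (simp add: exp_minus exp_of_nat_mult[of 16, simplified] divide_inverse)
 finally show ?thesis .
qed

lemma iso_smoothedI:
 assumes pm: "prob_measure_Rn n \<mu>" and iso: "isotropic n \<mu>" and lc: "log_concave n \<mu>" and a: "0 < a"
 shows "EX p. iso_smoothed n \<mu> a p"
proof -
 obtain p where p: "p \<in> borel_measurable (lborel_Rn n)" "!!x. x \<in> Rn n ==> 0 <= p x"
  "\<mu> = density (lborel_Rn n) (%x. ennreal (p x))" "convex_set_Rn n {x\<in>Rn n. 0 < p x}"
  "convex_on_Rn n {x\<in>Rn n. 0 < p x} (%x. ln (1/p x))"
  using lc unfolding log_concave_def by blast
 have m0: "mean_coord \<mu> i = 0" if "i < n" for i using iso that unfolding isotropic_def by blast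
 have "iso_smoothed n \<mu> a p"
 proof (intro iso_smoothed.intro lc_smoothed.intro smoothed.intro lc_smoothed_axioms.intro iso_smoothed_axioms.intro)
  show "prob_space \<mu>" "sets \<mu> = sets (Bn n)"
   using pm unfolding prob_measure_Rn_def borel_Rn_def by auto
  show "p x * p y <= (p (\<lambda>i\<in>{..<n}. (x i + y i)/2))^2" if "x \<in> Rn n" "y \<in> Rn n" for x y
   by (rule log_concave_midpoint[OF p(4,5,2) that])
  show "(LINT y|\<mu>. y i * y j) = (if i = j then 1 else 0)" if "i < n" "j < n" for i j
  proof -
   have "covariance_coord \<mu> i j = (if i = j then 1 else 0)" using iso that unfolding isotropic_def by blast
   thus ?thesis unfolding covariance_coord_def m0[OF that(1)] m0[OF that(2)] diff_zero .
  qed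
  show "(LINT y|\<mu>. y i) = 0" if "i < n" for i using m0[OF that] unfolding mean_coord_def .
  show "integrable \<mu> (%y. (y i)^2)" if "i < n" for i using iso that unfolding isotropic_def by blast
 qed (rule p a | assumption)+
 thus ?thesis by (intro exI[of _ p])
qed

lemma gauge_bounds:
 assumes n: "2 <= n" and pm: "prob_measure_Rn n \<mu>" and iso: "isotropic n \<mu>" and lc: "log_concave n \<mu>" and g: "gauge n N"
 shows "ennreal (gauge.gN n N/(901120 * ln (real n))) <= (nn_integral \<mu> (%x. ennreal (N x)))"
  "(nn_integral \<mu> (%x. ennreal (N x))) <= ennreal (675842 * ln (real n) * gauge.gN n N)"
proof -
 interpret gauge n N by fact
 have ln: "2/3 <= ln (real n)"
 proof -
  have "ln 2 <= ln (real n)" using n by simp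
  thus ?thesis using ln2_ge_two_thirds by linarith
 qed
 define L where "L = 32 * ln (real n)"
 have L: "2 < L" unfolding L_def using ln by simp
 obtain l where l: "L <= 2 ^ Suc l" "2 ^ Suc l <= 2 * L" using choose_exponent[OF L] by blast
 define q :: nat where "q = 2 ^ Suc l"
 have rq: "real q = 2 ^ Suc l" unfolding q_def by simp
 have q: "32 * ln (real n) <= real q" "real q <= 64 * ln (real n)" using l unfolding rq L_def by simp_all
 have q1: "1 <= real q" using q(1) ln by linarith
 define r where "r = 1/(3520 * real q)"
 have r: "0 < r" "r <= 1/3520" unfolding r_def using q1 by auto
 define T where "T = r^2"
 have sT: "sqrt T = r" unfolding T_def using r by simp
 have r1: "r <= 1" using r by linarith
 have T: "0 < T" "T <= 1" unfolding T_def using r by (auto intro: power_le_one)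
 have qT: "sqrt T*(3520*2 ^ Suc l) <= 1" unfolding sT rq[symmetric] r_def by simp
 \<comment> \<open>With \<open>a = 64 / T\<close> the smoothing scale
   \<open>eps = 1 / sqrt a\<close> equals \<open>r / 8\<close>, small enough to be absorbed in the
   lower bound.\<close>
 obtain p where "iso_smoothed n \<mu> (64/T) p" using iso_smoothedI[OF pm iso lc, of "64/T"] T by auto
 then interpret iso_smoothed n \<mu> "64/T" p .
 have eps: "eps = r/8" unfolding eps_def using sT by (simp add: real_sqrt_divide)
 have eps2: "eps <= 1/2" unfolding eps using r1 by simp
 have gN0: "0 <= gN" by (rule gN_nonneg)
 have n1: "1 <= real n" using n by simp
 have tail: "exp (2 ^ Suc l/8)/2 ^ (2 ^ Suc l) <= 1/real n ^ 16"
  using tail_small[OF n q(1)] unfolding rq unfolding q_def .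
 have pow: "2 ^ 15 <= real n ^ 15" "2 ^ 13 <= real n ^ 13" using n by (intro power_mono; simp)+
 let ?I = "\<integral>x. N x \<partial>nu" and ?E = "exp (2 ^ Suc l/8)/2 ^ (2 ^ Suc l) :: real"
 show "ennreal (gN/(901120 * ln (real n))) <= (nn_integral \<mu> (%x. ennreal (N x)))"
 proof -
  \<comment> \<open>For \<open>s = T / 16\<close> the two square roots are \<open>3/4 r\<close> and
    \<open>1/4 r\<close>. The tail and the smoothing cost at most \<open>1/8 r\<close> each, so
    \<open>1/4 r\<close> remains.\<close>
  have A: "sqrt (T/16 + T/2) * gN <= ?I + sqrt (T/16) * gN
    + sqrt (T/16 + T) * gN/2 ^ (2 ^ Suc l) * exp (2 ^ Suc l/8)*(2 * n)"
   using T by (intro lower_limit[OF g T qT _ eps2]) simp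
  have B: "sqrt (T/16 + T/2) = 3/4 * r"
  proof -
   have "T/16 + T/2 = (3/4 * r)^2" unfolding T_def by (simp add: power2_eq_square)
   thus ?thesis using r by simp
  qed
  have C: "sqrt (T/16) = 1/4 * r" using sT by (simp add: real_sqrt_divide)
  have D: "sqrt (T/16 + T) * gN/2 ^ (2 ^ Suc l) * exp (2 ^ Suc l/8)*(2 * n) <= 1/8 * r * gN"
  proof -
   have "T/16 + T <= (2 * r)^2" unfolding T_def by simp
   hence s2: "sqrt (T/16 + T) <= 2 * r" using r by (intro real_le_lsqrt) auto
   have "?E*(2 * n) <= 1/real n ^ 16*(2 * n)" using tail by (intro mult_right_mono) auto
   also have "... = 2/real n ^ 15" by (simp add: power_numeral_reduce)
   also have "... <= 2/2 ^ 15" using pow(1) n1 by (intro divide_left_mono) auto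
   also have "... <= 1/16" by simp
   finally have E: "?E*(2 * n) <= 1/16" .
   have "sqrt (T/16 + T) * gN/2 ^ (2 ^ Suc l) * exp (2 ^ Suc l/8)*(2 * n) = (sqrt (T/16 + T) * gN)*(?E*(2 * n))"
    by simp
   also have "... <= (2 * r * gN)*(1/16)"
    using s2 E gN0 r by (intro mult_mono mult_right_mono) auto
   finally show ?thesis by simp
  qed
  have "3/4 * r * gN <= ?I + 1/4 * r * gN + 1/8 * r * gN" using A D unfolding B C by linarith
  hence "1/4 * r * gN + eps * gN <= ?I" unfolding eps by simp
  hence "ennreal (1/4 * r * gN + eps * gN) <= ennreal ?I" by (rule ennreal_leI)
  also have "... <= (nn_integral \<mu> (%y. ennreal (N y))) + ennreal (eps * gN)" by (rule gauge_nu(3)[OF g])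
  finally have "ennreal (1/4 * r * gN) + ennreal (eps * gN) <= (nn_integral \<mu> (%y. ennreal (N y))) + ennreal (eps * gN)"
   using r gN0 eps_pos by simp
  hence "ennreal (1/4 * r * gN) <= (nn_integral \<mu> (%y. ennreal (N y)))"
   by (subst (asm) (1 2) add.commute) simp
  moreover have "gN/(901120 * ln (real n)) <= 1/4 * r * gN"
  proof -
   \<comment> \<open>Here \<open>1/4 * r = 1 / (14080 q)\<close>, and
     \<open>14080 * 64 = 901120\<close>.\<close>
   have "1/(901120 * ln (real n)) <= 1/(14080 * real q)" using q q1 by (intro divide_left_mono) auto
   also have "... = 1/4 * r" unfolding r_def by simp
   finally have "1/(901120 * ln (real n)) * gN <= 1/4 * r * gN" using gN0 by (rule mult_right_mono)
   thus ?thesis by simp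
  qed
  ultimately show ?thesis by (meson ennreal_leI order_trans)
 qed
 show "(nn_integral \<mu> (%x. ennreal (N x))) <= ennreal (675842 * ln (real n) * gN)"
 proof -
  have "?I <= sqrt (4/T + 9/2 * T) * gN + 2 * n * m/2 ^ (2 ^ Suc l) * exp (2 ^ Suc l/8)*(2 * n)"
   by (rule upper_limit[OF g T qT eps2])
  also have "... <= 3/r * gN + gN"
  proof (rule add_mono)
   have "T * T <= 1" using T by (intro mult_le_one) auto
   hence "4/T + 9/2 * T <= (3/r)^2"
    using T by (simp add: T_def power2_eq_square field_simps)
   hence "sqrt (4/T + 9/2 * T) <= 3/r" using r by (intro real_le_lsqrt) auto
   thus "sqrt (4/T + 9/2 * T) * gN <= 3/r * gN" using gN0 by (rule mult_right_mono)
   \<comment> \<open>By \<open>m_gN\<close> the factors add up to \<open>12 n^3 gN\<close>, against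
     a tail of \<open>1 / n^16\<close>.\<close>
   have "2 * n * m/2 ^ (2 ^ Suc l) * exp (2 ^ Suc l/8)*(2 * n) = m*(4*(real n)^2*?E)"
    by (simp add: power2_eq_square)
   also have "... <= (3 * n * gN)*(4*(real n)^2*(1/real n ^ 16))"
    using m_gN tail gN0 by (intro mult_mono mult_left_mono) auto
   also have "... = gN*(12/real n ^ 13)" by (simp add: power_numeral_reduce)
   also have "... <= gN*(12/2 ^ 13)" using pow(2) gN0 n1 by (intro mult_left_mono divide_left_mono) auto
   also have "... <= gN" using gN0 by simp
   finally show "2 * n * m/2 ^ (2 ^ Suc l) * exp (2 ^ Suc l/8)*(2 * n) <= gN" .
  qed
  also have "... = (10560 * real q + 1) * gN" unfolding r_def by (simp add: distrib_right)
  \<comment> \<open>\<open>10560 * 64 = 675840\<close>, and the remaining summand 1 is at most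
    \<open>2 ln n\<close>.\<close>
  also have "... <= (675842 * ln (real n)) * gN"
   using q ln gN0 by (intro mult_right_mono) auto
  finally have "ennreal ?I <= ennreal (675842 * ln (real n) * gN)" by (rule ennreal_leI)
  with gauge_nu(2)[OF g] show ?thesis by (rule order_trans)
 qed
qed

text \<open>A centred Gaussian of covariance \<open>s Id\<close> integrates a gauge function to
  \<open>sqrt s * gN\<close>. The bounds of \<open>gauge_bounds\<close>, of order
  \<open>gN / ln n\<close> and \<open>gN * ln n\<close>, are therefore Gaussian integrals for
  variances given by the squares of the factors.\<close>

theorem corollary1p6:
  shows "\<exists>c C :: real. 0 < c \<and> 0 < C \<and>
    (\<forall>(n :: nat) (\<mu> :: (nat \<Rightarrow> real) measure).
       2 \<le> n \<longrightarrow> prob_measure_Rn n \<mu> \<longrightarrow> isotropic n \<mu> \<longrightarrow> log_concave n \<mu> \<longrightarrow>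
         gauge_le n (gaussian_Rn n (c / (ln (real n))\<^sup>2)) \<mu> \<and>
         gauge_le n \<mu> (gaussian_Rn n (C * (ln (real n))\<^sup>2)))"
proof (rule exI[of _ "(1 / 901120)\<^sup>2"], rule exI[of _ "675842\<^sup>2"], intro conjI allI impI)
  fix n :: nat and \<mu> :: "(nat \<Rightarrow> real) measure"
  assume a: "2 \<le> n" "prob_measure_Rn n \<mu>" "isotropic n \<mu>" "log_concave n \<mu>"
  have ln: "0 < ln (real n)" using a(1) by simp
  have sm: "sets \<mu> = sets (Bn n)" using a(2) unfolding prob_measure_Rn_def borel_Rn_def by simp
  let ?N = "\<lambda>g x. g (\<lambda>i\<in>{..<n}. x i) :: real"
  have c: "0 < (1 / 901120)\<^sup>2 / (ln (real n))\<^sup>2" "sqrt ((1 / 901120)\<^sup>2 / (ln (real n))\<^sup>2) = 1 / (901120 * ln (real n))"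
    using ln by (simp_all add: real_sqrt_divide)
  have C: "0 < 675842\<^sup>2 * (ln (real n))\<^sup>2" "sqrt (675842\<^sup>2 * (ln (real n))\<^sup>2) = 675842 * ln (real n)"
    using ln by (simp_all add: real_sqrt_mult)
  show "gauge_le n (gaussian_Rn n ((1 / 901120)\<^sup>2 / (ln (real n))\<^sup>2)) \<mu>"
    unfolding gauge_le_def
  proof (intro allI impI)
    fix g assume "gauge_function n g"
    hence g: "gauge n (?N g)" by (rule gauge_function_gauge)
    show "(\<integral>\<^sup>+x. ennreal (g x) \<partial>gaussian_Rn n ((1 / 901120)\<^sup>2 / (ln (real n))\<^sup>2)) \<le> (\<integral>\<^sup>+x. ennreal (g x) \<partial>\<mu>)"
      unfolding restrict_nn[OF sm, where g = g] restrict_nn[OF sets_G, where g = g] gauge.gauge_nn[OF g c(1)] c(2)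
      using gauge_bounds(1)[OF a g] by simp
  qed
  show "gauge_le n \<mu> (gaussian_Rn n (675842\<^sup>2 * (ln (real n))\<^sup>2))"
    unfolding gauge_le_def
  proof (intro allI impI)
    fix g assume "gauge_function n g"
    hence g: "gauge n (?N g)" by (rule gauge_function_gauge)
    show "(\<integral>\<^sup>+x. ennreal (g x) \<partial>\<mu>) \<le> (\<integral>\<^sup>+x. ennreal (g x) \<partial>gaussian_Rn n (675842\<^sup>2 * (ln (real n))\<^sup>2))"
      unfolding restrict_nn[OF sm, where g = g] restrict_nn[OF sets_G, where g = g] gauge.gauge_nn[OF g C(1)] C(2)
      by (rule gauge_bounds(2)[OF a g])
  qed
qed simp_all

end
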